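(* Let $\mu$ and $\lambda$ be the Möbius and Liouville functions, and for $t\in\mathbb R$ let $$F(\mu;t)=\sum_{n=1}^\infty\frac{\mu(n)e^{2\pi i nt}}{n},\qquad F(\lambda;t)=\sum_{n=1}^\infty\frac{\lambda(n)e^{2\pi i nt}}{n}.$$ Assume the Generalized Riemann Hypothesis holds. Then: (i) The functions $F(\mu;t)$ and $F(\lambda;t)$ are Hölder continuous with exponent $1/4-\epsilon$ for any $\epsilon$ with $0<\epsilon<1/4$, and the same holds for the absolute values and the real and imaginary parts of these functions. (ii) The upper box-counting dimensions of the graphs of the functions $|F(\mu;t)|$, $\operatorname{Re}F(\mu;t)$, and $\operatorname{Im}F(\mu;t)$ over the interval $[0,1]$ are at most $7/4$, and the same holds for the graphs of $|F(\lambda;t)|$, $\operatorname{Re}F(\lambda;t)$, and $\operatorname{Im}F(\lambda;t)$. Moreover, suppose that for every $\epsilon>0$ there exist constants $C_\epsilon$ and $x_0(\epsilon)$ such that for all $x\ge x_0(\epsilon)$ and all $t\in\mathbb R$ $$\Bigl|\sum_{1\le n\le x}\mu(n)e^{2\pi i nt}\Bigr|\le C_\epsilon x^{1/2+\epsilon}\quad\text{and}\quad\Bigl|\sum_{1\le n\le x}\lambda(n)e^{2\pi i nt}\Bigr|\le C_\epsilon x^{1/2+\epsilon}.$$ Then the exponent $1/4-\epsilon$ in (i) can be replaced by $1/2-\epsilon$ (for any $0<\epsilon<1/2$) and the bound $7/4$ in (ii) can be replaced by $3/2$.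
   Context: The Möbius function: $\mu(1)=1$; $\mu(n)=(-1)^r$ if $n$ is the product of $r$ distinct primes; $\mu(n)=0$ otherwise. The Liouville function: $\lambda(1)=1$ and $\lambda(n)=(-1)^r$ if $n$ is the product of $r$ not necessarily distinct primes (i.e. counted with multiplicity). The infinite series are understood as limits of their partial sums $\sum_{n=1}^N$ as $N\to\infty$ (these converge for every $t$). The Generalized Riemann Hypothesis is the statement that, for every Dirichlet character $\chi$, all zeros of the Dirichlet $L$-function $L(s,\chi)$ in the strip $0<\operatorname{Re}s<1$ lie on the line $\operatorname{Re}s=1/2$. A function $g$ is Hölder continuous with exponent $\eta\in(0,1)$ if there is a constant $K>0$ such that $|g(x)-g(y)|\le K|x-y|^\eta$ for all $x,y$ in its domain (here $\mathbb R$; the functions are $1$-periodic). The graph of a real-valued function $g$ over $[0,1]$ is $\{(t,g(t))\in\mathbb R^2:t\in[0,1]\}$. For a bounded set $E\subset\mathbb R^d$ and $r>0$, let $N(E,r)$ be the minimal number of sets of diameter at most $r$ needed to cover $E$. The upper box-counting dimension of $E$ is $\overline{\dim_B}E=\limsup_{r\to0}\frac{\log N(E,r)}{\log(1/r)}$. *)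

theory Defs
  imports "HOL-Complex_Analysis.Complex_Analysis" "HOL-Computational_Algebra.Computational_Algebra"
begin

definition moebius_mu :: "nat \<Rightarrow> int" where
  "moebius_mu n = (if squarefree n then (-1) ^ card (prime_factors n) else 0)"

definition liouville_lambda :: "nat \<Rightarrow> int" where
  "liouville_lambda n = (if n = 0 then 0 else (-1) ^ size (prime_factorization n))"

definition exp_term :: "(nat \<Rightarrow> int) \<Rightarrow> real \<Rightarrow> nat \<Rightarrow> complex" where
  "exp_term f t n = of_int (f n) * exp (2 * of_real pi * \<i> * of_nat n * of_real t)"

(* suminf is the limit of the partial sums, so conditional convergence is enough. *)
definition F :: "(nat \<Rightarrow> int) \<Rightarrow> real \<Rightarrow> complex" where
  "F f t = (\<Sum>n. exp_term f t (Suc n) / of_nat (Suc n))"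

(* chi 1 = 1 follows, since chi 1 = chi 1 * chi 1 is nonzero. *)
definition dirichlet_character :: "nat \<Rightarrow> (nat \<Rightarrow> complex) \<Rightarrow> bool" where
  "dirichlet_character q chi \<longleftrightarrow>
     q > 0 \<and>
     (\<forall>n. chi (n + q) = chi n) \<and>
     (\<forall>m n. chi (m * n) = chi m * chi n) \<and>
     (\<forall>n. chi n \<noteq> 0 \<longleftrightarrow> coprime n q)"

(* The L-function on the half-plane Re s > 0, as the analytic continuation of its Dirichlet
   series. The half-plane without the possible pole 1 is connected, so the values there are
   determined uniquely; the value at s = 1 is left unspecified. *)
definition dirichlet_L :: "(nat \<Rightarrow> complex) \<Rightarrow> complex \<Rightarrow> complex" where
  "dirichlet_L chi = (SOME L.
     L holomorphic_on ({s. Re s > 0} - {1}) \<and>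
     (\<forall>s. Re s > 1 \<longrightarrow> (\<lambda>n. chi (Suc n) / of_nat (Suc n) powr s) sums L s))"

definition generalized_riemann_hypothesis :: bool where
  "generalized_riemann_hypothesis \<longleftrightarrow>
     (\<forall>q chi s. dirichlet_character q chi \<longrightarrow> 0 < Re s \<longrightarrow> Re s < 1 \<longrightarrow>
        dirichlet_L chi s = 0 \<longrightarrow> Re s = 1 / 2)"

definition hoelder_continuous :: "real \<Rightarrow> (real \<Rightarrow> 'a::real_normed_vector) \<Rightarrow> bool" where
  "hoelder_continuous \<eta> g \<longleftrightarrow>
     0 < \<eta> \<and> \<eta> < 1 \<and> (\<exists>K>0. \<forall>x y. norm (g x - g y) \<le> K * \<bar>x - y\<bar> powr \<eta>)"

definition graph01 :: "(real \<Rightarrow> real) \<Rightarrow> (real \<times> real) set" where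
  "graph01 g = {(t, g t) | t. t \<in> {0..1}}"

(* Boundedness of the covering sets is required separately because the diameter of an
   unbounded set is an arbitrary real number. Only meaningful for totally bounded E and r > 0. *)
definition covering_number :: "'a::metric_space set \<Rightarrow> real \<Rightarrow> nat" where
  "covering_number E r = (LEAST n. \<exists>\<C>. finite \<C> \<and> card \<C> = n \<and> E \<subseteq> \<Union>\<C> \<and>
     (\<forall>U\<in>\<C>. bounded U \<and> diameter U \<le> r))"

definition upper_box_dim :: "'a::metric_space set \<Rightarrow> ereal" where
  "upper_box_dim E =
     Limsup (at_right 0) (\<lambda>r. ereal (ln (real (covering_number E r)) / ln (1 / r)))"

end

theory Submission
  imports Defs "HOL-Probability.Probability" "HOL-Number_Theory.Number_Theory" "HOL-Real_Asymp.Real_Asymp"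
    "HOL-Analysis.Kronecker_Approximation_Theorem"
begin

text \<open>If \<open>\<Sum>n\<le>N. f n * e(n t)\<close> is \<open>O(N powr \<theta>)\<close> uniformly in \<open>t\<close>, Abel summation bounds the tails of \<open>F f\<close>,
  and cutting the series of \<open>F f x - F f y\<close> at \<open>1 / \<bar>x - y\<bar>\<close> shows that \<open>F f\<close> is Hoelder continuous with
  exponent \<open>1 - \<theta>\<close>; a graph of Hoelder exponent \<open>\<eta>\<close> has upper box dimension at most \<open>2 - \<eta>\<close>.

  Under GRH one can take \<open>\<theta> = 3/4 + \<epsilon>\<close> for \<open>\<mu>\<close>. The Borel--Caratheodory inequality applied to
  \<open>log L(s, \<chi>)\<close> gives \<open>1 / L(s, \<chi>) = O((q * \<bar>s\<bar>) powr \<epsilon>)\<close> for \<open>Re s \<ge> 1/2 + \<epsilon>\<close>, and Mellin inversion turns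
  this into a bound for \<open>\<Sum>n. \<mu> n * \<chi> n * n powr (-\<epsilon>) * exp (-n * w)\<close>. Dirichlet approximation \<open>t = a/q + \<beta>\<close> with
  denominators up to \<open>y powr (-1/2)\<close>, followed by an expansion of \<open>n \<mapsto> e(a n / q)\<close> into characters on each class
  \<open>gcd n q = d\<close>, yields \<open>\<Sum>n. \<mu> n * n powr (-\<epsilon>) * e(n t) * exp (-2 \<pi> n y) = O(y powr (-3/4 - \<epsilon>/2))\<close>. Taking
  \<open>y = 1/N\<close> and averaging against a truncation kernel with \<open>L\<^sup>1\<close>-norm \<open>O(N powr \<epsilon>)\<close> removes the smoothing.
  The bound passes to \<open>\<lambda>\<close> through \<open>\<lambda>(n) = \<Sum>k\<^sup>2 dvd n. \<mu>(n / k\<^sup>2)\<close>.\<close>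

section \<open>Hoelder continuity and box dimension\<close>

text \<open>The bound for one denominator q has size \<open>(q * |w|) powr (1/2 + \<epsilon>) / Re w
  powr (1 + \<epsilon>)\<close> with \<open>w = 2 * pi * (y - i * \<beta>)\<close>. It grows with
  \<open>q * |w|\<close>, and denominators up to \<open>y powr (-1/2)\<close> make both
  \<open>q * y\<close> and \<open>q * |\<beta>|\<close> of order \<open>sqrt y\<close>: this is the
  source of 1/4 - 1 = -3/4. The factor \<open>q powr (1/2)\<close> rests on Parseval, by which a
  function bounded by 1 has character coefficients of absolute sum at most \<open>sqrt q\<close>.
  All bounds must be uniform in q, which depends on t and y. The weight
  \<open>n powr (-\<epsilon>)\<close> lets the Mellin integral run exactly on Re s = 1/2, where the
  reflection formula gives |Gamma| without loss, while 1/L is evaluated at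
  \<open>s + \<epsilon>\<close>, inside the region of its bound. GRH speaks only of the open strip.
  The logarithm of L on a disc about 2 + i t also needs non-vanishing on Re s = 1, including s = 1
  for real characters; this comes from the 3-4-1 inequality and a Lambert series. For small t the
  disc contains s = 1, so the pole for the principal character is cancelled by (s - 1) / (s +
  1).\<close>

lemma abel_summation:
  fixes b g :: "nat \<Rightarrow> 'a::comm_ring"
  assumes "m \<le> k"
  shows "(\<Sum>n\<in>{m<..k}. b n * g n) =
    (\<Sum>j=1..k. b j) * g (Suc k) - (\<Sum>j=1..m. b j) * g (Suc m)
      + (\<Sum>n\<in>{m<..k}. (\<Sum>j=1..n. b j) * (g n - g (Suc n)))"
  using assms
proof (induction k rule: dec_induct)
  case (step k)
  have "{m<..Suc k} = insert (Suc k) {m<..k}" using step by auto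
  moreover have "{1..Suc k} = insert (Suc k) {1..k}" by auto
  ultimately show ?case using step by (simp add: algebra_simps)
qed simp

text \<open>Replaces an integral test: each error of the Abel summation is dominated by a
  telescoping difference, so the errors beyond \<open>N\<close> add up to
  O(\<open>N powr (\<theta> - 1)\<close>). By the mean value theorem that difference is
  \<open>(1 - \<theta>) * \<xi> powr (\<theta> - 2)\<close> with \<open>n < \<xi> < n + 1\<close>;
  the 2 pays for replacing \<open>n powr (\<theta> - 1)\<close> by its value at
  \<open>n + 1\<close>.\<close>

lemma powr_telescope_bound:
  fixes \<theta> :: real
  assumes "0 < \<theta>" "\<theta> < 1" "n \<ge> (1::nat)"
  shows "real n powr \<theta> * (1 / n - 1 / Suc n) \<le> 2 / (1 - \<theta>) * (real n powr (\<theta> - 1) - real (Suc n) powr (\<theta> - 1))"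
proof -
  have "\<exists>\<xi>::real. n < \<xi> \<and> \<xi> < Suc n \<and> real (Suc n) powr (\<theta> - 1) - real n powr (\<theta> - 1)
      = (real (Suc n) - real n) * ((\<theta> - 1) * \<xi> powr (\<theta> - 1 - 1))"
  proof (rule MVT2)
    fix x :: real assume "real n \<le> x"
    then have "x > 0" using assms by linarith
    then show "((\<lambda>x. x powr (\<theta> - 1)) has_real_derivative (\<theta> - 1) * x powr (\<theta> - 1 - 1)) (at x)"
      by (rule has_real_derivative_powr)
  qed simp
  then obtain \<xi> :: real where xi: "n < \<xi>" "\<xi> < Suc n"
    and eq: "real n powr (\<theta> - 1) - real (Suc n) powr (\<theta> - 1) = (1 - \<theta>) * \<xi> powr (\<theta> - 2)"
    by (auto simp: left_diff_distrib)
  have n0: "real n > 0" using assms by simp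
  have "real (Suc n) powr (\<theta> - 2) \<le> \<xi> powr (\<theta> - 2)"
    using xi n0 assms by (intro powr_mono2') auto
  moreover have "real n powr \<theta> * (1 / n - 1 / Suc n) = real n powr \<theta> / n / Suc n"
    using n0 by (simp add: field_simps)
  moreover have "real n powr \<theta> / n \<le> 2 * real (Suc n) powr (\<theta> - 1)"
  proof -
    have "real n powr \<theta> / n = real n powr (\<theta> - 1)" using n0 by (simp add: powr_diff)
    also have "\<dots> \<le> (real (Suc n) / 2) powr (\<theta> - 1)"
      using n0 assms by (intro powr_mono2') auto
    also have "\<dots> = real (Suc n) powr (\<theta> - 1) * 2 powr (1 - \<theta>)"
      by (simp add: powr_divide powr_diff field_simps)
    also have "\<dots> \<le> real (Suc n) powr (\<theta> - 1) * 2 powr 1"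
      using assms by (intro mult_left_mono powr_mono) auto
    finally show ?thesis by simp
  qed
  moreover have "real (Suc n) powr (\<theta> - 1) / Suc n = real (Suc n) powr (\<theta> - 2)"
    using powr_diff[of "real (Suc n)" "\<theta> - 1" 1] by simp
  ultimately have "real n powr \<theta> * (1 / n - 1 / Suc n) \<le> 2 * \<xi> powr (\<theta> - 2)"
    using divide_right_mono[of "real n powr \<theta> / n" "2 * real (Suc n) powr (\<theta> - 1)" "real (Suc n)"]
    unfolding times_divide_eq_right[symmetric] by linarith
  also have "\<dots> = 2 / (1 - \<theta>) * ((1 - \<theta>) * \<xi> powr (\<theta> - 2))" using assms by simp
  finally show ?thesis unfolding eq .
qed

section \<open>Hoelder continuity from uniform bounds for exponential sums\<close>

context
  fixes f :: "nat \<Rightarrow> int" and C \<theta> :: real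
  assumes \<theta>: "0 < \<theta>" "\<theta> < 1"
    and bound: "\<And>N t. N \<ge> 1 \<Longrightarrow> cmod (\<Sum>n=1..N. exp_term f t n) \<le> C * real N powr \<theta>"
begin

private lemma C0: "C \<ge> 0"
  using order_trans[OF norm_ge_zero bound[of 1]] by simp

private lemma tail_bound:
  assumes "1 \<le> N" "N \<le> M"
  shows "cmod (\<Sum>n\<in>{N<..M}. exp_term f t n / n) \<le> C * (2 + 2 / (1 - \<theta>)) * real N powr (\<theta> - 1)"
proof -
  define S where "S n = (\<Sum>j=1..n. exp_term f t j)" for n
  have edge: "cmod (S k * (1 / of_nat (Suc k))) \<le> C * real N powr (\<theta> - 1)" if "k \<ge> N" for k
  proof -
    have "cmod (S k * (1 / of_nat (Suc k))) = cmod (S k) / Suc k" by (simp add: norm_divide norm_mult del: of_nat_Suc)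
    also have "\<dots> \<le> C * real k powr \<theta> / Suc k"
      using bound[of k t] assms that by (intro divide_right_mono) (auto simp: S_def)
    also have "\<dots> \<le> C * real k powr \<theta> / k"
      using C0 assms that by (intro divide_left_mono) auto
    also have "\<dots> = C * real k powr (\<theta> - 1)" using assms that by (simp add: powr_diff)
    also have "\<dots> \<le> C * real N powr (\<theta> - 1)"
      using C0 assms that \<theta> by (intro mult_left_mono powr_mono2') auto
    finally show ?thesis .
  qed
  have "(\<Sum>n\<in>{N<..M}. exp_term f t n / n) = (\<Sum>n\<in>{N<..M}. exp_term f t n * (1 / of_nat n))"
    by simp
  also have "\<dots> = S M * (1 / of_nat (Suc M)) - S N * (1 / of_nat (Suc N))
      + (\<Sum>n\<in>{N<..M}. S n * (1 / of_nat n - 1 / of_nat (Suc n)))"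
    unfolding S_def by (rule abel_summation[OF assms(2)])
  also have "cmod \<dots> \<le> C * real N powr (\<theta> - 1) + C * real N powr (\<theta> - 1)
      + (\<Sum>n\<in>{N<..M}. C * (2 / (1 - \<theta>)) * (real n powr (\<theta> - 1) - real (Suc n) powr (\<theta> - 1)))"
  proof (intro order_trans[OF norm_triangle_ineq] add_mono order_trans[OF norm_triangle_ineq4] edge sum_norm_le)
    fix n assume n: "n \<in> {N<..M}"
    have "cmod (S n * (1 / of_nat n - 1 / of_nat (Suc n))) = cmod (S n) * (1 / n - 1 / Suc n)"
    proof -
      have "(1 / of_nat n - 1 / of_nat (Suc n) :: complex) = of_real (1 / n - 1 / Suc n)" by simp
      moreover have "1 / n - 1 / Suc n \<ge> 0" using n by (simp add: field_simps)
      ultimately show ?thesis by (metis norm_mult norm_of_real abs_of_nonneg)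
    qed
    also have "\<dots> \<le> C * real n powr \<theta> * (1 / n - 1 / Suc n)"
      using bound[of n t] n by (intro mult_right_mono) (auto simp: S_def field_simps)
    also have "\<dots> \<le> C * (2 / (1 - \<theta>) * (real n powr (\<theta> - 1) - real (Suc n) powr (\<theta> - 1)))"
      using mult_left_mono[OF powr_telescope_bound[OF \<theta>, of n] C0] n by (simp add: mult.assoc)
    finally show "cmod (S n * (1 / of_nat n - 1 / of_nat (Suc n))) \<le> C * (2 / (1 - \<theta>)) * (real n powr (\<theta> - 1) - real (Suc n) powr (\<theta> - 1))"
      by (simp add: mult.assoc)
  qed (use assms in auto)
  also have "(\<Sum>n\<in>{N<..M}. C * (2 / (1 - \<theta>)) * (real n powr (\<theta> - 1) - real (Suc n) powr (\<theta> - 1)))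
    = C * (2 / (1 - \<theta>)) * (\<Sum>n\<in>{N<..M}. (real n powr (\<theta> - 1) - real (Suc n) powr (\<theta> - 1)))"
    by (simp add: sum_distrib_left)
  also have "(\<Sum>n\<in>{N<..M}. (real n powr (\<theta> - 1) - real (Suc n) powr (\<theta> - 1)))
      = real (Suc N) powr (\<theta> - 1) - real (Suc M) powr (\<theta> - 1)"
    using assms(2)
  proof (induction M rule: dec_induct)
    case (step k)
    have "{N<..Suc k} = insert (Suc k) {N<..k}" using step by auto
    then show ?case using step by simp
  qed simp
  also have "C * (2 / (1 - \<theta>)) * (real (Suc N) powr (\<theta> - 1) - real (Suc M) powr (\<theta> - 1))
      \<le> C * (2 / (1 - \<theta>)) * real N powr (\<theta> - 1)"
  proof (intro mult_left_mono)
    have "real (Suc N) powr (\<theta> - 1) \<le> real N powr (\<theta> - 1)"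
      using assms \<theta> by (intro powr_mono2') auto
    then show "real (Suc N) powr (\<theta> - 1) - real (Suc M) powr (\<theta> - 1) \<le> real N powr (\<theta> - 1)"
      by (smt (verit) powr_ge_zero)
  qed (use C0 \<theta> in auto)
  finally show ?thesis by (simp add: algebra_simps)
qed

text \<open>The tail bound also makes the partial sums Cauchy. Only with this convergence is the
  \<open>suminf\<close> in \<open>F\<close> the intended limit, as the series need not converge
  absolutely.\<close>

private lemma F_approx:
  assumes "N \<ge> 1"
  shows "cmod (F f t - (\<Sum>n=1..N. exp_term f t n / n)) \<le> C * (2 + 2 / (1 - \<theta>)) * real N powr (\<theta> - 1)"
proof -
  define P where "P N = (\<Sum>n=1..N. exp_term f t n / n)" for N
  define K where "K = C * (2 + 2 / (1 - \<theta>))"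
  have K0: "K \<ge> 0" using C0 \<theta> by (simp add: K_def)
  have diff: "cmod (P M - P N) \<le> K * real N powr (\<theta> - 1)" if "1 \<le> N" "N \<le> M" for M N
  proof -
    have "{1..M} = {1..N} \<union> {N<..M}" using that by auto
    then have "P M = P N + (\<Sum>n\<in>{N<..M}. exp_term f t n / n)"
      unfolding P_def by (subst sum.union_disjoint[symmetric]) auto
    then show ?thesis using tail_bound[OF that, of t] by (simp add: K_def)
  qed
  have lim0: "(\<lambda>N. K * real N powr (\<theta> - 1)) \<longlonglongrightarrow> 0"
    using \<theta> by (intro tendsto_mult_right_zero tendsto_neg_powr filterlim_real_sequentially) auto
  have "Cauchy P"
  proof (rule CauchyI)
    fix e :: real assume "e > 0"
    then obtain N0 where N0: "\<And>N. N \<ge> N0 \<Longrightarrow> K * real N powr (\<theta> - 1) < e / 2"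
      using order_tendstoD(2)[OF lim0, of "e/2"] by (auto simp: eventually_sequentially)
    define N1 where "N1 = max 1 N0"
    have "cmod (P m - P n) < e" if "m \<ge> N1" "n \<ge> N1" for m n
    proof -
      have "cmod (P m - P N1) < e/2" "cmod (P n - P N1) < e/2"
        using diff[of N1 m] diff[of N1 n] that N0[of N1] by (auto simp: N1_def)
      then show ?thesis using norm_triangle_ineq4[of "P m - P N1" "P n - P N1"] by simp
    qed
    then show "\<exists>M. \<forall>m\<ge>M. \<forall>n\<ge>M. cmod (P m - P n) < e" by blast
  qed
  then obtain L where L: "P \<longlonglongrightarrow> L" using Cauchy_convergent convergent_def by blast
  have "(\<lambda>n. exp_term f t (Suc n) / of_nat (Suc n)) sums L"
    unfolding sums_def
  proof (rule Lim_transform_eventually[OF L always_eventually], rule allI)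
    fix n show "P n = (\<Sum>i<n. exp_term f t (Suc i) / of_nat (Suc i))"
      unfolding P_def by (induction n) (auto simp: field_simps)
  qed
  then have "F f t = L" by (simp add: F_def sums_iff)
  moreover have "cmod (L - P N) \<le> K * real N powr (\<theta> - 1)"
    by (rule tendsto_upperbound[OF tendsto_norm[OF tendsto_diff[OF L tendsto_const]]])
      (use diff[OF assms] in \<open>auto intro!: eventually_sequentiallyI[of N]\<close>)
  ultimately show ?thesis by (simp add: P_def K_def)
qed

text \<open>Differentiation in \<open>t\<close> produces the factor
  \<open>2 * pi * \<i> * n\<close>, which cancels the denominator \<open>n\<close>: the derivative
  of the partial sum is the exponential sum itself, bounded by hypothesis.\<close>

private lemma partial_sum_Lipschitz:
  assumes "N \<ge> 1"
  shows "cmod ((\<Sum>n=1..N. exp_term f x n / n) - (\<Sum>n=1..N. exp_term f y n / n))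
           \<le> 2 * pi * C * real N powr \<theta> * \<bar>x - y\<bar>"
proof -
  have "norm ((\<Sum>n=1..N. exp_term f x n / n) - (\<Sum>n=1..N. exp_term f y n / n)) \<le> (2 * pi * C * real N powr \<theta>) * norm (x - y)"
  proof (rule differentiable_bound[where S = UNIV and f' = "\<lambda>t h. h *\<^sub>R (2 * pi * \<i> * (\<Sum>n=1..N. exp_term f t n))"])
    fix t :: real
    have "((\<lambda>t. (\<Sum>n=1..N. exp_term f t n / n)) has_vector_derivative (2 * pi * \<i> * (\<Sum>n=1..N. exp_term f t n))) (at t)"
      unfolding exp_term_def sum_distrib_left
      by (rule has_vector_derivative_real_field, (rule derivative_eq_intros refl | simp)+)
        (auto intro!: sum.cong simp: field_simps)
    then show "((\<lambda>t. \<Sum>n=1..N. exp_term f t n / n) has_derivative (\<lambda>h. h *\<^sub>R (2 * pi * \<i> * (\<Sum>n=1..N. exp_term f t n)))) (at t within UNIV)"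
      by (simp add: has_vector_derivative_def)
    have "norm (2 * pi * \<i> * (\<Sum>n=1..N. exp_term f t n)) \<le> 2 * pi * C * real N powr \<theta>"
      using bound[OF assms, of t] by (simp add: norm_mult)
    then show "onorm (\<lambda>h. h *\<^sub>R (2 * pi * \<i> * (\<Sum>n=1..N. exp_term f t n))) \<le> 2 * pi * C * real N powr \<theta>"
      by (intro onorm_le) (metis norm_ge_zero norm_scaleR real_norm_def mult.commute mult_left_mono)
  qed auto
  then show ?thesis by simp
qed

lemma hoelder_continuous_F: "hoelder_continuous (1 - \<theta>) (F f)"
proof -
  define K where "K = C * (2 + 2 / (1 - \<theta>))"
  have K0: "K \<ge> 0" using C0 \<theta> by (simp add: K_def)
  define P where "P N t = (\<Sum>n=1..N. exp_term f t n / n)" for N t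
  have split: "cmod (F f x - F f y) \<le> 2 * (K * real N powr (\<theta> - 1)) + cmod (P N x - P N y)" if "N \<ge> 1" for N x y
  proof -
    have "cmod (F f x - F f y) \<le> cmod (F f x - P N x) + cmod (F f y - P N y) + cmod (P N x - P N y)"
      using norm_triangle_ineq4[of "F f x - P N x" "F f y - P N y"]
        norm_triangle_ineq[of "(F f x - P N x) - (F f y - P N y)" "P N x - P N y"] by simp
    moreover have "cmod (F f z - P N z) \<le> K * real N powr (\<theta> - 1)" for z
      using F_approx[OF that, of z] by (simp add: K_def P_def)
    ultimately show ?thesis by (smt (verit))
  qed
  \<comment> \<open>The first two summands serve distances up to 1, \<open>2 * K + 2 * C\<close>
    serves larger ones, and the final 1 keeps the constant positive when
    \<open>C = 0\<close>.\<close>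
  define K' where "K' = 2 * K + 4 * pi * C + 2 * C + 1"
  have "cmod (F f x - F f y) \<le> K' * \<bar>x - y\<bar> powr (1 - \<theta>)" for x y
  proof -
    consider "x = y" | "\<bar>x - y\<bar> > 1" | "0 < \<bar>x - y\<bar>" "\<bar>x - y\<bar> \<le> 1" by force
    then show ?thesis
    proof cases
      \<comment> \<open>Distant points only need boundedness: truncation at \<open>N = 1\<close>
        bounds the difference by a constant, and a power of a distance above 1 is at least
        1.\<close>
      case 2
      have "cmod (P 1 x - P 1 y) \<le> C + C"
        using bound[of 1 x] bound[of 1 y] norm_triangle_ineq4[of "P 1 x" "P 1 y"] by (simp add: P_def)
      then have "cmod (F f x - F f y) \<le> 2 * K + 2 * C" using split[of 1 x y] by simp
      also have "\<dots> \<le> K' * 1" using C0 by (simp add: K'_def)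
      also have "\<dots> \<le> K' * \<bar>x - y\<bar> powr (1 - \<theta>)"
        using 2 \<theta> C0 K0 by (intro mult_left_mono ge_one_powr_ge_zero) (auto simp: K'_def)
      finally show ?thesis .
    next
      case 3
      define h where "h = \<bar>x - y\<bar>"
      define N where "N = nat \<lceil>1 / h\<rceil>"
      have h: "0 < h" "h \<le> 1" using 3 by (auto simp: h_def)
      then have N1: "real N \<ge> 1 / h" "real N \<le> 2 / h"
      proof -
        have "1 / h \<ge> 1" using h by simp
        then show "real N \<ge> 1 / h" "real N \<le> 2 / h" unfolding N_def by linarith+
      qed
      have "real N \<ge> 1" using N1(1) h by (smt (verit) le_divide_eq_1_pos)
      then have N: "N \<ge> 1" by simp
      \<comment> \<open>As \<open>N\<close> lies between \<open>1 / h\<close> and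
        \<open>2 / h\<close>, the tail \<open>N powr (\<theta> - 1)\<close> and the Lipschitz term
        \<open>N powr \<theta> * h\<close> both have order
        \<open>h powr (1 - \<theta>)\<close>.\<close>
      have "2 * (K * real N powr (\<theta> - 1)) \<le> 2 * (K * (1 / h) powr (\<theta> - 1))"
        using N1 h \<theta> K0 by (intro mult_left_mono powr_mono2') auto
      also have "(1 / h) powr (\<theta> - 1) = h powr (1 - \<theta>)"
        using h by (simp add: powr_divide powr_diff)
      finally have 1: "2 * (K * real N powr (\<theta> - 1)) \<le> 2 * K * h powr (1 - \<theta>)" by simp
      have "cmod (P N x - P N y) \<le> 2 * pi * C * real N powr \<theta> * h"
        using partial_sum_Lipschitz[OF N, of x y] unfolding P_def h_def .
      also have "\<dots> \<le> 2 * pi * C * (2 / h) powr \<theta> * h"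
        using C0 \<theta> N1 h by (intro mult_right_mono mult_left_mono powr_mono2) auto
      also have "\<dots> = 2 * pi * C * 2 powr \<theta> * h powr (1 - \<theta>)"
        using h by (simp add: powr_divide powr_diff)
      also have "\<dots> \<le> 2 * pi * C * 2 powr 1 * h powr (1 - \<theta>)"
        using C0 \<theta> by (intro mult_right_mono mult_left_mono powr_mono) auto
      finally have 2: "cmod (P N x - P N y) \<le> 4 * pi * C * h powr (1 - \<theta>)" by simp
      have "cmod (F f x - F f y) \<le> (2 * K + 4 * pi * C) * h powr (1 - \<theta>)"
        using split[OF N, of x y] 1 2 by (simp add: algebra_simps)
      also have "\<dots> \<le> K' * h powr (1 - \<theta>)"
        using C0 by (intro mult_right_mono) (auto simp: K'_def)
      finally show ?thesis by (simp add: h_def)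
    qed auto
  qed
  moreover have "K' > 0" using K0 C0 by (auto simp: K'_def intro!: add_nonneg_pos)
  ultimately show ?thesis using \<theta> by (auto simp: hoelder_continuous_def)
qed

end

lemma hoelder_continuous_compose:
  assumes "hoelder_continuous \<eta> g" and "\<And>u v. norm (h u - h v) \<le> norm (u - v)"
  shows "hoelder_continuous \<eta> (\<lambda>t. h (g t))"
  using assms unfolding hoelder_continuous_def by (meson order_trans)

lemma hoelder_continuous_parts:
  fixes g :: "real \<Rightarrow> complex"
  assumes "hoelder_continuous \<eta> g"
  shows "hoelder_continuous \<eta> (\<lambda>t. cmod (g t))" "hoelder_continuous \<eta> (\<lambda>t. Re (g t))"
    "hoelder_continuous \<eta> (\<lambda>t. Im (g t))"
proof -
  show "hoelder_continuous \<eta> (\<lambda>t. cmod (g t))"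
    by (rule hoelder_continuous_compose[OF assms]) (simp add: norm_triangle_ineq3)
  show "hoelder_continuous \<eta> (\<lambda>t. Re (g t))"
    by (rule hoelder_continuous_compose[OF assms]) (metis abs_Re_le_cmod minus_complex.simps(1) real_norm_def)
  show "hoelder_continuous \<eta> (\<lambda>t. Im (g t))"
    by (rule hoelder_continuous_compose[OF assms]) (metis abs_Im_le_cmod minus_complex.simps(2) real_norm_def)
qed

section \<open>Box-counting dimension of Hoelder graphs\<close>

lemma covering_number_le:
  assumes "finite \<C>" "E \<subseteq> \<Union>\<C>" "\<And>U. U \<in> \<C> \<Longrightarrow> bounded U \<and> diameter U \<le> r"
  shows "covering_number E r \<le> card \<C>"
  unfolding covering_number_def by (rule Least_le) (use assms in blast)

lemma covering_number_graph:
  fixes g :: "real \<Rightarrow> real"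
  assumes "K > 0" "0 < \<eta>" "\<eta> < 1" "\<And>x y. \<bar>g x - g y\<bar> \<le> K * \<bar>x - y\<bar> powr \<eta>" "0 < r" "r < 1"
  shows "real (covering_number (graph01 g) r) \<le> (16 * (K + 1)) * r powr (\<eta> - 2)"
proof -
  \<comment> \<open>A square of side \<open>h\<close> has diameter at most \<open>2 * h = r\<close>,
    as the norm of a pair is at most the sum of its entries. Over a column of width \<open>h\<close>
    the graph stays within \<open>K * h powr \<eta>\<close> of its value at the left end, which
    fixes the number \<open>B\<close> of squares needed on either side.\<close>
  define h where "h = r / 2"
  have h: "0 < h" "h < 1" using assms by (auto simp: h_def)
  define A where "A = nat \<lfloor>1 / h\<rfloor>"
  define B where "B = nat \<lfloor>K * h powr \<eta> / h\<rfloor>"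
  define box where "box i j = cbox (real i * h, g (real i * h) + of_int j * h) (real i * h + h, g (real i * h) + of_int j * h + h)" for i :: nat and j :: int
  \<comment> \<open>The lower end is \<open>- B - 1\<close> because the floor of a number that is at
    least \<open>- K * h powr \<eta> / h\<close> may fall one below \<open>- B\<close>.\<close>
  define \<C> where "\<C> = (\<lambda>(i, j). box i j) ` ({0..A} \<times> {- int B - 1..int B})"
  have fin: "finite \<C>" by (simp add: \<C>_def)
  have cov: "graph01 g \<subseteq> \<Union>\<C>"
  proof
    fix p assume "p \<in> graph01 g"
    then obtain t where p: "p = (t, g t)" and t: "0 \<le> t" "t \<le> 1" by (auto simp: graph01_def)
    define i where "i = nat \<lfloor>t / h\<rfloor>"
    have th: "t / h \<ge> 0" using t h by simp
    have i1: "real i \<le> t / h" "t / h < real i + 1" unfolding i_def using th by linarith+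
    then have i2: "real i * h \<le> t" "t \<le> real i * h + h" using h by (auto simp: field_simps)
    have "t / h \<le> 1 / h" using t h by (simp add: divide_right_mono)
    then have iA: "i \<le> A" unfolding i_def A_def by (intro nat_mono floor_mono)
    define u where "u = (g t - g (real i * h)) / h"
    define j where "j = \<lfloor>u\<rfloor>"
    have "\<bar>g t - g (real i * h)\<bar> \<le> K * \<bar>t - real i * h\<bar> powr \<eta>" by (rule assms)
    also have "\<dots> \<le> K * h powr \<eta>"
      using i2 assms by (intro mult_left_mono powr_mono2) auto
    finally have "\<bar>u\<bar> \<le> K * h powr \<eta> / h" using h by (simp add: u_def divide_right_mono)
    then have "- int B - 1 \<le> j" "j \<le> int B" unfolding j_def B_def by linarith+
    moreover have "of_int j * h \<le> g t - g (real i * h)" "g t - g (real i * h) \<le> of_int j * h + h"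
    proof -
      have "of_int j \<le> u" "u \<le> of_int j + 1" unfolding j_def by linarith+
      then have "of_int j * h \<le> u * h" "u * h \<le> (of_int j + 1) * h" using h by (auto intro!: mult_right_mono)
      then show "of_int j * h \<le> g t - g (real i * h)" "g t - g (real i * h) \<le> of_int j * h + h"
        using h by (auto simp: u_def distrib_right)
    qed
    ultimately have "p \<in> box i j" "box i j \<in> \<C>"
      using i2 iA by (auto simp: p box_def \<C>_def)
    then show "p \<in> \<Union>\<C>" by blast
  qed
  have diam: "bounded U \<and> diameter U \<le> r" if "U \<in> \<C>" for U
  proof -
    obtain i j where U: "U = box i j" using \<open>U \<in> \<C>\<close> by (auto simp: \<C>_def)
    have "diameter U \<le> r"
    proof (rule diameter_le)
      fix p q assume pq: "p \<in> U" "q \<in> U"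
      have "\<bar>fst p - fst q\<bar> \<le> h" "\<bar>snd p - snd q\<bar> \<le> h"
        using pq by (cases p; cases q; auto simp: U box_def mem_box cbox_Pair_eq)+
      then show "norm (p - q) \<le> r"
        using norm_Pair_le[of "fst (p - q)" "snd (p - q)"] by (simp add: h_def del: fst_diff snd_diff add: fst_diff[symmetric] snd_diff[symmetric])
    qed (use assms in auto)
    then show ?thesis by (simp add: U box_def)
  qed
  have "covering_number (graph01 g) r \<le> card \<C>"
    by (rule covering_number_le[OF fin cov diam])
  also have "card \<C> \<le> card ({0..A} \<times> {- int B - 1..int B})"
    unfolding \<C>_def by (intro card_image_le) auto
  also have "\<dots> = (A + 1) * (2 * B + 2)" 
    by (simp add: card_cartesian_product nat_add_distrib nat_mult_distrib)
  finally have "real (covering_number (graph01 g) r) \<le> real ((A + 1) * (2 * B + 2))"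
    using of_nat_le_iff by blast
  also have "\<dots> = (real A + 1) * (2 * real B + 2)" by (simp add: algebra_simps)
  \<comment> \<open>Both additive constants are absorbed by using \<open>1 \<le> 1 / h\<close> and
    \<open>1 \<le> h powr \<eta> / h\<close>; this gives \<open>4 * (K + 1)\<close>, and
    \<open>h = r / 2\<close> costs another factor of at most 4, hence the 16.\<close>
  also have "\<dots> \<le> (1 / h + 1 / h) * (2 * (K * h powr \<eta> / h) + 2 * (h powr \<eta> / h))"
  proof -
    have "real A \<le> 1 / h" "1 \<le> 1 / h" using h by (auto simp: A_def)
    moreover have "0 \<le> K * h powr \<eta> / h" using h assms by simp
    then have "real B \<le> K * h powr \<eta> / h" by (auto simp: B_def)
    moreover have "1 \<le> h powr \<eta> / h"
    proof -
      have "h powr 1 \<le> h powr \<eta>" using h assms by (intro powr_mono') auto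
      then show ?thesis using h by simp
    qed
    ultimately have "real A + 1 \<le> 1 / h + 1 / h" "2 * real B + 2 \<le> 2 * (K * h powr \<eta> / h) + 2 * (h powr \<eta> / h)"
      by linarith+
    then show ?thesis using h by (intro mult_mono) auto
  qed
  also have "\<dots> = 4 * (K + 1) * (h powr \<eta> / h^2)" using h by (simp add: field_simps power2_eq_square)
  also have "h powr \<eta> / h^2 = h powr (\<eta> - 2)" using h by (simp add: powr_diff)
  also have "\<dots> = r powr (\<eta> - 2) * 2 powr (2 - \<eta>)"
    using assms by (simp add: h_def powr_divide powr_diff)
  also have "4 * (K + 1) * (r powr (\<eta> - 2) * 2 powr (2 - \<eta>)) \<le> 4 * (K + 1) * (r powr (\<eta> - 2) * 2 powr 2)"
    using assms by (intro mult_left_mono powr_mono) auto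
  finally show ?thesis using assms by (simp add: algebra_simps)
qed

lemma upper_box_dim_graph:
  assumes "hoelder_continuous \<eta> (g :: real \<Rightarrow> real)"
  shows "upper_box_dim (graph01 g) \<le> ereal (2 - \<eta>)"
proof -
  obtain K where K: "K > 0" "\<And>x y. \<bar>g x - g y\<bar> \<le> K * \<bar>x - y\<bar> powr \<eta>" and \<eta>: "0 < \<eta>" "\<eta> < 1"
    using assms unfolding hoelder_continuous_def real_norm_def by blast
  \<comment> \<open>\<open>D \<ge> 1\<close> makes the logarithmic bound nonnegative, which disposes
    of the case of a covering number 0 with its default \<open>ln 0 = 0\<close>.\<close>
  define D where "D = max 1 (16 * (K + 1))"
  have "((\<lambda>r. (ln D + (2 - \<eta>) * ln (1 / r)) / ln (1 / r)) \<longlongrightarrow> 2 - \<eta>) (at_right 0)"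
  proof (rule Lim_transform_eventually)
    have "((\<lambda>r::real. 1 / ln (1 / r)) \<longlongrightarrow> 0) (at_right 0)" by real_asymp
    from tendsto_add[OF tendsto_mult[OF tendsto_const this] tendsto_const]
    show "((\<lambda>r. ln D * (1 / ln (1 / r)) + (2 - \<eta>)) \<longlongrightarrow> 2 - \<eta>) (at_right 0)" by simp
    have "eventually (\<lambda>r. r \<in> {0<..<1::real}) (at_right 0)"
      by (rule eventually_at_right_real) simp
    then show "\<forall>\<^sub>F r in at_right 0. ln D * (1 / ln (1 / r)) + (2 - \<eta>) = (ln D + (2 - \<eta>) * ln (1 / r)) / ln (1 / r)"
      by eventually_elim (auto simp: field_simps ln_div)
  qed
  then have lim: "((\<lambda>r. ereal ((ln D + (2 - \<eta>) * ln (1 / r)) / ln (1 / r))) \<longlongrightarrow> ereal (2 - \<eta>)) (at_right 0)"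
    by simp
  have "upper_box_dim (graph01 g) \<le> Limsup (at_right 0) (\<lambda>r. ereal ((ln D + (2 - \<eta>) * ln (1 / r)) / ln (1 / r)))"
    unfolding upper_box_dim_def
  proof (rule Limsup_mono)
    have "eventually (\<lambda>r. r \<in> {0<..<1::real}) (at_right 0)"
      by (rule eventually_at_right_real) simp
    then show "\<forall>\<^sub>F r in at_right 0. ereal (ln (real (covering_number (graph01 g) r)) / ln (1 / r))
        \<le> ereal ((ln D + (2 - \<eta>) * ln (1 / r)) / ln (1 / r))"
    proof eventually_elim
      case (elim r)
      then have r: "0 < r" "r < 1" by auto
      define n where "n = covering_number (graph01 g) r"
      have "real n \<le> (16 * (K + 1)) * r powr (\<eta> - 2)"
        unfolding n_def by (rule covering_number_graph) (use K \<eta> r in auto)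
      also have "\<dots> \<le> D * r powr (\<eta> - 2)" by (intro mult_right_mono) (auto simp: D_def)
      finally have n: "real n \<le> D * r powr (\<eta> - 2)" .
      have ln_rhs: "ln (D * r powr (\<eta> - 2)) = ln D + (2 - \<eta>) * ln (1 / r)"
      proof -
        have "ln (D * r powr (\<eta> - 2)) = ln D + ln (r powr (\<eta> - 2))"
          using r by (intro ln_mult_pos) (auto simp: D_def)
        also have "ln (r powr (\<eta> - 2)) = (2 - \<eta>) * ln (1 / r)"
          using r by (simp add: ln_powr ln_div left_diff_distrib)
        finally show ?thesis .
      qed
      have "ln (real n) \<le> ln D + (2 - \<eta>) * ln (1 / r)"
      proof (cases "n = 0")
        case True
        have "0 \<le> ln D + (2 - \<eta>) * ln (1 / r)"
          using r \<eta> by (intro add_nonneg_nonneg mult_nonneg_nonneg ln_ge_zero) (auto simp: D_def)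
        with True show ?thesis by simp
      next
        case False
        then have "ln (real n) \<le> ln (D * r powr (\<eta> - 2))" using n by (intro ln_mono) auto
        then show ?thesis using ln_rhs by simp
      qed
      moreover have "ln (1 / r) > 0" using r by simp
      ultimately show ?case
        unfolding n_def ereal_less_eq by (intro divide_right_mono) auto
    qed
  qed
  also have "\<dots> = ereal (2 - \<eta>)"
    by (rule lim_imp_Limsup[OF trivial_limit_at_right_real lim])
  finally show ?thesis .
qed

lemma upper_box_dim_graph_limit:
  assumes "\<And>\<epsilon>. 0 < \<epsilon> \<Longrightarrow> \<epsilon> < \<eta> \<Longrightarrow> hoelder_continuous (\<eta> - \<epsilon>) (g :: real \<Rightarrow> real)" and "\<eta> > 0"
  shows "upper_box_dim (graph01 g) \<le> ereal (2 - \<eta>)"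
proof (rule ereal_le_epsilon2)
  fix e :: real assume e: "e > 0"
  define \<epsilon> where "\<epsilon> = min e (\<eta> / 2)"
  have "upper_box_dim (graph01 g) \<le> ereal (2 - (\<eta> - \<epsilon>))"
    by (rule upper_box_dim_graph[OF assms(1)]) (use e assms in \<open>auto simp: \<epsilon>_def\<close>)
  also have "\<dots> \<le> ereal (2 - \<eta>) + ereal e" by (simp add: \<epsilon>_def)
  finally show "upper_box_dim (graph01 g) \<le> ereal (2 - \<eta>) + ereal e" .
qed

section \<open>The Moebius and Liouville functions\<close>

lemma sum_divisors_coprime:
  fixes f :: "nat \<Rightarrow> 'a::comm_semiring_0"
  assumes f: "\<And>m n. coprime m n \<Longrightarrow> m dvd a \<Longrightarrow> n dvd b \<Longrightarrow> f (m * n) = f m * f n"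
    and "coprime a b" "a > 0" "b > 0"
  shows "(\<Sum>d | d dvd a * b. f d) = (\<Sum>d | d dvd a. f d) * (\<Sum>d | d dvd b. f d)"
proof -
  have "(\<Sum>d | d dvd a. f d) * (\<Sum>d | d dvd b. f d) = (\<Sum>(m, n)\<in>{d. d dvd a} \<times> {d. d dvd b}. f m * f n)"
    by (simp add: sum_product sum.cartesian_product)
  also have "\<dots> = (\<Sum>d | d dvd a * b. f d)"
  proof (rule sum.reindex_bij_witness[where i = "\<lambda>d. (gcd d a, gcd d b)" and j = "\<lambda>(m, n). m * n"])
    fix p assume "p \<in> {d. d dvd a} \<times> {d. d dvd b}"
    then obtain m n where p: "p = (m, n)" "m dvd a" "n dvd b" by auto
    then have co: "coprime m b" "coprime n a" "coprime m n"
      using \<open>coprime a b\<close> by (meson coprime_divisors dvd_refl coprime_commute)+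
    have "gcd (m * n) a = gcd m a" "gcd (m * n) b = gcd n b"
      using co by (simp_all add: gcd_mult_left_right_cancel gcd_mult_left_left_cancel coprime_commute)
    then show "(case case p of (m, n) \<Rightarrow> m * n of d \<Rightarrow> (gcd d a, gcd d b)) = p"
      using p by (simp add: gcd_proj1_if_dvd)
    show "(case p of (m, n) \<Rightarrow> m * n) \<in> {d. d dvd a * b}" using p by (simp add: mult_dvd_mono)
    show "f (case p of (m, n) \<Rightarrow> m * n) = (case p of (m, n) \<Rightarrow> f m * f n)"
      using f co p by simp
  next
    fix d assume d: "d \<in> {d. d dvd a * b}"
    have "gcd d a * gcd d b = d"
    proof (rule dvd_antisym)
      have "coprime (gcd d a) (gcd d b)"
        using \<open>coprime a b\<close> by (meson coprime_divisors gcd_dvd2)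
      then show "gcd d a * gcd d b dvd d" by (intro divides_mult) auto
      \<comment> \<open>The product of the two gcds is the gcd of the four products
        \<open>d * d\<close>, \<open>d * b\<close>, \<open>a * d\<close>, \<open>a * b\<close>, and
        \<open>d\<close> divides each of them.\<close>
      have "gcd d a * gcd d b = gcd (gcd (d * d) (d * b)) (gcd (a * d) (a * b))"
        by (simp add: gcd_mult_distrib_nat gcd_mult_distrib_nat[of _ d, simplified mult.commute] mult.commute gcd.assoc gcd.left_commute gcd.commute)
      then show "d dvd gcd d a * gcd d b" using d by simp
    qed
    then show "(case (gcd d a, gcd d b) of (m, n) \<Rightarrow> m * n) = d" by simp
    show "(gcd d a, gcd d b) \<in> {d. d dvd a} \<times> {d. d dvd b}" by simp
  qed
  finally show ?thesis by simp
qed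

lemma moebius_mu_1 [simp]: "moebius_mu (Suc 0) = 1"
  by (simp add: moebius_mu_def)

lemma abs_moebius_mu_le: "\<bar>moebius_mu n\<bar> \<le> 1"
  by (simp add: moebius_mu_def power_abs)

lemma abs_liouville_lambda_le: "\<bar>liouville_lambda n\<bar> \<le> 1"
  by (simp add: liouville_lambda_def power_abs)

lemma moebius_mu_mult_coprime:
  assumes "coprime a b"
  shows "moebius_mu (a * b) = moebius_mu a * moebius_mu b"
proof (cases "squarefree a \<and> squarefree b")
  case True
  then have "a \<noteq> 0" "b \<noteq> 0" by (metis not_squarefree_0)+
  then have "prime_factors (a * b) = prime_factors a \<union> prime_factors b" by (rule prime_factors_product)
  moreover have "prime_factors a \<inter> prime_factors b = {}"
    using assms by (auto simp: in_prime_factors_iff) (meson coprime_common_divisor not_prime_unit)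
  ultimately show ?thesis
    using True assms by (simp add: moebius_mu_def squarefree_mult_coprime card_Un_disjoint power_add)
next
  case False
  then have "\<not> squarefree (a * b)" by (meson squarefree_multD)
  with False show ?thesis by (auto simp: moebius_mu_def)
qed

lemma moebius_mu_mult:
  "moebius_mu (a * b) = (if coprime a b then moebius_mu a * moebius_mu b else 0)"
proof (cases "coprime a b")
  case False
  then obtain d where "d dvd a" "d dvd b" "\<not> is_unit d" using not_coprimeE by blast
  then have "d\<^sup>2 dvd a * b" by (simp add: power2_eq_square mult_dvd_mono)
  then have "\<not> squarefree (a * b)" using \<open>\<not> is_unit d\<close> squarefreeD by blast
  with False show ?thesis by (simp add: moebius_mu_def)
qed (simp add: moebius_mu_mult_coprime)

lemma moebius_mu_prime_power:
  assumes "prime p"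
  shows "moebius_mu (p ^ k) = (if k = 0 then 1 else if k = 1 then -1 else 0)"
proof -
  consider "k = 0" | "k = 1" | "k \<ge> 2" by linarith
  then show ?thesis
  proof cases
    case 2 then show ?thesis using assms by (simp add: moebius_mu_def squarefree_prime prime_prime_factors)
  next
    case 3
    then have "p\<^sup>2 dvd p ^ k" by (rule le_imp_power_dvd)
    then have "\<not> squarefree (p ^ k)" using assms squarefreeD not_prime_unit by blast
    with 3 show ?thesis by (simp add: moebius_mu_def)
  qed auto
qed

lemma sum_divisors_prime_power:
  assumes "prime (p::nat)"
  shows "(\<Sum>d | d dvd p ^ k. f d) = (\<Sum>i\<le>k. f (p ^ i))"
proof -
  have "{d. d dvd p ^ k} = (\<lambda>i. p ^ i) ` {..k}"
    using assms by (auto simp: divides_primepow_nat le_imp_power_dvd)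
  moreover have "inj_on (\<lambda>i. p ^ i) {..k}"
    using prime_gt_1_nat[OF assms] by (auto simp: inj_on_def power_inject_exp)
  ultimately show ?thesis by (simp add: sum.reindex)
qed

text \<open>Splitting off the full power of a single prime \<open>p\<close> yields the factor
  \<open>moebius_mu 1 + moebius_mu p = 0\<close>, so no induction over the factorization is
  required.\<close>

lemma sum_moebius_mu_divisors:
  assumes "n > 0"
  shows "(\<Sum>d | d dvd n. moebius_mu d) = (if n = 1 then 1 else 0)"
proof (cases "n = 1")
  case False
  then obtain p where p: "prime p" "p dvd n" using prime_factor_nat by blast
  obtain m where m: "n = p ^ multiplicity p n * m" "\<not> p dvd m"
    using multiplicity_decompose'[of n p] assms p by (metis not_prime_unit not_gr0)
  define k where "k = multiplicity p n"
  have "k > 0" using p assms by (simp add: k_def prime_multiplicity_gt_zero_iff)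
  have "coprime (p ^ k) m" using m p by (simp add: prime_imp_coprime coprime_power_left_iff)
  moreover have "p ^ k > 0" "m > 0" using p m assms by (auto simp: prime_gt_0_nat intro!: gr0I)
  ultimately have "(\<Sum>d | d dvd n. moebius_mu d) = (\<Sum>i\<le>k. moebius_mu (p ^ i)) * (\<Sum>d | d dvd m. moebius_mu d)"
    by (subst m(1), fold k_def, subst sum_divisors_coprime)
      (auto simp: moebius_mu_mult_coprime sum_divisors_prime_power[OF p(1)])
  also have "(\<Sum>i\<le>k. moebius_mu (p ^ i)) = (\<Sum>i\<in>{0, 1}. moebius_mu (p ^ i))"
    using \<open>k > 0\<close> by (intro sum.mono_neutral_right) (auto simp: moebius_mu_prime_power[OF p(1)])
  also have "\<dots> = 0" using moebius_mu_prime_power[OF p(1), of 1] by simp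
  finally show ?thesis using False by simp
qed (simp add: moebius_mu_def)

text \<open>Write \<open>n = u * s\<^sup>2\<close> with \<open>u\<close> squarefree. Then
  \<open>k\<^sup>2 dvd n\<close> means \<open>s = k * j\<close>, and the quotient
  \<open>u * j\<^sup>2\<close> is squarefree only for \<open>j = 1\<close>. The one surviving term
  is \<open>moebius_mu u\<close>, and the square part does not change the parity of the number of
  prime factors.\<close>

lemma liouville_lambda_eq_sum:
  assumes "n > 0"
  shows "liouville_lambda n = (\<Sum>k | k\<^sup>2 dvd n. moebius_mu (n div k\<^sup>2))"
proof -
  define s where "s = square_part n"
  define u where "u = squarefree_part n"
  have n: "n = u * s\<^sup>2" unfolding s_def u_def by (rule squarefree_decompose)
  have s0: "s \<noteq> 0" "u \<noteq> 0" using n assms by auto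
  have u: "squarefree u" by (simp add: u_def)
  have fin: "finite {k. k\<^sup>2 dvd n}"
    by (rule finite_subset[of _ "{..n}"]) (use assms in \<open>auto dest!: dvd_imp_le simp: power2_nat_le_imp_le\<close>)
  have "(\<Sum>k | k\<^sup>2 dvd n. moebius_mu (n div k\<^sup>2)) = (\<Sum>k\<in>{s}. moebius_mu (n div k\<^sup>2))"
  proof (rule sum.mono_neutral_right[OF fin])
    show "{s} \<subseteq> {k. k\<^sup>2 dvd n}" by (simp add: s_def)
    show "\<forall>k\<in>{k. k\<^sup>2 dvd n} - {s}. moebius_mu (n div k\<^sup>2) = 0"
    proof
      fix k assume k: "k \<in> {k. k\<^sup>2 dvd n} - {s}"
      then obtain j where j: "s = k * j" by (auto simp: s_def dvd_square_part_iff[symmetric])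
      then have "j \<noteq> 1" "k \<noteq> 0" using k s0 by auto
      have "n div k\<^sup>2 = u * j\<^sup>2" using n j \<open>k \<noteq> 0\<close> by (simp add: power_mult_distrib)
      then have "\<not> squarefree (n div k\<^sup>2)" using \<open>j \<noteq> 1\<close> by (auto dest: squarefreeD[where x = j])
      then show "moebius_mu (n div k\<^sup>2) = 0" by (simp add: moebius_mu_def)
    qed
  qed
  also have "\<dots> = moebius_mu u" using n s0 by simp
  also have "moebius_mu u = (-1) ^ size (prime_factorization u)"
  proof -
    have "size (prime_factorization u) = (\<Sum>p\<in>prime_factors u. multiplicity p u)"
      by (auto simp: size_multiset_overloaded_eq count_prime_factorization intro!: sum.cong)
    also have "\<dots> = (\<Sum>p\<in>prime_factors u. 1)"
      using u s0 by (intro sum.cong) (metis One_nat_def in_prime_factors_iff le_antisym less_eq_Suc_le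
        prime_multiplicity_gt_zero_iff squarefree_factorial_semiring'' prime_imp_prime_elem | simp)+
    finally show ?thesis using u by (simp add: moebius_mu_def)
  qed
  also have "\<dots> = liouville_lambda n"
  proof -
    have "prime_factorization n = prime_factorization u + (prime_factorization s + prime_factorization s)"
      using s0 by (simp add: n prime_factorization_mult power2_eq_square)
    then show ?thesis using assms by (simp add: liouville_lambda_def power_add flip: power_mult_distrib)
  qed
  finally show ?thesis by simp
qed

section \<open>Dirichlet characters\<close>

lemma dirichlet_character_mult:
  "dirichlet_character q chi \<Longrightarrow> chi (m * n) = chi m * chi n"
  by (simp add: dirichlet_character_def)

lemma dirichlet_character_zero_iff:
  "dirichlet_character q chi \<Longrightarrow> chi n = 0 \<longleftrightarrow> \<not> coprime n q"
  by (auto simp: dirichlet_character_def)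

lemma dirichlet_character_1:
  assumes "dirichlet_character q chi" shows "chi (Suc 0) = 1"
proof -
  have "chi (1 * 1) = chi 1 * chi 1" using assms unfolding dirichlet_character_def by blast
  moreover have "chi 1 \<noteq> 0" using assms by (simp add: dirichlet_character_def)
  ultimately show ?thesis by simp
qed

lemma dirichlet_character_power:
  "dirichlet_character q chi \<Longrightarrow> chi (m ^ n) = chi m ^ n"
  by (induction n) (simp_all add: dirichlet_character_1 dirichlet_character_mult)

lemma coprime_add_self_iff: "coprime (n + q) q \<longleftrightarrow> coprime n (q::nat)"
  unfolding coprime_iff_gcd_eq_1 by (simp only: gcd_add1)

lemma periodic_mod_eq:
  fixes h :: "nat \<Rightarrow> 'a" and q :: nat
  assumes "\<And>n. h (n + q) = h n" "m mod q = n mod q"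
  shows "h m = h n"
proof -
  have *: "h (k + j * q) = h k" for j k
  proof (induction j)
    case (Suc j)
    have "k + Suc j * q = (k + j * q) + q" by simp
    then show ?case using assms(1)[of "k + j * q"] Suc by (simp only:)
  qed simp
  have "h k = h (k mod q)" for k using *[of "k mod q" "k div q"] by simp
  then show ?thesis using assms(2) by metis
qed

lemma dirichlet_character_cong:
  "dirichlet_character q chi \<Longrightarrow> [m = n] (mod q) \<Longrightarrow> chi m = chi n"
  by (rule periodic_mod_eq[of chi q]) (auto simp: dirichlet_character_def cong_def)

text \<open>By Euler's theorem \<open>chi n\<close> is a root of unity whenever \<open>n\<close> is
  coprime to \<open>q\<close>.\<close>

lemma norm_dirichlet_character:
  assumes "dirichlet_character q chi" shows "cmod (chi n) = (if coprime n q then 1 else 0)"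
proof (cases "coprime n q")
  case True
  have q: "q > 0" using assms by (simp add: dirichlet_character_def)
  have "chi n ^ totient q = chi 1"
    unfolding dirichlet_character_power[OF assms, symmetric]
    by (rule dirichlet_character_cong[OF assms euler_theorem[OF True]])
  then have "cmod (chi n) ^ totient q = 1"
    using dirichlet_character_1[OF assms] by (metis norm_one norm_power One_nat_def)
  moreover have "totient q > 0" using q by simp
  ultimately have "cmod (chi n) = 1" using power_eq_imp_eq_base[of "cmod (chi n)" "totient q" 1] by simp
  with True show ?thesis by simp
qed (use assms in \<open>simp add: dirichlet_character_zero_iff\<close>)

lemma norm_dirichlet_character_le: "dirichlet_character q chi \<Longrightarrow> cmod (chi n) \<le> 1"
  by (simp add: norm_dirichlet_character)

section \<open>Orthogonality of characters\<close>

lemma dirichlet_character_eqI: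
  assumes "dirichlet_character q chi" "dirichlet_character q \<psi>" "\<And>n. n \<in> totatives q \<Longrightarrow> chi n = \<psi> n"
  shows "chi = \<psi>"
proof
  fix n show "chi n = \<psi> n"
  proof (cases "coprime n q")
    case True
    have "q > 0" using assms(1) by (simp add: dirichlet_character_def)
    \<comment> \<open>Representatives are taken in \<open>1..q\<close>, as in
      \<open>totatives q\<close>. The residue 0 is coprime to \<open>q\<close> only for
      \<open>q = 1\<close>, where \<open>totatives q = {1}\<close>.\<close>
    define m where "m = (if n mod q = 0 then q else n mod q)"
    have c: "[n = m] (mod q)" by (auto simp: m_def cong_def)
    then have "coprime m q" using True cong_imp_coprime by blast
    moreover have "0 < m" "m \<le> q" using \<open>q > 0\<close> by (auto simp: m_def)
    ultimately have "m \<in> totatives q" by (simp add: totatives_def)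
    then show ?thesis
      using assms(3) dirichlet_character_cong[OF assms(1) c] dirichlet_character_cong[OF assms(2) c] by simp
  next
    case False
    then show ?thesis
      using dirichlet_character_zero_iff[OF assms(1)] dirichlet_character_zero_iff[OF assms(2)] by metis
  qed
qed

text \<open>Multiplication by the unit \<open>g\<close>, reduced to the representatives in
  \<open>1..q\<close>, is injective on a finite set and hence a permutation of it.\<close>

lemma sum_totatives_mult:
  fixes h :: "nat \<Rightarrow> 'a::comm_monoid_add"
  assumes per: "\<And>n. h (n + q) = h n" and "coprime g q" "q > 0"
  shows "(\<Sum>n\<in>totatives q. h (g * n)) = (\<Sum>n\<in>totatives q. h n)"
proof -
  define r where "r n = (if n mod q = 0 then q else n mod q)" for n
  have r: "r n \<in> totatives q" if "coprime n q" for n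
  proof -
    have "[n = r n] (mod q)" by (auto simp: r_def cong_def)
    then have "coprime (r n) q" using that cong_imp_coprime by blast
    then show ?thesis using \<open>q > 0\<close> by (auto simp: totatives_def r_def)
  qed
  have r_mod: "r n mod q = n mod q" for n by (auto simp: r_def)
  have r_id: "r n = n" if "n \<in> totatives q" for n
  proof (cases "n = q")
    case False
    then have "0 < n" "n < q" using that by (auto simp: totatives_def)
    then show ?thesis by (simp add: r_def)
  qed (simp add: r_def)
  have inj: "inj_on (\<lambda>n. r (g * n)) (totatives q)"
  proof (rule inj_onI)
    fix m n assume mn: "m \<in> totatives q" "n \<in> totatives q" "r (g * m) = r (g * n)"
    then have "[g * m = g * n] (mod q)" using r_mod by (metis cong_def)
    then have "[m = n] (mod q)" using assms(2) by (simp add: cong_mult_lcancel_nat)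
    then have "r m = r n" by (simp add: r_def cong_def)
    then show "m = n" using mn r_id by simp
  qed
  have img: "(\<lambda>n. r (g * n)) ` totatives q = totatives q"
  proof (rule endo_inj_surj[OF _ _ inj])
    show "(\<lambda>n. r (g * n)) ` totatives q \<subseteq> totatives q"
      using assms(2) by (intro image_subsetI r) (simp add: totatives_def)
  qed simp
  have "(\<Sum>n\<in>totatives q. h n) = (\<Sum>n\<in>totatives q. h (r (g * n)))"
    using sum.reindex[OF inj, of h] unfolding img comp_def .
  also have "\<dots> = (\<Sum>n\<in>totatives q. h (g * n))"
    by (rule sum.cong[OF refl], rule periodic_mod_eq[of h q, OF per r_mod])
  finally show ?thesis by simp
qed

text \<open>Replacing \<open>n\<close> by \<open>g * n\<close> multiplies the sum by
  \<open>chi g * cnj (\<psi> g)\<close>. If the characters differ at \<open>g\<close>, this factor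
  is not 1, and the sum must vanish.\<close>

lemma dirichlet_character_orthogonal:
  assumes "dirichlet_character q chi" "dirichlet_character q \<psi>" "chi \<noteq> \<psi>"
  shows "(\<Sum>n\<in>totatives q. chi n * cnj (\<psi> n)) = 0"
proof -
  have q: "q > 0" using assms by (simp add: dirichlet_character_def)
  obtain g where g: "g \<in> totatives q" "chi g \<noteq> \<psi> g"
    using dirichlet_character_eqI[OF assms(1,2)] assms(3) by blast
  then have co: "coprime g q" by (simp add: totatives_def)
  have "cmod (\<psi> g) = 1" using norm_dirichlet_character[OF assms(2)] co by simp
  then have psi: "\<psi> g * cnj (\<psi> g) = 1" by (simp add: complex_norm_square[symmetric])
  define S where "S = (\<Sum>n\<in>totatives q. chi n * cnj (\<psi> n))"
  have "S = (\<Sum>n\<in>totatives q. chi (g * n) * cnj (\<psi> (g * n)))"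
    unfolding S_def
    by (rule sum_totatives_mult[symmetric, where h = "\<lambda>n. chi n * cnj (\<psi> n)"])
      (use assms co q in \<open>auto simp: dirichlet_character_def\<close>)
  also have "\<dots> = chi g * cnj (\<psi> g) * S"
    unfolding S_def sum_distrib_left
    by (simp add: dirichlet_character_mult[OF assms(1)] dirichlet_character_mult[OF assms(2)] mult_ac)
  finally have "S * (chi g * cnj (\<psi> g) - 1) = 0" by (simp add: algebra_simps)
  moreover have "chi g * cnj (\<psi> g) \<noteq> 1"
  proof
    assume "chi g * cnj (\<psi> g) = 1"
    then have "chi g * (\<psi> g * cnj (\<psi> g)) = \<psi> g" by (simp add: mult_ac)
    then show False using psi g by simp
  qed
  ultimately show ?thesis by (simp add: S_def)
qed

lemma dirichlet_character_norm_sum: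
  assumes "dirichlet_character q chi"
  shows "(\<Sum>n\<in>totatives q. chi n * cnj (chi n)) = of_nat (totient q)"
proof -
  have "chi n * cnj (chi n) = 1" if "n \<in> totatives q" for n
    using norm_dirichlet_character[OF assms, of n] that by (simp add: complex_norm_square[symmetric] totatives_def)
  then show ?thesis by (simp add: totient_def)
qed

text \<open>A function on the residues coprime to \<open>q\<close> is split successively, for each residue \<open>g\<close>, into
  eigenfunctions of the shift \<open>f \<mapsto> f (g * \<cdot>)\<close>; a common eigenfunction of all
  shifts is a multiple of a character.\<close>

definition shift_eigen :: "nat \<Rightarrow> nat set \<Rightarrow> (nat \<Rightarrow> complex) \<Rightarrow> bool" where
  "shift_eigen q A f \<longleftrightarrow> (\<forall>n. f (n + q) = f n) \<and> (\<forall>n. \<not> coprime n q \<longrightarrow> f n = 0) \<and>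
     (\<forall>g\<in>A. \<exists>w. \<forall>n. f (g * n) = w * f n)"

text \<open>The shift by \<open>g\<close> has finite order dividing \<open>N = totient q\<close>, so
  the discrete Fourier average over its powers, \<open>F j\<close>, projects onto the eigenvalue
  \<open>inverse (w ^ j)\<close>. The projections add up to \<open>f\<close>. They commute with the
  other shifts, so the eigenfunction property for \<open>A\<close> survives.\<close>

lemma shift_eigen_split:
  assumes f: "shift_eigen q A f" and g: "coprime g q" and q: "q > 0"
  shows "\<exists>k. \<exists>F::nat \<Rightarrow> nat \<Rightarrow> complex. (\<forall>j<k. shift_eigen q (insert g A) (F j)) \<and> (\<forall>n. f n = (\<Sum>j<k. F j n))"
proof -
  define N where "N = totient q"
  have N: "N > 0" using q by (simp add: N_def)
  define w where "w = cis (2 * pi / N)"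
  define F where "F j n = (\<Sum>i<N. w ^ (i * j) * f (g ^ i * n)) / of_nat N" for j n
  have w_pow: "w ^ i = cis (real i * (2 * pi / N))" for i
    unfolding w_def by (rule Complex.DeMoivre)
  have "real N * (2 * pi / N) = 2 * pi" using N by simp
  then have wN: "w ^ N = 1" using w_pow[of N] by (metis cis_2pi)
  have per: "f m = f n" if "[m = n] (mod q)" for m n
    by (rule periodic_mod_eq[of f q]) (use f that in \<open>simp_all add: shift_eigen_def cong_def\<close>)
  have fN: "f (g ^ N * n) = f n" for n
    using per[OF cong_mult[OF euler_theorem[OF g] cong_refl[of n q]]] unfolding N_def[symmetric] mult_1 .
  have eig: "F j (g * n) * w ^ j = F j n" for j n
  proof -
    have "(\<Sum>i<N. w ^ (i * j) * f (g ^ i * (g * n))) * w ^ j = (\<Sum>i<N. w ^ (Suc i * j) * f (g ^ Suc i * n))"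
      unfolding sum_distrib_right by (intro sum.cong) (simp_all add: power_add mult_ac)
    also have "\<dots> = (\<Sum>i<Suc N. w ^ (i * j) * f (g ^ i * n)) - f n"
      by (subst sum.lessThan_Suc_shift) simp
    also have "\<dots> = (\<Sum>i<N. w ^ (i * j) * f (g ^ i * n))"
      using wN by (simp add: fN power_mult)
    finally show ?thesis by (simp add: F_def)
  qed
  have "shift_eigen q (insert g A) (F j)" for j
    unfolding shift_eigen_def
  proof (intro conjI allI ballI impI)
    fix n
    have "f (g ^ i * (n + q)) = f (g ^ i * n)" for i
      by (rule per) (simp add: cong_def algebra_simps)
    then show "F j (n + q) = F j n" by (simp add: F_def)
    show "F j n = 0" if "\<not> coprime n q"
    proof -
      have "f (g ^ i * n) = 0" for i using f that by (simp add: shift_eigen_def)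
      then show ?thesis by (simp add: F_def)
    qed
  next
    fix a assume "a \<in> insert g A"
    then show "\<exists>w. \<forall>n. F j (a * n) = w * F j n"
    proof
      assume "a = g"
      have "w ^ j \<noteq> 0" by (simp add: w_def)
      then have "F j (g * n) = inverse (w ^ j) * F j n" for n using eig[of j n] by (simp add: field_simps)
      with \<open>a = g\<close> show ?thesis by blast
    next
      assume "a \<in> A"
      then obtain v where v: "\<And>n. f (a * n) = v * f n" using f unfolding shift_eigen_def by blast
      have "F j (a * n) = v * F j n" for n
        unfolding F_def by (simp add: v mult.left_commute[of _ a] sum_distrib_left) (simp add: mult_ac)
      then show ?thesis by blast
    qed
  qed
  moreover have "f n = (\<Sum>j<N. F j n)" for n
  proof -
    have "(\<Sum>j<N. F j n) = (\<Sum>i<N. (\<Sum>j<N. (w ^ i) ^ j) * f (g ^ i * n)) / of_nat N"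
      unfolding F_def sum_divide_distrib[symmetric]
      by (subst sum.swap) (simp add: sum_distrib_right power_mult)
    also have "(\<Sum>i<N. (\<Sum>j<N. (w ^ i) ^ j) * f (g ^ i * n)) = (\<Sum>i\<in>{0}. (\<Sum>j<N. (w ^ i) ^ j) * f (g ^ i * n))"
    proof (rule sum.mono_neutral_right)
      show "\<forall>i\<in>{..<N} - {0}. (\<Sum>j<N. (w ^ i) ^ j) * f (g ^ i * n) = 0"
      proof
        fix i assume i: "i \<in> {..<N} - {0}"
        have "w ^ i \<noteq> 1"
        proof
          assume "w ^ i = 1"
          then have "Re (cis (real i * (2 * pi / N))) = 1" unfolding w_pow by simp
          then have "cos (real i * (2 * pi / N)) = 1" unfolding cis.sel .
          then obtain m :: int where "real i * (2 * pi / N) = m * 2 * pi" using cos_one_2pi_int by auto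
          then have "2 * pi * (real i / N - of_int m) = 0" by (simp add: algebra_simps)
          then have "real i = of_int m * N" using N by (simp add: field_simps)
          then have "int i = m * int N" by (metis of_int_eq_iff of_int_mult of_int_of_nat_eq)
          moreover have "0 < int i" "int i < int N" using i by auto
          ultimately show False using zdvd_not_zless[of "int i" "int N"] by simp
        qed
        moreover have "(w ^ i) ^ N = 1" using wN by (simp add: power_mult[symmetric] mult.commute[of i]) (simp add: power_mult)
        ultimately have "(\<Sum>j<N. (w ^ i) ^ j) = 0" by (simp add: sum_gp_strict)
        then show "(\<Sum>j<N. (w ^ i) ^ j) * f (g ^ i * n) = 0" by simp
      qed
    qed (use N in auto)
    finally show ?thesis using N by simp
  qed
  ultimately show ?thesis by blast
qed

lemma shift_eigen_decomposition:
  assumes "finite A" "\<forall>g\<in>A. coprime g q" and q: "q > 0"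
    and f: "\<And>n. f (n + q) = f n" "\<And>n. \<not> coprime n q \<Longrightarrow> f n = 0"
  shows "\<exists>k. \<exists>F::nat \<Rightarrow> nat \<Rightarrow> complex. (\<forall>j<k. shift_eigen q A (F j)) \<and> (\<forall>n. f n = (\<Sum>j<k. F j n))"
  using assms(1,2)
proof (induction A rule: finite_induct)
  case empty
  show ?case
    by (rule exI[of _ 1], rule exI[of _ "\<lambda>_. f"]) (use f in \<open>auto simp: shift_eigen_def\<close>)
next
  case (insert g A)
  then obtain k and F :: "nat \<Rightarrow> nat \<Rightarrow> complex"
    where F: "\<And>j. j < k \<Longrightarrow> shift_eigen q A (F j)" "\<And>n. f n = (\<Sum>j<k. F j n)" by auto
  have "\<forall>j\<in>{..<k}. \<exists>l. \<exists>G::nat \<Rightarrow> nat \<Rightarrow> complex. (\<forall>i<l. shift_eigen q (insert g A) (G i)) \<and> (\<forall>n. F j n = (\<Sum>i<l. G i n))"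
    by (intro ballI shift_eigen_split[OF F(1) _ q]) (use insert.prems in simp_all)
  from bchoice[OF this] obtain l where
    "\<forall>j\<in>{..<k}. \<exists>G::nat \<Rightarrow> nat \<Rightarrow> complex. (\<forall>i<l j. shift_eigen q (insert g A) (G i)) \<and> (\<forall>n. F j n = (\<Sum>i<l j. G i n))"
    by blast
  from bchoice[OF this] obtain G :: "nat \<Rightarrow> nat \<Rightarrow> nat \<Rightarrow> complex" where
    G: "\<And>j i. j < k \<Longrightarrow> i < l j \<Longrightarrow> shift_eigen q (insert g A) (G j i)" "\<And>j n. j < k \<Longrightarrow> F j n = (\<Sum>i<l j. G j i n)"
    by blast
  \<comment> \<open>The pieces are indexed by pairs; an enumeration of the finite index set turns
    them into one list.\<close>
  define P where "P = Sigma {..<k} (\<lambda>j. {..<l j})"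
  have finP: "finite P" by (simp add: P_def)
  then obtain e where e: "bij_betw e {..<card P} P"
    by (metis atLeast0LessThan ex_bij_betw_nat_finite)
  have "f n = (\<Sum>p\<in>P. G (fst p) (snd p) n)" for n
  proof -
    have "f n = (\<Sum>j<k. \<Sum>i<l j. G j i n)" unfolding F(2) by (intro sum.cong refl) (simp add: G(2))
    also have "\<dots> = (\<Sum>(j, i)\<in>P. G j i n)" unfolding P_def by (subst sum.Sigma) auto
    finally show ?thesis by (simp add: case_prod_unfold)
  qed
  then have f_eq: "f n = (\<Sum>i<card P. G (fst (e i)) (snd (e i)) n)" for n
    by (simp add: sum.reindex_bij_betw[OF e, of "\<lambda>p. G (fst p) (snd p) n"])
  have eig: "shift_eigen q (insert g A) (G (fst (e i)) (snd (e i)))" if "i < card P" for i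
  proof -
    have "e i \<in> P" using e that by (auto simp: bij_betw_def)
    then show ?thesis by (auto simp: P_def intro!: G(1))
  qed
  define E where "E i = G (fst (e i)) (snd (e i))" for i
  have "(\<forall>j<card P. shift_eigen q (insert g A) (E j)) \<and> (\<forall>n. f n = (\<Sum>j<card P. E j n))"
    unfolding E_def using eig f_eq by blast
  then show ?case by blast
qed

lemma shift_eigen_character:
  assumes f: "shift_eigen q (totatives q) f" and q: "q > 0"
  shows "\<exists>c chi. dirichlet_character q chi \<and> (\<forall>n. f n = c * chi n)"
proof (cases "f 1 = 0")
  \<comment> \<open>Every residue \<open>m\<close> satisfies
    \<open>f m = f (m * 1) = w * f 1 = 0\<close>, so \<open>f\<close> vanishes and is 0 times any
    character; the principal one is taken.\<close>
  case True
  define chi0 where "chi0 n = (if coprime n q then 1 else 0 :: complex)" for n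
  have "dirichlet_character q chi0" using q by (simp add: dirichlet_character_def chi0_def coprime_add_self_iff)
  moreover have "f n = 0" for n
  proof (cases "coprime n q")
    case co: True
    define m where "m = (if n mod q = 0 then q else n mod q)"
    have c: "[n = m] (mod q)" by (auto simp: m_def cong_def)
    then have "coprime m q" using co cong_imp_coprime by blast
    moreover have "0 < m" "m \<le> q" using q by (auto simp: m_def)
    ultimately have "m \<in> totatives q" by (simp add: totatives_def)
    then obtain w where "\<And>n. f (m * n) = w * f n" using f unfolding shift_eigen_def by blast
    from this[of 1] have "f m = 0" using True by simp
    moreover have "f n = f m"
      by (rule periodic_mod_eq[of f q]) (use f c in \<open>simp_all add: shift_eigen_def cong_def\<close>)
    ultimately show ?thesis by simp
  qed (use f in \<open>auto simp: shift_eigen_def\<close>)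
  ultimately show ?thesis by (intro exI[of _ 0] exI[of _ chi0]) auto
next
  case False
  define chi where "chi n = f n / f 1" for n
  have per: "f m = f n" if "[m = n] (mod q)" for m n
    by (rule periodic_mod_eq[of f q]) (use f that in \<open>simp_all add: shift_eigen_def cong_def\<close>)
  have mult: "chi (a * n) = chi a * chi n" if co: "coprime a q" for a n
  proof -
    define m where "m = (if a mod q = 0 then q else a mod q)"
    have c: "[a = m] (mod q)" by (auto simp: m_def cong_def)
    then have "coprime m q" using co cong_imp_coprime by blast
    moreover have "0 < m" "m \<le> q" using q by (auto simp: m_def)
    ultimately have "m \<in> totatives q" by (simp add: totatives_def)
    then obtain w where w: "\<And>n. f (m * n) = w * f n" using f unfolding shift_eigen_def by blast
    have "f (a * n) = w * f n" for n
      using w[of n] per[OF cong_mult[OF c cong_refl[of n]]] by simp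
    from this[of n] this[of 1] show ?thesis using False by (simp add: chi_def)
  qed
  have "dirichlet_character q chi"
    unfolding dirichlet_character_def
  proof (intro conjI allI)
    show "chi (n + q) = chi n" for n using f by (simp add: chi_def shift_eigen_def)
    show "chi (m * n) = chi m * chi n" for m n
    proof (cases "coprime m q")
      case False
      then have "\<not> coprime (m * n) q" by simp
      then show ?thesis using False f by (simp add: chi_def shift_eigen_def)
    qed (rule mult)
    show "chi n \<noteq> 0 \<longleftrightarrow> coprime n q" for n
    proof
      assume co: "coprime n q"
      have "chi (Suc 0) = 1" using False by (simp add: chi_def)
      then have "chi (n ^ i) = chi n ^ i" for i
        by (induction i) (use mult[OF co] in simp_all)
      from this[of "totient q"] have "chi n ^ totient q = chi (n ^ totient q)" by simp
      also have "\<dots> = chi 1" using per[OF euler_theorem[OF co]] by (simp add: chi_def)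
      also have "\<dots> = 1" using False by (simp add: chi_def)
      finally show "chi n \<noteq> 0" using q by (auto simp: power_0_left)
    qed (use f in \<open>auto simp: chi_def shift_eigen_def\<close>)
  qed (use q in auto)
  moreover have "f n = f 1 * chi n" for n using False by (simp add: chi_def)
  ultimately show ?thesis by blast
qed

text \<open>Parseval: after expanding the square only the diagonal pairs survive. \<open>X\<close>
  may be any finite set of characters, so the identity serves both to count characters and to bound
  coefficients.\<close>

lemma character_sum_square:
  fixes c :: "(nat \<Rightarrow> complex) \<Rightarrow> complex"
  assumes X: "finite X" "\<And>chi. chi \<in> X \<Longrightarrow> dirichlet_character q chi"
  shows "(\<Sum>n\<in>totatives q. (cmod (\<Sum>chi\<in>X. c chi * chi n))\<^sup>2) = totient q * (\<Sum>chi\<in>X. (cmod (c chi))\<^sup>2)"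
proof -
  have "of_real (\<Sum>n\<in>totatives q. (cmod (\<Sum>chi\<in>X. c chi * chi n))\<^sup>2)
      = (\<Sum>n\<in>totatives q. (\<Sum>chi\<in>X. c chi * chi n) * cnj (\<Sum>chi\<in>X. c chi * chi n))"
    by (simp only: of_real_sum complex_norm_square)
  also have "\<dots> = (\<Sum>n\<in>totatives q. \<Sum>chi\<in>X. \<Sum>\<psi>\<in>X. c chi * cnj (c \<psi>) * (chi n * cnj (\<psi> n)))"
    by (simp add: sum_product mult_ac)
  also have "\<dots> = (\<Sum>chi\<in>X. \<Sum>\<psi>\<in>X. \<Sum>n\<in>totatives q. c chi * cnj (c \<psi>) * (chi n * cnj (\<psi> n)))"
    by (subst sum.swap) (intro sum.cong refl sum.swap)
  also have "\<dots> = (\<Sum>chi\<in>X. \<Sum>\<psi>\<in>X. if \<psi> = chi then c chi * cnj (c chi) * of_nat (totient q) else 0)"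
    unfolding sum_distrib_left[symmetric]
    by (intro sum.cong refl) (use X(2) in \<open>auto simp: dirichlet_character_norm_sum dirichlet_character_orthogonal\<close>)
  also have "\<dots> = of_real (totient q * (\<Sum>chi\<in>X. (cmod (c chi))\<^sup>2))"
    using X(1) by (simp add: sum.delta complex_norm_square[symmetric] sum_distrib_left mult_ac)
  finally show ?thesis unfolding of_real_eq_iff .
qed

text \<open>Applied to the coefficients \<open>cnj (chi 1) = 1\<close>, Parseval and the term \<open>n = 1\<close> bound the number of characters.\<close>

lemma card_characters_le:
  assumes X: "finite X" "\<And>chi. chi \<in> X \<Longrightarrow> dirichlet_character q chi"
  shows "card X \<le> totient q"
proof (cases "X = {}")
  case False
  then have q: "q > 0" using X by (auto simp: dirichlet_character_def)
  have "1 \<in> totatives q" using q by (auto simp: totatives_def)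
  then have "(cmod (\<Sum>chi\<in>X. 1 * chi 1))\<^sup>2 \<le> (\<Sum>n\<in>totatives q. (cmod (\<Sum>chi\<in>X. 1 * chi n))\<^sup>2)"
    by (intro member_le_sum) auto
  also have "\<dots> = totient q * (\<Sum>chi\<in>X. (cmod 1)\<^sup>2)"
    by (rule character_sum_square[OF X, where c = "\<lambda>_. 1"])
  also have "(\<Sum>chi\<in>X. 1 * chi 1) = of_nat (card X)"
  proof -
    have "(\<Sum>chi\<in>X. 1 * chi 1) = (\<Sum>chi\<in>X. (1::complex))"
      by (intro sum.cong refl) (simp add: dirichlet_character_1[OF X(2)])
    then show ?thesis by simp
  qed
  finally have "real (card X * card X) \<le> real (totient q * card X)" by (simp add: power2_eq_square)
  then have "card X * card X \<le> totient q * card X" by (simp only: of_nat_le_iff)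
  then show ?thesis using False X(1) by (simp add: card_gt_0_iff)
qed simp

text \<open>Parseval bounds the sum of the squared coefficients by 1, since \<open>h\<close> is at
  most 1 in modulus. With at most \<open>q\<close> characters, Cauchy--Schwarz gives
  \<open>sqrt q\<close> for the sum of the coefficients, where bounding each of them by 1 would only
  give \<open>q\<close>. This saving enters the final exponent.\<close>

theorem character_expansion:
  fixes h :: "nat \<Rightarrow> complex"
  assumes q: "q > 0" and per: "\<And>n. h (n + q) = h n" and le: "\<And>n. cmod (h n) \<le> 1"
  obtains X :: "(nat \<Rightarrow> complex) set" and c where "finite X" "\<And>chi. chi \<in> X \<Longrightarrow> dirichlet_character q chi"
    "\<And>n. coprime n q \<Longrightarrow> h n = (\<Sum>chi\<in>X. c chi * chi n)" "(\<Sum>chi\<in>X. cmod (c chi)) \<le> sqrt q"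
proof -
  define f where "f n = (if coprime n q then h n else 0)" for n
  have "\<exists>k. \<exists>F::nat \<Rightarrow> nat \<Rightarrow> complex. (\<forall>j<k. shift_eigen q (totatives q) (F j)) \<and> (\<forall>n. f n = (\<Sum>j<k. F j n))"
    by (rule shift_eigen_decomposition) (use q per in \<open>auto simp: f_def totatives_def coprime_add_self_iff\<close>)
  then obtain k and F :: "nat \<Rightarrow> nat \<Rightarrow> complex" where
    F: "\<And>j. j < k \<Longrightarrow> shift_eigen q (totatives q) (F j)" "\<And>n. f n = (\<Sum>j<k. F j n)" by auto
  have "\<forall>j\<in>{..<k}. \<exists>c chi. dirichlet_character q chi \<and> (\<forall>n. F j n = c * chi n)"
    by (intro ballI shift_eigen_character[OF F(1) q]) simp
  from bchoice[OF this] obtain d where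
    "\<forall>j\<in>{..<k}. \<exists>chi. dirichlet_character q chi \<and> (\<forall>n. F j n = d j * chi n)"
    by blast
  from bchoice[OF this] obtain \<psi> where
    d: "\<And>j. j < k \<Longrightarrow> dirichlet_character q (\<psi> j)" "\<And>j n. j < k \<Longrightarrow> F j n = d j * \<psi> j n"
    by blast
  \<comment> \<open>Different pieces may belong to the same character, so coefficients are collected
    per character before orthogonality is used.\<close>
  define X where "X = \<psi> ` {..<k}"
  define c where "c chi = (\<Sum>j | j < k \<and> \<psi> j = chi. d j)" for chi
  have X: "finite X" "\<And>chi. chi \<in> X \<Longrightarrow> dirichlet_character q chi" using d by (auto simp: X_def)
  have eq: "f n = (\<Sum>chi\<in>X. c chi * chi n)" for n
  proof -
    have "f n = (\<Sum>j<k. d j * \<psi> j n)" using F(2) d(2) by simp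
    also have "\<dots> = (\<Sum>chi\<in>X. \<Sum>j | j \<in> {..<k} \<and> \<psi> j = chi. d j * \<psi> j n)"
      unfolding X_def by (rule sum.image_gen) simp
    also have "\<dots> = (\<Sum>chi\<in>X. c chi * chi n)"
      unfolding c_def sum_distrib_right by (intro sum.cong refl) auto
    finally show ?thesis .
  qed
  have t0: "totient q > 0" using q by simp
  have "totient q * (\<Sum>chi\<in>X. (cmod (c chi))\<^sup>2) = (\<Sum>n\<in>totatives q. (cmod (f n))\<^sup>2)"
    unfolding eq by (rule character_sum_square[OF X, symmetric])
  also have "\<dots> \<le> (\<Sum>n\<in>totatives q. 1)"
    using le by (intro sum_mono) (auto simp: f_def power_le_one)
  finally have "totient q * (\<Sum>chi\<in>X. (cmod (c chi))\<^sup>2) \<le> totient q * 1" by (simp add: totient_def)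
  then have sq: "(\<Sum>chi\<in>X. (cmod (c chi))\<^sup>2) \<le> 1" 
    using mult_le_cancel_left_pos[of "real (totient q)" "\<Sum>chi\<in>X. (cmod (c chi))\<^sup>2" 1] t0 by simp
  have "(\<Sum>chi\<in>X. cmod (c chi) * 1)\<^sup>2 \<le> (\<Sum>chi\<in>X. (cmod (c chi))\<^sup>2) * (\<Sum>chi\<in>X. 1\<^sup>2)"
    by (rule Cauchy_Schwarz_ineq_sum)
  also have "\<dots> \<le> 1 * (\<Sum>chi\<in>X. 1\<^sup>2)" using sq by (intro mult_right_mono) auto
  also have "\<dots> \<le> real q"
    using card_characters_le[OF X] totient_le[of q] by simp
  finally have c_le: "(\<Sum>chi\<in>X. cmod (c chi)) \<le> sqrt q"
    by (intro real_le_rsqrt) simp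
  have h_eq: "h n = (\<Sum>chi\<in>X. c chi * chi n)" if "coprime n q" for n
    using eq[of n] that by (simp add: f_def)
  show thesis by (rule that[OF X h_eq c_le])
qed

section \<open>Mellin inversion of the exponential\<close>

lemma has_bochner_integral_Re_Im:
  fixes f :: "'a \<Rightarrow> complex"
  assumes "has_bochner_integral M (\<lambda>x. Re (f x)) (Re I)" "has_bochner_integral M (\<lambda>x. Im (f x)) (Im I)"
  shows "has_bochner_integral M f I"
proof -
  have "has_bochner_integral M (\<lambda>x. of_real (Re (f x)) + \<i> * of_real (Im (f x))) (of_real (Re I) + \<i> * of_real (Im I))"
    using assms by (intro has_bochner_integral_add has_bochner_integral_mult_right has_bochner_integral_of_real)
  then show ?thesis by (simp only: complex_eq[symmetric])
qed

text \<open>Euler's integral after the substitution \<open>u = exp v\<close>. In the variable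
  \<open>v\<close>, the Mellin transform along a vertical line becomes a Fourier transform on the
  real line.\<close>

lemma has_bochner_integral_Gamma_exp:
  fixes s :: complex
  assumes "Re s > 0"
  shows "has_bochner_integral lborel (\<lambda>v. exp (s * complex_of_real v - complex_of_real (exp v))) (Gamma s)"
proof -
  define k where "k v = exp (s * complex_of_real v - complex_of_real (exp v))" for v
  define g where "g u = complex_of_real u powr (s - 1) / complex_of_real (exp u)" for u
  have abs: "g absolutely_integrable_on {0<..}" and int: "(g has_integral Gamma s) {0<..}"
    unfolding g_def using absolutely_integrable_Gamma_integral'[OF assms] Gamma_integral_complex'[OF assms] by simp_all
  have eq: "complex_of_real (exp v) * g (exp v) = k v" for v :: real
  proof -
    have "complex_of_real (exp v) powr (s - 1) = exp ((s - 1) * complex_of_real v)"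
      by (simp add: powr_def Ln_of_real)
    then have "complex_of_real (exp v) * g (exp v) = exp (complex_of_real v) * exp ((s - 1) * complex_of_real v) / exp (complex_of_real (exp v))"
      by (simp add: g_def exp_of_real)
    also have "\<dots> = exp (complex_of_real v + (s - 1) * complex_of_real v - complex_of_real (exp v))"
      by (simp only: exp_add exp_diff)
    finally show ?thesis by (simp add: k_def left_diff_distrib)
  qed
  have img: "exp ` (UNIV::real set) = {0<..}"
  proof -
    have "x \<in> range exp" if "x > 0" for x :: real
      using that by (intro image_eqI[of _ exp "ln x"]) auto
    then show ?thesis by auto
  qed
  \<comment> \<open>\<open>p\<close> stands for \<open>Re\<close> or \<open>Im\<close>; the change
    of variables is made for each of these real functions, and both results are combined
    below.\<close>
  have main: "has_bochner_integral lborel (\<lambda>v. p (k v)) (p (Gamma s))"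
    if p: "bounded_linear p" and p_scale: "\<And>r z. p (of_real r * z) = r * p z" for p :: "complex \<Rightarrow> real"
  proof -
    have "(\<lambda>u. p (g u)) absolutely_integrable_on {0<..}"
      using absolutely_integrable_linear[OF abs p] by (simp add: comp_def)
    moreover have "integral {0<..} (\<lambda>u. p (g u)) = p (Gamma s)"
      using has_integral_linear[OF int p] by (simp add: comp_def integral_unique)
    ultimately have "(\<lambda>v. \<bar>exp v\<bar> * p (g (exp v))) absolutely_integrable_on UNIV \<and>
        integral UNIV (\<lambda>v. \<bar>exp v\<bar> * p (g (exp v))) = p (Gamma s)"
      by (subst has_absolute_integral_change_of_variables_1')
        (auto simp: img intro!: derivative_eq_intros inj_onI)
    moreover have "\<bar>exp v\<bar> * p (g (exp v)) = p (k v)" for v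
      using p_scale[of "exp v" "g (exp v)"] eq[of v] by simp
    ultimately have *: "(\<lambda>v. p (k v)) absolutely_integrable_on UNIV"
      "integral UNIV (\<lambda>v. p (k v)) = p (Gamma s)" by simp_all
    have [measurable]: "p \<in> borel_measurable borel"
      by (intro borel_measurable_continuous_onI linear_continuous_on p)
    have meas: "(\<lambda>v. p (k v)) \<in> borel_measurable lborel"
      unfolding k_def by measurable
    have "integrable lebesgue (\<lambda>v. p (k v))"
      using *(1) by (simp add: set_integrable_def)
    then have int': "integrable lborel (\<lambda>v. p (k v))"
      using integrable_completion[OF meas] by simp
    then have "integral\<^sup>L lborel (\<lambda>v. p (k v)) = p (Gamma s)"
      using *(2) integral_lborel[OF int'] by simp
    with int' show ?thesis by (simp add: has_bochner_integral_iff)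
  qed
  have "has_bochner_integral lborel k (Gamma s)"
    by (rule has_bochner_integral_Re_Im; rule main) (simp_all add: bounded_linear_Re bounded_linear_Im)
  then show ?thesis unfolding k_def .
qed

lemma has_bochner_integral_Gamma_exp_scaled:
  fixes s :: complex and x :: real
  assumes "Re s > 0" "x > 0"
  shows "has_bochner_integral lborel (\<lambda>v. exp (s * complex_of_real v - complex_of_real (x * exp v)))
    (Gamma s * complex_of_real x powr (-s))"
proof -
  define k where "k v = exp (s * complex_of_real v - complex_of_real (exp v))" for v
  have "has_bochner_integral lborel (\<lambda>v. k (ln x + 1 * v)) (Gamma s /\<^sub>R \<bar>1\<bar>)"
    using lborel_has_bochner_integral_real_affine_iff[of 1 k "Gamma s" "ln x"]
      has_bochner_integral_Gamma_exp[OF assms(1)] unfolding k_def by simp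
  then have "has_bochner_integral lborel (\<lambda>v. k (ln x + 1 * v) * complex_of_real x powr (-s)) (Gamma s /\<^sub>R \<bar>1\<bar> * complex_of_real x powr (-s))"
    by (rule has_bochner_integral_mult_left)
  then have "has_bochner_integral lborel (\<lambda>v. k (ln x + v) * complex_of_real x powr (-s)) (Gamma s * complex_of_real x powr (-s))"
    by simp
  moreover have "k (ln x + v) * complex_of_real x powr (-s) = exp (s * complex_of_real v - complex_of_real (x * exp v))" for v
  proof -
    have "complex_of_real x powr (-s) = exp (- (s * complex_of_real (ln x)))"
      using assms by (simp add: powr_def Ln_of_real)
    moreover have "complex_of_real (exp (ln x + v)) = complex_of_real (x * exp v)"
      using assms by (simp add: exp_add)
    ultimately have "k (ln x + v) * complex_of_real x powr (-s)
        = exp (s * complex_of_real (ln x + v) - complex_of_real (x * exp v) + - (s * complex_of_real (ln x)))"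
      by (simp only: k_def exp_add)
    then show ?thesis by (simp add: algebra_simps)
  qed
  ultimately show ?thesis by simp
qed

lemma has_bochner_integral_Gamma_exp_real:
  fixes \<sigma> x :: real
  assumes "\<sigma> > 0" "x > 0"
  shows "has_bochner_integral lborel (\<lambda>v. exp (\<sigma> * v - x * exp v)) (Gamma \<sigma> * x powr (-\<sigma>))"
proof -
  have "has_bochner_integral lborel (\<lambda>v. exp (of_real \<sigma> * complex_of_real v - complex_of_real (x * exp v)))
    (Gamma (of_real \<sigma>) * complex_of_real x powr (- of_real \<sigma>))"
    by (rule has_bochner_integral_Gamma_exp_scaled) (use assms in auto)
  moreover have "exp (of_real \<sigma> * complex_of_real v - complex_of_real (x * exp v)) = complex_of_real (exp (\<sigma> * v - x * exp v))" for v
    by (simp only: exp_of_real[symmetric] of_real_diff of_real_mult)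
  moreover have "Gamma (of_real \<sigma>) * complex_of_real x powr (- of_real \<sigma>) = complex_of_real (Gamma \<sigma> * x powr (-\<sigma>))"
    using assms by (simp add: Gamma_complex_of_real powr_of_real[symmetric])
  ultimately have "has_bochner_integral lborel (\<lambda>v. complex_of_real (exp (\<sigma> * v - x * exp v))) (complex_of_real (Gamma \<sigma> * x powr (-\<sigma>)))"
    by simp
  from has_bochner_integral_bounded_linear[OF bounded_linear_Re this] show ?thesis by simp
qed

lemma Gamma_binomial_sums:
  fixes s z :: complex
  assumes "Re s > 0" "cmod z < 1"
  shows "(\<lambda>k. Gamma (s + of_nat k) * z ^ k / fact k) sums (Gamma s * (1 - z) powr (-s))"
proof -
  have s: "s \<notin> \<int>\<^sub>\<le>\<^sub>0"
    using assms(1) by (auto elim!: nonpos_Ints_cases)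
  have "(\<lambda>k. (-s gchoose k) * (-z) ^ k) sums (1 + -z) powr (-s)"
    by (rule gen_binomial_complex) (use assms in simp)
  from sums_mult[OF this, of "Gamma s"]
  have "(\<lambda>k. Gamma s * ((-s gchoose k) * (-z) ^ k)) sums (Gamma s * (1 - z) powr (-s))" by simp
  moreover have "Gamma s * ((-s gchoose k) * (-z) ^ k) = Gamma (s + of_nat k) * z ^ k / fact k" for k
  proof -
    have "Gamma s * pochhammer s k = Gamma (s + of_nat k)"
      using pochhammer_Gamma[OF s, of k] s by (simp add: Gamma_eq_zero_iff)
    moreover have "(-s gchoose k) * (-z) ^ k = pochhammer s k * z ^ k / fact k"
    proof -
      have "(-s gchoose k) * (-z) ^ k = ((-1) ^ k * (-z) ^ k) * pochhammer s k / fact k"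
        unfolding gbinomial_pochhammer minus_minus by simp
      also have "(-1) ^ k * (-z) ^ k = z ^ k" unfolding power_mult_distrib[symmetric] by simp
      finally show ?thesis by (simp add: mult.commute)
    qed
    ultimately show ?thesis by (simp add: mult.assoc[symmetric])
  qed
  ultimately show ?thesis by simp
qed

text \<open>Expanding around a large real point \<open>x\<close> turns the claim into the binomial series.\<close>

theorem has_bochner_integral_Gamma_exp_complex:
  fixes s w :: complex
  assumes s: "Re s > 0" and w: "Re w > 0"
  shows "has_bochner_integral lborel (\<lambda>v. exp (s * complex_of_real v - w * complex_of_real (exp v))) (Gamma s * w powr (-s))"
proof -
  \<comment> \<open>The circle of centre \<open>x\<close> through the origin must contain
    \<open>w\<close> in its interior: with this \<open>x\<close>,
    \<open>|x - w|\<^sup>2 = x\<^sup>2 - |w|\<^sup>2\<close>.\<close>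
  define x where "x = (cmod w)\<^sup>2 / Re w"
  have w0: "w \<noteq> 0" using w by auto
  have x: "x > 0" using w w0 by (simp add: x_def)
  have close: "cmod (of_real x - w) < x"
  proof -
    have "x * Re w = (Re w)\<^sup>2 + (Im w)\<^sup>2" using w by (simp add: x_def cmod_power2)
    moreover have "(cmod (of_real x - w))\<^sup>2 = (x - Re w)\<^sup>2 + (Im w)\<^sup>2" by (simp add: cmod_power2)
    ultimately have "(cmod (of_real x - w))\<^sup>2 = x\<^sup>2 - ((Re w)\<^sup>2 + (Im w)\<^sup>2)"
      by (simp add: power2_diff)
    moreover have "(Re w)\<^sup>2 + (Im w)\<^sup>2 > 0" using w by (simp add: add_pos_nonneg)
    ultimately have "(cmod (of_real x - w))\<^sup>2 < x\<^sup>2" by simp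
    then show ?thesis using x by (simp add: power2_less_imp_less)
  qed
  define d where "d = of_real x - w"
  define z where "z = d / of_real x"
  have z: "cmod z < 1" using close x by (simp add: z_def d_def norm_divide)
  define E where "E v = exp (s * complex_of_real v - complex_of_real (x * exp v))" for v
  define f where "f k v = d ^ k / fact k * (E v * complex_of_real (exp v) ^ k)" for k v
  have E_pow: "E v * complex_of_real (exp v) ^ k = exp ((s + of_nat k) * complex_of_real v - complex_of_real (x * exp v))" for k v
    by (simp add: E_def exp_of_real[symmetric] exp_of_nat_mult[symmetric] exp_add[symmetric] algebra_simps del: of_real_mult)
  have norm_E_pow: "norm (E v * complex_of_real (exp v) ^ k) = exp ((Re s + k) * v - x * exp v)" for k v
    unfolding E_pow by simp
  have term_int: "has_bochner_integral lborel (f k) (of_real x powr (-s) * (Gamma (s + of_nat k) * z ^ k / fact k))" for k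
  proof -
    have "has_bochner_integral lborel (f k) (d ^ k / fact k * (Gamma (s + of_nat k) * complex_of_real x powr (-(s + of_nat k))))"
      unfolding f_def E_pow using s x by (intro has_bochner_integral_mult_right has_bochner_integral_Gamma_exp_scaled) auto
    also have "complex_of_real x powr (-(s + of_nat k)) = of_real x powr (-s) / of_real x ^ k"
    proof -
      have "complex_of_real x powr (-(s + of_nat k)) = of_real x powr (-s - of_nat k)" by simp
      also have "\<dots> = of_real x powr (-s) / of_real x powr (of_nat k)" by (rule powr_diff)
      finally show ?thesis using x by (simp add: powr_nat)
    qed
    finally show ?thesis using x by (simp add: z_def power_divide mult_ac)
  qed
  \<comment> \<open>The integrals of the norms form the same binomial series with
    \<open>Re s\<close> and \<open>|z|\<close> in place of \<open>s\<close> and \<open>z\<close>. It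
    still converges, which permits exchanging sum and integral.\<close>
  have norm_int: "has_bochner_integral lborel (\<lambda>v. norm (f k v))
      (x powr (- Re s) * (Gamma (Re s + k) * cmod z ^ k / fact k))" for k
  proof -
    have "has_bochner_integral lborel (\<lambda>v. cmod d ^ k / fact k * exp ((Re s + k) * v - x * exp v))
      (cmod d ^ k / fact k * (Gamma (Re s + k) * x powr (-(Re s + k))))"
      using s x by (intro has_bochner_integral_mult_right has_bochner_integral_Gamma_exp_real) auto
    also have "(\<lambda>v. cmod d ^ k / fact k * exp ((Re s + k) * v - x * exp v)) = (\<lambda>v. norm (f k v))"
      unfolding f_def norm_mult[of "d ^ k / fact k"] norm_E_pow by (simp add: norm_divide norm_power)
    also have "x powr (-(Re s + k)) = x powr (- Re s) / x ^ k"
      using x powr_diff[of x "- Re s" k] by (simp add: powr_realpow)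
    finally show ?thesis using x by (simp add: z_def norm_divide power_divide mult_ac)
  qed
  have "summable (\<lambda>k. Gamma (of_real (Re s) + of_nat k) * complex_of_real (cmod z) ^ k / fact k)"
    by (rule sums_summable[OF Gamma_binomial_sums]) (use s z in auto)
  then have "summable (\<lambda>k. Re (Gamma (of_real (Re s) + of_nat k) * complex_of_real (cmod z) ^ k / fact k))"
    by (rule summable_Re)
  moreover have "Re (Gamma (of_real (Re s) + of_nat k) * complex_of_real (cmod z) ^ k / fact k) = Gamma (Re s + k) * cmod z ^ k / fact k" for k
  proof -
    have "Gamma (of_real (Re s) + of_nat k) * complex_of_real (cmod z) ^ k / fact k = complex_of_real (Gamma (Re s + k) * cmod z ^ k / fact k)"
      using Gamma_complex_of_real[of "Re s + k"] by simp
    then show ?thesis by (simp only: Re_complex_of_real)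
  qed
  ultimately have "summable (\<lambda>k. Gamma (Re s + k) * cmod z ^ k / fact k)" by simp
  then have "summable (\<lambda>k. x powr (- Re s) * (Gamma (Re s + k) * cmod z ^ k / fact k))"
    by (rule summable_mult)
  then have summ: "summable (\<lambda>k. integral\<^sup>L lborel (\<lambda>v. norm (f k v)))"
    unfolding has_bochner_integral_integral_eq[OF norm_int] .
  have sums_f: "(\<lambda>k. f k v) sums exp (s * complex_of_real v - w * complex_of_real (exp v))" for v
  proof -
    have "(\<lambda>k. (d * complex_of_real (exp v)) ^ k /\<^sub>R fact k) sums exp (d * complex_of_real (exp v))"
      by (rule exp_converges)
    from sums_mult[OF this, of "E v"]
    have "(\<lambda>k. E v * ((d * complex_of_real (exp v)) ^ k /\<^sub>R fact k)) sums (E v * exp (d * complex_of_real (exp v)))" .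
    moreover have "E v * exp (d * complex_of_real (exp v)) = exp (s * complex_of_real v - w * complex_of_real (exp v))"
      by (simp add: E_def d_def exp_add[symmetric] algebra_simps)
    moreover have "E v * ((d * complex_of_real (exp v)) ^ k /\<^sub>R fact k) = f k v" for k
      by (simp add: f_def power_mult_distrib scaleR_conv_of_real divide_inverse mult_ac)
    ultimately show ?thesis by simp
  qed
  have summ_ae: "AE v in lborel. summable (\<lambda>k. norm (f k v))"
  proof (rule AE_I2)
    fix v :: real
    have "summable (\<lambda>k. norm (E v) * ((cmod d * exp v) ^ k /\<^sub>R fact k))"
      by (rule summable_mult[OF sums_summable[OF exp_converges]])
    moreover have "norm (f k v) = norm (E v) * ((cmod d * exp v) ^ k /\<^sub>R fact k)" for k
      by (simp add: f_def norm_mult norm_divide norm_power power_mult_distrib divide_inverse norm_inverse mult_ac)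
    ultimately show "summable (\<lambda>k. norm (f k v))" by simp
  qed
  have int_f: "integrable lborel (f k)" for k using term_int[of k] by (simp add: has_bochner_integral_iff)
  have suminf_f: "(\<Sum>k. f k v) = exp (s * complex_of_real v - w * complex_of_real (exp v))" for v
    using sums_f[of v] by (rule sums_unique[symmetric])
  have "integrable lborel (\<lambda>v. \<Sum>k. f k v)"
    by (rule integrable_suminf[OF int_f summ_ae summ])
  moreover have "(\<lambda>k. integral\<^sup>L lborel (f k)) sums (\<integral>v. (\<Sum>k. f k v) \<partial>lborel)"
    by (rule sums_integral[OF int_f summ_ae summ])
  moreover have "(\<lambda>k. integral\<^sup>L lborel (f k)) sums (of_real x powr (-s) * (Gamma s * (1 - z) powr (-s)))"
    using sums_mult[OF Gamma_binomial_sums[OF s z], of "of_real x powr (-s)"] term_int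
    by (simp add: has_bochner_integral_iff)
  moreover have "of_real x powr (-s) * (Gamma s * (1 - z) powr (-s)) = Gamma s * w powr (-s)"
  proof -
    have "1 - z \<noteq> 0" using z by auto
    moreover have w_eq: "w = of_real x * (1 - z)"
    proof -
      have "of_real x * z = d" using x by (simp add: z_def)
      then show ?thesis by (simp add: d_def right_diff_distrib)
    qed
    ultimately have "Ln w = of_real (ln x) + Ln (1 - z)" using Ln_times_of_real[of x "1 - z"] Ln_of_real[OF x] x by simp
    moreover have "Ln (complex_of_real x) = of_real (ln x)" by (rule Ln_of_real[OF x])
    ultimately show ?thesis using x w0 \<open>1 - z \<noteq> 0\<close>
      by (simp add: powr_def exp_add[symmetric] algebra_simps)
  qed
  ultimately have "integrable lborel (\<lambda>v. \<Sum>k. f k v)" "(\<integral>v. (\<Sum>k. f k v) \<partial>lborel) = Gamma s * w powr (-s)"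
    using sums_unique2 by auto
  then show ?thesis unfolding suminf_f by (simp add: has_bochner_integral_iff)
qed

section \<open>Decay of the Gamma function on vertical lines\<close>

lemma norm_Gamma_le:
  fixes \<sigma> \<theta> t :: real
  assumes "\<sigma> > 0" "0 \<le> \<theta>" "\<theta> < pi / 2"
  shows "cmod (Gamma (Complex \<sigma> t)) \<le> Gamma \<sigma> * cos \<theta> powr (-\<sigma>) * exp (- \<theta> * \<bar>t\<bar>)"
proof -
  \<comment> \<open>The ray of integration is rotated by an angle with the sign of \<open>t\<close>:
    then \<open>w powr (-s)\<close> has modulus \<open>exp (\<theta> * |t|)\<close>, while the
    integrand has the modulus of a real Gamma integral with parameter
    \<open>cos \<theta>\<close>.\<close>
  define \<phi> where "\<phi> = (if t \<ge> 0 then \<theta> else - \<theta>)"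
  define w where "w = cis \<phi>"
  have \<phi>: "\<bar>\<phi>\<bar> < pi / 2" "\<phi> * t = \<theta> * \<bar>t\<bar>" using assms by (auto simp: \<phi>_def)
  have cos: "cos \<phi> = cos \<theta>" "cos \<theta> > 0" using assms by (auto simp: \<phi>_def intro!: cos_gt_zero_pi)
  have Re_w: "Re w = cos \<theta>" by (simp add: w_def cos)
  define s where "s = Complex \<sigma> t"
  have 1: "has_bochner_integral lborel (\<lambda>v. exp (s * complex_of_real v - w * complex_of_real (exp v))) (Gamma s * w powr (-s))"
    by (rule has_bochner_integral_Gamma_exp_complex) (use assms Re_w cos in \<open>auto simp: s_def\<close>)
  have 2: "has_bochner_integral lborel (\<lambda>v. exp (\<sigma> * v - cos \<theta> * exp v)) (Gamma \<sigma> * cos \<theta> powr (-\<sigma>))"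
    by (rule has_bochner_integral_Gamma_exp_real) (use assms cos in auto)
  have norm_eq: "norm (exp (s * complex_of_real v - w * complex_of_real (exp v))) = exp (\<sigma> * v - cos \<theta> * exp v)" for v
    by (simp add: s_def Re_w)
  have "norm (Gamma s * w powr (-s)) \<le> (\<integral>v. norm (exp (s * complex_of_real v - w * complex_of_real (exp v))) \<partial>lborel)"
    using integral_norm_bound[of lborel "\<lambda>v. exp (s * complex_of_real v - w * complex_of_real (exp v))"]
    unfolding has_bochner_integral_integral_eq[OF 1] .
  also have "\<dots> = Gamma \<sigma> * cos \<theta> powr (-\<sigma>)"
    unfolding norm_eq by (rule has_bochner_integral_integral_eq[OF 2])
  also have "norm (Gamma s * w powr (-s)) = cmod (Gamma s) * exp (\<theta> * \<bar>t\<bar>)"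
  proof -
    have "Ln w = \<i> * \<phi>" unfolding w_def cis_conv_exp using \<phi> pi_gt_zero by (intro Ln_exp) auto
    moreover have "w \<noteq> 0" by (simp add: w_def)
    ultimately show ?thesis using \<phi> by (simp add: powr_def norm_mult s_def mult.commute)
  qed
  finally show ?thesis by (simp add: s_def exp_minus field_simps)
qed

text \<open>On this line \<open>cnj s = 1 - s\<close>, so the reflection formula gives the exact
  modulus. The resulting rate \<open>pi / 2\<close> is the limiting case that rotation of the ray
  does not reach, since its constant blows up as \<open>\<theta>\<close> approaches
  \<open>pi / 2\<close>.\<close>

lemma norm_Gamma_half: "(cmod (Gamma (Complex (1/2) t)))\<^sup>2 = pi / cosh (pi * t)"
proof -
  define s where "s = Complex (1/2) t"
  have "cnj s = 1 - s" by (simp add: s_def complex_eq_iff)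
  then have "of_real ((cmod (Gamma s))\<^sup>2) = Gamma s * Gamma (1 - s)"
    by (simp only: complex_norm_square cnj_Gamma)
  also have "\<dots> = of_real pi / sin (of_real pi * s)" by (rule Gamma_reflection_complex)
  also have "of_real pi * s = \<i> * of_real (pi * t) + of_real pi / 2"
    by (simp add: s_def complex_eq_iff)
  also have "sin \<dots> = cos (\<i> * of_real (pi * t))"
    by (simp add: sin_cos_eq)
  also have "\<dots> = of_real (cosh (pi * t))"
    by (simp add: cosh_conv_cos[symmetric] cosh_def exp_of_real[symmetric] del: of_real_mult) (simp add: exp_of_real scaleR_conv_of_real)
  finally have "complex_of_real ((cmod (Gamma s))\<^sup>2) = complex_of_real (pi / cosh (pi * t))" by simp
  then show ?thesis unfolding s_def of_real_eq_iff .
qed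

lemma norm_Gamma_half_le: "cmod (Gamma (Complex (1/2) t)) \<le> sqrt (2 * pi) * exp (- pi * \<bar>t\<bar> / 2)"
proof -
  have "(cmod (Gamma (Complex (1/2) t)))\<^sup>2 = pi / cosh (pi * \<bar>t\<bar>)"
    using norm_Gamma_half[of t] by (cases "t \<ge> 0") auto
  also have "\<dots> \<le> pi / (exp (pi * \<bar>t\<bar>) / 2)"
  proof (rule divide_left_mono)
    show "exp (pi * \<bar>t\<bar>) / 2 \<le> cosh (pi * \<bar>t\<bar>)" by (simp add: cosh_def)
  qed (auto intro!: mult_pos_pos)
  also have "\<dots> = 2 * pi * exp (- (pi * \<bar>t\<bar>))" by (simp add: exp_minus field_simps)
  also have "exp (- (pi * \<bar>t\<bar>)) = (exp (- pi * \<bar>t\<bar> / 2))\<^sup>2" by (simp flip: exp_double)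
  also have "2 * pi * (exp (- pi * \<bar>t\<bar> / 2))\<^sup>2 = (sqrt (2 * pi) * exp (- pi * \<bar>t\<bar> / 2))\<^sup>2"
    by (simp add: power_mult_distrib)
  finally show ?thesis by (rule power2_le_imp_le) simp
qed

section \<open>Fourier inversion at a point\<close>

lemma integrable_exp_minus_abs: "\<delta> > 0 \<Longrightarrow> integrable lborel (\<lambda>t::real. exp (- \<delta> * \<bar>t\<bar>))"
proof -
  assume \<delta>: "\<delta> > 0"
  interpret prob_space "density lborel (exponential_density \<delta>)" by (rule prob_space_exponential_density[OF \<delta>])
  have "integrable (density lborel (exponential_density \<delta>)) (\<lambda>_. 1::real)" by simp
  then have e: "integrable lborel (exponential_density \<delta>)"
    by (subst (asm) integrable_density) (auto simp: exponential_density_nonneg[OF \<delta>])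
  then have "integrable lborel (\<lambda>t. exponential_density \<delta> (0 + (-1) * t))"
    by (rule lborel_integrable_real_affine) simp
  with e have "integrable lborel (\<lambda>t. (exponential_density \<delta> t + exponential_density \<delta> (0 + (-1) * t)) / \<delta>)"
    by (intro integrable_divide_zero Bochner_Integration.integrable_add) auto
  then show ?thesis
    by (rule Bochner_Integration.integrable_bound)
      (use \<delta> in \<open>auto simp: exponential_density_def abs_if mult.commute\<close>)
qed

lemma integral_exp_minus_abs:
  assumes "\<delta> > 0"
  shows "(\<integral>t. exp (- \<delta> * \<bar>t\<bar>) \<partial>lborel) = (\<integral>t. exp (- \<bar>t::real\<bar>) \<partial>lborel) / \<delta>"
proof -
  have "(\<integral>t. exp (- \<bar>t::real\<bar>) \<partial>lborel) = \<bar>\<delta>\<bar> *\<^sub>R (\<integral>t. exp (- \<bar>0 + \<delta> * t\<bar>) \<partial>lborel)"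
    by (rule lborel_integral_real_affine) (use assms in simp)
  then show ?thesis using assms by (simp add: abs_mult)
qed

lemma integral_iexp_gaussian:
  assumes "\<delta> > 0"
  shows "(\<integral>t. iexp (t * v) * of_real (\<delta> * std_normal_density (\<delta> * t)) \<partial>lborel) = of_real (exp (- (v / \<delta>)\<^sup>2 / 2))"
proof -
  define n where "n = \<delta>"
  have n: "n > 0" using assms by (simp add: n_def)
  have "of_real (exp (- (v / \<delta>)\<^sup>2 / 2)) = char std_normal_distribution (v / \<delta>)"
    by (simp add: char_std_normal_distribution)
  also have "\<dots> = (\<integral>x. iexp (v / \<delta> * x) * of_real (std_normal_density x) \<partial>lborel)"
    unfolding char_def by (subst integral_density) (auto simp: scaleR_conv_of_real mult.commute)
  also have "\<dots> = \<bar>\<delta>\<bar> *\<^sub>R (\<integral>t. iexp (v / \<delta> * (0 + \<delta> * t)) * of_real (std_normal_density (0 + \<delta> * t)) \<partial>lborel)"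
    by (rule lborel_integral_real_affine) (use assms in simp)
  also have "\<dots> = (\<integral>t. \<bar>\<delta>\<bar> *\<^sub>R (iexp (v / \<delta> * (0 + \<delta> * t)) * of_real (std_normal_density (0 + \<delta> * t))) \<partial>lborel)"
    by simp
  also have "\<dots> = (\<integral>t. iexp (t * v) * of_real (\<delta> * std_normal_density (\<delta> * t)) \<partial>lborel)"
    using assms by (intro Bochner_Integration.integral_cong refl) (simp add: scaleR_conv_of_real mult.commute mult.left_commute)
  finally show ?thesis by simp
qed

text \<open>Both sides are regularised by a Gaussian factor, for which the exchange of the two integrals is
  legitimate.\<close>

theorem fourier_inversion_at_0:
  fixes f :: "real \<Rightarrow> complex"
  assumes f: "integrable lborel f" and cont: "isCont f 0" and bdd: "\<And>v. norm (f v) \<le> B"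
    and g: "integrable lborel (\<lambda>t. \<integral>v. f v * iexp (t * v) \<partial>lborel)"
  shows "(\<integral>t. (\<integral>v. f v * iexp (t * v) \<partial>lborel) \<partial>lborel) = 2 * pi * f 0"
proof -
  define h where "h t = (\<integral>v. f v * iexp (t * v) \<partial>lborel)" for t
  have [measurable]: "f \<in> borel_measurable borel" using borel_measurable_integrable[OF f] by simp
  have h[measurable]: "h \<in> borel_measurable borel" using borel_measurable_integrable[OF g] unfolding h_def by simp
  \<comment> \<open>The Gaussian cut-off \<open>exp (- (t / (n + 1))\<^sup>2 / 2)\<close>, written
    through the normal density because its Fourier transform is then a characteristic function. It
    stays below 1 and tends to 1 pointwise.\<close>
  define G where "G n t = sqrt (2 * pi) * std_normal_density (t / real (Suc n))" for n t
  have G_eq: "G n t = exp (- (t / Suc n)\<^sup>2 / 2)" for n t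
    by (simp add: G_def std_normal_density_def)
  have [measurable]: "G n \<in> borel_measurable borel" for n unfolding G_def by measurable
  have G_int: "integrable lborel (G n)" for n
  proof -
    have "integrable lborel (\<lambda>t. std_normal_density (0 + (1 / real (Suc n)) * t))"
      by (rule lborel_integrable_real_affine) (auto intro: integrable_normal_density)
    then show ?thesis unfolding G_def by (simp add: field_simps)
  qed
  have swap: "(\<integral>t. h t * of_real (G n t) \<partial>lborel)
      = 2 * pi * (\<integral>x. f (x / Suc n) * of_real (std_normal_density x) \<partial>lborel)" for n
  proof -
    define N where "N = real (Suc n)"
    have N: "N > 0" by (simp add: N_def)
    have int2: "integrable (lborel \<Otimes>\<^sub>M lborel) (\<lambda>(t, v). f v * iexp (t * v) * of_real (G n t))"
    proof (rule lborel_pair.Fubini_integrable)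
      show "(\<lambda>(t, v). f v * iexp (t * v) * of_real (G n t)) \<in> borel_measurable (lborel \<Otimes>\<^sub>M lborel)"
        by measurable
      have "integrable lborel (\<lambda>t. (\<integral>v. norm (f v) \<partial>lborel) * norm (G n t))"
        using G_int by (intro integrable_mult_right integrable_norm)
      then show "integrable lborel (\<lambda>t. \<integral>v. norm (case (t, v) of (t, v) \<Rightarrow> f v * iexp (t * v) * of_real (G n t)) \<partial>lborel)"
        by (simp add: norm_mult)
      show "AE t in lborel. integrable lborel (\<lambda>v. case (t, v) of (t, v) \<Rightarrow> f v * iexp (t * v) * of_real (G n t))"
      proof (rule AE_I2)
        fix t
        have "integrable lborel (\<lambda>v. f v * iexp (t * v))"
          by (rule Bochner_Integration.integrable_bound[OF f]) (auto simp: norm_mult)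
        then show "integrable lborel (\<lambda>v. case (t, v) of (t, v) \<Rightarrow> f v * iexp (t * v) * of_real (G n t))"
          by simp
      qed
    qed
    have "(\<integral>t. h t * of_real (G n t) \<partial>lborel) = (\<integral>t. (\<integral>v. f v * iexp (t * v) * of_real (G n t) \<partial>lborel) \<partial>lborel)"
      unfolding h_def by simp
    also have "\<dots> = (\<integral>v. (\<integral>t. f v * iexp (t * v) * of_real (G n t) \<partial>lborel) \<partial>lborel)"
      using lborel_pair.Fubini_integral[OF int2] by simp
    also have "\<dots> = (\<integral>v. 2 * pi * (f v * of_real (N * std_normal_density (N * v))) \<partial>lborel)"
    proof (intro Bochner_Integration.integral_cong refl)
      fix v
      have "(\<integral>t. f v * iexp (t * v) * of_real (G n t) \<partial>lborel)
          = (\<integral>t. f v * (sqrt (2 * pi) * N) * (iexp (t * v) * of_real (1 / N * std_normal_density (1 / N * t))) \<partial>lborel)"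
        by (intro Bochner_Integration.integral_cong refl) (use N in \<open>simp add: G_def N_def del: of_nat_Suc\<close>)
      also have "\<dots> = f v * (sqrt (2 * pi) * N) * of_real (exp (- (v / (1 / N))\<^sup>2 / 2))"
        using N by (subst integral_mult_right_zero, subst integral_iexp_gaussian) auto
      also have "of_real (exp (- (v / (1 / N))\<^sup>2 / 2)) = complex_of_real (sqrt (2 * pi) * std_normal_density (N * v))"
        by (simp add: std_normal_density_def mult.commute)
      also have "f v * (sqrt (2 * pi) * N) * complex_of_real (sqrt (2 * pi) * std_normal_density (N * v))
          = complex_of_real (sqrt (2 * pi) * sqrt (2 * pi)) * (f v * of_real (N * std_normal_density (N * v)))"
        unfolding of_real_mult by (simp only: mult_ac)
      also have "sqrt (2 * pi) * sqrt (2 * pi) = 2 * pi" by simp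
      finally show "(\<integral>t. f v * iexp (t * v) * of_real (G n t) \<partial>lborel) = 2 * pi * (f v * of_real (N * std_normal_density (N * v)))"
        by simp
    qed
    also have "\<dots> = 2 * pi * (\<integral>v. f v * of_real (N * std_normal_density (N * v)) \<partial>lborel)"
      by (rule integral_mult_right_zero)
    \<comment> \<open>The rescaling moves \<open>N\<close> into the argument of \<open>f\<close> and
      leaves a fixed integrable weight, ready for dominated convergence.\<close>
    also have "(\<integral>v. f v * of_real (N * std_normal_density (N * v)) \<partial>lborel)
        = (\<integral>x. f (x / N) * of_real (std_normal_density x) \<partial>lborel)"
    proof -
      have "(\<integral>x. f (x / N) * of_real (std_normal_density x) \<partial>lborel)
          = \<bar>N\<bar> *\<^sub>R (\<integral>v. f ((0 + N * v) / N) * of_real (std_normal_density (0 + N * v)) \<partial>lborel)"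
        by (rule lborel_integral_real_affine) (use N in simp)
      also have "\<dots> = (\<integral>v. \<bar>N\<bar> *\<^sub>R (f ((0 + N * v) / N) * of_real (std_normal_density (0 + N * v))) \<partial>lborel)"
        by simp
      also have "\<dots> = (\<integral>v. f v * of_real (N * std_normal_density (N * v)) \<partial>lborel)"
        using N by (intro Bochner_Integration.integral_cong refl) (simp add: scaleR_conv_of_real)
      finally show ?thesis by simp
    qed
    finally show ?thesis by (simp add: N_def)
  qed
  have lim1: "(\<lambda>n. \<integral>t. h t * of_real (G n t) \<partial>lborel) \<longlonglongrightarrow> (\<integral>t. h t \<partial>lborel)"
  proof (rule integral_dominated_convergence[where w = "\<lambda>t. norm (h t)"])
    show "integrable lborel (\<lambda>t. norm (h t))" using g by (simp add: h_def)
    show "AE t in lborel. norm (h t * of_real (G n t)) \<le> norm (h t)" for n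
      by (auto simp: norm_mult G_eq mult_left_le)
    show "AE t in lborel. (\<lambda>n. h t * of_real (G n t)) \<longlonglongrightarrow> h t"
    proof (rule AE_I2)
      fix t
      have "(\<lambda>n. t / real (Suc n)) \<longlonglongrightarrow> 0"
        by (rule LIMSEQ_Suc[OF lim_const_over_n])
      then have "(\<lambda>n. exp (- (t / Suc n)\<^sup>2 / 2)) \<longlonglongrightarrow> exp (- 0\<^sup>2 / 2)"
        by (intro tendsto_intros) auto
      then have "(\<lambda>n. complex_of_real (G n t)) \<longlonglongrightarrow> 1" unfolding G_eq using tendsto_of_real by fastforce
      from tendsto_mult[OF tendsto_const this] show "(\<lambda>n. h t * of_real (G n t)) \<longlonglongrightarrow> h t" by simp
    qed
  qed measurable
  have lim2: "(\<lambda>n. \<integral>x. f (x / Suc n) * of_real (std_normal_density x) \<partial>lborel) \<longlonglongrightarrow> (\<integral>x. f 0 * of_real (std_normal_density x) \<partial>lborel)"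
  proof (rule integral_dominated_convergence[where w = "\<lambda>x. B * std_normal_density x"])
    show "integrable lborel (\<lambda>x. B * std_normal_density x)" by (intro integrable_mult_right integrable_normal_density) auto
    show "AE x in lborel. norm (f (x / Suc n) * of_real (std_normal_density x)) \<le> B * std_normal_density x" for n
      using bdd by (auto simp: norm_mult intro!: mult_right_mono)
    show "AE x in lborel. (\<lambda>n. f (x / Suc n) * of_real (std_normal_density x)) \<longlonglongrightarrow> f 0 * of_real (std_normal_density x)"
    proof (rule AE_I2)
      fix x :: real
      have "(\<lambda>n. x / real (Suc n)) \<longlonglongrightarrow> 0"
        by (rule LIMSEQ_Suc[OF lim_const_over_n])
      then have "(\<lambda>n. f (x / Suc n)) \<longlonglongrightarrow> f 0" by (rule isCont_tendsto_compose[OF cont])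
      then show "(\<lambda>n. f (x / Suc n) * of_real (std_normal_density x)) \<longlonglongrightarrow> f 0 * of_real (std_normal_density x)"
        by (intro tendsto_intros)
    qed
  qed measurable
  have "(\<integral>x. f 0 * of_real (std_normal_density x) \<partial>lborel) = f 0"
  proof -
    have "(\<integral>x. std_normal_density x \<partial>lborel) = 1" by (rule integral_normal_density) simp
    then show ?thesis by simp
  qed
  then have "(\<lambda>n. \<integral>t. h t * of_real (G n t) \<partial>lborel) \<longlonglongrightarrow> 2 * pi * f 0"
    unfolding swap using tendsto_mult[OF tendsto_const lim2] by simp
  then show ?thesis using LIMSEQ_unique[OF lim1] unfolding h_def by blast
qed

section \<open>Mellin inversion along vertical lines\<close>

lemma norm_powr_minus:
  fixes w :: complex
  assumes "w \<noteq> 0"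
  shows "cmod (w powr (- Complex \<sigma> t)) = cmod w powr (-\<sigma>) * exp (t * Im (Ln w))"
  using assms by (simp add: powr_def exp_add[symmetric])

lemma norm_Gamma_powr_le:
  fixes w :: complex
  assumes "0 < Re w" "\<sigma> > 0" "\<bar>Im (Ln w)\<bar> \<le> \<theta>'" "0 \<le> \<theta>" "\<theta> < pi / 2"
  shows "cmod (Gamma (Complex \<sigma> t) * w powr (- Complex \<sigma> t))
      \<le> Gamma \<sigma> * cos \<theta> powr (-\<sigma>) * cmod w powr (-\<sigma>) * exp (- (\<theta> - \<theta>') * \<bar>t\<bar>)"
proof -
  have w: "w \<noteq> 0" using assms by auto
  have "t * Im (Ln w) \<le> \<bar>t\<bar> * \<bar>Im (Ln w)\<bar>" by (metis abs_ge_self abs_mult)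
  also have "\<dots> \<le> \<theta>' * \<bar>t\<bar>" using mult_left_mono[OF assms(3) abs_ge_zero[of t]] by (simp only: mult.commute)
  finally have e: "exp (t * Im (Ln w)) \<le> exp (\<theta>' * \<bar>t\<bar>)" by simp
  have "cmod (Gamma (Complex \<sigma> t) * w powr (- Complex \<sigma> t))
      = cmod (Gamma (Complex \<sigma> t)) * (cmod w powr (-\<sigma>) * exp (t * Im (Ln w)))"
    unfolding norm_mult norm_powr_minus[OF w] ..
  also have "\<dots> \<le> (Gamma \<sigma> * cos \<theta> powr (-\<sigma>) * exp (- \<theta> * \<bar>t\<bar>)) * (cmod w powr (-\<sigma>) * exp (\<theta>' * \<bar>t\<bar>))"
    using e assms by (intro mult_mono norm_Gamma_le mult_nonneg_nonneg) (auto intro: Gamma_real_nonneg)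
  also have "\<dots> = Gamma \<sigma> * cos \<theta> powr (-\<sigma>) * cmod w powr (-\<sigma>) * (exp (- \<theta> * \<bar>t\<bar>) * exp (\<theta>' * \<bar>t\<bar>))"
    by (simp add: mult_ac)
  also have "exp (- \<theta> * \<bar>t\<bar>) * exp (\<theta>' * \<bar>t\<bar>) = exp (- (\<theta> - \<theta>') * \<bar>t\<bar>)"
    by (simp add: exp_add[symmetric] algebra_simps)
  finally show ?thesis .
qed

lemma continuous_Gamma_powr_line:
  fixes w :: complex
  assumes "0 < Re w" "\<sigma> > 0"
  shows "continuous_on UNIV (\<lambda>t. Gamma (Complex \<sigma> t) * w powr (- Complex \<sigma> t))"
proof -
  have *: "Complex \<sigma> t \<notin> \<int>\<^sub>\<le>\<^sub>0" for t
    using assms by (auto elim!: nonpos_Ints_cases simp: complex_eq_iff)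
  have "continuous_on UNIV (\<lambda>t. \<sigma> + \<i> * complex_of_real t)"
    by (intro continuous_intros)
  then have c: "continuous_on UNIV (Complex \<sigma>)" unfolding Complex_eq .
  have "continuous_on UNIV (\<lambda>t. Gamma (Complex \<sigma> t))"
    by (rule continuous_on_compose2[OF continuous_on_Gamma c, of "- \<int>\<^sub>\<le>\<^sub>0"]) (use * in auto)
  moreover have "continuous_on UNIV (\<lambda>t. exp (- Complex \<sigma> t * Ln w))"
    by (intro continuous_intros c)
  moreover have "w \<noteq> 0" using assms by auto
  ultimately show ?thesis
    unfolding powr_def by (simp add: continuous_on_mult)
qed

text \<open>Since \<open>Re w > 0\<close>, the argument of \<open>w\<close> is strictly smaller than
  \<open>pi / 2\<close> in modulus. A decay rate \<open>\<theta>\<close> of Gamma halfway between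
  the two beats the growth of \<open>w powr (-s)\<close>, and the surplus
  \<open>\<theta> - \<theta>'\<close> does not depend on the strip.\<close>

lemma Gamma_powr_line_bound:
  fixes w :: complex
  assumes "0 < Re w"
  obtains \<delta> where "\<delta> > 0" "\<And>a b. 0 < a \<Longrightarrow> a \<le> b \<Longrightarrow>
    \<exists>M\<ge>0. \<forall>\<sigma>\<in>{a..b}. \<forall>t. cmod (Gamma (Complex \<sigma> t) * w powr (- Complex \<sigma> t)) \<le> M * exp (- \<delta> * \<bar>t\<bar>)"
proof -
  have w: "w \<noteq> 0" using assms by auto
  define \<theta>' where "\<theta>' = \<bar>Im (Ln w)\<bar>"
  define \<theta> where "\<theta> = (\<theta>' + pi / 2) / 2"
  have "\<theta>' < pi / 2" using Re_Ln_pos_lt[OF w] assms by (simp add: \<theta>'_def)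
  moreover have "0 \<le> \<theta>'" by (simp add: \<theta>'_def)
  ultimately have \<theta>: "\<theta>' < \<theta>" "\<theta> < pi / 2" "0 \<le> \<theta>" by (auto simp: \<theta>_def)
  have bound: "\<exists>M\<ge>0. \<forall>\<sigma>\<in>{a..b}. \<forall>t. cmod (Gamma (Complex \<sigma> t) * w powr (- Complex \<sigma> t)) \<le> M * exp (- (\<theta> - \<theta>') * \<bar>t\<bar>)"
    if ab: "0 < a" "a \<le> b" for a b
  proof -
    define m where "m \<sigma> = Gamma \<sigma> * cos \<theta> powr (-\<sigma>) * cmod w powr (-\<sigma>)" for \<sigma>
    have cos: "cos \<theta> > 0" using \<theta> by (intro cos_gt_zero_pi) auto
    have "continuous_on {a..b} m"
      unfolding m_def using ab cos w
      by (intro continuous_intros) (auto elim!: nonpos_Ints_cases)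
    then obtain M where M: "\<And>\<sigma>. \<sigma> \<in> {a..b} \<Longrightarrow> norm (m \<sigma>) \<le> M"
      using compact_continuous_image[OF _ compact_Icc] compact_imp_bounded bounded_iff by (metis image_eqI)
    have "cmod (Gamma (Complex \<sigma> t) * w powr (- Complex \<sigma> t)) \<le> \<bar>M\<bar> * exp (- (\<theta> - \<theta>') * \<bar>t\<bar>)" if "\<sigma> \<in> {a..b}" for \<sigma> t
    proof -
      have "cmod (Gamma (Complex \<sigma> t) * w powr (- Complex \<sigma> t)) \<le> m \<sigma> * exp (- (\<theta> - \<theta>') * \<bar>t\<bar>)"
        unfolding m_def by (rule norm_Gamma_powr_le) (use assms ab that \<theta> in \<open>auto simp: \<theta>'_def\<close>)
      also have "\<dots> \<le> \<bar>M\<bar> * exp (- (\<theta> - \<theta>') * \<bar>t\<bar>)"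
        using M[OF that] by (intro mult_right_mono) auto
      finally show ?thesis .
    qed
    then show ?thesis by (intro exI[of _ "\<bar>M\<bar>"]) auto
  qed
  show thesis by (rule that[of "\<theta> - \<theta>'", OF _ bound]) (use \<theta> in auto)
qed

lemma integrable_exp_bounded_line:
  fixes g :: "real \<Rightarrow> complex"
  assumes "continuous_on UNIV g" "\<And>t. norm (g t) \<le> M * exp (- \<delta> * \<bar>t\<bar>)" "\<delta> > 0"
  shows "integrable lborel g"
proof (rule Bochner_Integration.integrable_bound)
  show "integrable lborel (\<lambda>t. M * exp (- \<delta> * \<bar>t\<bar>))"
    using integrable_exp_minus_abs[OF assms(3)] by simp
  show "g \<in> borel_measurable lborel"
    using borel_measurable_continuous_onI[OF assms(1)] by simp
  show "AE t in lborel. norm (g t) \<le> norm (M * exp (- \<delta> * \<bar>t\<bar>))"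
    using assms(2) by (auto intro: order_trans[OF _ abs_ge_self])
qed

text \<open>The function \<open>v \<mapsto> exp (c * v - w * exp v)\<close> has Fourier transform
  \<open>Gamma (c + i t) * w powr (- (c + i t))\<close> and the value \<open>exp (-w)\<close> at 0,
  so inversion at 0 is exactly the claim.\<close>

theorem mellin_inversion_exp:
  fixes w :: complex and c :: real
  assumes w: "Re w > 0" and c: "c > 0"
  shows "integrable lborel (\<lambda>t. Gamma (Complex c t) * w powr (- Complex c t))"
    and "(\<integral>t. Gamma (Complex c t) * w powr (- Complex c t) \<partial>lborel) = 2 * pi * exp (-w)"
proof -
  obtain \<delta> where \<delta>: "\<delta> > 0" "\<And>a b. 0 < a \<Longrightarrow> a \<le> b \<Longrightarrow>
    \<exists>M\<ge>0. \<forall>\<sigma>\<in>{a..b}. \<forall>t. cmod (Gamma (Complex \<sigma> t) * w powr (- Complex \<sigma> t)) \<le> M * exp (- \<delta> * \<bar>t\<bar>)"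
    using Gamma_powr_line_bound[OF w] by blast
  from \<delta>(2)[of c c] c obtain M where "\<And>t. cmod (Gamma (Complex c t) * w powr (- Complex c t)) \<le> M * exp (- \<delta> * \<bar>t\<bar>)" by auto
  then show int: "integrable lborel (\<lambda>t. Gamma (Complex c t) * w powr (- Complex c t))"
    by (intro integrable_exp_bounded_line[OF continuous_Gamma_powr_line[OF w c] _ \<delta>(1)])
  define f where "f v = exp (of_real c * complex_of_real v - w * complex_of_real (exp v))" for v
  have f: "has_bochner_integral lborel f (Gamma (of_real c) * w powr (- of_real c))"
    unfolding f_def by (rule has_bochner_integral_Gamma_exp_complex) (use assms in auto)
  have ft: "(\<integral>v. f v * iexp (t * v) \<partial>lborel) = Gamma (Complex c t) * w powr (- Complex c t)" for t
  proof -
    have "f v * iexp (t * v) = exp (Complex c t * complex_of_real v - w * complex_of_real (exp v))" for v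
      unfolding f_def Complex_eq by (simp add: exp_add[symmetric] algebra_simps)
    moreover have "has_bochner_integral lborel (\<lambda>v. exp (Complex c t * complex_of_real v - w * complex_of_real (exp v)))
        (Gamma (Complex c t) * w powr (- Complex c t))"
      by (rule has_bochner_integral_Gamma_exp_complex) (use assms in auto)
    ultimately show ?thesis by (simp add: has_bochner_integral_integral_eq)
  qed
  \<comment> \<open>The maximum of the exponent is read off from \<open>ln y \<le> y\<close> at
    \<open>y = Re w * exp v / c\<close>.\<close>
  have bdd: "norm (f v) \<le> (c / Re w) powr c" for v
  proof -
    define y where "y = Re w * exp v / c"
    have y: "y > 0" using assms by (simp add: y_def)
    have "ln y \<le> y" using ln_bound[OF y] .
    then have "c * ln y \<le> c * y" using c by simp
    moreover have "ln y = ln (Re w) + v - ln c" using assms by (simp add: y_def ln_mult_pos ln_div)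
    moreover have "c * y = Re w * exp v" using c by (simp add: y_def)
    ultimately have "c * v - Re w * exp v \<le> c * (ln c - ln (Re w))" by (simp add: algebra_simps)
    also have "\<dots> = c * ln (c / Re w)" using assms by (simp add: ln_div)
    finally have "exp (c * v - Re w * exp v) \<le> exp (c * ln (c / Re w))" by simp
    also have "\<dots> = (c / Re w) powr c" using assms by (simp add: powr_def)
    finally show ?thesis by (simp add: f_def)
  qed
  have "(\<integral>t. (\<integral>v. f v * iexp (t * v) \<partial>lborel) \<partial>lborel) = 2 * pi * f 0"
  proof (rule fourier_inversion_at_0)
    show "integrable lborel f" using f by (simp add: has_bochner_integral_iff)
    show "isCont f 0" unfolding f_def by (intro continuous_intros)
    show "integrable lborel (\<lambda>t. \<integral>v. f v * iexp (t * v) \<partial>lborel)" unfolding ft by (rule int)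
  qed (rule bdd)
  then show "(\<integral>t. Gamma (Complex c t) * w powr (- Complex c t) \<partial>lborel) = 2 * pi * exp (-w)"
    unfolding ft by (simp add: f_def)
qed

section \<open>Shifting the line of integration, and smoothed Dirichlet series\<close>

lemma tendsto_integral_symmetric_interval:
  fixes g :: "real \<Rightarrow> complex"
  assumes "integrable lborel g"
  shows "(\<lambda>n. \<integral>t. indicator {- real n..real n} t *\<^sub>R g t \<partial>lborel) \<longlonglongrightarrow> (\<integral>t. g t \<partial>lborel)"
proof (rule integral_dominated_convergence[where w = "\<lambda>t. norm (g t)"])
  have [measurable]: "g \<in> borel_measurable borel" using borel_measurable_integrable[OF assms] by simp
  show "g \<in> borel_measurable lborel" by measurable
  show "(\<lambda>t. indicator {- real n..real n} t *\<^sub>R g t) \<in> borel_measurable lborel" for n by measurable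
  show "integrable lborel (\<lambda>t. norm (g t))" using assms by simp
  show "AE t in lborel. norm (indicator {- real n..real n} t *\<^sub>R g t) \<le> norm (g t)" for n
    by (auto simp: indicator_def)
  show "AE t in lborel. (\<lambda>n. indicator {- real n..real n} t *\<^sub>R g t) \<longlonglongrightarrow> g t"
  proof (rule AE_I2, rule tendsto_eventually)
    fix t :: real
    obtain N where "\<bar>t\<bar> \<le> real N" using real_arch_simple by blast
    then have "\<bar>t\<bar> \<le> real n" if "n \<ge> N" for n
      using that by (meson of_nat_mono order_trans)
    then have "t \<in> {- real n..real n}" if "n \<ge> N" for n
      using that by (force simp: abs_le_iff)
    then show "\<forall>\<^sub>F n in sequentially. indicator {- real n..real n} t *\<^sub>R g t = g t"
      by (intro eventually_sequentiallyI[of N]) simp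
  qed
qed

text \<open>The closed strip is convex, so \<open>h\<close> has a primitive \<open>P\<close> there
  and the truncated integrals are differences of values of \<open>P\<close>. Between the two lines,
  \<open>P\<close> changes at height \<open>y\<close> by at most
  \<open>M * exp (- \<delta> * |y|) * (b - a)\<close>, which tends to 0.\<close>

lemma vertical_line_shift:
  fixes h :: "complex \<Rightarrow> complex"
  assumes hol: "h holomorphic_on S" and S: "open S" "{s. a \<le> Re s \<and> Re s \<le> b} \<subseteq> S" and "a \<le> b"
    and bound: "\<And>s. a \<le> Re s \<Longrightarrow> Re s \<le> b \<Longrightarrow> cmod (h s) \<le> M * exp (- \<delta> * \<bar>Im s\<bar>)" and "\<delta> > 0"
  shows "(\<integral>t. h (Complex a t) \<partial>lborel) = (\<integral>t. h (Complex b t) \<partial>lborel)"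
proof -
  define K where "K = {s. a \<le> Re s \<and> Re s \<le> b}"
  have KS: "K \<subseteq> S" using S by (simp add: K_def)
  have "K = {s. Re s \<ge> a} \<inter> {s. Re s \<le> b}" by (auto simp: K_def)
  then have cvx: "convex K" by (simp add: convex_Int convex_halfspace_Re_ge convex_halfspace_Re_le)
  have cont: "continuous_on K h"
    using hol KS holomorphic_on_imp_continuous_on continuous_on_subset by blast
  obtain P where P: "\<And>x. x \<in> K \<Longrightarrow> (P has_field_derivative h x) (at x within K)"
  proof (rule holomorphic_convex_primitive[OF cvx _ cont, of "{}"])
    fix x assume "x \<in> interior K - {}"
    then have "x \<in> S" using interior_subset KS by blast
    then show "h field_differentiable at x"
      using hol S(1) holomorphic_on_imp_differentiable_at by blast
  qed auto
  have line_cont: "continuous_on UNIV (\<lambda>t. h (Complex c t))" if "c \<in> {a..b}" for c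
  proof -
    have "continuous_on UNIV (Complex c)"
      unfolding Complex_eq by (intro continuous_intros)
    then show ?thesis
      by (rule continuous_on_compose2[OF cont]) (use that in \<open>auto simp: K_def\<close>)
  qed
  define I where "I c n = (\<integral>t. indicator {- real n..real n} t *\<^sub>R h (Complex c t) \<partial>lborel)" for c and n :: nat
  have lim: "I c \<longlonglongrightarrow> (\<integral>t. h (Complex c t) \<partial>lborel)" if c: "c \<in> {a..b}" for c
  proof -
    have "integrable lborel (\<lambda>t. h (Complex c t))"
      by (rule integrable_exp_bounded_line[OF line_cont[OF c] _ \<open>\<delta> > 0\<close>, of M]) (use bound[of "Complex c _"] c in simp)
    then show ?thesis unfolding I_def by (rule tendsto_integral_symmetric_interval)
  qed
  have I_eq: "I c n = (-\<i>) * P (Complex c n) - (-\<i>) * P (Complex c (- n))" if c: "c \<in> {a..b}" for c n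
    unfolding I_def
  proof (rule integral_FTC_Icc)
    fix t assume t: "- real n \<le> t" "t \<le> real n"
    have "((\<lambda>t. of_real c + \<i> * complex_of_real t) has_vector_derivative \<i>) (at t within {- real n..real n})"
      by (rule has_vector_derivative_real_field, (rule derivative_eq_intros refl | simp)+)
    then have 1: "(Complex c has_vector_derivative \<i>) (at t within {- real n..real n})"
      unfolding Complex_eq .
    have 2: "(P has_field_derivative h (Complex c t)) (at (Complex c t) within Complex c ` {- real n..real n})"
      by (rule has_field_derivative_subset[OF P]) (use c in \<open>auto simp: K_def\<close>)
    have "((P \<circ> Complex c) has_vector_derivative \<i> * h (Complex c t)) (at t within {- real n..real n})"
      by (rule field_vector_diff_chain_within[OF 1 2])
    then have "((\<lambda>t. (-\<i>) * (P \<circ> Complex c) t) has_vector_derivative (-\<i>) * (\<i> * h (Complex c t))) (at t within {- real n..real n})"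
      by (intro has_vector_derivative_mult_right)
    then show "((\<lambda>t. (-\<i>) * P (Complex c t)) has_vector_derivative h (Complex c t)) (at t within {- real n..real n})"
      by (simp add: mult.assoc[symmetric] comp_def)
  qed (use line_cont[OF c] continuous_on_subset in auto)
  have edge: "norm (P (Complex a y) - P (Complex b y)) \<le> M * exp (- \<delta> * \<bar>y\<bar>) * (b - a)" for y
  proof -
    define L where "L = K \<inter> {s. Im s = y}"
    have "{s. Im s = y} = {s. Im s \<ge> y} \<inter> {s. Im s \<le> y}" by auto
    then have "convex {s. Im s = y}" by (simp add: convex_Int convex_halfspace_Im_ge convex_halfspace_Im_le)
    then have "convex L" unfolding L_def by (rule convex_Int[OF cvx])
    then have "norm (P (Complex a y) - P (Complex b y)) \<le> M * exp (- \<delta> * \<bar>y\<bar>) * norm (Complex a y - Complex b y)"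
    proof (rule field_differentiable_bound)
      fix z assume z: "z \<in> L"
      show "(P has_field_derivative h z) (at z within L)"
        by (rule has_field_derivative_subset[OF P]) (use z in \<open>auto simp: L_def\<close>)
      show "norm (h z) \<le> M * exp (- \<delta> * \<bar>y\<bar>)"
        using bound[of z] z by (simp add: L_def K_def)
    qed (use \<open>a \<le> b\<close> in \<open>auto simp: L_def K_def\<close>)
    also have "Complex a y - Complex b y = of_real (a - b)" by (simp add: complex_eq_iff)
    finally show ?thesis using \<open>a \<le> b\<close> by (simp only: norm_of_real) simp
  qed
  have "(\<lambda>n. I a n - I b n) \<longlonglongrightarrow> 0"
  proof (rule Lim_null_comparison[OF always_eventually])
    show "\<forall>n. norm (I a n - I b n) \<le> 2 * M * (b - a) * exp (- \<delta> * real n)"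
    proof
      fix n
      have "I a n - I b n = (-\<i>) * (P (Complex a n) - P (Complex b n)) - (-\<i>) * (P (Complex a (-n)) - P (Complex b (-n)))"
      proof -
        have "I a n = (-\<i>) * P (Complex a n) - (-\<i>) * P (Complex a (- real n))"
          "I b n = (-\<i>) * P (Complex b n) - (-\<i>) * P (Complex b (- real n))"
          using I_eq[of a n] I_eq[of b n] \<open>a \<le> b\<close> by simp_all
        then show ?thesis by (simp only:) (simp only: right_diff_distrib diff_diff_eq2 add_diff_eq diff_add_eq diff_diff_eq ac_simps)
      qed
      also have "norm \<dots> \<le> norm (P (Complex a n) - P (Complex b n)) + norm (P (Complex a (-n)) - P (Complex b (-n)))"
        by (rule order_trans[OF norm_triangle_ineq4]) (simp add: norm_mult)
      also have "\<dots> \<le> M * exp (- \<delta> * real n) * (b - a) + M * exp (- \<delta> * real n) * (b - a)"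
        using edge[of "real n"] edge[of "- real n"] by (intro add_mono) auto
      finally show "norm (I a n - I b n) \<le> 2 * M * (b - a) * exp (- \<delta> * real n)" by (simp add: algebra_simps)
    qed
    have "filterlim (\<lambda>n. - \<delta> * real n) at_bot sequentially"
      using \<open>\<delta> > 0\<close> by real_asymp
    then have "(\<lambda>n. exp (- \<delta> * real n)) \<longlonglongrightarrow> 0" by (rule filterlim_compose[OF exp_at_bot])
    then show "(\<lambda>n. 2 * M * (b - a) * exp (- \<delta> * real n)) \<longlonglongrightarrow> 0" by (rule tendsto_mult_right_zero)
  qed
  moreover have "(\<lambda>n. I a n - I b n) \<longlonglongrightarrow> (\<integral>t. h (Complex a t) \<partial>lborel) - (\<integral>t. h (Complex b t) \<partial>lborel)"
    using \<open>a \<le> b\<close> by (intro tendsto_diff lim) auto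
  ultimately show ?thesis using LIMSEQ_unique by fastforce
qed

definition mellin_const :: real where
  "mellin_const = 2 * sqrt (2 * pi) * exp 2 * (\<integral>t. exp (- \<bar>t::real\<bar>) \<partial>lborel)"

lemma mellin_const_nonneg: "mellin_const \<ge> 0"
  unfolding mellin_const_def by (intro mult_nonneg_nonneg integral_nonneg_AE) auto

text \<open>Against a decay \<open>exp (- \<delta> * x)\<close>, a factor
  \<open>x powr \<epsilon>\<close> costs half of the rate and the factor
  \<open>\<delta> powr (-\<epsilon>)\<close>, since \<open>x\<close> is effectively of size
  \<open>1 / \<delta>\<close>.\<close>

lemma powr_le_exp_of_scale:
  fixes x \<epsilon> \<delta> :: real
  assumes "x > 0" "0 < \<epsilon>" "\<epsilon> \<le> 1/2" "\<delta> > 0"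
  shows "x powr \<epsilon> \<le> \<delta> powr (-\<epsilon>) * exp (\<delta> * x / 2)"
proof -
  have "ln (\<delta> * x) \<le> \<delta> * x" using assms by (intro ln_bound) simp
  then have "\<epsilon> * ln (\<delta> * x) \<le> \<epsilon> * (\<delta> * x)" using assms by simp
  also have "\<dots> \<le> 1/2 * (\<delta> * x)" using assms by (intro mult_right_mono) auto
  finally have "(\<delta> * x) powr \<epsilon> \<le> exp (\<delta> * x / 2)" using assms by (simp add: powr_def)
  moreover have "(\<delta> * x) powr \<epsilon> = \<delta> powr \<epsilon> * x powr \<epsilon>" using assms by (simp add: powr_mult)
  ultimately show ?thesis using assms by (simp add: powr_minus field_simps)
qed

text \<open>The sum is a Mellin integral over Re s = 3/2, where the series for
  \<open>D (s + \<epsilon>)\<close> converges absolutely; the line is moved to 1/2. The weight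
  \<open>n powr (-\<epsilon>)\<close> is what turns \<open>D s\<close> into
  \<open>D (s + \<epsilon>)\<close>: Gamma is met on the line with exact decay, \<open>D\<close>
  only at real part at least \<open>1/2 + \<epsilon>\<close>.\<close>

theorem dirichlet_series_exp_bound:
  fixes a :: "nat \<Rightarrow> complex" and D :: "complex \<Rightarrow> complex"
  assumes a: "\<And>n. cmod (a n) \<le> 1" and \<epsilon>: "0 < \<epsilon>" "\<epsilon> \<le> 1/2"
    and hol: "D holomorphic_on {s. Re s > 1/2}"
    and D_sums: "\<And>s. Re s > 1 \<Longrightarrow> (\<lambda>n. a (Suc n) * of_nat (Suc n) powr (-s)) sums D s"
    and D_le: "\<And>s. 1/2 + \<epsilon> \<le> Re s \<Longrightarrow> Re s \<le> 3/2 + \<epsilon> \<Longrightarrow> cmod (D s) \<le> A * (2 + \<bar>Im s\<bar>) powr \<epsilon>"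
    and w: "Re w > 0"
  shows "cmod (\<Sum>n. a (Suc n) * of_real (real (Suc n) powr (-\<epsilon>)) * exp (- of_nat (Suc n) * w))
    \<le> mellin_const * A * cmod w powr (1/2 + \<epsilon>) / Re w powr (1 + \<epsilon>)"
proof -
  have w0: "w \<noteq> 0" using w by auto
  have A: "A \<ge> 0"
    using order_trans[OF norm_ge_zero D_le[of 1]] \<epsilon> by (simp add: zero_le_mult_iff)
  define \<Phi> where "\<Phi> s = Gamma s * w powr (-s)" for s
  define h where "h s = \<Phi> s * D (s + of_real \<epsilon>)" for s
  obtain \<eta> where \<eta>: "\<eta> > 0" "\<And>a b. 0 < a \<Longrightarrow> a \<le> b \<Longrightarrow>
    \<exists>M\<ge>0. \<forall>\<sigma>\<in>{a..b}. \<forall>t. cmod (Gamma (Complex \<sigma> t) * w powr (- Complex \<sigma> t)) \<le> M * exp (- \<eta> * \<bar>t\<bar>)"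
    using Gamma_powr_line_bound[OF w] by blast
  from \<eta>(2)[of "1/2" "3/2"] obtain M where M: "M \<ge> 0"
    "\<And>\<sigma> t. \<sigma> \<in> {1/2..3/2} \<Longrightarrow> cmod (Gamma (Complex \<sigma> t) * w powr (- Complex \<sigma> t)) \<le> M * exp (- \<eta> * \<bar>t\<bar>)"
    by auto
  have \<Phi>_le: "cmod (\<Phi> s) \<le> M * exp (- \<eta> * \<bar>Im s\<bar>)" if "1/2 \<le> Re s" "Re s \<le> 3/2" for s
    using M(2)[of "Re s" "Im s"] that by (simp add: \<Phi>_def complex_surj)
  have D_int: "integrable lborel (\<lambda>t. \<Phi> (Complex (3/2) t))"
    unfolding \<Phi>_def by (rule mellin_inversion_exp(1)[OF w]) simp

  define T where "T n t = a (Suc n) * of_real (real (Suc n) powr (-\<epsilon>)) * (\<Phi> (Complex (3/2) t) * of_nat (Suc n) powr (- Complex (3/2) t))" for n t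
  have T_eq: "T n t = a (Suc n) * of_real (real (Suc n) powr (-\<epsilon>)) *
      (Gamma (Complex (3/2) t) * (of_nat (Suc n) * w) powr (- Complex (3/2) t))" for n t
  proof -
    have "(of_nat (Suc n) * w) powr (- Complex (3/2) t) = of_nat (Suc n) powr (- Complex (3/2) t) * w powr (- Complex (3/2) t)"
      by (rule powr_times_real_left) auto
    then show ?thesis by (simp only: T_def \<Phi>_def mult_ac)
  qed
  have Re_nw: "Re (of_nat (Suc n) * w) > 0" for n
    using w by (simp add: mult_pos_pos del: of_nat_Suc)
  have T_int: "integrable lborel (T n)" for n
    unfolding T_eq by (intro integrable_mult_right mellin_inversion_exp(1)[OF Re_nw]) simp
  have T_integral: "(\<integral>t. T n t \<partial>lborel) = 2 * pi * (a (Suc n) * of_real (real (Suc n) powr (-\<epsilon>)) * exp (- of_nat (Suc n) * w))" for n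
    unfolding T_eq using mellin_inversion_exp(2)[OF Re_nw, of "3/2" n] by (simp add: mult_ac del: of_nat_Suc)
  have norm_T: "norm (T n t) \<le> real (Suc n) powr (-3/2) * norm (\<Phi> (Complex (3/2) t))" for n t
  proof -
    have "norm (T n t) = cmod (a (Suc n)) * real (Suc n) powr (-\<epsilon>) * (norm (\<Phi> (Complex (3/2) t)) * real (Suc n) powr (-3/2))"
      using norm_powr_real_powr[of "of_nat (Suc n)" "- Complex (3/2) t"]
      by (simp add: T_def norm_mult del: of_nat_Suc)
    also have "\<dots> \<le> 1 * 1 * (norm (\<Phi> (Complex (3/2) t)) * real (Suc n) powr (-3/2))"
    proof -
      have "real (Suc n) powr (-\<epsilon>) \<le> real (Suc n) powr 0" using \<epsilon> by (intro powr_mono) auto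
      then show ?thesis using a by (intro mult_mono mult_nonneg_nonneg) auto
    qed
    finally show ?thesis by (simp add: mult.commute)
  qed
  have summ32: "summable (\<lambda>n. real (Suc n) powr (-3/2))"
    by (subst summable_Suc_iff) (simp add: summable_real_powr_iff)
  have summ_ae: "AE t in lborel. summable (\<lambda>n. norm (T n t))"
    by (intro AE_I2 summable_comparison_test'[OF summable_mult2[OF summ32]]) (use norm_T in auto)
  have summ_int: "summable (\<lambda>n. \<integral>t. norm (T n t) \<partial>lborel)"
  proof (rule summable_comparison_test'[OF summable_mult2[OF summ32], of 0])
    fix n
    have "(\<integral>t. norm (T n t) \<partial>lborel) \<le> (\<integral>t. real (Suc n) powr (-3/2) * norm (\<Phi> (Complex (3/2) t)) \<partial>lborel)"
      by (intro integral_mono norm_T integrable_norm T_int integrable_mult_right D_int)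
    then show "norm (\<integral>t. norm (T n t) \<partial>lborel) \<le> real (Suc n) powr (-3/2) * (\<integral>t. norm (\<Phi> (Complex (3/2) t)) \<partial>lborel)"
      by simp
  qed
  have T_sums: "(\<lambda>n. T n t) sums h (Complex (3/2) t)" for t
  proof -
    have "(\<lambda>n. a (Suc n) * of_nat (Suc n) powr (-(Complex (3/2) t + of_real \<epsilon>))) sums D (Complex (3/2) t + of_real \<epsilon>)"
      by (rule D_sums) (use \<epsilon> in simp)
    from sums_mult[OF this, of "\<Phi> (Complex (3/2) t)"]
    have "(\<lambda>n. \<Phi> (Complex (3/2) t) * (a (Suc n) * of_nat (Suc n) powr (-(Complex (3/2) t + of_real \<epsilon>)))) sums h (Complex (3/2) t)"
      by (simp only: h_def)
    moreover have "\<Phi> (Complex (3/2) t) * (a (Suc n) * of_nat (Suc n) powr (-(Complex (3/2) t + of_real \<epsilon>))) = T n t" for n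
    proof -
      have "complex_of_nat (Suc n) powr (-(Complex (3/2) t + of_real \<epsilon>)) = of_nat (Suc n) powr (- of_real \<epsilon>) * of_nat (Suc n) powr (- Complex (3/2) t)"
        unfolding minus_add_distrib powr_add by (rule mult.commute)
      moreover have "complex_of_nat (Suc n) powr (- of_real \<epsilon>) = of_real (real (Suc n) powr (-\<epsilon>))"
        using powr_of_real[of "real (Suc n)" "-\<epsilon>"] by simp
      ultimately show ?thesis by (simp only: T_def mult_ac)
    qed
    ultimately show ?thesis by simp
  qed
  define E where "E = (\<Sum>n. a (Suc n) * of_real (real (Suc n) powr (-\<epsilon>)) * exp (- of_nat (Suc n) * w))"
  have "(\<lambda>n. \<integral>t. T n t \<partial>lborel) sums (\<integral>t. (\<Sum>n. T n t) \<partial>lborel)"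
    by (rule sums_integral[OF T_int summ_ae summ_int])
  then have "(\<lambda>n. 2 * pi * (a (Suc n) * of_real (real (Suc n) powr (-\<epsilon>)) * exp (- of_nat (Suc n) * w))) sums (\<integral>t. h (Complex (3/2) t) \<partial>lborel)"
    unfolding T_integral sums_unique[OF T_sums, symmetric] .
  from sums_mult[OF this, of "1 / (2 * pi)"]
  have "E = (\<integral>t. h (Complex (3/2) t) \<partial>lborel) / (2 * pi)"
    unfolding E_def by (simp add: sums_iff)
  \<comment> \<open>The poles of Gamma have \<open>Re s \<le> 0\<close> and
    \<open>D (s + \<epsilon>)\<close> is holomorphic in the strip, so no residue appears. The
    constants of this estimate depend on \<open>w\<close>; they only justify the shift.\<close>
  also have "(\<integral>t. h (Complex (3/2) t) \<partial>lborel) = (\<integral>t. h (Complex (1/2) t) \<partial>lborel)"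
  proof (rule vertical_line_shift[symmetric])
    show "h holomorphic_on {s. Re s > 1/2 - \<epsilon>}"
      unfolding h_def \<Phi>_def
    proof (intro holomorphic_intros)
      show "{s. Re s > 1/2 - \<epsilon>} \<inter> \<int>\<^sub>\<le>\<^sub>0 = {}"
        using \<epsilon> by (auto elim!: nonpos_Ints_cases)
      have "(D \<circ> (\<lambda>s. s + of_real \<epsilon>)) holomorphic_on {s. Re s > 1/2 - \<epsilon>}"
        by (rule holomorphic_on_compose_gen[OF _ hol]) (auto intro!: holomorphic_intros)
      then show "(\<lambda>s. D (s + of_real \<epsilon>)) holomorphic_on {s. Re s > 1/2 - \<epsilon>}" by (simp add: comp_def)
    qed
    show "open {s. Re s > 1/2 - \<epsilon>}" by (rule open_halfspace_Re_gt)
    show "{s. 1/2 \<le> Re s \<and> Re s \<le> 3/2} \<subseteq> {s. Re s > 1/2 - \<epsilon>}" using \<epsilon> by auto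
    show "\<eta> / 2 > 0" using \<eta> by simp
    fix s assume s: "1/2 \<le> Re s" "Re s \<le> 3/2"
    have "cmod (D (s + of_real \<epsilon>)) \<le> A * (2 + \<bar>Im s\<bar>) powr \<epsilon>"
      using D_le[of "s + of_real \<epsilon>"] s by simp
    also have "\<dots> \<le> A * (\<eta> powr (-\<epsilon>) * exp (\<eta> * (2 + \<bar>Im s\<bar>) / 2))"
      using A \<epsilon> \<eta> by (intro mult_left_mono powr_le_exp_of_scale) auto
    finally have "cmod (h s) \<le> (M * exp (- \<eta> * \<bar>Im s\<bar>)) * (A * (\<eta> powr (-\<epsilon>) * exp (\<eta> * (2 + \<bar>Im s\<bar>) / 2)))"
      unfolding h_def norm_mult using \<Phi>_le[OF s] by (intro mult_mono) (use M in auto)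
    also have "\<dots> = M * A * \<eta> powr (-\<epsilon>) * (exp (- \<eta> * \<bar>Im s\<bar>) * exp (\<eta> * (2 + \<bar>Im s\<bar>) / 2))"
      by (simp only: mult_ac)
    also have "exp (- \<eta> * \<bar>Im s\<bar>) * exp (\<eta> * (2 + \<bar>Im s\<bar>) / 2) = exp \<eta> * exp (- (\<eta> / 2) * \<bar>Im s\<bar>)"
      unfolding exp_add[symmetric] by (rule arg_cong[of _ _ exp]) (simp add: field_simps)
    finally show "cmod (h s) \<le> (M * A * \<eta> powr (-\<epsilon>) * exp \<eta>) * exp (- (\<eta> / 2) * \<bar>Im s\<bar>)"
      by (simp only: mult.assoc)
  qed simp
  finally have E_eq: "E = (\<integral>t. h (Complex (1/2) t) \<partial>lborel) / (2 * pi)" .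

  define \<theta> where "\<theta> = \<bar>Im (Ln w)\<bar>"
  \<comment> \<open>Gamma decays at rate \<open>pi / 2\<close> and \<open>w powr (-s)\<close> grows
    at rate \<open>|Im (Ln w)|\<close>; \<open>\<delta>\<close> is the rate that remains. Half of it
    will absorb the power of \<open>t\<close> contributed by \<open>D\<close>.\<close>
  define \<delta> where "\<delta> = pi / 2 - \<theta>"
  have \<delta>: "\<delta> > 0" using Re_Ln_pos_lt[OF w0] w by (simp add: \<delta>_def \<theta>_def)
  have \<delta>2: "\<delta> \<le> 2" using pi_less_4 by (simp add: \<delta>_def \<theta>_def)
  \<comment> \<open>\<open>Re w / |w|\<close> is the cosine of the argument of \<open>w\<close>,
    that is \<open>sin \<delta>\<close>. This converts the powers of \<open>1 / \<delta>\<close>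
    into powers of \<open>|w| / Re w\<close>.\<close>
  have \<delta>_ge: "Re w / cmod w \<le> \<delta>"
  proof -
    have "w = exp (Ln w)" using w0 by simp
    also have "\<dots> = of_real (cmod w) * cis (Im (Ln w))"
      using w0 by (simp add: exp_eq_polar)
    finally have "Re w = Re (of_real (cmod w) * cis (Im (Ln w)))" by simp
    then have "Re w = cmod w * cos (Im (Ln w))" by simp
    also have "cos (Im (Ln w)) = cos \<theta>" by (simp add: \<theta>_def)
    also have "cos \<theta> = sin \<delta>" by (simp add: \<delta>_def sin_diff)
    finally have "Re w / cmod w = sin \<delta>" using w0 by simp
    also have "\<dots> \<le> \<delta>" using \<delta> by (simp add: sin_x_le_x)
    finally show ?thesis .
  qed
  have h_le: "norm (h (Complex (1/2) t)) \<le> (sqrt (2 * pi) * cmod w powr (-1/2) * A * \<delta> powr (-\<epsilon>) * exp 2) * exp (- (\<delta> / 2) * \<bar>t\<bar>)" for t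
  proof -
    have "t * Im (Ln w) \<le> \<bar>t\<bar> * \<theta>" unfolding \<theta>_def by (metis abs_ge_self abs_mult)
    then have p: "cmod (w powr (- Complex (1/2) t)) \<le> cmod w powr (-1/2) * exp (\<theta> * \<bar>t\<bar>)"
      unfolding norm_powr_minus[OF w0] by (intro mult_mono) (auto simp: mult.commute)
    have d: "cmod (D (Complex (1/2) t + of_real \<epsilon>)) \<le> A * (\<delta> powr (-\<epsilon>) * exp (\<delta> * (2 + \<bar>t\<bar>) / 2))"
    proof -
      have "cmod (D (Complex (1/2) t + of_real \<epsilon>)) \<le> A * (2 + \<bar>t\<bar>) powr \<epsilon>"
        using D_le[of "Complex (1/2) t + of_real \<epsilon>"] by simp
      also have "\<dots> \<le> A * (\<delta> powr (-\<epsilon>) * exp (\<delta> * (2 + \<bar>t\<bar>) / 2))"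
        using A \<epsilon> \<delta> by (intro mult_left_mono powr_le_exp_of_scale) auto
      finally show ?thesis .
    qed
    have "norm (h (Complex (1/2) t)) \<le> (sqrt (2 * pi) * exp (- pi * \<bar>t\<bar> / 2)) * (cmod w powr (-1/2) * exp (\<theta> * \<bar>t\<bar>))
        * (A * (\<delta> powr (-\<epsilon>) * exp (\<delta> * (2 + \<bar>t\<bar>) / 2)))"
      unfolding h_def \<Phi>_def norm_mult using A
      by (intro mult_mono norm_Gamma_half_le p d mult_nonneg_nonneg) auto
    also have "\<dots> = (sqrt (2 * pi) * cmod w powr (-1/2) * A * \<delta> powr (-\<epsilon>)) *
        (exp (- pi * \<bar>t\<bar> / 2) * exp (\<theta> * \<bar>t\<bar>) * exp (\<delta> * (2 + \<bar>t\<bar>) / 2))"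
      by (simp only: mult_ac)
    also have "exp (- pi * \<bar>t\<bar> / 2) * exp (\<theta> * \<bar>t\<bar>) * exp (\<delta> * (2 + \<bar>t\<bar>) / 2) = exp \<delta> * exp (- (\<delta> / 2) * \<bar>t\<bar>)"
      unfolding exp_add[symmetric] by (rule arg_cong[of _ _ exp]) (simp add: \<delta>_def field_simps)
    also have "\<dots> \<le> exp 2 * exp (- (\<delta> / 2) * \<bar>t\<bar>)" using \<delta>2 by simp
    finally show ?thesis using A by (simp add: mult_left_mono mult.assoc)
  qed
  have "norm (\<integral>t. h (Complex (1/2) t) \<partial>lborel)
      \<le> (\<integral>t. (sqrt (2 * pi) * cmod w powr (-1/2) * A * \<delta> powr (-\<epsilon>) * exp 2) * exp (- (\<delta> / 2) * \<bar>t\<bar>) \<partial>lborel)"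
    using \<delta> A by (intro order_trans[OF integral_norm_bound] integral_mono' h_le integrable_mult_right integrable_exp_minus_abs)
      auto
  also have "\<dots> = (sqrt (2 * pi) * cmod w powr (-1/2) * A * \<delta> powr (-\<epsilon>) * exp 2) * ((\<integral>t. exp (- \<bar>t::real\<bar>) \<partial>lborel) / (\<delta> / 2))"
    using \<delta> by (subst integral_mult_right_zero, subst integral_exp_minus_abs) auto
  also have "\<dots> = mellin_const * A * cmod w powr (-1/2) * (\<delta> powr (-\<epsilon>) / \<delta>)"
    by (simp add: mellin_const_def)
  also have "\<delta> powr (-\<epsilon>) / \<delta> = \<delta> powr (- (1 + \<epsilon>))"
  proof -
    have e: "- (1 + \<epsilon>) = - \<epsilon> - 1" by simp
    show ?thesis unfolding e powr_diff using \<delta> by simp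
  qed
  also have "mellin_const * A * cmod w powr (-1/2) * \<delta> powr (- (1 + \<epsilon>))
      \<le> mellin_const * A * cmod w powr (-1/2) * (Re w / cmod w) powr (- (1 + \<epsilon>))"
    using \<delta>_ge w w0 \<epsilon> A mellin_const_nonneg by (intro mult_left_mono powr_mono2') auto
  also have "(Re w / cmod w) powr (- (1 + \<epsilon>)) = cmod w powr (1 + \<epsilon>) / Re w powr (1 + \<epsilon>)"
    using w w0 by (simp only: powr_divide powr_minus) (simp add: field_simps)
  also have "mellin_const * A * cmod w powr (-1/2) * (cmod w powr (1 + \<epsilon>) / Re w powr (1 + \<epsilon>))
      = mellin_const * A * (cmod w powr (-1/2) * cmod w powr (1 + \<epsilon>)) / Re w powr (1 + \<epsilon>)"
    by simp
  also have "cmod w powr (-1/2) * cmod w powr (1 + \<epsilon>) = cmod w powr (1/2 + \<epsilon>)"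
    by (simp add: powr_add[symmetric])
  finally have "norm (\<integral>t. h (Complex (1/2) t) \<partial>lborel) \<le> mellin_const * A * cmod w powr (1/2 + \<epsilon>) / Re w powr (1 + \<epsilon>)" .
  moreover have "norm E \<le> norm (\<integral>t. h (Complex (1/2) t) \<partial>lborel)"
  proof -
    have "norm (\<integral>t. h (Complex (1/2) t) \<partial>lborel) / (2 * pi) \<le> norm (\<integral>t. h (Complex (1/2) t) \<partial>lborel) / 1"
      using pi_ge_two by (intro divide_left_mono) auto
    then show ?thesis by (simp add: E_eq norm_divide norm_mult)
  qed
  ultimately show ?thesis unfolding E_def by linarith
qed

section \<open>L-functions of Dirichlet characters\<close>

lemma norm_powr_diff_le:
  fixes n y :: real and s :: complex
  assumes "n > 0" "y \<ge> 0" "Re s \<ge> -1"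
  shows "cmod (of_real n powr (-s) - of_real (n + y) powr (-s)) \<le> cmod s * n powr (- Re s - 1) * y"
proof -
  have "norm (complex_of_real n powr (-s) - of_real (n + y) powr (-s)) \<le> (cmod s * n powr (- Re s - 1)) * norm (complex_of_real n - of_real (n + y))"
  proof (rule field_differentiable_bound)
    fix z assume "z \<in> closed_segment (complex_of_real n) (of_real (n + y))"
    then obtain x where x: "z = of_real x" "n \<le> x" "x \<le> n + y"
      using assms unfolding closed_segment_of_real by (auto simp: closed_segment_eq_real_ivl)
    then have "x > 0" using assms by linarith
    then have "z \<notin> \<real>\<^sub>\<le>\<^sub>0" using x by (auto simp: complex_nonpos_Reals_iff)
    then show "((\<lambda>z. z powr (-s)) has_field_derivative (-s) * z powr (-s - 1)) (at z within closed_segment (complex_of_real n) (of_real (n + y)))"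
      by (intro has_field_derivative_powr has_field_derivative_at_within)
    have "cmod ((-s) * z powr (-s - 1)) = cmod s * x powr (- Re s - 1)"
      using \<open>x > 0\<close> x by (simp add: norm_mult norm_powr_real_powr)
    also have "\<dots> \<le> cmod s * n powr (- Re s - 1)"
      using assms x by (intro mult_left_mono powr_mono2') auto
    finally show "cmod ((-s) * z powr (-s - 1)) \<le> cmod s * n powr (- Re s - 1)" .
  qed auto
  also have "complex_of_real n - of_real (n + y) = of_real (- y)" by simp
  finally show ?thesis using assms(2) by (simp only: norm_of_real) simp
qed

lemma summable_Suc_powr: "x < -1 \<Longrightarrow> summable (\<lambda>n. real (Suc n) powr x)"
  by (subst summable_Suc_iff) (simp add: summable_real_powr_iff)

text \<open>The exponent \<open>- Re s - 1\<close> is summable throughout \<open>Re s > 0\<close>.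
  On the disc of radius \<open>Re s / 2\<close> it stays below \<open>- 1 - Re s / 2\<close> while
  \<open>p\<close> is bounded by compactness, so the M-test applies locally. For
  \<open>Re s \<ge> 1/2\<close> the uniform majorant is the series for zeta(3/2).\<close>

lemma holomorphic_series_bounded_by_zeta:
  fixes f :: "nat \<Rightarrow> complex \<Rightarrow> complex" and p :: "complex \<Rightarrow> real"
  assumes hol: "\<And>n. f n holomorphic_on {s. Re s > 0}"
    and bound: "\<And>n s. Re s > 0 \<Longrightarrow> cmod (f n s) \<le> p s * real (Suc n) powr (- Re s - 1)"
    and p: "continuous_on UNIV p"
  shows "(\<lambda>s. \<Sum>n. f n s) holomorphic_on {s. Re s > 0}"
    and "\<And>s. Re s > 0 \<Longrightarrow> summable (\<lambda>n. f n s)"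
    and "\<And>s. Re s \<ge> 1/2 \<Longrightarrow> cmod (\<Sum>n. f n s) \<le> p s * (\<Sum>n. real (Suc n) powr (-3/2))"
proof -
  show "(\<lambda>s. \<Sum>n. f n s) holomorphic_on {s. Re s > 0}"
  proof (rule holomorphic_uniform_sequence[where f = "\<lambda>N s. \<Sum>n<N. f n s"])
    show "open {s. Re s > 0}" by (rule open_halfspace_Re_gt)
    show "(\<lambda>s. \<Sum>n<N. f n s) holomorphic_on {s. Re s > 0}" for N
      by (intro holomorphic_intros hol)
    fix s assume "s \<in> {s. Re s > 0}"
    then have s: "Re s > 0" by simp
    define d where "d = Re s / 2"
    have d: "d > 0" using s by (simp add: d_def)
    have Re_z: "Re z \<ge> d" if "z \<in> cball s d" for z
    proof -
      have "Re s - Re z \<le> d" using that complex_Re_le_cmod[of "s - z"] by (simp add: dist_norm)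
      then show ?thesis by (simp add: d_def field_simps)
    qed
    have "compact (p ` cball s d)"
      by (rule compact_continuous_image[OF continuous_on_subset[OF p subset_UNIV] compact_cball])
    from compact_imp_bounded[OF this] obtain P where "\<forall>x\<in>p ` cball s d. norm x \<le> P"
      unfolding bounded_iff by auto
    then have P: "\<And>z. z \<in> cball s d \<Longrightarrow> norm (p z) \<le> P" by simp
    have "uniform_limit (cball s d) (\<lambda>N z. \<Sum>n<N. f n z) (\<lambda>z. \<Sum>n. f n z) sequentially"
    proof (rule Weierstrass_m_test[where M = "\<lambda>n. P * real (Suc n) powr (- d - 1)"])
      fix n z assume z: "z \<in> cball s d"
      then have "Re z > 0" using Re_z[OF z] d by linarith
      then have "cmod (f n z) \<le> p z * real (Suc n) powr (- Re z - 1)" by (rule bound)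
      also have "\<dots> \<le> P * real (Suc n) powr (- d - 1)"
        using P[OF z] Re_z[OF z] by (intro mult_mono powr_mono) (auto intro: order_trans[OF norm_ge_zero])
      finally show "cmod (f n z) \<le> P * real (Suc n) powr (- d - 1)" .
    qed (use d in \<open>intro summable_mult summable_Suc_powr, simp\<close>)
    moreover have "cball s d \<subseteq> {s. Re s > 0}" using Re_z d by (auto intro: less_le_trans)
    ultimately show "\<exists>d>0. cball s d \<subseteq> {s. Re s > 0} \<and> uniform_limit (cball s d) (\<lambda>N z. \<Sum>n<N. f n z) (\<lambda>z. \<Sum>n. f n z) sequentially"
      using d by blast
  qed
  show summ: "summable (\<lambda>n. f n s)" if "Re s > 0" for s
    by (rule summable_comparison_test'[OF summable_mult[OF summable_Suc_powr], of "- Re s - 1" 0 _ "p s"])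
      (use that bound in auto)
  fix s assume s: "Re s \<ge> 1/2"
  have p0: "p s \<ge> 0"
    using order_trans[OF norm_ge_zero bound[of s 0]] s by simp
  have le: "cmod (f n s) \<le> p s * real (Suc n) powr (-3/2)" for n
  proof -
    have "cmod (f n s) \<le> p s * real (Suc n) powr (- Re s - 1)" by (rule bound) (use s in linarith)
    also have "\<dots> \<le> p s * real (Suc n) powr (-3/2)"
      using s p0 by (intro mult_left_mono powr_mono) auto
    finally show ?thesis .
  qed
  have sm: "summable (\<lambda>n. p s * real (Suc n) powr (-3/2))" by (intro summable_mult summable_Suc_powr) simp
  have "cmod (\<Sum>n. f n s) \<le> (\<Sum>n. p s * real (Suc n) powr (-3/2))"
    by (rule norm_suminf_le[OF le sm])
  also have "\<dots> = p s * (\<Sum>n. real (Suc n) powr (-3/2))"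
    by (rule suminf_mult) (intro summable_Suc_powr, simp)
  finally show "cmod (\<Sum>n. f n s) \<le> p s * (\<Sum>n. real (Suc n) powr (-3/2))" .
qed

definition zeta32 :: real where "zeta32 = (\<Sum>n. real (Suc n) powr (-3/2))"

lemma zeta32_nonneg: "zeta32 \<ge> 0"
  unfolding zeta32_def by (intro suminf_nonneg summable_Suc_powr) auto

text \<open>Abel summation continues a Dirichlet series with bounded coefficient sums to \<open>Re s > 0\<close>.\<close>

lemma bounded_partial_sums_continuation:
  fixes b :: "nat \<Rightarrow> complex" and B :: real
  assumes B: "\<And>n. cmod (\<Sum>j=1..n. b j) \<le> B"
  defines "R \<equiv> \<lambda>s. \<Sum>n. (\<Sum>j=1..Suc n. b j) * (of_nat (Suc n) powr (-s) - of_nat (Suc (Suc n)) powr (-s))"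
  shows "R holomorphic_on {s. Re s > 0}"
    and "\<And>s. Re s \<ge> 1/2 \<Longrightarrow> cmod (R s) \<le> B * cmod s * zeta32"
    and "\<And>s. Re s > 0 \<Longrightarrow> (\<lambda>n. b (Suc n) * of_nat (Suc n) powr (-s)) sums R s"
proof -
  define f where "f n s = (\<Sum>j=1..Suc n. b j) * (of_nat (Suc n) powr (-s) - of_nat (Suc (Suc n)) powr (-s))" for n s
  have R: "R = (\<lambda>s. \<Sum>n. f n s)" by (simp add: R_def f_def)
  have hol: "f n holomorphic_on {s. Re s > 0}" for n
    unfolding f_def by (intro holomorphic_intros)
  have le: "cmod (f n s) \<le> (B * cmod s) * real (Suc n) powr (- Re s - 1)" if "Re s > 0" for n s
  proof -
    have "cmod (of_nat (Suc n) powr (-s) - of_nat (Suc (Suc n)) powr (-s)) \<le> cmod s * real (Suc n) powr (- Re s - 1)"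
      using norm_powr_diff_le[of "real (Suc n)" 1 s] that by (simp add: add.commute)
    then show ?thesis
      unfolding f_def norm_mult mult.assoc
      by (rule mult_mono[OF B _ order_trans[OF norm_ge_zero B] norm_ge_zero])
  qed
  have cont: "continuous_on UNIV (\<lambda>s. B * cmod s)" by (intro continuous_intros)
  show "R holomorphic_on {s. Re s > 0}"
    unfolding R by (rule holomorphic_series_bounded_by_zeta(1)[OF hol _ cont]) (rule le)
  show "cmod (R s) \<le> B * cmod s * zeta32" if "Re s \<ge> 1/2" for s
    unfolding R zeta32_def
    by (rule holomorphic_series_bounded_by_zeta(3)[where p = "\<lambda>s. B * cmod s", OF hol _ cont that]) (rule le)
  fix s assume s: "Re s > 0"
  have eq: "(\<Sum>i<n. b (Suc i) * of_nat (Suc i) powr (-s)) = (\<Sum>j=1..n. b j) * of_nat (Suc n) powr (-s) + (\<Sum>i<n. f i s)" for n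
    by (induction n) (simp_all add: f_def algebra_simps)
  have "(\<lambda>n. (\<Sum>j=1..n. b j) * of_nat (Suc n) powr (-s)) \<longlonglongrightarrow> 0"
  proof (rule Lim_null_comparison[OF always_eventually])
    show "\<forall>n. cmod ((\<Sum>j=1..n. b j) * of_nat (Suc n) powr (-s)) \<le> B * real (Suc n) powr (- Re s)"
    proof
      fix n
      have "cmod (of_nat (Suc n) powr (-s)) = real (Suc n) powr (- Re s)"
        using norm_powr_real_powr[of "of_nat (Suc n)" "-s"] by simp
      then show "cmod ((\<Sum>j=1..n. b j) * of_nat (Suc n) powr (-s)) \<le> B * real (Suc n) powr (- Re s)"
        unfolding norm_mult using B[of n] by (simp add: mult_right_mono del: of_nat_Suc)
    qed
    have "(\<lambda>n. real n powr (- Re s)) \<longlonglongrightarrow> 0"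
      using s by (intro tendsto_neg_powr filterlim_real_sequentially) auto
    then show "(\<lambda>n. B * real (Suc n) powr (- Re s)) \<longlonglongrightarrow> 0"
      by (intro tendsto_mult_right_zero LIMSEQ_Suc)
  qed
  moreover have "(\<lambda>n. \<Sum>i<n. f i s) \<longlonglongrightarrow> R s"
    unfolding R
    by (rule summable_LIMSEQ, rule holomorphic_series_bounded_by_zeta(2)[where p = "\<lambda>s. B * cmod s", OF hol _ cont s]) (rule le)
  ultimately show "(\<lambda>n. b (Suc n) * of_nat (Suc n) powr (-s)) sums R s"
    unfolding sums_def eq using tendsto_add by fastforce
qed

text \<open>The function \<open>(s - 1) \<zeta>(s)\<close>.\<close>

definition zeta_num :: "complex \<Rightarrow> complex" where
  "zeta_num s = 1 + (\<Sum>n. (s - 1) * of_nat (Suc n) powr (-s) - of_nat (Suc n) powr (1 - s) + of_nat (Suc (Suc n)) powr (1 - s))"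

text \<open>Each summand is \<open>s - 1\<close> times the difference of \<open>n powr (-s)\<close>
  and the integral of \<open>x powr (-s)\<close> over the unit interval from \<open>n\<close> to
  \<open>n + 1\<close>, hence smaller by a factor of order \<open>|s| / n\<close>. For
  \<open>Re s > 1\<close> the remaining differences telescope and cancel the leading 1.\<close>

lemma zeta_num:
  shows "zeta_num holomorphic_on {s. Re s > 0}"
    and "\<And>s. Re s \<ge> 1/2 \<Longrightarrow> cmod (zeta_num s) \<le> 1 + cmod (s - 1) * cmod s * zeta32"
    and "\<And>s. Re s > 1 \<Longrightarrow> (\<lambda>n. of_nat (Suc n) powr (-s)) sums (zeta_num s / (s - 1))"
    and "zeta_num 1 = 1"
proof -
  define f where "f n s = (s - 1) * of_nat (Suc n) powr (-s) - of_nat (Suc n) powr (1 - s) + of_nat (Suc (Suc n)) powr (1 - s)" for n and s :: complex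
  have Z: "zeta_num = (\<lambda>s. 1 + (\<Sum>n. f n s))" unfolding zeta_num_def f_def ..
  have hol: "f n holomorphic_on {s. Re s > 0}" for n
    unfolding f_def by (intro holomorphic_intros)
  have le: "cmod (f n s) \<le> (cmod (s - 1) * cmod s) * real (Suc n) powr (- Re s - 1)" if s: "Re s > 0" for n s
  proof -
    define m where "m = real (Suc n)"
    have m: "m > 0" by (simp add: m_def)
    \<comment> \<open>\<open>\<psi>\<close> interpolates the summand along the unit segment,
      \<open>\<psi> 1 - \<psi> 0 = f n s\<close>. Its derivative is \<open>s - 1\<close> times a
      difference of two nearby powers, which is already small.\<close>
    define \<psi> where "\<psi> z = (s - 1) * of_real m powr (-s) * z + (of_real m + z) powr (1 - s)" for z :: complex
    have "norm (\<psi> 1 - \<psi> 0) \<le> (cmod (s - 1) * cmod s * m powr (- Re s - 1)) * norm (1 - 0 :: complex)"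
    proof (rule field_differentiable_bound[where S = "closed_segment 0 1"])
      fix z :: complex assume "z \<in> closed_segment 0 1"
      then obtain x where x: "z = of_real x" "0 \<le> x" "x \<le> 1"
        using closed_segment_of_real[of 0 1, where 'a = complex] by (auto simp: closed_segment_eq_real_ivl)
      have mz: "of_real m + z = of_real (m + x)" by (simp add: x)
      have "of_real m + z \<notin> \<real>\<^sub>\<le>\<^sub>0" unfolding mz using m x by (auto simp: complex_nonpos_Reals_iff simp del: of_real_add)
      then show "(\<psi> has_field_derivative ((s - 1) * of_real m powr (-s) + (1 - s) * (of_real m + z) powr (-s))) (at z within closed_segment 0 1)"
        unfolding \<psi>_def by (auto intro!: derivative_eq_intros)
      have "cmod ((s - 1) * of_real m powr (-s) + (1 - s) * (of_real m + z) powr (-s))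
          = cmod (s - 1) * cmod (of_real m powr (-s) - of_real (m + x) powr (-s))"
        unfolding mz norm_mult[symmetric] by (simp add: algebra_simps)
      also have "\<dots> \<le> cmod (s - 1) * (cmod s * m powr (- Re s - 1) * x)"
        using s m x by (intro mult_left_mono norm_powr_diff_le) auto
      also have "\<dots> \<le> cmod (s - 1) * (cmod s * m powr (- Re s - 1) * 1)"
        using x by (intro mult_left_mono) auto
      finally show "cmod ((s - 1) * of_real m powr (-s) + (1 - s) * (of_real m + z) powr (-s)) \<le> cmod (s - 1) * cmod s * m powr (- Re s - 1)"
        by (simp add: mult.assoc)
    qed auto
    moreover have "\<psi> 1 - \<psi> 0 = f n s" by (simp add: \<psi>_def f_def m_def add_ac)
    ultimately show ?thesis by (simp add: m_def)
  qed
  have cont: "continuous_on UNIV (\<lambda>s. cmod (s - 1) * cmod s)" by (intro continuous_intros)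
  note * = holomorphic_series_bounded_by_zeta[where f = f and p = "\<lambda>s. cmod (s - 1) * cmod s", OF hol _ cont]
  have "(\<lambda>s. \<Sum>n. f n s) holomorphic_on {s. Re s > 0}" by (rule *(1)) (rule le)
  then show "zeta_num holomorphic_on {s. Re s > 0}" unfolding Z by (intro holomorphic_intros)
  show "cmod (zeta_num s) \<le> 1 + cmod (s - 1) * cmod s * zeta32" if "Re s \<ge> 1/2" for s
  proof -
    have "cmod (\<Sum>n. f n s) \<le> cmod (s - 1) * cmod s * zeta32"
      unfolding zeta32_def by (rule *(3)[OF _ that]) (rule le)
    then show ?thesis unfolding Z using norm_triangle_ineq[of 1 "\<Sum>n. f n s"] by (simp only: norm_one)
  qed
  show "zeta_num 1 = 1" by (simp add: zeta_num_def del: of_nat_Suc)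
  fix s :: complex assume s: "Re s > 1"
  have eq: "(\<Sum>i<n. of_nat (Suc i) powr (-s)) = (1 + (\<Sum>i<n. f i s) - of_nat (Suc n) powr (1 - s)) / (s - 1)" for n
  proof -
    have "s \<noteq> 1" using s by auto
    moreover have "(s - 1) * (\<Sum>i<n. of_nat (Suc i) powr (-s)) = 1 + (\<Sum>i<n. f i s) - of_nat (Suc n) powr (1 - s)"
      by (induction n) (simp_all add: f_def algebra_simps)
    ultimately show ?thesis by (simp add: field_simps)
  qed
  have "(\<lambda>n. of_nat (Suc n) powr (1 - s)) \<longlonglongrightarrow> 0"
  proof (rule tendsto_norm_zero_cancel)
    have "cmod (of_nat (Suc n) powr (1 - s)) = real (Suc n) powr (- (Re s - 1))" for n
      using norm_powr_real_powr[of "of_nat (Suc n)" "1 - s"] by simp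
    moreover have "(\<lambda>n. real (Suc n) powr (- (Re s - 1))) \<longlonglongrightarrow> 0"
      using s by (intro LIMSEQ_Suc[of "\<lambda>n. real n powr (- (Re s - 1))"] tendsto_neg_powr filterlim_real_sequentially) auto
    ultimately show "(\<lambda>n. cmod (of_nat (Suc n) powr (1 - s))) \<longlonglongrightarrow> 0" by simp
  qed
  moreover have "(\<lambda>n. \<Sum>i<n. f i s) \<longlonglongrightarrow> (\<Sum>n. f n s)"
  proof (rule summable_LIMSEQ, rule *(2))
    show "Re s > 0" using s by linarith
  qed (rule le)
  ultimately have "(\<lambda>n. (1 + (\<Sum>i<n. f i s) - of_nat (Suc n) powr (1 - s)) / (s - 1)) \<longlonglongrightarrow> (1 + (\<Sum>n. f n s) - 0) / (s - 1)"
    using s by (intro tendsto_intros) auto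
  then show "(\<lambda>n. of_nat (Suc n) powr (-s)) sums (zeta_num s / (s - 1))"
    unfolding sums_def eq Z by simp
qed

section \<open>Dirichlet convolution, Moebius inversion and Euler products\<close>

lemma
  fixes f :: "nat \<Rightarrow> complex"
  assumes "summable (\<lambda>n. norm (f (Suc n)))"
  shows abs_summable_on_pos: "(\<lambda>n. norm (f n)) summable_on {0<..}"
    and infsum_pos_eq_suminf: "infsum f {0<..} = (\<Sum>n. f (Suc n))"
proof -
  have img: "{0<..} = range Suc" by (auto simp: image_iff gr0_conv_Suc)
  have inj: "inj Suc" by simp
  have "(\<lambda>n. norm (f (Suc n))) summable_on UNIV"
    by (rule norm_summable_imp_summable_on) (use assms in simp)
  then show "(\<lambda>n. norm (f n)) summable_on {0<..}"
    unfolding img by (subst summable_on_reindex[OF inj]) (simp add: comp_def)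
  have "((\<lambda>n. f (Suc n)) has_sum (\<Sum>n. f (Suc n))) UNIV"
    by (rule norm_summable_imp_has_sum[OF assms]) (use summable_norm_cancel[OF assms] in \<open>rule summable_sums\<close>)
  then have "infsum (\<lambda>n. f (Suc n)) UNIV = (\<Sum>n. f (Suc n))" by (rule infsumI)
  then show "infsum f {0<..} = (\<Sum>n. f (Suc n))"
    unfolding img by (subst infsum_reindex[OF inj]) (simp add: comp_def)
qed

text \<open>Sending a number \<open>n\<close> with a divisor \<open>d\<close> to
  \<open>(d, n div d)\<close> is a bijection onto all pairs of positive integers; absolute
  summability allows the regrouping.\<close>

lemma infsum_divisor_swap:
  fixes F :: "nat \<times> nat \<Rightarrow> complex"
  assumes "(\<lambda>p. norm (F p)) summable_on {0<..} \<times> {0<..}"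
  shows "(\<Sum>\<^sub>\<infinity>n\<in>{0<..}. \<Sum>d | d dvd n. F (d, n div d)) = (\<Sum>\<^sub>\<infinity>d\<in>{0<..}. \<Sum>\<^sub>\<infinity>m\<in>{0<..}. F (d, m))"
    and "(\<lambda>n. \<Sum>d | d dvd n. F (d, n div d)) summable_on {0<..}"
proof -
  define S where "S = Sigma {0<..} (\<lambda>n::nat. {d. d dvd n})"
  define j where "j = (\<lambda>(n::nat, d). (d, n div d))"
  have bij: "bij_betw j S ({0<..} \<times> {0<..})"
    by (rule bij_betw_byWitness[where f' = "\<lambda>(d, m). (d * m, d)"])
      (auto simp: S_def j_def dvd_pos_nat intro!: Nat.gr0I)
  have summ: "F summable_on {0<..} \<times> {0<..}" using assms by (rule abs_summable_summable)
  then have summ': "(\<lambda>p. F (j p)) summable_on S"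
    using summable_on_reindex_bij_betw[OF bij, of F] by simp
  have inner: "(\<Sum>\<^sub>\<infinity>d\<in>{d. d dvd n}. F (j (n, d))) = (\<Sum>d | d dvd n. F (d, n div d))" if "n \<in> {0<..}" for n
    using that by (subst infsum_finite) (auto simp: j_def)
  have "(\<Sum>\<^sub>\<infinity>n\<in>{0<..}. \<Sum>d | d dvd n. F (d, n div d)) = (\<Sum>\<^sub>\<infinity>n\<in>{0<..}. \<Sum>\<^sub>\<infinity>d\<in>{d. d dvd n}. F (j (n, d)))"
    by (rule infsum_cong) (simp only: inner)
  also have "\<dots> = infsum (\<lambda>p. F (j p)) S"
    unfolding S_def by (rule infsum_Sigma_banach[where f = "\<lambda>p. F (j p)"]) (use summ' in \<open>simp add: S_def\<close>)
  also have "\<dots> = infsum F ({0<..} \<times> {0<..})" by (rule infsum_reindex_bij_betw[OF bij])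
  also have "\<dots> = (\<Sum>\<^sub>\<infinity>d\<in>{0<..}. \<Sum>\<^sub>\<infinity>m\<in>{0<..}. F (d, m))"
    by (rule infsum_Sigma_banach[symmetric]) (rule summ)
  finally show "(\<Sum>\<^sub>\<infinity>n\<in>{0<..}. \<Sum>d | d dvd n. F (d, n div d)) = (\<Sum>\<^sub>\<infinity>d\<in>{0<..}. \<Sum>\<^sub>\<infinity>m\<in>{0<..}. F (d, m))" .
  have "(\<lambda>n. \<Sum>\<^sub>\<infinity>d\<in>{d. d dvd n}. F (j (n, d))) summable_on {0<..}"
    by (rule summable_on_Sigma_banach) (use summ' in \<open>simp add: S_def case_prod_unfold\<close>)
  then show "(\<lambda>n. \<Sum>d | d dvd n. F (d, n div d)) summable_on {0<..}"
    by (rule summable_on_cong[THEN iffD1, rotated]) (rule inner)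
qed

lemma norm_product_summable_on:
  fixes f g :: "'a \<Rightarrow> 'b::real_normed_div_algebra"
  assumes "(\<lambda>x. norm (f x)) summable_on A" "(\<lambda>y. norm (g y)) summable_on B"
  shows "(\<lambda>p. norm (f (fst p) * g (snd p))) summable_on A \<times> B"
proof (rule summable_on_SigmaI)
  fix x assume "x \<in> A"
  show "((\<lambda>y. norm (f (fst (x, y)) * g (snd (x, y)))) has_sum norm (f x) * (\<Sum>\<^sub>\<infinity>y\<in>B. norm (g y))) B"
    using has_sum_cmult_right[OF has_sum_infsum[OF assms(2)], of "norm (f x)"] by (simp add: norm_mult)
qed (use assms(1) in \<open>auto intro: summable_on_cmult_left\<close>)

text \<open>Complete multiplicativity gives \<open>f d * f (n div d) = f n\<close>, so the
  convolution reduces to \<open>f n\<close> times the divisor sum of \<open>moebius_mu\<close>,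
  which vanishes for \<open>n > 1\<close>.\<close>

lemma moebius_inverse_series:
  fixes f :: "nat \<Rightarrow> complex"
  assumes mult: "\<And>m n. f (m * n) = f m * f n" and f1: "f (Suc 0) = 1"
    and summ: "summable (\<lambda>n. norm (f (Suc n)))"
  shows "(\<Sum>n. f (Suc n)) * (\<Sum>n. of_int (moebius_mu (Suc n)) * f (Suc n)) = 1"
    and "summable (\<lambda>n. norm (of_int (moebius_mu (Suc n)) * f (Suc n)))"
proof -
  define g where "g n = of_int (moebius_mu n) * f n" for n
  have g_le: "norm (g n) \<le> norm (f n)" for n
  proof -
    have "norm (of_int (moebius_mu n) :: complex) \<le> 1" using abs_moebius_mu_le[of n] by simp
    then show ?thesis unfolding g_def norm_mult by (simp add: mult_left_le_one_le)
  qed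
  have summ_g: "summable (\<lambda>n. norm (g (Suc n)))"
    by (rule summable_comparison_test'[OF summ, of 0]) (use g_le in simp)
  then show "summable (\<lambda>n. norm (of_int (moebius_mu (Suc n)) * f (Suc n)))" by (simp add: g_def)
  have abs: "(\<lambda>p. norm (case p of (d, m) \<Rightarrow> g d * f m)) summable_on {0<..} \<times> {0<..}"
    using norm_product_summable_on[OF abs_summable_on_pos[OF summ_g] abs_summable_on_pos[OF summ]]
    by (simp add: case_prod_unfold)
  have "(\<Sum>n. g (Suc n)) * (\<Sum>n. f (Suc n)) = infsum g {0<..} * infsum f {0<..}"
    using infsum_pos_eq_suminf[OF summ] infsum_pos_eq_suminf[OF summ_g] by simp
  also have "\<dots> = (\<Sum>\<^sub>\<infinity>d\<in>{0<..}. \<Sum>\<^sub>\<infinity>m\<in>{0<..}. g d * f m)"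
    by (simp add: infsum_cmult_left' infsum_cmult_right')
  also have "\<dots> = (\<Sum>\<^sub>\<infinity>n\<in>{0<..}. \<Sum>d | d dvd n. g d * f (n div d))"
    using infsum_divisor_swap(1)[OF abs] by simp
  also have "\<dots> = (\<Sum>\<^sub>\<infinity>n\<in>{0<..}. if n = (1::nat) then 1 else 0)"
  proof (rule infsum_cong)
    fix n :: nat assume n: "n \<in> {0<..}"
    have "(\<Sum>d | d dvd n. g d * f (n div d)) = (\<Sum>d | d dvd n. of_int (moebius_mu d) * f n)"
    proof (rule sum.cong[OF refl])
      fix d assume "d \<in> {d. d dvd n}"
      then have "f n = f d * f (n div d)" by (metis mem_Collect_eq dvd_mult_div_cancel mult)
      then show "g d * f (n div d) = of_int (moebius_mu d) * f n" by (simp add: g_def)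
    qed
    also have "\<dots> = of_int (\<Sum>d | d dvd n. moebius_mu d) * f n" by (simp add: sum_distrib_right)
    also have "\<dots> = (if n = 1 then 1 else 0)"
      using n f1 by (subst sum_moebius_mu_divisors) auto
    finally show "(\<Sum>d | d dvd n. g d * f (n div d)) = (if n = 1 then 1 else 0)" .
  qed
  also have "\<dots> = infsum (\<lambda>_. 1) {1::nat}"
    by (rule infsum_cong_neutral) auto
  also have "\<dots> = 1" by simp
  finally show "(\<Sum>n. f (Suc n)) * (\<Sum>n. of_int (moebius_mu (Suc n)) * f (Suc n)) = 1"
    by (simp add: g_def mult.commute)
qed

text \<open>Multiplying by \<open>1 - f p\<close> removes the multiples of \<open>p\<close> from the sum.\<close>

lemma euler_product_sieve:
  fixes f :: "nat \<Rightarrow> complex"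
  assumes mult: "\<And>m n. f (m * n) = f m * f n"
    and abs: "(\<lambda>n. norm (f n)) summable_on {0<..}" and P: "finite P" "\<And>p. p \<in> P \<Longrightarrow> prime p"
  shows "infsum f {0<..} * (\<Prod>p\<in>P. 1 - f p) = infsum f {n. n > 0 \<and> (\<forall>p\<in>P. \<not> p dvd n)}"
  using P
proof (induction P rule: finite_induct)
  case empty
  have "{n::nat. n > 0} = {0<..}" by auto
  then show ?case by simp
next
  case (insert p P)
  define U where "U = {n. n > 0 \<and> (\<forall>p\<in>P. \<not> p dvd n)}"
  have p: "prime p" using insert.prems by simp
  have U_sub: "U \<subseteq> {0<..}" by (auto simp: U_def)
  have summ: "f summable_on V" if "V \<subseteq> {0<..}" for V
    by (rule summable_on_subset_banach[OF abs_summable_summable[OF abs] that])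
  have U_p: "p * n \<in> U \<longleftrightarrow> n \<in> U" for n
  proof -
    have "r dvd p * n \<longleftrightarrow> r dvd n" if "r \<in> P" for r
    proof -
      have "prime r" using insert.prems that by simp
      moreover have "\<not> r dvd p" using primes_dvd_imp_eq[OF \<open>prime r\<close> p] insert.hyps(2) that by auto
      ultimately show ?thesis by (simp add: prime_dvd_mult_iff)
    qed
    then show ?thesis using prime_gt_0_nat[OF p] by (auto simp: U_def)
  qed
  define V where "V = {n \<in> U. p dvd n}"
  have V_eq: "V = (\<lambda>n. p * n) ` U"
    using U_p by (auto simp: V_def elim!: dvdE)
  have "inj_on (\<lambda>n. p * n) U" using prime_gt_0_nat[OF p] by (auto simp: inj_on_def)
  then have "infsum f V = infsum (\<lambda>n. f p * f n) U"
    unfolding V_eq by (subst infsum_reindex) (auto simp: comp_def mult)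
  also have "\<dots> = f p * infsum f U" by (rule infsum_cmult_right')
  finally have V: "infsum f V = f p * infsum f U" .
  have "U = V \<union> (U - V)" by (auto simp: V_def)
  moreover have "infsum f (V \<union> (U - V)) = infsum f V + infsum f (U - V)"
    using U_sub by (intro infsum_Un_disjoint summ) (auto simp: V_def)
  ultimately have "infsum f U = infsum f V + infsum f (U - V)" by simp
  moreover have "U - V = {n. n > 0 \<and> (\<forall>r\<in>insert p P. \<not> r dvd n)}" by (auto simp: U_def V_def)
  moreover have "infsum f {0<..} * (\<Prod>r\<in>P. 1 - f r) = infsum f U"
    unfolding U_def by (rule insert.IH) (use insert.prems in simp)
  ultimately show ?case using insert.hyps V by (simp add: algebra_simps)
qed

text \<open>What the sieve leaves besides 1 are numbers without prime factors up to
  \<open>N\<close>; these exceed \<open>N\<close>, so the error is bounded by a tail of the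
  absolutely convergent series. In this form no infinite product occurs.\<close>

lemma euler_product_tendsto:
  fixes f :: "nat \<Rightarrow> complex"
  assumes mult: "\<And>m n. f (m * n) = f m * f n" and f1: "f (Suc 0) = 1"
    and summ: "summable (\<lambda>n. norm (f (Suc n)))"
  shows "(\<lambda>N. (\<Sum>n. f (Suc n)) * (\<Prod>p | prime p \<and> p \<le> N. 1 - f p)) \<longlonglongrightarrow> 1"
proof (rule LIM_zero_cancel, rule Lim_null_comparison[OF always_eventually])
  show "\<forall>N. norm ((\<Sum>n. f (Suc n)) * (\<Prod>p | prime p \<and> p \<le> N. 1 - f p) - 1) \<le> (\<Sum>n. norm (f (Suc (n + N))))"
  proof
    fix N
    define U where "U = {n::nat. n > 0 \<and> (\<forall>p\<in>{p. prime p \<and> p \<le> N}. \<not> p dvd n)}"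
    define g where "g n = (if n \<in> U \<and> n \<noteq> 1 then f n else 0)" for n
    have abs: "(\<lambda>n. norm (f n)) summable_on {0<..}" by (rule abs_summable_on_pos[OF summ])
    have fin: "finite {p. prime p \<and> p \<le> N}" by simp
    have g_le: "norm (g n) \<le> norm (f n)" for n by (simp add: g_def)
    have g_summ: "summable (\<lambda>n. norm (g (Suc n)))"
      by (rule summable_comparison_test'[OF summ, of 0]) (use g_le in simp)
    have g_0: "g (Suc n) = 0" if "n < N" for n
    proof (cases "n = 0")
      case False
      then obtain p where "prime p" "p dvd Suc n" using prime_factor_nat[of "Suc n"] by auto
      moreover from this have "p \<le> N" using that dvd_imp_le[of p "Suc n"] by simp
      ultimately show ?thesis by (auto simp: g_def U_def)
    qed (simp add: g_def)
    have "(\<Sum>n. f (Suc n)) * (\<Prod>p | prime p \<and> p \<le> N. 1 - f p) = infsum f U"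
      unfolding infsum_pos_eq_suminf[OF summ, symmetric] U_def
      by (rule euler_product_sieve[OF mult abs fin]) simp
    also have "U = {1} \<union> (U - {1})" by (auto simp: U_def dest: not_prime_unit)
    also have "infsum f \<dots> = f 1 + infsum f (U - {1})"
    proof (subst infsum_Un_disjoint)
      have "U \<subseteq> {0<..}" by (auto simp: U_def)
      then show "f summable_on U - {1}"
        by (intro summable_on_subset_banach[OF abs_summable_summable[OF abs]]) auto
    qed auto
    also have "infsum f (U - {1}) = infsum g {0<..}"
      by (rule infsum_cong_neutral) (auto simp: g_def U_def)
    also have "infsum g {0<..} = (\<Sum>n. g (Suc n))" by (rule infsum_pos_eq_suminf[OF g_summ])
    finally have "(\<Sum>n. f (Suc n)) * (\<Prod>p | prime p \<and> p \<le> N. 1 - f p) - 1 = (\<Sum>n. g (Suc n))"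
      using f1 by simp
    also have "(\<Sum>n. g (Suc n)) = (\<Sum>n. g (Suc (n + N)))"
      using suminf_split_initial_segment[OF summable_norm_cancel[OF g_summ], of N] g_0 by simp
    also have "norm \<dots> \<le> (\<Sum>n. norm (f (Suc (n + N))))"
      by (rule norm_suminf_le[OF g_le]) (use summable_ignore_initial_segment[OF summ, of N] in simp)
    finally show "norm ((\<Sum>n. f (Suc n)) * (\<Prod>p | prime p \<and> p \<le> N. 1 - f p) - 1) \<le> (\<Sum>n. norm (f (Suc (n + N))))" .
  qed
  show "(\<lambda>N. \<Sum>n. norm (f (Suc (n + N)))) \<longlonglongrightarrow> 0"
    by (rule suminf_exist_split2[OF summ])
qed

text \<open>In the logarithmic series the coefficient at \<open>r ^ n / n\<close> is
  \<open>-(3 + 4 * c + Re ((z\<^sup>2) ^ n))\<close> with \<open>c = Re (z ^ n)\<close>. As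
  \<open>z\<close> lies on the unit circle, the bracket equals
  \<open>2 * (1 + c)\<^sup>2\<close>.\<close>

lemma three_four_one_factor:
  fixes r :: real and z :: complex
  assumes "0 \<le> r" "r < 1" "cmod z = 1"
  shows "cmod (1 - of_real r) ^ 3 * cmod (1 - of_real r * z) ^ 4 * cmod (1 - of_real r * z\<^sup>2) \<le> 1"
proof -
  have ln_sums: "(\<lambda>n. - (r ^ n / n) * Re (u ^ n)) sums ln (cmod (1 - of_real r * u))" if u: "cmod u = 1" for u
  proof -
    have ru: "cmod (- (of_real r * u)) < 1" using assms u by (simp add: norm_mult)
    from sums_Re[OF Ln_series'[OF this]]
    have "(\<lambda>n. Re (- ((of_real r * u) ^ n) / of_nat n)) sums Re (Ln (1 - of_real r * u))"
      by (simp only: minus_minus add_uminus_conv_diff)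
    moreover have "Re (- ((of_real r * u) ^ n) / of_nat n) = - (r ^ n / n) * Re (u ^ n)" for n
    proof -
      have "- ((of_real r * u) ^ n) / of_nat n = of_real (- (r ^ n / n)) * u ^ n"
        by (simp add: power_mult_distrib)
      then show ?thesis by (simp only: Re_complex_of_real Im_complex_of_real times_complex.sel)
    qed
    moreover have "1 - of_real r * u \<noteq> 0" using ru by auto
    ultimately show ?thesis by (simp only: Re_Ln simp_thms)
  qed
  have z2: "cmod (z\<^sup>2) = 1" using assms by (simp add: norm_power)
  define S where "S = 3 * ln (cmod (1 - of_real r * 1)) + 4 * ln (cmod (1 - of_real r * z)) + ln (cmod (1 - of_real r * z\<^sup>2))"
  have "(\<lambda>n. 3 * (- (r ^ n / n) * Re (1 ^ n)) + 4 * (- (r ^ n / n) * Re (z ^ n)) + - (r ^ n / n) * Re ((z\<^sup>2) ^ n)) sums S"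
    unfolding S_def by (intro sums_add sums_mult ln_sums assms z2) simp
  moreover have "3 * (- (r ^ n / n) * Re (1 ^ n)) + 4 * (- (r ^ n / n) * Re (z ^ n)) + - (r ^ n / n) * Re ((z\<^sup>2) ^ n) \<le> 0" for n
  proof -
    define c where "c = Re (z ^ n)"
    have "(cmod (z ^ n))\<^sup>2 = 1" using assms by (simp add: norm_power)
    then have "(Re (z ^ n))\<^sup>2 + (Im (z ^ n))\<^sup>2 = 1" by (simp add: cmod_power2)
    moreover have "(z\<^sup>2) ^ n = (z ^ n)\<^sup>2" unfolding power_mult[symmetric] by (simp only: mult.commute)
    then have "Re ((z\<^sup>2) ^ n) = (Re (z ^ n))\<^sup>2 - (Im (z ^ n))\<^sup>2" by (simp only: Re_power2)
    ultimately have Re_z2: "Re ((z\<^sup>2) ^ n) = 2 * c\<^sup>2 - 1" unfolding c_def by linarith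
    have "3 * (- (r ^ n / n) * Re (1 ^ n)) + 4 * (- (r ^ n / n) * Re (z ^ n)) + - (r ^ n / n) * Re ((z\<^sup>2) ^ n)
        = - (r ^ n / n) * (2 * (1 + c)\<^sup>2)"
      unfolding Re_z2 c_def[symmetric] by (simp add: power2_eq_square algebra_simps)
    also have "\<dots> \<le> 0" 
    proof -
      have "0 \<le> (r ^ n / n) * (2 * (1 + c)\<^sup>2)" using assms by (intro mult_nonneg_nonneg divide_nonneg_nonneg) auto
      then show ?thesis by simp
    qed
    finally show ?thesis .
  qed
  ultimately have "S \<le> 0" by (intro sums_le[OF _ _ sums_zero, of _ S])
  moreover have pos: "cmod (1 - of_real r * u) > 0" if "cmod u = 1" for u
  proof -
    have "cmod (of_real r * u) < 1" using assms that by (simp add: norm_mult)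
    then show ?thesis by auto
  qed
  have "exp S = cmod (1 - of_real r * 1) ^ 3 * cmod (1 - of_real r * z) ^ 4 * cmod (1 - of_real r * z\<^sup>2)"
  proof -
    have "exp (3 * x) = exp x ^ 3" "exp (4 * x) = exp x ^ 4" for x :: real
      using exp_of_nat_mult[of 3 x] exp_of_nat_mult[of 4 x] by simp_all
    then show ?thesis unfolding S_def exp_add using pos[of 1] pos[OF assms(3)] pos[OF z2] by simp
  qed
  moreover have "exp S \<le> 1" using \<open>S \<le> 0\<close> by simp
  ultimately show ?thesis by simp
qed

section \<open>The L-function as a multiple of zeta plus a holomorphic rest\<close>

definition char_mean :: "nat \<Rightarrow> (nat \<Rightarrow> complex) \<Rightarrow> complex" where
  "char_mean q chi = (\<Sum>j=1..q. chi j) / of_nat q"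

text \<open>The Abel-summed Dirichlet series of \<open>chi\<close> minus its mean over a period.
  Subtracting the mean makes the coefficient sums bounded, and the mean itself contributes a
  multiple of zeta that carries the possible pole. Principal and other characters thus share one
  formula, with bounds linear in \<open>q\<close>.\<close>

definition char_rest :: "nat \<Rightarrow> (nat \<Rightarrow> complex) \<Rightarrow> complex \<Rightarrow> complex" where
  "char_rest q chi s = (\<Sum>n. (\<Sum>j=1..Suc n. chi j - char_mean q chi) *
     (of_nat (Suc n) powr (-s) - of_nat (Suc (Suc n)) powr (-s)))"

text \<open>For \<open>char_mean q chi = 0\<close> the first summand vanishes even at \<open>s = 1\<close>, since \<open>x / 0 = 0\<close>.\<close>

definition char_L :: "nat \<Rightarrow> (nat \<Rightarrow> complex) \<Rightarrow> complex \<Rightarrow> complex" where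
  "char_L q chi s = char_mean q chi * zeta_num s / (s - 1) + char_rest q chi s"

lemma sum_period_shift:
  fixes h :: "nat \<Rightarrow> 'a::ab_group_add"
  assumes "\<And>n. h (n + q) = h n"
  shows "(\<Sum>j=1..n + q. h j) = (\<Sum>j=1..n. h j) + (\<Sum>j=1..q. h j)"
proof (induction n)
  case (Suc n)
  have "h (Suc (n + q)) = h (Suc n)" using assms[of "Suc n"] by simp
  with Suc show ?case by (simp add: algebra_simps)
qed simp

lemma norm_char_mean_le:
  assumes "dirichlet_character q chi"
  shows "cmod (char_mean q chi) \<le> 1"
proof -
  have q: "q > 0" using assms by (simp add: dirichlet_character_def)
  have "cmod (\<Sum>j=1..q. chi j) \<le> (\<Sum>j=1..q. 1)"
    by (intro sum_norm_le norm_dirichlet_character_le[OF assms])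
  then show ?thesis using q by (simp add: char_mean_def norm_divide)
qed

text \<open>Full periods of the centred character add up to 0, so fewer than \<open>q\<close> terms
  remain, each of modulus at most 2.\<close>

lemma norm_char_partial_sum_le:
  assumes chi: "dirichlet_character q chi"
  shows "cmod (\<Sum>j=1..n. chi j - char_mean q chi) \<le> 2 * real q"
proof -
  define h where "h j = chi j - char_mean q chi" for j
  have q: "q > 0" using chi by (simp add: dirichlet_character_def)
  have per: "h (j + q) = h j" for j using chi by (simp add: h_def dirichlet_character_def)
  have zero: "(\<Sum>j=1..q. h j) = 0"
    using q by (simp add: h_def sum_subtractf char_mean_def)
  have h_le: "cmod (h j) \<le> 2" for j
    using norm_triangle_ineq4[of "chi j" "char_mean q chi"] norm_dirichlet_character_le[OF chi, of j] norm_char_mean_le[OF chi]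
    by (simp add: h_def)
  have "cmod (\<Sum>j=1..n. h j) \<le> 2 * real q"
  proof (induction n rule: less_induct)
    case (less n)
    show ?case
    proof (cases "n < q")
      case True
      have "cmod (\<Sum>j=1..n. h j) \<le> (\<Sum>j=1..n. 2)" by (intro sum_norm_le h_le)
      also have "\<dots> \<le> 2 * real q" using True by simp
      finally show ?thesis .
    next
      case False
      then have "n = (n - q) + q" by simp
      then have "(\<Sum>j=1..n. h j) = (\<Sum>j=1..n - q. h j)"
        using sum_period_shift[of h q "n - q", OF per] zero by simp
      then show ?thesis using less[of "n - q"] q False by simp
    qed
  qed
  then show ?thesis by (simp add: h_def)
qed

lemma char_rest:
  assumes chi: "dirichlet_character q chi"
  shows "char_rest q chi holomorphic_on {s. Re s > 0}"
    and "\<And>s. Re s \<ge> 1/2 \<Longrightarrow> cmod (char_rest q chi s) \<le> 2 * real q * cmod s * zeta32"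
    and "\<And>s. Re s > 0 \<Longrightarrow> (\<lambda>n. (chi (Suc n) - char_mean q chi) * of_nat (Suc n) powr (-s)) sums char_rest q chi s"
proof -
  have eq: "char_rest q chi = (\<lambda>s. \<Sum>n. (\<Sum>j=1..Suc n. chi j - char_mean q chi) *
     (of_nat (Suc n) powr (-s) - of_nat (Suc (Suc n)) powr (-s)))"
    unfolding char_rest_def ..
  note * = bounded_partial_sums_continuation[of "\<lambda>j. chi j - char_mean q chi" "2 * real q", OF norm_char_partial_sum_le[OF chi]]
  show "char_rest q chi holomorphic_on {s. Re s > 0}" unfolding eq by (rule *(1))
  show "cmod (char_rest q chi s) \<le> 2 * real q * cmod s * zeta32" if "Re s \<ge> 1/2" for s
    unfolding eq by (rule *(2)[OF that])
  show "(\<lambda>n. (chi (Suc n) - char_mean q chi) * of_nat (Suc n) powr (-s)) sums char_rest q chi s" if "Re s > 0" for s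
    unfolding eq by (rule *(3)[OF that])
qed

lemma char_L_sums:
  assumes chi: "dirichlet_character q chi" and s: "Re s > 1"
  shows "(\<lambda>n. chi (Suc n) * of_nat (Suc n) powr (-s)) sums char_L q chi s"
proof -
  have "(\<lambda>n. char_mean q chi * of_nat (Suc n) powr (-s) + (chi (Suc n) - char_mean q chi) * of_nat (Suc n) powr (-s))
      sums (char_mean q chi * (zeta_num s / (s - 1)) + char_rest q chi s)"
    using s by (intro sums_add sums_mult zeta_num(3) char_rest(3)[OF chi]) auto
  then show ?thesis by (simp add: char_L_def algebra_simps)
qed

lemma char_L_holomorphic:
  assumes chi: "dirichlet_character q chi"
  shows "char_L q chi holomorphic_on {s. Re s > 0} - {1}"
    and "char_mean q chi = 0 \<Longrightarrow> char_L q chi holomorphic_on {s. Re s > 0}"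
proof -
  have "(\<lambda>s. char_mean q chi * zeta_num s / (s - 1) + char_rest q chi s) holomorphic_on {s. Re s > 0} - {1}"
    by (intro holomorphic_intros holomorphic_on_subset[OF zeta_num(1)] holomorphic_on_subset[OF char_rest(1)[OF chi]]) auto
  then show "char_L q chi holomorphic_on {s. Re s > 0} - {1}" by (simp add: char_L_def[abs_def])
  assume "char_mean q chi = 0"
  then have "char_L q chi = char_rest q chi" by (simp add: char_L_def[abs_def])
  then show "char_L q chi holomorphic_on {s. Re s > 0}" using char_rest(1)[OF chi] by simp
qed

text \<open>\<open>char_L\<close> shows that the choice operator in \<open>dirichlet_L\<close> has a
  witness; uniqueness follows from the identity theorem, as the half-plane without 1 is open and
  connected. Excluding \<open>s = 1\<close> is essential, since the chosen value there is
  arbitrary.\<close>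

lemma dirichlet_L_eq_char_L:
  assumes chi: "dirichlet_character q chi" and s: "Re s > 0" "s \<noteq> 1"
  shows "dirichlet_L chi s = char_L q chi s"
proof -
  define P where "P L \<longleftrightarrow> L holomorphic_on ({s. Re s > 0} - {1}) \<and>
     (\<forall>s. Re s > 1 \<longrightarrow> (\<lambda>n. chi (Suc n) / of_nat (Suc n) powr s) sums L s)" for L
  have "P (char_L q chi)"
    using char_L_holomorphic(1)[OF chi] char_L_sums[OF chi] by (simp add: P_def powr_minus divide_inverse)
  then have "P (SOME L. P L)" by (rule someI[where P = P])
  moreover have "dirichlet_L chi = (SOME L. P L)" unfolding P_def dirichlet_L_def ..
  ultimately have L: "P (dirichlet_L chi)" by simp
  show ?thesis
  proof (rule analytic_continuation_open[where f = "dirichlet_L chi" and g = "char_L q chi" and z = s and s = "{s. Re s > 1}" and s' = "{s. Re s > 0} - {1}"])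
    show "dirichlet_L chi holomorphic_on {s. Re s > 0} - {1}" using L by (simp add: P_def)
    show "char_L q chi holomorphic_on {s. Re s > 0} - {1}" by (rule char_L_holomorphic(1)[OF chi])
    show "open {s. Re s > 1}" by (rule open_halfspace_Re_gt)
    show "open ({s. Re s > 0} - {1})" by (intro open_Diff open_halfspace_Re_gt) auto
    show "connected ({s. Re s > 0} - {1})"
      by (intro connected_open_delete open_halfspace_Re_gt convex_connected convex_halfspace_Re_gt) auto
    have "(2::complex) \<in> {s. Re s > 1}" by simp
    then show "{s. Re s > 1} \<noteq> {}" by blast
    show "{s. Re s > 1} \<subseteq> {s. Re s > 0} - {1}" by auto
    show "s \<in> {s. Re s > 0} - {1}" using s by simp
    show "dirichlet_L chi z = char_L q chi z" if "z \<in> {s. Re s > 1}" for z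
    proof -
      have "(\<lambda>n. chi (Suc n) / of_nat (Suc n) powr z) sums dirichlet_L chi z" using L that by (simp add: P_def del: of_nat_Suc)
      moreover have "(\<lambda>n. chi (Suc n) / of_nat (Suc n) powr z) sums char_L q chi z"
        using char_L_sums[OF chi] that by (simp add: powr_minus divide_inverse del: of_nat_Suc)
      ultimately show ?thesis by (rule sums_unique2)
    qed
  qed
qed

definition char_term :: "(nat \<Rightarrow> complex) \<Rightarrow> complex \<Rightarrow> nat \<Rightarrow> complex" where
  "char_term chi s n = chi n * of_nat n powr (-s)"

lemma char_term:
  assumes chi: "dirichlet_character q chi"
  shows "char_term chi s (m * n) = char_term chi s m * char_term chi s n"
    and "char_term chi s (Suc 0) = 1"
    and "cmod (char_term chi s n) \<le> real n powr (- Re s)"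
    and "Re s > 1 \<Longrightarrow> summable (\<lambda>n. norm (char_term chi s (Suc n)))"
    and "Re s > 1 \<Longrightarrow> (\<Sum>n. char_term chi s (Suc n)) = char_L q chi s"
proof -
  show "char_term chi s (m * n) = char_term chi s m * char_term chi s n" for m n
    by (simp add: char_term_def dirichlet_character_mult[OF chi] powr_times_real mult_ac)
  show "char_term chi s (Suc 0) = 1" by (simp add: char_term_def dirichlet_character_1[OF chi])
  show le: "cmod (char_term chi s n) \<le> real n powr (- Re s)" for n
  proof -
    have "cmod (of_nat n powr (-s)) = real n powr (- Re s)"
      using norm_powr_real_powr[of "of_nat n" "-s"] by simp
    then show ?thesis using norm_dirichlet_character_le[OF chi, of n]
      by (simp add: char_term_def norm_mult mult_left_le_one_le)
  qed
  assume s: "Re s > 1"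
  show "summable (\<lambda>n. norm (char_term chi s (Suc n)))"
    by (rule summable_comparison_test'[OF summable_Suc_powr[of "- Re s"], of 0]) (use s le in \<open>auto simp del: of_nat_Suc\<close>)
  show "(\<Sum>n. char_term chi s (Suc n)) = char_L q chi s"
    using char_L_sums[OF chi s] by (simp add: char_term_def sums_iff)
qed

lemma char_L_inverse:
  assumes chi: "dirichlet_character q chi" and s: "Re s > 1"
  shows "char_L q chi s * (\<Sum>n. of_int (moebius_mu (Suc n)) * char_term chi s (Suc n)) = 1"
    and "(\<lambda>n. of_int (moebius_mu (Suc n)) * char_term chi s (Suc n)) sums (1 / char_L q chi s)"
    and "char_L q chi s \<noteq> 0"
    and "cmod (char_L q chi s) \<le> (\<Sum>n. real (Suc n) powr (- Re s))"
    and "cmod (1 / char_L q chi s) \<le> (\<Sum>n. real (Suc n) powr (- Re s))"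
proof -
  note inv = moebius_inverse_series[where f = "char_term chi s", OF char_term(1)[OF chi] char_term(2)[OF chi] char_term(4)[OF chi s]]
  show 1: "char_L q chi s * (\<Sum>n. of_int (moebius_mu (Suc n)) * char_term chi s (Suc n)) = 1"
    using inv(1) by (simp only: char_term(5)[OF chi s])
  then show nz: "char_L q chi s \<noteq> 0" by auto
  have D: "(\<Sum>n. of_int (moebius_mu (Suc n)) * char_term chi s (Suc n)) = 1 / char_L q chi s"
    using 1 nz by (simp add: field_simps)
  show "(\<lambda>n. of_int (moebius_mu (Suc n)) * char_term chi s (Suc n)) sums (1 / char_L q chi s)"
    using summable_sums[OF summable_norm_cancel[OF inv(2)]] by (simp only: D)
  have summ: "summable (\<lambda>n. real (Suc n) powr (- Re s))" using s by (intro summable_Suc_powr) simp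
  show "cmod (char_L q chi s) \<le> (\<Sum>n. real (Suc n) powr (- Re s))"
    unfolding char_term(5)[OF chi s, symmetric] by (rule norm_suminf_le[OF char_term(3)[OF chi] summ])
  have "cmod (of_int (moebius_mu n) * char_term chi s n) \<le> real n powr (- Re s)" for n
  proof -
    have "cmod (of_int (moebius_mu n)) \<le> 1" using abs_moebius_mu_le[of n] by simp
    then have "cmod (of_int (moebius_mu n)) * cmod (char_term chi s n) \<le> 1 * real n powr (- Re s)"
      by (intro mult_mono char_term(3)[OF chi]) auto
    then show ?thesis by (simp add: norm_mult)
  qed
  then show "cmod (1 / char_L q chi s) \<le> (\<Sum>n. real (Suc n) powr (- Re s))"
    unfolding D[symmetric] by (intro norm_suminf_le[OF _ summ])
qed

section \<open>Non-vanishing on the line Re s = 1\<close>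

definition principal_char :: "nat \<Rightarrow> nat \<Rightarrow> complex" where
  "principal_char q n = (if coprime n q then 1 else 0)"

lemma dirichlet_character_principal: "q > 0 \<Longrightarrow> dirichlet_character q (principal_char q)"
  by (simp add: dirichlet_character_def principal_char_def coprime_add_self_iff)

lemma dirichlet_character_square: "dirichlet_character q chi \<Longrightarrow> dirichlet_character q (\<lambda>n. (chi n)\<^sup>2)"
  by (simp add: dirichlet_character_def power_mult_distrib)

text \<open>L times its inverse partial Euler product tends to 1, and the 3-4-1 combination of the
  inverse products is at most 1 prime by prime. Primes dividing \<open>q\<close> contribute the
  factor 1 because all three characters vanish there.\<close>

lemma three_four_one:
  assumes chi: "dirichlet_character q chi" and x: "x > 0"
  shows "1 \<le> cmod (char_L q (principal_char q) (of_real (1 + x))) ^ 3 * cmod (char_L q chi (Complex (1 + x) t)) ^ 4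
      * cmod (char_L q (\<lambda>n. (chi n)\<^sup>2) (Complex (1 + x) (2 * t)))"
proof -
  have q: "q > 0" using chi by (simp add: dirichlet_character_def)
  define chi1 where "chi1 = principal_char q"
  define chi3 where "chi3 = (\<lambda>n. (chi n)\<^sup>2)"
  have c1: "dirichlet_character q chi1" unfolding chi1_def by (rule dirichlet_character_principal[OF q])
  have c3: "dirichlet_character q chi3" unfolding chi3_def by (rule dirichlet_character_square[OF chi])
  define s1 s2 s3 where s_def: "s1 = complex_of_real (1 + x)" "s2 = Complex (1 + x) t" "s3 = Complex (1 + x) (2 * t)"
  have s: "Re s1 > 1" "Re s2 > 1" "Re s3 > 1" using x by (simp_all add: s_def)
  define Q where "Q N = {p. prime p \<and> p \<le> (N::nat)}" for N
  have lim: "(\<lambda>N. char_L q c s * (\<Prod>p\<in>Q N. 1 - char_term c s p)) \<longlonglongrightarrow> 1"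
    if c: "dirichlet_character q c" and s: "Re s > 1" for c s
    using euler_product_tendsto[where f = "char_term c s", OF char_term(1)[OF c] char_term(2)[OF c] char_term(4)[OF c s]]
    unfolding char_term(5)[OF c s] Q_def .
  have "(\<lambda>N. cmod (char_L q chi1 s1 * (\<Prod>p\<in>Q N. 1 - char_term chi1 s1 p)) ^ 3
      * cmod (char_L q chi s2 * (\<Prod>p\<in>Q N. 1 - char_term chi s2 p)) ^ 4
      * cmod (char_L q chi3 s3 * (\<Prod>p\<in>Q N. 1 - char_term chi3 s3 p))) \<longlonglongrightarrow> cmod 1 ^ 3 * cmod 1 ^ 4 * cmod 1"
    by (intro tendsto_mult tendsto_power tendsto_norm lim c1 c3 chi s)
  then have "(\<lambda>N. cmod (char_L q chi1 s1 * (\<Prod>p\<in>Q N. 1 - char_term chi1 s1 p)) ^ 3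
      * cmod (char_L q chi s2 * (\<Prod>p\<in>Q N. 1 - char_term chi s2 p)) ^ 4
      * cmod (char_L q chi3 s3 * (\<Prod>p\<in>Q N. 1 - char_term chi3 s3 p))) \<longlonglongrightarrow> 1" by simp
  moreover have "cmod (char_L q chi1 s1 * (\<Prod>p\<in>Q N. 1 - char_term chi1 s1 p)) ^ 3
      * cmod (char_L q chi s2 * (\<Prod>p\<in>Q N. 1 - char_term chi s2 p)) ^ 4
      * cmod (char_L q chi3 s3 * (\<Prod>p\<in>Q N. 1 - char_term chi3 s3 p))
      \<le> cmod (char_L q chi1 s1) ^ 3 * cmod (char_L q chi s2) ^ 4 * cmod (char_L q chi3 s3)" for N
  proof -
    define E where "E p = cmod (1 - char_term chi1 s1 p) ^ 3 * cmod (1 - char_term chi s2 p) ^ 4 * cmod (1 - char_term chi3 s3 p)" for p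
    have E: "0 \<le> E p \<and> E p \<le> 1" if p: "p \<in> Q N" for p
    proof (cases "coprime p q")
      case False
      then have "chi p = 0" "chi1 p = 0"
        using dirichlet_character_zero_iff[OF chi] by (auto simp: chi1_def principal_char_def)
      then show ?thesis by (simp add: E_def char_term_def chi3_def)
    next
      case True
      have p1: "p > 1" using p prime_gt_1_nat by (auto simp: Q_def)
      define r where "r = real p powr (- (1 + x))"
      have "r < real p powr 0" unfolding r_def using p1 x by (intro powr_less_mono) auto
      then have r: "0 \<le> r" "r < 1" using p1 by (auto simp: r_def)
      define z where "z = chi p * of_nat p powr (- (\<i> * of_real t))"
      have "cmod (of_nat p powr (- (\<i> * of_real t))) = 1"
        using norm_powr_real_powr[of "of_nat p" "- (\<i> * of_real t)"] p1 by simp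
      then have z: "cmod z = 1" using norm_dirichlet_character[OF chi, of p] True by (simp add: z_def norm_mult)
      have rp: "complex_of_nat p powr (- of_real (1 + x)) = of_real r"
        using powr_of_real[of "real p" "- (1 + x)"] by (simp add: r_def)
      have t1: "char_term chi1 s1 p = of_real r"
        using True rp by (simp add: char_term_def chi1_def principal_char_def s_def)
      have s2': "- s2 = - of_real (1 + x) + - (\<i> * of_real t)" "- s3 = - of_real (1 + x) + (- (\<i> * of_real t) + - (\<i> * of_real t))"
        by (simp_all add: s_def complex_eq_iff)
      have t2: "char_term chi s2 p = of_real r * z"
        unfolding char_term_def s2' powr_add rp by (simp add: z_def mult_ac)
      have t3: "char_term chi3 s3 p = of_real r * z\<^sup>2"
        unfolding char_term_def s2' powr_add rp by (simp add: z_def chi3_def power2_eq_square mult_ac)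
      show ?thesis unfolding E_def t1 t2 t3 using three_four_one_factor[OF r z] by simp
    qed
    have "(\<Prod>p\<in>Q N. E p) \<le> 1" by (rule prod_le_1) (use E in auto)
    moreover have "0 \<le> cmod (char_L q chi1 s1) ^ 3 * cmod (char_L q chi s2) ^ 4 * cmod (char_L q chi3 s3)" by simp
    ultimately have "(cmod (char_L q chi1 s1) ^ 3 * cmod (char_L q chi s2) ^ 4 * cmod (char_L q chi3 s3)) * (\<Prod>p\<in>Q N. E p)
        \<le> cmod (char_L q chi1 s1) ^ 3 * cmod (char_L q chi s2) ^ 4 * cmod (char_L q chi3 s3)"
      by (rule mult_left_le)
    moreover have "(\<Prod>p\<in>Q N. E p) = cmod (\<Prod>p\<in>Q N. 1 - char_term chi1 s1 p) ^ 3 * cmod (\<Prod>p\<in>Q N. 1 - char_term chi s2 p) ^ 4 * cmod (\<Prod>p\<in>Q N. 1 - char_term chi3 s3 p)"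
      unfolding E_def prod.distrib prod_norm[symmetric] by (simp add: prod_power_distrib)
    ultimately show ?thesis by (simp add: norm_mult power_mult_distrib mult_ac)
  qed
  ultimately have "1 \<le> cmod (char_L q chi1 s1) ^ 3 * cmod (char_L q chi s2) ^ 4 * cmod (char_L q chi3 s3)"
    by (intro LIMSEQ_le_const2) auto
  then show ?thesis by (simp add: s_def chi1_def chi3_def)
qed

text \<open>A zero would enter with the fourth power, while the pole of the principal character
  enters only with the third. The side conditions keep \<open>char_L\<close> of \<open>chi\<close>
  at \<open>1 + i t\<close> and of its square at \<open>1 + 2 i t\<close> away from a pole.\<close>

lemma char_L_1_nonzero_by_341:
  assumes chi: "dirichlet_character q chi" and "t \<noteq> 0 \<or> char_mean q chi = 0"
    and "t \<noteq> 0 \<or> char_mean q (\<lambda>n. (chi n)\<^sup>2) = 0"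
  shows "char_L q chi (Complex 1 t) \<noteq> 0"
proof
  assume zero: "char_L q chi (Complex 1 t) = 0"
  have q: "q > 0" using chi by (simp add: dirichlet_character_def)
  define chi3 where "chi3 = (\<lambda>n. (chi n)\<^sup>2)"
  have c3: "dirichlet_character q chi3" unfolding chi3_def by (rule dirichlet_character_square[OF chi])
  have diff: "char_L q c field_differentiable at (Complex 1 u)"
    if c: "dirichlet_character q c" and u: "u \<noteq> 0 \<or> char_mean q c = 0" for c u
  proof (cases "char_mean q c = 0")
    case True
    show ?thesis
      by (rule holomorphic_on_imp_differentiable_at[OF char_L_holomorphic(2)[OF c True] open_halfspace_Re_gt]) simp
  next
    case False
    then have "u \<noteq> 0" using u by simp
    then show ?thesis
      by (intro holomorphic_on_imp_differentiable_at[OF char_L_holomorphic(1)[OF c]] open_Diff open_halfspace_Re_gt)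
        (auto simp: complex_eq_iff)
  qed
  define y where "y n = 1 / real (Suc n)" for n
  have y0: "y n > 0" "y n \<le> 1" for n by (auto simp: y_def)
  have y: "y \<longlonglongrightarrow> 0" unfolding y_def by (rule LIMSEQ_Suc[OF lim_const_over_n])
  have line: "(\<lambda>n. Complex (1 + y n) u) \<longlonglongrightarrow> Complex 1 u" for u
    unfolding Complex_eq using y by (auto intro!: tendsto_eq_intros)
  obtain D where D: "(char_L q chi has_field_derivative D) (at (Complex 1 t))"
    using diff[OF chi assms(2)] by (auto simp: field_differentiable_def)
  have L2: "(\<lambda>n. cmod (char_L q chi (Complex (1 + y n) t)) / y n) \<longlonglongrightarrow> cmod D"
  proof -
    have "((\<lambda>s. (char_L q chi s - char_L q chi (Complex 1 t)) / (s - Complex 1 t)) \<longlongrightarrow> D) (at (Complex 1 t))"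
      using D by (simp add: has_field_derivative_iff)
    moreover have "filterlim (\<lambda>n. Complex (1 + y n) t) (at (Complex 1 t)) sequentially"
      unfolding filterlim_at using line[of t] y0(1) by (simp add: less_imp_neq[OF y0(1), symmetric])
    ultimately have "(\<lambda>n. (char_L q chi (Complex (1 + y n) t) - char_L q chi (Complex 1 t)) / (Complex (1 + y n) t - Complex 1 t)) \<longlonglongrightarrow> D"
      by (rule filterlim_compose)
    moreover have "Complex (1 + y n) t - Complex 1 t = of_real (y n)" for n by (simp add: complex_eq_iff)
    ultimately have "(\<lambda>n. char_L q chi (Complex (1 + y n) t) / of_real (y n)) \<longlonglongrightarrow> D"
      by (simp only: zero diff_zero)
    from tendsto_norm[OF this] show ?thesis
      by (simp only: norm_divide norm_of_real abs_of_pos[OF y0(1)])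
  qed
  have L3: "(\<lambda>n. cmod (char_L q chi3 (Complex (1 + y n) (2 * t)))) \<longlonglongrightarrow> cmod (char_L q chi3 (Complex 1 (2 * t)))"
  proof -
    have "isCont (char_L q chi3) (Complex 1 (2 * t))"
      by (rule field_differentiable_imp_continuous_at[OF diff[OF c3]]) (use assms(3) in \<open>auto simp: chi3_def\<close>)
    then show ?thesis by (rule tendsto_norm[OF isCont_tendsto_compose[OF _ line]])
  qed
  \<comment> \<open>On the segment from 1 to 2, \<open>s - 1 = y n\<close> and
    \<open>|s| \<le> 2\<close>. The pole part times \<open>y n\<close> is bounded by
    \<open>1 + 2 * zeta32\<close>, the rest by \<open>4 * q * zeta32\<close>.\<close>
  define K where "K = 1 + 2 * zeta32 + 4 * real q * zeta32"
  have L1: "y n * cmod (char_L q (principal_char q) (of_real (1 + y n))) \<le> K" for n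
  proof -
    define s where "s = complex_of_real (1 + y n)"
    have "cmod s = 1 + y n" unfolding s_def norm_of_real using y0[of n] by simp
    then have s: "s - 1 = of_real (y n)" "Re s \<ge> 1/2" "cmod s \<le> 2" using y0[of n] by (simp_all add: s_def)
    have c1: "dirichlet_character q (principal_char q)" by (rule dirichlet_character_principal[OF q])
    have "of_real (y n) * char_L q (principal_char q) s = char_mean q (principal_char q) * zeta_num s + of_real (y n) * char_rest q (principal_char q) s"
      using y0(1)[of n] s by (simp add: char_L_def field_simps)
    also have "cmod \<dots> \<le> cmod (char_mean q (principal_char q)) * cmod (zeta_num s) + y n * cmod (char_rest q (principal_char q) s)"
      using y0(1)[of n] by (intro order_trans[OF norm_triangle_ineq]) (simp add: norm_mult)
    also have "\<dots> \<le> 1 * (1 + 1 * 2 * zeta32) + 1 * (2 * real q * 2 * zeta32)"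
    proof (intro add_mono mult_mono norm_char_mean_le[OF c1] y0(2))
      have "cmod (zeta_num s) \<le> 1 + cmod (s - 1) * cmod s * zeta32" by (rule zeta_num(2)[OF s(2)])
      also have "cmod (s - 1) = y n" using s(1) y0(1)[of n] by simp
      also have "1 + y n * cmod s * zeta32 \<le> 1 + 1 * 2 * zeta32"
        using y0[of n] s(3) zeta32_nonneg by (intro add_mono mult_right_mono mult_mono) auto
      finally show "cmod (zeta_num s) \<le> 1 + 1 * 2 * zeta32" .
      have "cmod (char_rest q (principal_char q) s) \<le> 2 * real q * cmod s * zeta32" by (rule char_rest(2)[OF c1 s(2)])
      also have "\<dots> \<le> 2 * real q * 2 * zeta32"
        using s(3) zeta32_nonneg by (intro mult_right_mono mult_left_mono) auto
      finally show "cmod (char_rest q (principal_char q) s) \<le> 2 * real q * 2 * zeta32" .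
    qed (use y0[of n] in auto)
    finally show ?thesis using y0(1)[of n] by (simp add: norm_mult s_def K_def)
  qed
  have "1 \<le> K ^ 3 * (cmod (char_L q chi (Complex (1 + y n) t)) / y n) ^ 4 * cmod (char_L q chi3 (Complex (1 + y n) (2 * t))) * y n" for n
  proof -
    define a b c where abc: "a = cmod (char_L q (principal_char q) (of_real (1 + y n)))" "b = cmod (char_L q chi (Complex (1 + y n) t))"
      "c = cmod (char_L q chi3 (Complex (1 + y n) (2 * t)))"
    have nn: "a \<ge> 0" "b \<ge> 0" "c \<ge> 0" by (simp_all add: abc)
    have "1 \<le> a ^ 3 * b ^ 4 * c" using three_four_one[OF chi y0(1), of n t] by (simp add: abc chi3_def)
    \<comment> \<open>The normalisation uses \<open>y n ^ 3\<close> for the pole and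
      \<open>y n ^ 4\<close> for the zero, so one factor \<open>y n\<close> is left over and drives
      the product to 0.\<close>
    also have "\<dots> = (y n * a) ^ 3 * (b / y n) ^ 4 * c * y n"
    proof -
      have "(y n * a) ^ 3 * (b / y n) ^ 4 * c * y n = (a ^ 3 * b ^ 4 * c) * ((y n ^ 3 * y n) / y n ^ 4)"
        unfolding power_mult_distrib power_divide by simp
      also have "y n ^ 3 * y n = y n ^ 4" by (simp add: eval_nat_numeral)
      also have "y n ^ 4 / y n ^ 4 = 1" using y0(1)[of n] by simp
      finally show ?thesis by (simp only: mult_1_right)
    qed
    also have "\<dots> \<le> K ^ 3 * (b / y n) ^ 4 * c * y n"
      using L1[of n] y0(1)[of n] nn by (intro mult_right_mono power_mono) (auto simp: abc)
    finally show ?thesis by (simp add: abc)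
  qed
  moreover have "(\<lambda>n. K ^ 3 * (cmod (char_L q chi (Complex (1 + y n) t)) / y n) ^ 4 * cmod (char_L q chi3 (Complex (1 + y n) (2 * t))) * y n)
      \<longlonglongrightarrow> K ^ 3 * cmod D ^ 4 * cmod (char_L q chi3 (Complex 1 (2 * t))) * 0"
    by (intro tendsto_mult tendsto_const tendsto_power L2 L3 y)
  ultimately have "1 \<le> K ^ 3 * cmod D ^ 4 * cmod (char_L q chi3 (Complex 1 (2 * t))) * 0"
    by (intro LIMSEQ_le_const) auto
  then show False by simp
qed

lemma char_mean_eq_totatives:
  assumes chi: "dirichlet_character q chi"
  shows "char_mean q chi = (\<Sum>n\<in>totatives q. chi n) / of_nat q"
proof -
  have "(\<Sum>j=1..q. chi j) = (\<Sum>n\<in>totatives q. chi n)"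
  proof (rule sum.mono_neutral_right)
    show "totatives q \<subseteq> {1..q}" by (auto simp: totatives_def)
    show "\<forall>i\<in>{1..q} - totatives q. chi i = 0"
    proof
      fix i assume "i \<in> {1..q} - totatives q"
      then have "\<not> coprime i q" by (auto simp: totatives_def)
      then show "chi i = 0" using dirichlet_character_zero_iff[OF chi] by blast
    qed
  qed simp
  then show ?thesis by (simp add: char_mean_def)
qed

lemma char_mean_nonzero_imp_principal:
  assumes chi: "dirichlet_character q chi" and "char_mean q chi \<noteq> 0"
  shows "chi = principal_char q"
proof (rule ccontr)
  have q: "q > 0" using chi by (simp add: dirichlet_character_def)
  assume "chi \<noteq> principal_char q"
  then have "(\<Sum>n\<in>totatives q. chi n * cnj (principal_char q n)) = 0"
    by (rule dirichlet_character_orthogonal[OF chi dirichlet_character_principal[OF q]])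
  moreover have "(\<Sum>n\<in>totatives q. chi n * cnj (principal_char q n)) = (\<Sum>n\<in>totatives q. chi n)"
    by (intro sum.cong) (auto simp: totatives_def principal_char_def)
  ultimately show False using assms(2) char_mean_eq_totatives[OF chi] by simp
qed

section \<open>Real characters at s = 1\<close>

lemma square_coprime_factors:
  fixes p k m c :: nat
  assumes "prime p" "\<not> p dvd m" "c\<^sup>2 = p ^ k * m"
  shows "even k" "\<exists>b. m = b\<^sup>2"
proof -
  have p1: "p > 1" using prime_gt_1_nat[OF assms(1)] .
  have m0: "m \<noteq> 0" using assms(2) by (metis dvd_0_right)
  have c0: "c \<noteq> 0"
  proof
    assume "c = 0"
    then have "p ^ k * m = 0" using assms(3) by simp
    then show False using m0 p1 by simp
  qed
  obtain j b where b: "c = p ^ j * b" "\<not> p dvd b"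
    using multiplicity_decompose'[of c p] c0 assms(1) by (metis not_prime_unit)
  have eq: "p ^ (2 * j) * b\<^sup>2 = p ^ k * m"
    using assms(3) unfolding b(1) by (simp add: power_mult_distrib power_mult mult.commute)
  have nb: "\<not> p dvd b\<^sup>2" using b(2) assms(1) prime_dvd_power by blast
  have "multiplicity p (p ^ (2 * j) * b\<^sup>2) = 2 * j"
    by (rule multiplicity_eqI) (use nb p1 in auto)
  moreover have "multiplicity p (p ^ k * m) = k"
    by (rule multiplicity_eqI) (use assms(2) p1 in auto)
  ultimately have k: "k = 2 * j" using eq by simp
  then show "even k" by simp
  show "\<exists>b. m = b\<^sup>2" using eq p1 by (intro exI[of _ b]) (simp add: k)
qed

text \<open>The divisor sum is multiplicative. At \<open>p ^ k\<close> it equals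
  \<open>k + 1\<close>, 1, or the alternating sum 1, 0, 1, ... according to
  \<open>\<rho> p = 1, 0, -1\<close>; it is never negative, and at least 1 when \<open>k\<close> is
  even, as for squares.\<close>

lemma divisor_sum_real_char_nonneg:
  fixes \<rho> :: "nat \<Rightarrow> real"
  assumes mult: "\<And>m n. \<rho> (m * n) = \<rho> m * \<rho> n" and one: "\<rho> (Suc 0) = 1"
    and vals: "\<And>n. \<rho> n \<in> {-1, 0, 1}" and "n > 0"
  shows "0 \<le> (\<Sum>d | d dvd n. \<rho> d) \<and> ((\<exists>c. n = c\<^sup>2) \<longrightarrow> 1 \<le> (\<Sum>d | d dvd n. \<rho> d))"
  using \<open>n > 0\<close>
proof (induction n rule: less_induct)
  case (less n)
  show ?case
  proof (cases "n = 1")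
    case True
    then show ?thesis using one by simp
  next
    case False
    then obtain p where p: "prime p" "p dvd n" using prime_factor_nat by blast
    obtain m where m: "n = p ^ multiplicity p n * m" "\<not> p dvd m"
      using multiplicity_decompose'[of n p] less.prems p by (metis not_prime_unit not_gr0)
    define k where "k = multiplicity p n"
    have "k > 0" using p less.prems by (simp add: k_def prime_multiplicity_gt_zero_iff)
    have n: "n = p ^ k * m" using m by (simp add: k_def)
    have m0: "m > 0" using less.prems n by (auto intro: gr0I)
    have "p ^ k > 1" by (rule one_less_power[OF prime_gt_1_nat[OF p(1)] \<open>k > 0\<close>])
    then have "m < n" using m0 n by simp
    have co: "coprime (p ^ k) m" using m p by (simp add: prime_imp_coprime coprime_power_left_iff)
    have "(\<Sum>d | d dvd n. \<rho> d) = (\<Sum>d | d dvd p ^ k. \<rho> d) * (\<Sum>d | d dvd m. \<rho> d)"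
      unfolding n by (rule sum_divisors_coprime[OF mult co]) (use m0 p(1) in \<open>auto simp: prime_gt_0_nat\<close>)
    also have "(\<Sum>d | d dvd p ^ k. \<rho> d) = (\<Sum>i\<le>k. \<rho> p ^ i)"
    proof -
      have "\<rho> (p ^ i) = \<rho> p ^ i" for i by (induction i) (simp_all add: one mult)
      then show ?thesis by (simp add: sum_divisors_prime_power[OF p(1)])
    qed
    finally have split: "(\<Sum>d | d dvd n. \<rho> d) = (\<Sum>i\<le>k. \<rho> p ^ i) * (\<Sum>d | d dvd m. \<rho> d)" .
    have alt: "(\<Sum>i\<le>k. (-1::real) ^ i) = (if even k then 1 else 0)" for k by (induction k) auto
    have zero: "(\<Sum>i\<le>k. (0::real) ^ i) = 1" for k by (induction k) auto
    have fac: "0 \<le> (\<Sum>i\<le>k. \<rho> p ^ i) \<and> (even k \<longrightarrow> 1 \<le> (\<Sum>i\<le>k. \<rho> p ^ i))"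
      using vals[of p] alt[of k] zero[of k] by auto
    have IH: "0 \<le> (\<Sum>d | d dvd m. \<rho> d)" "(\<exists>c. m = c\<^sup>2) \<Longrightarrow> 1 \<le> (\<Sum>d | d dvd m. \<rho> d)"
      using less.IH[OF \<open>m < n\<close> m0] by auto
    show ?thesis
    proof (intro conjI impI)
      show "0 \<le> (\<Sum>d | d dvd n. \<rho> d)" unfolding split using fac IH(1) by simp
      assume "\<exists>c. n = c\<^sup>2"
      then obtain c where "c\<^sup>2 = p ^ k * m" using n by metis
      note sq = square_coprime_factors[OF p(1) m(2) this]
      have "1 * 1 \<le> (\<Sum>i\<le>k. \<rho> p ^ i) * (\<Sum>d | d dvd m. \<rho> d)"
        using fac sq(1) IH(2)[OF sq(2)] by (intro mult_mono) auto
      then show "1 \<le> (\<Sum>d | d dvd n. \<rho> d)" unfolding split by simp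
    qed
  qed
qed

text \<open>The Lambert kernel \<open>1 / (exp u - 1)\<close> and its leading part
  \<open>1 / u\<close> are both singular at 0; their difference is bounded and monotone, as a weight
  for Abel summation should be.\<close>

definition lambert_defect :: "real \<Rightarrow> real" where
  "lambert_defect u = 1 / u - 1 / (exp u - 1)"

lemma lambert_defect:
  assumes "u > 0"
  shows "0 \<le> lambert_defect u" "lambert_defect u \<le> 1"
    and "u \<le> v \<Longrightarrow> lambert_defect v \<le> lambert_defect u"
proof -
  have e: "exp u - 1 \<ge> u" using exp_ge_add_one_self[of u] by linarith
  have "1 / (exp u - 1) \<le> 1 / u" using e assms by (intro divide_left_mono) auto
  then show "0 \<le> lambert_defect u" by (simp add: lambert_defect_def)
  have "1 - exp (-u) \<le> u" using exp_ge_add_one_self[of "-u"] by linarith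
  then have "(1 - exp (-u)) * exp u \<le> u * exp u" by (rule mult_right_mono) simp
  then have "exp u - 1 \<le> u * exp u" by (simp add: left_diff_distrib exp_minus)
  then have "exp u - 1 - u \<le> u * (exp u - 1)" by (simp add: algebra_simps)
  then have "(exp u - 1 - u) / (u * (exp u - 1)) \<le> 1"
    using assms e by (subst divide_le_eq_1_pos) auto
  moreover have "lambert_defect u = (exp u - 1 - u) / (u * (exp u - 1))"
    using assms e by (simp add: lambert_defect_def field_simps)
  ultimately show "lambert_defect u \<le> 1" by simp
  assume uv: "u \<le> v"
  show "lambert_defect v \<le> lambert_defect u"
  proof (rule DERIV_nonpos_imp_nonincreasing[OF uv])
    fix x assume x: "u \<le> x" "x \<le> v"
    then have x0: "x > 0" using assms by simp
    have ex: "exp x > 1" using x0 by simp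
    have "(lambert_defect has_real_derivative (exp x / (exp x - 1)\<^sup>2 - 1 / x\<^sup>2)) (at x)"
      unfolding lambert_defect_def using x0 ex
      by (auto intro!: derivative_eq_intros simp: field_simps power2_eq_square)
    moreover have "exp x / (exp x - 1)\<^sup>2 - 1 / x\<^sup>2 \<le> 0"
    proof -
      \<comment> \<open>The sign of the derivative amounts to
        \<open>x * exp (x / 2) \<le> exp x - 1\<close>, which after division by
        \<open>2 * exp (x / 2)\<close> is this inequality.\<close>
      have "x / 2 \<le> sinh (x / 2)"
      proof -
        have "sinh (0::real) - 0 \<le> sinh (x / 2) - x / 2"
        proof (rule DERIV_nonneg_imp_nondecreasing[of 0 "x / 2" "\<lambda>y. sinh y - y"])
          fix y :: real
          have "((\<lambda>y. sinh y - y) has_real_derivative (cosh y - 1)) (at y)"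
            by (auto intro!: derivative_eq_intros)
          moreover have "cosh y - 1 \<ge> 0" using cosh_real_ge_1[of y] by simp
          ultimately show "\<exists>d. ((\<lambda>y. sinh y - y) has_real_derivative d) (at y) \<and> 0 \<le> d" by blast
        qed (use x0 in simp)
        then show ?thesis by simp
      qed
      then have "x * exp (x / 2) \<le> (2 * sinh (x / 2)) * exp (x / 2)" by (intro mult_right_mono) auto
      also have "\<dots> = exp x - 1"
      proof -
        have "exp (x / 2) * exp (x / 2) = exp x" by (simp flip: exp_add)
        moreover have "exp (- (x / 2)) * exp (x / 2) = 1" by (simp flip: exp_add)
        ultimately show ?thesis by (simp add: sinh_def left_diff_distrib)
      qed
      finally have "(x * exp (x / 2))\<^sup>2 \<le> (exp x - 1)\<^sup>2" using x0 by (intro power_mono) auto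
      moreover have "(exp (x / 2))\<^sup>2 = exp x" by (simp add: exp_double[symmetric])
      ultimately have "x\<^sup>2 * exp x \<le> (exp x - 1)\<^sup>2" by (simp add: power_mult_distrib)
      then have "exp x / (exp x - 1)\<^sup>2 \<le> 1 / x\<^sup>2"
        using x0 ex by (simp add: field_simps)
      then show ?thesis by simp
    qed
    ultimately show "\<exists>y. (lambert_defect has_real_derivative y) (at x) \<and> y \<le> 0" by blast
  qed
qed

text \<open>If \<open>L(1, chi) = 0\<close>, Abel summation with the decreasing weight \<open>lambert_defect\<close> bounds the
  Lambert series of \<open>chi\<close> near \<open>x = 0\<close>.\<close>

lemma lambert_partial_sum_bound:
  fixes chi :: "nat \<Rightarrow> complex"
  assumes B: "\<And>n. cmod (\<Sum>j=1..n. chi j) \<le> B" and x: "x > 0"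
  shows "cmod (\<Sum>d=1..N. chi d * of_real (lambert_defect (real d * x))) \<le> B"
proof -
  define g where "g d = lambert_defect (real d * x)" for d
  have B0: "B \<ge> 0" using order_trans[OF norm_ge_zero B[of 0]] .
  have mono: "g (Suc d) \<le> g d" if "d \<ge> 1" for d
    unfolding g_def using x that by (intro lambert_defect(3)) (auto intro: mult_right_mono)
  have "(\<Sum>d\<in>{0<..N}. chi d * of_real (g d)) = (\<Sum>j=1..N. chi j) * of_real (g (Suc N)) - (\<Sum>j=1..0. chi j) * of_real (g (Suc 0))
      + (\<Sum>n\<in>{0<..N}. (\<Sum>j=1..n. chi j) * (of_real (g n) - of_real (g (Suc n))))"
    by (rule abel_summation) simp
  also have "\<dots> = (\<Sum>j=1..N. chi j) * of_real (g (Suc N))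
      + (\<Sum>n\<in>{0<..N}. (\<Sum>j=1..n. chi j) * of_real (g n - g (Suc n)))" by simp
  also have "cmod \<dots> \<le> B * g (Suc N) + (\<Sum>n\<in>{0<..N}. B * (g n - g (Suc n)))"
  proof (intro order_trans[OF norm_triangle_ineq] add_mono sum_norm_le)
    have "0 \<le> g (Suc N)" unfolding g_def using x by (intro lambert_defect(1)) simp
    then show "cmod ((\<Sum>j=1..N. chi j) * of_real (g (Suc N))) \<le> B * g (Suc N)"
      using B[of N] by (simp add: norm_mult mult_right_mono)
    fix n assume "n \<in> {0<..N}"
    then have "0 \<le> g n - g (Suc n)" using mono[of n] by simp
    then show "cmod ((\<Sum>j=1..n. chi j) * of_real (g n - g (Suc n))) \<le> B * (g n - g (Suc n))"
      using B[of n] unfolding norm_mult norm_of_real by (simp add: mult_right_mono)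
  qed
  also have "(\<Sum>n\<in>{0<..N}. B * (g n - g (Suc n))) = B * (g 1 - g (Suc N))"
  proof (induction N)
    case (Suc N)
    have "{0<..Suc N} = insert (Suc N) {0<..N}" by auto
    with Suc show ?case by (simp add: algebra_simps)
  qed simp
  also have "B * g (Suc N) + B * (g 1 - g (Suc N)) = B * g 1" by (simp add: algebra_simps)
  also have "\<dots> \<le> B * 1"
    unfolding g_def using x B0 by (intro mult_left_mono lambert_defect(2)) auto
  also have "{0<..N} = {1..N}" by auto
  finally show ?thesis by (simp add: g_def)
qed

text \<open>The series of \<open>chi d / (exp (d * x) - 1)\<close> over \<open>d\<close> equals that
  of \<open>r n * exp (- n * x)\<close> over \<open>n\<close>, where \<open>r\<close> is the divisor
  sum of \<open>chi\<close>. If \<open>L(1) = 0\<close>, it stays below \<open>B\<close> for all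
  \<open>x > 0\<close>; but \<open>r\<close> is nonnegative and at least 1 at squares, so the sum
  exceeds every bound as \<open>x\<close> tends to 0.\<close>

lemma char_L_1_nonzero_real:
  assumes chi: "dirichlet_character q chi" and mean: "char_mean q chi = 0"
    and sq: "\<And>n. coprime n q \<Longrightarrow> (chi n)\<^sup>2 = 1"
  shows "char_L q chi 1 \<noteq> 0"
proof
  assume "char_L q chi 1 = 0"
  then have rest0: "char_rest q chi 1 = 0" using mean by (simp add: char_L_def)
  define B where "B = 2 * real q"
  have B: "cmod (\<Sum>j=1..n. chi j) \<le> B" for n
    using norm_char_partial_sum_le[OF chi, of n] mean by (simp add: B_def)
  define \<rho> where "\<rho> n = Re (chi n)" for n
  have chi_vals: "chi n \<in> {-1, 0, 1}" for n
    using sq[of n] dirichlet_character_zero_iff[OF chi, of n] by (cases "coprime n q") (auto simp: power2_eq_1_iff)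
  have chi_\<rho>: "chi n = of_real (\<rho> n)" for n using chi_vals[of n] by (auto simp: \<rho>_def complex_eq_iff)
  have \<rho>_vals: "\<rho> n \<in> {-1, 0, 1}" for n using chi_vals[of n] by (auto simp: \<rho>_def)
  have \<rho>_mult: "\<rho> (m * n) = \<rho> m * \<rho> n" for m n
    using dirichlet_character_mult[OF chi, of m n] unfolding chi_\<rho> of_real_mult[symmetric] of_real_eq_iff .
  have \<rho>_1: "\<rho> (Suc 0) = 1" using dirichlet_character_1[OF chi] by (simp add: \<rho>_def)
  define r where "r n = (\<Sum>d | d dvd n. \<rho> d)" for n
  have r0: "r n \<ge> 0" if "n > 0" for n
    using divisor_sum_real_char_nonneg[OF \<rho>_mult \<rho>_1 \<rho>_vals that] by (simp add: r_def)
  have r1: "r (c\<^sup>2) \<ge> 1" if "c > 0" for c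
    using divisor_sum_real_char_nonneg[OF \<rho>_mult \<rho>_1 \<rho>_vals, of "c\<^sup>2"] that by (auto simp: r_def)

  have upper: "(\<Sum>k=1..K. exp (- real (k\<^sup>2) * x)) \<le> B" if x: "x > 0" for x K
  proof -
    define F where "F = (\<lambda>(d, m). chi d * of_real (exp (- (real d * real m * x))))"
    have geo: "summable (\<lambda>n. exp (- real (Suc n) * x / 2))"
    proof -
      have "summable (\<lambda>n. exp (- x / 2) ^ Suc n)"
        using x by (subst summable_Suc_iff) (intro summable_geometric, simp)
      moreover have "exp (- x / 2) ^ Suc n = exp (- real (Suc n) * x / 2)" for n
      proof -
        have "- real (Suc n) * x / 2 = real (Suc n) * (- x / 2)" by (simp add: field_simps)
        then show ?thesis by (simp only: exp_of_nat_mult)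
      qed
      ultimately show ?thesis by (simp only:)
    qed
    have F_norm: "(\<lambda>p. norm (F p)) summable_on {0<..} \<times> {0<..}"
    proof (rule summable_on_comparison_test)
      define e where "e n = complex_of_real (exp (- real n * x / 2))" for n
      have "summable (\<lambda>n. norm (e (Suc n)))" using geo by (simp add: e_def)
      then have e: "(\<lambda>n. norm (e n)) summable_on {0<..}" by (rule abs_summable_on_pos)
      show "(\<lambda>p. norm (e (fst p) * e (snd p))) summable_on {0<..} \<times> {0<..}"
        by (rule norm_product_summable_on[OF e e])
      fix p :: "nat \<times> nat" assume "p \<in> {0<..} \<times> {0<..}"
      then obtain d m where p: "p = (d, m)" "d \<ge> 1" "m \<ge> 1" by auto
      have "real d * 1 \<le> real d * real m" "1 * real m \<le> real d * real m"
        using p by (auto intro!: mult_left_mono mult_right_mono)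
      \<comment> \<open>For \<open>d, m \<ge> 1\<close> the product \<open>d * m\<close> is at least
        the mean of \<open>d\<close> and \<open>m\<close>; this separates the double series into a
        product of two geometric ones.\<close>
      then have "(real d + real m) / 2 * x \<le> real d * real m * x" using x by (intro mult_right_mono) auto
      then have "exp (- (real d * real m * x)) \<le> exp (- real d * x / 2 + - real m * x / 2)" by (simp add: algebra_simps)
      then have "exp (- (real d * real m * x)) \<le> exp (- real d * x / 2) * exp (- real m * x / 2)" by (simp only: exp_add)
      moreover have "norm (F p) \<le> 1 * exp (- (real d * real m * x))"
        unfolding F_def p prod.case norm_mult using norm_dirichlet_character_le[OF chi] by (intro mult_mono) auto
      ultimately show "norm (F p) \<le> norm (e (fst p) * e (snd p))" by (simp add: p e_def norm_mult)
    qed auto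
    have inner: "(\<Sum>\<^sub>\<infinity>m\<in>{0<..}. F (d, m)) = chi d * of_real (1 / (exp (real d * x) - 1))" if d: "d > 0" for d
    proof -
      define y where "y = exp (- (real d * x))"
      have y: "0 < y" "y < 1" using d x by (simp_all add: y_def)
      have pow: "exp (- (real d * real m * x)) = y ^ m" for m
        by (simp add: y_def exp_of_nat_mult[symmetric] mult_ac)
      have "summable (\<lambda>n. norm (complex_of_real (y ^ Suc n)))"
        using y by (simp only: norm_of_real abs_of_pos zero_less_power) (subst summable_Suc_iff, intro summable_geometric, simp)
      then have "infsum (\<lambda>m. complex_of_real (y ^ m)) {0<..} = (\<Sum>n. complex_of_real (y ^ Suc n))"
        by (rule infsum_pos_eq_suminf)
      also have "(\<lambda>n. y ^ Suc n) sums (y * (1 / (1 - y)))"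
        using sums_mult[OF geometric_sums[of y], of y] y by simp
      then have "(\<lambda>n. complex_of_real (y ^ Suc n)) sums of_real (y * (1 / (1 - y)))" by (rule sums_of_real)
      then have "(\<Sum>n. complex_of_real (y ^ Suc n)) = of_real (y / (1 - y))"
        by (simp only: sums_unique[symmetric]) simp
      also have "y / (1 - y) = 1 / (exp (real d * x) - 1)"
        using y by (simp add: y_def exp_minus field_simps)
      finally show ?thesis
        unfolding F_def prod.case pow infsum_cmult_right' by simp
    qed
    define b where "b d = chi d * of_real (1 / (exp (real d * x) - 1))" for d
    define c where "c n = (\<Sum>d | d dvd n. F (d, n div d))" for n
    have c_eq: "c n = of_real (r n * exp (- real n * x))" if n: "n \<in> {0<..}" for n
    proof -
      have "F (d, n div d) = of_real (\<rho> d * exp (- real n * x))" if "d dvd n" for d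
      proof -
        have "real d * real (n div d) = real n" using that by (metis dvd_mult_div_cancel of_nat_mult)
        then show ?thesis by (simp add: F_def chi_\<rho>)
      qed
      then show ?thesis by (simp add: c_def r_def sum_distrib_right)
    qed
    have "infsum c {0<..} = (\<Sum>\<^sub>\<infinity>d\<in>{0<..}. \<Sum>\<^sub>\<infinity>m\<in>{0<..}. F (d, m))"
      unfolding c_def by (rule infsum_divisor_swap(1)[OF F_norm])
    also have "\<dots> = infsum b {0<..}" by (rule infsum_cong) (simp add: inner b_def)
    finally have cb: "infsum c {0<..} = infsum b {0<..}" .
    have c_summ: "c summable_on {0<..}" unfolding c_def by (rule infsum_divisor_swap(2)[OF F_norm])

    \<comment> \<open>All terms \<open>r n * exp (- n * x)\<close> are nonnegative, so only the
      squares need to be kept for the lower bound.\<close>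
    have "(\<Sum>k=1..K. exp (- real (k\<^sup>2) * x)) \<le> Re (infsum c {0<..})"
    proof -
      define cr where "cr n = r n * exp (- real n * x)" for n
      have "(c has_sum infsum c {0<..}) {0<..}" by (rule has_sum_infsum[OF c_summ])
      then have "((\<lambda>n. Re (c n)) has_sum Re (infsum c {0<..})) {0<..}" by (rule has_sum_Re)
      then have "(cr has_sum Re (infsum c {0<..})) {0<..}"
        by (rule has_sum_cong[THEN iffD1, rotated]) (simp add: c_eq cr_def)
      then have cr_summ: "cr summable_on {0<..}" and Re_c: "Re (infsum c {0<..}) = infsum cr {0<..}"
        by (auto simp: summable_on_def infsumI)
      have "(\<Sum>k=1..K. exp (- real (k\<^sup>2) * x)) \<le> (\<Sum>k=1..K. cr (k\<^sup>2))"
      proof (rule sum_mono)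
        fix k assume "k \<in> {1..K}"
        then have "1 * exp (- real (k\<^sup>2) * x) \<le> r (k\<^sup>2) * exp (- real (k\<^sup>2) * x)"
          using r1[of k] by (intro mult_right_mono) auto
        then show "exp (- real (k\<^sup>2) * x) \<le> cr (k\<^sup>2)" by (simp add: cr_def)
      qed
      also have "\<dots> = sum cr ((\<lambda>k. k\<^sup>2) ` {1..K})"
        by (subst sum.reindex) (auto simp: inj_on_def power2_eq_iff)
      also have "\<dots> \<le> infsum cr {0<..}"
        by (rule finite_sum_le_infsum[OF cr_summ]) (use r0 in \<open>auto simp: cr_def\<close>)
      finally show ?thesis by (simp only: Re_c)
    qed
    also have "\<dots> \<le> cmod (infsum b {0<..})" unfolding cb by (rule complex_Re_le_cmod)
    also have "\<dots> \<le> B"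
    proof -
      have b_le: "norm (b (Suc n)) \<le> (2 / x) * exp (- real (Suc n) * x / 2)" for n
      proof -
        define u where "u = real (Suc n) * x"
        have "1 * x \<le> real (Suc n) * x" using x by (intro mult_right_mono) auto
        then have u: "u > 0" "u \<ge> x" using x unfolding u_def by linarith+
        have "u / 2 \<le> exp (u / 2) - 1" using exp_ge_add_one_self[of "u / 2"] by linarith
        moreover have "exp (u / 2) \<ge> 1" using u by simp
        ultimately have "exp (u / 2) * (u / 2) \<le> exp (u / 2) * (exp (u / 2) - 1)" by (intro mult_left_mono) auto
        also have "\<dots> = exp u - exp (u / 2)" by (simp add: right_diff_distrib exp_add[symmetric])
        also have "\<dots> \<le> exp u - 1" using \<open>exp (u / 2) \<ge> 1\<close> by simp
        finally have "exp (u / 2) * (u / 2) \<le> exp u - 1" .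
        moreover have "exp (u / 2) * (x / 2) \<le> exp (u / 2) * (u / 2)" using u by (intro mult_left_mono) auto
        ultimately have "exp (u / 2) * (x / 2) \<le> exp u - 1" by linarith
        then have "1 / (exp u - 1) \<le> 1 / (exp (u / 2) * (x / 2))"
          using x u by (intro divide_left_mono mult_pos_pos) auto
        also have "\<dots> = (2 / x) * exp (- u / 2)" by (simp add: exp_minus field_simps)
        finally have "\<bar>1 / (exp u - 1)\<bar> \<le> (2 / x) * exp (- u / 2)" using u by (subst abs_of_nonneg) auto
        moreover have "norm (b (Suc n)) \<le> 1 * \<bar>1 / (exp u - 1)\<bar>"
          unfolding b_def norm_mult norm_of_real u_def using norm_dirichlet_character_le[OF chi] by (intro mult_mono) auto
        moreover have "- real (Suc n) * x / 2 = - u / 2" by (simp only: u_def mult_minus_left)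
        ultimately show ?thesis by (simp only:)
      qed
      have "summable (\<lambda>n. norm (b (Suc n)))"
        by (rule summable_comparison_test'[OF summable_mult[OF geo, of "2 / x"], of 0]) (use b_le in simp)
      from infsum_pos_eq_suminf[OF this] summable_LIMSEQ[OF summable_norm_cancel[OF this]]
      have lim: "(\<lambda>N. \<Sum>n<N. b (Suc n)) \<longlonglongrightarrow> infsum b {0<..}" by simp
      have shift: "(\<Sum>n<N. h (Suc n)) = (\<Sum>d=1..N. h d)" for h :: "nat \<Rightarrow> complex" and N
        by (induction N) auto
      have "(\<lambda>n. (chi (Suc n) - char_mean q chi) * of_nat (Suc n) powr (-1)) sums char_rest q chi 1"
        by (rule char_rest(3)[OF chi]) simp
      then have "(\<lambda>n. chi (Suc n) / of_nat (Suc n)) sums 0"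
        by (simp add: mean rest0 powr_minus divide_inverse del: of_nat_Suc)
      then have lim0: "(\<lambda>N. \<Sum>d=1..N. chi d / of_nat d) \<longlonglongrightarrow> 0"
        unfolding sums_def shift[where h = "\<lambda>d. chi d / of_nat d"] .
      \<comment> \<open>The kernel is \<open>1 / u\<close> minus the defect. The part with
        \<open>1 / u\<close> consists of partial sums of \<open>L(1)\<close> and tends to 0, so in
        the limit only the bounded defect part remains.\<close>
      have split: "(\<Sum>d=1..N. b d) = (\<Sum>d=1..N. chi d / of_nat d) / of_real x - (\<Sum>d=1..N. chi d * of_real (lambert_defect (real d * x)))" for N
        unfolding sum_divide_distrib sum_subtractf[symmetric]
        by (intro sum.cong refl) (simp add: b_def lambert_defect_def right_diff_distrib)
      have "cmod (\<Sum>d=1..N. b d) \<le> cmod (\<Sum>d=1..N. chi d / of_nat d) / x + B" for N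
      proof -
        have "cmod (\<Sum>d=1..N. b d) \<le> cmod ((\<Sum>d=1..N. chi d / of_nat d) / of_real x) + cmod (\<Sum>d=1..N. chi d * of_real (lambert_defect (real d * x)))"
          unfolding split by (rule norm_triangle_ineq4)
        also have "\<dots> \<le> cmod (\<Sum>d=1..N. chi d / of_nat d) / x + B"
          using x by (intro add_mono lambert_partial_sum_bound B) (auto simp: norm_divide)
        finally show ?thesis .
      qed
      moreover have "(\<lambda>N. cmod (\<Sum>d=1..N. chi d / of_nat d) / x + B) \<longlonglongrightarrow> cmod 0 / x + B"
        using x by (intro tendsto_intros lim0) auto
      moreover have "(\<lambda>N. cmod (\<Sum>d=1..N. b d)) \<longlonglongrightarrow> cmod (infsum b {0<..})"
        using tendsto_norm[OF lim] unfolding shift .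
      ultimately have "cmod (infsum b {0<..}) \<le> cmod 0 / x + B" by (intro LIMSEQ_le) auto
      then show ?thesis by simp
    qed
    finally show ?thesis .
  qed
  \<comment> \<open>For \<open>x = 1 / K ^ 3\<close> each of the \<open>K\<close> exponentials is at
    least \<open>1 - K\<^sup>2 * x = 1 - 1 / K\<close>. Their sum is at least
    \<open>K - 1 = B + 1\<close>, beyond the bound \<open>B\<close>.\<close>
  define K where "K = 2 * q + 2"
  have K: "real K > 0" by (simp add: K_def)
  define x where "x = 1 / real K ^ 3"
  have x: "x > 0" using K by (simp add: x_def)
  have "real K * (1 - real K ^ 2 * x) = (\<Sum>k=1..K. 1 - real K ^ 2 * x)" by simp
  also have "\<dots> \<le> (\<Sum>k=1..K. exp (- real (k\<^sup>2) * x))"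
  proof (rule sum_mono)
    fix k assume "k \<in> {1..K}"
    then have "real (k\<^sup>2) \<le> real K ^ 2" by (simp add: power_mono)
    then have "real (k\<^sup>2) * x \<le> real K ^ 2 * x" using x by (intro mult_right_mono) auto
    then show "1 - real K ^ 2 * x \<le> exp (- real (k\<^sup>2) * x)"
      using exp_ge_add_one_self[of "- real (k\<^sup>2) * x"] by linarith
  qed
  also have "\<dots> \<le> B" by (rule upper[OF x])
  also have "real K * (1 - real K ^ 2 * x) = real K - 1"
    using K by (simp add: x_def right_diff_distrib eval_nat_numeral)
  finally show False by (simp add: K_def B_def)
qed

text \<open>The 3-4-1 argument breaks down only at \<open>t = 0\<close> when the square of
  \<open>chi\<close> is principal and so has a pole at 1. Such a \<open>chi\<close> takes only the
  values -1, 0 and 1, and the Lambert series applies.\<close>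

theorem char_L_1_line_nonzero:
  assumes chi: "dirichlet_character q chi" and "t \<noteq> 0 \<or> char_mean q chi = 0"
  shows "char_L q chi (Complex 1 t) \<noteq> 0"
proof (cases "t \<noteq> 0 \<or> char_mean q (\<lambda>n. (chi n)\<^sup>2) = 0")
  case True
  then show ?thesis by (rule char_L_1_nonzero_by_341[OF assms])
next
  case False
  then have t: "t = 0" and mean: "char_mean q chi = 0" and "char_mean q (\<lambda>n. (chi n)\<^sup>2) \<noteq> 0"
    using assms(2) by auto
  then have "(\<lambda>n. (chi n)\<^sup>2) = principal_char q"
    by (intro char_mean_nonzero_imp_principal dirichlet_character_square chi)
  then have "(chi n)\<^sup>2 = principal_char q n" for n by (rule fun_cong)
  then have "char_L q chi 1 \<noteq> 0"
    by (intro char_L_1_nonzero_real[OF chi mean]) (simp add: principal_char_def)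
  moreover have "Complex 1 t = 1" using t by (simp add: complex_eq_iff)
  ultimately show ?thesis by simp
qed

section \<open>Bounds for the inverse of an L-function\<close>

text \<open>The Moebius map \<open>h / (2 * M - h)\<close> sends the half-plane
  \<open>Re h < M\<close> into the unit disc and fixes 0. The Schwarz lemma bounds the image by
  \<open>|z| / R\<close>, and solving back for \<open>h\<close> gives the estimate.\<close>

lemma borel_caratheodory:
  fixes f :: "complex \<Rightarrow> complex"
  assumes hol: "f holomorphic_on ball 0 R" and f0: "f 0 = 0" and M: "M > 0"
    and Re_f: "\<And>z. cmod z < R \<Longrightarrow> Re (f z) < M" and z: "cmod z < R"
  shows "cmod (f z) \<le> 2 * M * cmod z / (R - cmod z)"
proof -
  have R: "R > 0" using order_le_less_trans[OF norm_ge_zero z] .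
  define h where "h \<zeta> = f (of_real R * \<zeta>)" for \<zeta>
  define \<phi> where "\<phi> \<zeta> = h \<zeta> / (2 * of_real M - h \<zeta>)" for \<zeta>
  have inb: "cmod (of_real R * \<zeta>) < R" if "cmod \<zeta> < 1" for \<zeta>
    using that R by (simp add: norm_mult)
  have Re_h: "Re (h \<zeta>) < M" if "cmod \<zeta> < 1" for \<zeta>
    unfolding h_def by (rule Re_f[OF inb[OF that]])
  have den: "2 * of_real M - h \<zeta> \<noteq> 0" if "cmod \<zeta> < 1" for \<zeta>
  proof
    assume "2 * of_real M - h \<zeta> = 0"
    then have "Re (2 * of_real M - h \<zeta>) = 0" by simp
    then show False using Re_h[OF that] M by simp
  qed
  have h_hol: "h holomorphic_on ball 0 1"
  proof -
    have "(f \<circ> (\<lambda>\<zeta>. of_real R * \<zeta>)) holomorphic_on ball 0 1"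
      by (rule holomorphic_on_compose_gen[OF _ hol]) (use inb in \<open>auto intro!: holomorphic_intros\<close>)
    then show ?thesis by (simp add: h_def[abs_def] comp_def)
  qed
  have phi_hol: "\<phi> holomorphic_on ball 0 1"
    unfolding \<phi>_def by (intro holomorphic_intros h_hol) (use den in auto)
  have phi_less: "cmod (\<phi> \<zeta>) < 1" if "cmod \<zeta> < 1" for \<zeta>
  proof -
    have "(cmod (2 * of_real M - h \<zeta>))\<^sup>2 - (cmod (h \<zeta>))\<^sup>2 = 4 * M * (M - Re (h \<zeta>))"
      unfolding cmod_power2 by (simp add: power2_eq_square algebra_simps)
    also have "\<dots> > 0" using M Re_h[OF that] by simp
    finally have "(cmod (h \<zeta>))\<^sup>2 < (cmod (2 * of_real M - h \<zeta>))\<^sup>2" by simp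
    then have "cmod (h \<zeta>) < cmod (2 * of_real M - h \<zeta>)" by (rule power2_less_imp_less) simp
    then show ?thesis using den[OF that] by (simp add: \<phi>_def norm_divide)
  qed
  define \<zeta> where "\<zeta> = z / of_real R"
  have \<zeta>: "cmod \<zeta> = cmod z / R" using R by (simp add: \<zeta>_def norm_divide)
  have \<zeta>1: "cmod \<zeta> < 1" using z R by (simp add: \<zeta>)
  have "\<phi> 0 = 0" by (simp add: \<phi>_def h_def f0)
  then have phi_le: "cmod (\<phi> \<zeta>) \<le> cmod \<zeta>"
    using Schwarz_Lemma(1)[OF phi_hol _ phi_less \<zeta>1] by simp
  have hz: "h \<zeta> = f z" using R by (simp add: h_def \<zeta>_def)
  have "1 + \<phi> \<zeta> \<noteq> 0" using phi_less[OF \<zeta>1] by (metis add_eq_0_iff2 less_irrefl norm_minus_cancel norm_one)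
  moreover have "h \<zeta> * (1 + \<phi> \<zeta>) = 2 * of_real M * \<phi> \<zeta>"
    using den[OF \<zeta>1] by (simp add: \<phi>_def field_simps)
  ultimately have "f z = 2 * of_real M * \<phi> \<zeta> / (1 + \<phi> \<zeta>)" by (simp add: hz[symmetric] field_simps)
  then have "cmod (f z) = 2 * M * cmod (\<phi> \<zeta>) / cmod (1 + \<phi> \<zeta>)"
    using M by (simp add: norm_mult norm_divide)
  also have "\<dots> \<le> 2 * M * cmod \<zeta> / (1 - cmod \<zeta>)"
  proof (rule frac_le)
    have "1 - cmod (\<phi> \<zeta>) \<le> cmod (1 + \<phi> \<zeta>)"
      using norm_triangle_ineq2[of 1 "- \<phi> \<zeta>"] by simp
    then show "1 - cmod \<zeta> \<le> cmod (1 + \<phi> \<zeta>)" using phi_le by linarith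
  qed (use M phi_le \<zeta>1 in auto)
  also have "\<dots> = 2 * M * cmod z / (R - cmod z)"
    using R z by (simp add: \<zeta> field_simps)
  finally show ?thesis .
qed

text \<open>A quantitative substitute for the three circles theorem, obtained by using for each Taylor
  coefficient the better one of the two Cauchy estimates.\<close>

lemma two_circles_bound:
  fixes r1 r r2 \<eta> :: real
  assumes r: "0 < r1" "0 < r" "r < r2" and "r1 \<le> r2" and \<eta>: "\<eta> > 0"
  obtains C where "C \<ge> 0" "\<And>f R M1 M2 z. f holomorphic_on ball 0 R \<Longrightarrow> r2 < R \<Longrightarrow>
     (\<And>z. cmod z \<le> r1 \<Longrightarrow> cmod (f z) \<le> M1) \<Longrightarrow> (\<And>z. cmod z \<le> r2 \<Longrightarrow> cmod (f z) \<le> M2) \<Longrightarrow>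
     cmod z \<le> r \<Longrightarrow> cmod (f z) \<le> C * M1 + \<eta> * M2"
proof -
  define \<rho> where "\<rho> = r / r2"
  have \<rho>: "0 < \<rho>" "\<rho> < 1" using r by (auto simp: \<rho>_def)
  \<comment> \<open>The cut-off \<open>K\<close> makes the tail of the series with outer Cauchy
    estimates smaller than \<open>\<eta> * M2\<close>. It depends only on the radii and
    \<open>\<eta>\<close>, so the constant \<open>C\<close> is the same for all functions.\<close>
  have "(\<lambda>K. \<rho> ^ K / (1 - \<rho>)) \<longlonglongrightarrow> 0 / (1 - \<rho>)"
    using \<rho> by (intro tendsto_divide LIMSEQ_realpow_zero tendsto_const) auto
  then have "eventually (\<lambda>K. \<rho> ^ K / (1 - \<rho>) < \<eta>) sequentially"
    using \<eta> by (intro order_tendstoD(2)) auto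
  then obtain K where K: "\<rho> ^ K / (1 - \<rho>) < \<eta>" by (auto simp: eventually_sequentially)
  define C where "C = (\<Sum>k<K. (r / r1) ^ k)"
  have "C \<ge> 0" using r by (simp add: C_def sum_nonneg)
  moreover have "cmod (f z) \<le> C * M1 + \<eta> * M2"
    if hol: "f holomorphic_on ball 0 R" and R: "r2 < R"
      and M1: "\<And>z. cmod z \<le> r1 \<Longrightarrow> cmod (f z) \<le> M1" and M2: "\<And>z. cmod z \<le> r2 \<Longrightarrow> cmod (f z) \<le> M2"
      and z: "cmod z \<le> r" for f :: "complex \<Rightarrow> complex" and R M1 M2 z
  proof -
    define c where "c k = (deriv ^^ k) f 0 / fact k" for k
    have M0: "M1 \<ge> 0" "M2 \<ge> 0"
      using order_trans[OF norm_ge_zero M1[of 0]] order_trans[OF norm_ge_zero M2[of 0]] r by auto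
    have cauchy: "cmod (c k) \<le> M / \<rho>' ^ k"
      if "0 < \<rho>'" "\<rho>' \<le> r2" "\<And>z. cmod z \<le> \<rho>' \<Longrightarrow> cmod (f z) \<le> M" for \<rho>' M k
    proof -
      have sub: "cball 0 \<rho>' \<subseteq> ball (0::complex) R" using that R by auto
      have "cmod ((deriv ^^ k) f 0) \<le> fact k * M / \<rho>' ^ k"
      proof (rule Cauchy_inequality)
        show "f holomorphic_on ball 0 \<rho>'" by (rule holomorphic_on_subset[OF hol]) (use sub in auto)
        show "continuous_on (cball 0 \<rho>') f"
          using holomorphic_on_imp_continuous_on[OF holomorphic_on_subset[OF hol sub]] .
      qed (use that in auto)
      then show ?thesis by (simp add: c_def norm_divide field_simps)
    qed
    have c1: "cmod (c k) \<le> M1 / r1 ^ k" for k by (rule cauchy) (use r \<open>r1 \<le> r2\<close> M1 in auto)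
    have c2: "cmod (c k) \<le> M2 / r2 ^ k" for k by (rule cauchy) (use r M2 in auto)
    have zR: "z \<in> ball 0 R" using z r R by simp
    have sums: "(\<lambda>k. c k * z ^ k) sums f z"
      using holomorphic_power_series[OF hol zR] by (simp add: c_def)
    have t1: "cmod (c k * z ^ k) \<le> M1 * (r / r1) ^ k" for k
    proof -
      have "cmod (c k * z ^ k) \<le> (M1 / r1 ^ k) * r ^ k"
        unfolding norm_mult norm_power using c1 z M0 r by (intro mult_mono power_mono) auto
      then show ?thesis by (simp add: power_divide)
    qed
    have t2: "cmod (c k * z ^ k) \<le> M2 * \<rho> ^ k" for k
    proof -
      have "cmod (c k * z ^ k) \<le> (M2 / r2 ^ k) * r ^ k"
        unfolding norm_mult norm_power using c2 z M0 r by (intro mult_mono power_mono) auto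
      then show ?thesis by (simp add: \<rho>_def power_divide)
    qed
    have geo: "summable (\<lambda>k. M2 * \<rho> ^ k)" using \<rho> by (intro summable_mult summable_geometric) simp
    have summ: "summable (\<lambda>k. cmod (c k * z ^ k))"
      by (rule summable_comparison_test'[OF geo, of 0]) (use t2 in simp)
    have "cmod (f z) \<le> (\<Sum>k. cmod (c k * z ^ k))"
      unfolding sums_unique[OF sums] by (rule summable_norm[OF summ])
    also have "\<dots> = (\<Sum>k. cmod (c (k + K) * z ^ (k + K))) + (\<Sum>k<K. cmod (c k * z ^ k))"
      by (rule suminf_split_initial_segment[OF summ])
    also have "\<dots> \<le> (\<Sum>k. M2 * \<rho> ^ (k + K)) + (\<Sum>k<K. M1 * (r / r1) ^ k)"
    proof (intro add_mono suminf_le sum_mono t1 t2)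
      show "summable (\<lambda>k. cmod (c (k + K) * z ^ (k + K)))" by (rule summable_ignore_initial_segment[OF summ])
      show "summable (\<lambda>k. M2 * \<rho> ^ (k + K))" by (rule summable_ignore_initial_segment[OF geo])
    qed
    also have "(\<Sum>k<K. M1 * (r / r1) ^ k) = C * M1" by (simp add: C_def sum_distrib_left mult.commute)
    also have "(\<Sum>k. M2 * \<rho> ^ (k + K)) = M2 * (\<rho> ^ K / (1 - \<rho>))"
    proof -
      have "(\<lambda>k. M2 * \<rho> ^ K * \<rho> ^ k) sums (M2 * \<rho> ^ K * (1 / (1 - \<rho>)))"
        using \<rho> by (intro sums_mult geometric_sums) simp
      then show ?thesis by (simp add: sums_iff power_add mult_ac)
    qed
    also have "M2 * (\<rho> ^ K / (1 - \<rho>)) \<le> M2 * \<eta>" using K M0 by (intro mult_left_mono) auto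
    finally show ?thesis by (simp add: mult.commute add.commute)
  qed
  ultimately show thesis by (rule that)
qed

section \<open>Logarithmic bounds for the inverse L-function\<close>

definition zeta54 :: real where "zeta54 = (\<Sum>n. real (Suc n) powr (-5/4))"

lemma zeta54_ge_1: "zeta54 \<ge> 1"
proof -
  have "summable (\<lambda>n. real (Suc n) powr (-5/4))" by (rule summable_Suc_powr) simp
  then have "(\<Sum>n\<in>{0}. real (Suc n) powr (-5/4)) \<le> zeta54"
    unfolding zeta54_def by (intro sum_le_suminf) auto
  then show ?thesis by simp
qed

text \<open>The abscissa 5/4 is chosen because the disc of radius 3/4 about \<open>2 + i t\<close>
  lies to its right. There the absolutely convergent series bound L and its inverse by zeta(5/4),
  independently of \<open>q\<close> and \<open>t\<close>.\<close>

lemma char_L_bounds_54: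
  assumes chi: "dirichlet_character q chi" and s: "Re s \<ge> 5/4"
  shows "cmod (char_L q chi s) \<le> zeta54" and "cmod (1 / char_L q chi s) \<le> zeta54"
proof -
  have "(\<Sum>n. real (Suc n) powr (- Re s)) \<le> zeta54"
    unfolding zeta54_def using s by (intro suminf_le powr_mono summable_Suc_powr) auto
  moreover have "Re s > 1" using s by simp
  ultimately show "cmod (char_L q chi s) \<le> zeta54" "cmod (1 / char_L q chi s) \<le> zeta54"
    using char_L_inverse(4,5)[OF chi, of s] by linarith+
qed

text \<open>L with its possible pole removed. The factor \<open>(s - 1) / (s + 1)\<close> is at most
  1 in modulus for \<open>Re s \<ge> 0\<close>, so it does not spoil bounds. The product is expanded
  through \<open>zeta_num\<close>, which gives the correct value at \<open>s = 1\<close>, where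
  \<open>char_L\<close> itself has a default value.\<close>

definition char_G :: "nat \<Rightarrow> (nat \<Rightarrow> complex) \<Rightarrow> complex \<Rightarrow> complex" where
  "char_G q chi s = (if char_mean q chi = 0 then char_L q chi s
     else (char_mean q chi * zeta_num s + (s - 1) * char_rest q chi s) / (s + 1))"

lemma norm_minus_le_norm_plus: "Re s \<ge> 0 \<Longrightarrow> cmod (s - 1) \<le> cmod (s + 1)"
proof (rule power2_le_imp_le)
  assume "Re s \<ge> 0"
  then have "(Re (s - 1))\<^sup>2 \<le> (Re (s + 1))\<^sup>2" by (intro power2_le_iff_abs_le[THEN iffD2]) auto
  then show "(cmod (s - 1))\<^sup>2 \<le> (cmod (s + 1))\<^sup>2" unfolding cmod_power2 by simp
qed simp

lemma norm_plus_one_ge: "Re s \<ge> 0 \<Longrightarrow> 1 \<le> cmod (s + 1)"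
  using complex_Re_le_cmod[of "s + 1"] by simp

lemma char_G_eq:
  assumes "char_mean q chi \<noteq> 0" "s \<noteq> 1" "Re s > 0"
  shows "char_G q chi s = (s - 1) / (s + 1) * char_L q chi s"
proof -
  have "s + 1 \<noteq> 0" using assms(3) by (auto simp: complex_eq_iff)
  have "(s - 1) * char_L q chi s = char_mean q chi * zeta_num s + (s - 1) * char_rest q chi s"
    using assms(2) by (simp add: char_L_def distrib_left)
  then show ?thesis using assms(1) by (simp add: char_G_def)
qed

lemma char_G_holomorphic:
  assumes chi: "dirichlet_character q chi"
  shows "char_G q chi holomorphic_on {s. Re s > 0}"
proof (cases "char_mean q chi = 0")
  case True
  then show ?thesis using char_L_holomorphic(2)[OF chi] by (simp add: char_G_def[abs_def])
next
  case False
  have "(\<lambda>s. (char_mean q chi * zeta_num s + (s - 1) * char_rest q chi s) / (s + 1)) holomorphic_on {s. Re s > 0}"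
    by (intro holomorphic_intros zeta_num(1) char_rest(1)[OF chi]) (auto simp: complex_eq_iff)
  then show ?thesis using False by (simp add: char_G_def[abs_def])
qed

text \<open>Multiplication by \<open>s - 1\<close> would raise the degree of growth in
  \<open>s\<close> by one; the division by \<open>s + 1\<close> brings it back to linear.\<close>

lemma norm_char_G_le:
  assumes chi: "dirichlet_character q chi" and s: "Re s \<ge> 1/2"
  shows "cmod (char_G q chi s) \<le> (1 + 3 * zeta32) * (real q * (1 + cmod s))"
proof -
  have q: "real q \<ge> 1" using chi by (simp add: dirichlet_character_def)
  have c: "zeta32 \<ge> 0" by (rule zeta32_nonneg)
  have rest: "cmod (char_rest q chi s) \<le> 2 * real q * cmod s * zeta32" by (rule char_rest(2)[OF chi s])
  have qs: "cmod s \<le> real q * cmod s" using q mult_right_mono[of 1 "real q" "cmod s"] by simp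
  have qsc: "cmod s * zeta32 \<le> real q * cmod s * zeta32" using qs c by (intro mult_right_mono)
  have total: "1 + cmod s * zeta32 + 2 * real q * cmod s * zeta32 \<le> (1 + 3 * zeta32) * (real q * (1 + cmod s))"
  proof -
    have "(1 + 3 * zeta32) * (real q * (1 + cmod s)) = real q + real q * cmod s + 3 * zeta32 * real q + 3 * (real q * cmod s * zeta32)"
      by (simp add: algebra_simps)
    moreover have "0 \<le> real q * cmod s" "0 \<le> 3 * zeta32 * real q" using c by auto
    ultimately show ?thesis using q qsc by linarith
  qed
  show ?thesis
  proof (cases "char_mean q chi = 0")
    case True
    then have "cmod (char_G q chi s) = cmod (char_rest q chi s)" by (simp add: char_G_def char_L_def)
    moreover have "0 \<le> cmod s * zeta32" using c by simp
    ultimately show ?thesis using rest total by linarith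
  next
    case False
    have s1: "1 \<le> cmod (s + 1)" "cmod (s - 1) \<le> cmod (s + 1)"
      using norm_plus_one_ge[of s] norm_minus_le_norm_plus[of s] s by auto
    have "cmod (char_mean q chi * zeta_num s + (s - 1) * char_rest q chi s)
        \<le> 1 * cmod (zeta_num s) + cmod (s - 1) * cmod (char_rest q chi s)"
      using norm_char_mean_le[OF chi]
      by (intro order_trans[OF norm_triangle_ineq] add_mono) (auto simp: norm_mult mult_left_le_one_le)
    also have "\<dots> \<le> 1 * (1 + cmod (s - 1) * cmod s * zeta32) + cmod (s - 1) * (2 * real q * cmod s * zeta32)"
      using zeta_num(2)[OF s] rest by (intro add_mono mult_left_mono) auto
    also have "\<dots> \<le> cmod (s + 1) * 1 + cmod (s + 1) * (cmod s * zeta32) + cmod (s + 1) * (2 * real q * cmod s * zeta32)"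
    proof -
      have "cmod (s - 1) * (cmod s * zeta32) \<le> cmod (s + 1) * (cmod s * zeta32)"
        "cmod (s - 1) * (2 * real q * cmod s * zeta32) \<le> cmod (s + 1) * (2 * real q * cmod s * zeta32)"
        using s1 c by (intro mult_right_mono; simp)+
      then show ?thesis using s1 by (simp add: mult.assoc)
    qed
    also have "\<dots> = cmod (s + 1) * (1 + cmod s * zeta32 + 2 * real q * cmod s * zeta32)" by (simp add: algebra_simps)
    also have "\<dots> \<le> cmod (s + 1) * ((1 + 3 * zeta32) * (real q * (1 + cmod s)))"
      using total by (intro mult_left_mono) auto
    finally have "cmod (char_mean q chi * zeta_num s + (s - 1) * char_rest q chi s) / cmod (s + 1) \<le> (1 + 3 * zeta32) * (real q * (1 + cmod s))"
      using s1 by (subst pos_divide_le_eq) (auto simp: mult.commute)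
    then show ?thesis using False by (simp add: char_G_def norm_divide)
  qed
qed

lemma char_G_bounds_54:
  assumes chi: "dirichlet_character q chi" and s: "Re s \<ge> 5/4"
  shows "cmod (char_G q chi s) \<le> zeta54"
proof (cases "char_mean q chi = 0")
  case True
  then show ?thesis using char_L_bounds_54(1)[OF chi s] by (simp add: char_G_def)
next
  case False
  have "s \<noteq> 1" "Re s > 0" using s by auto
  then have "cmod (char_G q chi s) = cmod (s - 1) / cmod (s + 1) * cmod (char_L q chi s)"
    using char_G_eq[OF False] by (simp add: norm_mult norm_divide)
  also have "\<dots> \<le> 1 * zeta54"
  proof (intro mult_mono char_L_bounds_54[OF chi s])
    show "cmod (s - 1) / cmod (s + 1) \<le> 1"
      using norm_minus_le_norm_plus[of s] norm_plus_one_ge[of s] s by (subst divide_le_eq_1_pos) auto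
  qed auto
  finally show ?thesis by simp
qed

lemma char_G_center:
  assumes chi: "dirichlet_character q chi"
  shows "cmod (1 / char_G q chi (Complex 2 t)) \<le> 3 * zeta54"
proof -
  define s where "s = Complex 2 t"
  have s: "Re s \<ge> 5/4" "s \<noteq> 1" "Re s > 0" by (auto simp: s_def complex_eq_iff)
  have L: "cmod (1 / char_L q chi s) \<le> zeta54" by (rule char_L_bounds_54(2)[OF chi s(1)])
  show ?thesis
  proof (cases "char_mean q chi = 0")
    case True
    then show ?thesis using L zeta54_ge_1 by (simp add: char_G_def s_def)
  next
    case False
    have "cmod (s + 1) \<le> cmod (s - 1) + cmod 2" using norm_triangle_ineq[of "s - 1" 2] by (simp add: add.commute)
    moreover have s1: "1 \<le> cmod (s - 1)" using complex_Re_le_cmod[of "s - 1"] by (simp add: s_def)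
    ultimately have "cmod (s + 1) \<le> 3 * cmod (s - 1)" by simp
    then have "cmod (s + 1) / cmod (s - 1) \<le> 3" using s1 by (subst pos_divide_le_eq) auto
    then have "cmod (s + 1) / cmod (s - 1) * cmod (1 / char_L q chi s) \<le> 3 * zeta54"
      using L by (intro mult_mono) auto
    moreover have "1 / char_G q chi s = (s + 1) / (s - 1) * (1 / char_L q chi s)"
      using char_G_eq[OF False s(2,3)] by simp
    ultimately show ?thesis by (simp add: s_def norm_mult norm_divide)
  qed
qed

text \<open>GRH covers \<open>1/2 < Re s < 1\<close>. The line \<open>Re s = 1\<close> is the
  classical non-vanishing, and to its right the Moebius series is an inverse. At a removed pole
  \<open>s = 1\<close> the value is half of the mean, since \<open>zeta_num 1 = 1\<close>.\<close>

lemma char_G_nonzero: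
  assumes GRH: generalized_riemann_hypothesis and chi: "dirichlet_character q chi" and s: "Re s > 1/2"
  shows "char_G q chi s \<noteq> 0"
proof -
  have nz: "char_L q chi s \<noteq> 0" if "s \<noteq> 1 \<or> char_mean q chi = 0"
  proof -
    consider "Re s < 1" | "Re s = 1" | "Re s > 1" by linarith
    then show ?thesis
    proof cases
      case 1
      have "s \<noteq> 1" using 1 by auto
      then have "dirichlet_L chi s = char_L q chi s" using s by (intro dirichlet_L_eq_char_L[OF chi]) auto
      moreover have "dirichlet_L chi s \<noteq> 0"
      proof
        assume "dirichlet_L chi s = 0"
        then have "Re s = 1/2" using GRH chi s 1 unfolding generalized_riemann_hypothesis_def by force
        then show False using s by simp
      qed
      ultimately show ?thesis by simp
    next
      case 2
      then have sc: "s = Complex 1 (Im s)" by (simp add: complex_eq_iff)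
      have "Im s \<noteq> 0 \<or> char_mean q chi = 0" using that 2 by (auto simp: complex_eq_iff)
      from char_L_1_line_nonzero[OF chi this] show ?thesis using sc by simp
    next
      case 3
      then show ?thesis by (rule char_L_inverse(3)[OF chi])
    qed
  qed
  show ?thesis
  proof (cases "char_mean q chi = 0")
    case True
    then show ?thesis using nz by (simp add: char_G_def)
  next
    case mean: False
    show ?thesis
    proof (cases "s = 1")
      case True
      then show ?thesis using mean by (simp add: char_G_def zeta_num(4))
    next
      case False
      have "s + 1 \<noteq> 0" using s by (auto simp: complex_eq_iff)
      then show ?thesis using char_G_eq[OF mean False] nz False s by simp
    qed
  qed
qed

text \<open>With no zeros to the right of 1/2, the quotient of \<open>char_G\<close> by its value at
  \<open>s0 = 2 + i t\<close> has a logarithm \<open>g\<close> on the disc of radius 3/2.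
  Borel--Caratheodory bounds \<open>g\<close> by a constant near the centre and by
  O(\<open>ln (q * (2 + |t|))\<close>) up to radius \<open>3/2 - \<epsilon> / 2\<close>. Combining
  both circles brings the factor of the logarithm down to \<open>\<epsilon>\<close>, which
  exponentiates to the power \<open>\<epsilon>\<close>.\<close>

lemma norm_inverse_char_G_le:
  assumes GRH: generalized_riemann_hypothesis and \<epsilon>: "0 < \<epsilon>" "\<epsilon> \<le> 1/2"
  obtains A where "A \<ge> 0" "\<And>q chi s. dirichlet_character q chi \<Longrightarrow> 1/2 + \<epsilon> \<le> Re s \<Longrightarrow> Re s \<le> 3/2 + \<epsilon> \<Longrightarrow>
    cmod (1 / char_G q chi s) \<le> A * (real q * (2 + \<bar>Im s\<bar>)) powr \<epsilon>"
proof -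
  \<comment> \<open>At this radius a gap \<open>\<epsilon> / 2\<close> is left for
    Borel--Caratheodory, which costs \<open>6 / \<epsilon>\<close>; the weight
    \<open>\<epsilon>\<^sup>2 / 6\<close> for the outer circle turns that into
    \<open>\<epsilon> * M2\<close>.\<close>
  define r2 where "r2 = 3/2 - \<epsilon> / 2"
  obtain C where C: "C \<ge> 0" "\<And>f R M1 M2 z. f holomorphic_on ball 0 R \<Longrightarrow> r2 < R \<Longrightarrow>
     (\<And>z. cmod z \<le> 1/2 \<Longrightarrow> cmod (f z) \<le> M1) \<Longrightarrow> (\<And>z. cmod z \<le> r2 \<Longrightarrow> cmod (f z) \<le> M2) \<Longrightarrow>
     cmod z \<le> 3/2 - \<epsilon> \<Longrightarrow> cmod (f z) \<le> C * M1 + \<epsilon>\<^sup>2 / 6 * M2"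
    by (rule two_circles_bound[of "1/2" "3/2 - \<epsilon>" r2 "\<epsilon>\<^sup>2 / 6"]) (use \<epsilon> in \<open>auto simp: r2_def\<close>)
  \<comment> \<open>A bound for the real part of \<open>g\<close> on the disc of radius 3/4; adding
    1 makes it strict and positive. In \<open>k\<close> the 15 combines
    \<open>1 + |s0 + z| \<le> 5 * (2 + |t|)\<close> with the bound \<open>3 * zeta54\<close> for the
    inverse at the centre.\<close>
  define M1 where "M1 = ln (3 * zeta54\<^sup>2) + 1"
  define k where "k = 15 * zeta54 * (1 + 3 * zeta32)"
  define A where "A = 3 * zeta54 * exp (C * (4 * M1) + \<epsilon> * (ln k + 1))"
  have Z: "zeta54 \<ge> 1" by (rule zeta54_ge_1)
  have c: "zeta32 \<ge> 0" by (rule zeta32_nonneg)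
  have k1: "k \<ge> 1"
  proof -
    have "1 * 1 \<le> (15 * zeta54) * (1 + 3 * zeta32)" using Z c by (intro mult_mono) auto
    then show ?thesis by (simp add: k_def)
  qed
  have "1 \<le> zeta54\<^sup>2" using Z by simp
  then have "ln (3 * zeta54\<^sup>2) \<ge> 0" by (intro ln_ge_zero) linarith
  then have M1: "M1 > 0" by (simp add: M1_def)
  have "A \<ge> 0" using Z by (simp add: A_def)
  moreover have "cmod (1 / char_G q chi s) \<le> A * (real q * (2 + \<bar>Im s\<bar>)) powr \<epsilon>"
    if chi: "dirichlet_character q chi" and s: "1/2 + \<epsilon> \<le> Re s" "Re s \<le> 3/2 + \<epsilon>" for q chi s
  proof -
    define t where "t = Im s"
    define s0 where "s0 = Complex 2 t"
    define G where "G = char_G q chi"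
    have q: "real q \<ge> 1" using chi by (simp add: dirichlet_character_def)
    define T where "T = real q * (2 + \<bar>t\<bar>)"
    have T: "T \<ge> 1"
    proof -
      have "1 * 1 \<le> real q * (2 + \<bar>t\<bar>)" using q by (intro mult_mono) auto
      then show ?thesis by (simp add: T_def)
    qed
    define M2 where "M2 = ln (k * T) + 1"
    have M2: "M2 > 0"
    proof -
      have "1 * 1 \<le> k * T" using k1 T by (intro mult_mono) auto
      then have "ln (k * T) \<ge> 0" by (intro ln_ge_zero) simp
      then show ?thesis by (simp add: M2_def)
    qed
    have Re_s0: "Re (s0 + z) > 2 - \<rho>" if "cmod z < \<rho>" for z \<rho>
      using abs_Re_le_cmod[of z] that by (simp add: s0_def)
    have nzG: "G (s0 + z) \<noteq> 0" if "cmod z < 3/2" for z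
      unfolding G_def using Re_s0[OF that] by (intro char_G_nonzero[OF GRH chi]) simp
    have G0: "G s0 \<noteq> 0" using nzG[of 0] by simp
    define h where "h z = G (s0 + z) / G s0" for z
    have h_hol: "h holomorphic_on ball 0 (3/2)"
    proof -
      have "(G \<circ> (\<lambda>z. s0 + z)) holomorphic_on ball 0 (3/2)"
        unfolding G_def
      proof (rule holomorphic_on_compose_gen[OF _ char_G_holomorphic[OF chi]])
        show "(\<lambda>z. s0 + z) ` ball 0 (3/2) \<subseteq> {s. Re s > 0}"
          using Re_s0[of _ "3/2"] by (force simp: dist_norm)
      qed (intro holomorphic_intros)
      then have "(\<lambda>z. G (s0 + z)) holomorphic_on ball 0 (3/2)" by (simp add: comp_def)
      then show ?thesis unfolding h_def using G0 by (intro holomorphic_intros) auto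
    qed
    have h_nz: "h z \<noteq> 0" if "z \<in> ball 0 (3/2)" for z using nzG[of z] G0 that by (simp add: h_def)
    obtain g0 where g0: "g0 holomorphic_on ball 0 (3/2)" "\<And>z. z \<in> ball 0 (3/2) \<Longrightarrow> h z = exp (g0 z)"
      using contractible_imp_holomorphic_log[OF h_hol convex_imp_contractible[OF convex_ball] h_nz] by blast
    define g where "g z = g0 z - g0 0" for z
    have g_hol: "g holomorphic_on ball 0 (3/2)" unfolding g_def by (intro holomorphic_intros g0(1))
    have "exp (g0 0) = 1" using g0(2)[of 0] G0 by (simp add: h_def)
    then have h_eq: "h z = exp (g z)" if "cmod z < 3/2" for z
      using g0(2)[of z] that by (simp add: g_def exp_diff)
    have Re_g: "Re (g z) = ln (cmod (h z))" if "cmod z < 3/2" for z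
      using h_eq[OF that] by simp
    have g00: "g 0 = 0" by (simp add: g_def)
    have cent: "cmod (1 / G s0) \<le> 3 * zeta54" unfolding G_def s0_def by (rule char_G_center[OF chi])
    have small: "Re (g z) < M1" if z: "cmod z < 3/4" for z
    proof -
      have "cmod (G (s0 + z)) \<le> zeta54"
        unfolding G_def using Re_s0[OF z] by (intro char_G_bounds_54[OF chi]) simp
      then have "cmod (G (s0 + z)) * cmod (1 / G s0) \<le> zeta54 * (3 * zeta54)"
        using cent Z by (intro mult_mono) auto
      then have "cmod (h z) \<le> 3 * zeta54\<^sup>2" by (simp add: h_def norm_divide power2_eq_square)
      moreover have "cmod (h z) > 0" using h_nz[of z] z by simp
      ultimately have "ln (cmod (h z)) \<le> ln (3 * zeta54\<^sup>2)" by (intro ln_mono) auto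
      then show ?thesis using Re_g[of z] z by (simp add: M1_def)
    qed
    have large: "Re (g z) < M2" if z: "cmod z < 3/2" for z
    proof -
      have "cmod (G (s0 + z)) \<le> (1 + 3 * zeta32) * (real q * (1 + cmod (s0 + z)))"
        unfolding G_def using Re_s0[OF z] by (intro norm_char_G_le[OF chi]) simp
      also have "\<dots> \<le> (1 + 3 * zeta32) * (real q * (5 * (2 + \<bar>t\<bar>)))"
      proof -
        have "cmod (s0 + z) \<le> cmod s0 + cmod z" by (rule norm_triangle_ineq)
        also have "cmod s0 \<le> \<bar>Re s0\<bar> + \<bar>Im s0\<bar>" by (rule cmod_le)
        finally have "1 + cmod (s0 + z) \<le> 5 * (2 + \<bar>t\<bar>)" using z by (simp add: s0_def)
        then show ?thesis using c q by (intro mult_left_mono) auto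
      qed
      finally have "cmod (G (s0 + z)) * cmod (1 / G s0) \<le> ((1 + 3 * zeta32) * (real q * (5 * (2 + \<bar>t\<bar>)))) * (3 * zeta54)"
        using cent c q by (intro mult_mono) auto
      moreover have "((1 + 3 * zeta32) * (real q * (5 * (2 + \<bar>t\<bar>)))) * (3 * zeta54) = k * T"
        unfolding k_def T_def by (simp add: algebra_simps)
      moreover have "cmod (G (s0 + z)) * cmod (1 / G s0) = cmod (h z)" by (simp add: h_def norm_divide)
      ultimately have "cmod (h z) \<le> k * T" by simp
      moreover have "cmod (h z) > 0" using h_nz[of z] z by simp
      ultimately have "ln (cmod (h z)) \<le> ln (k * T)" by (intro ln_mono) auto
      then show ?thesis using Re_g[OF z] by (simp add: M2_def)
    qed
    have g1: "cmod (g z) \<le> 4 * M1" if z: "cmod z \<le> 1/2" for z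
    proof -
      have "cmod (g z) \<le> 2 * M1 * cmod z / (3/4 - cmod z)"
      proof (rule borel_caratheodory[where M = M1 and R = "3/4"])
        show "g holomorphic_on ball 0 (3/4)" by (rule holomorphic_on_subset[OF g_hol]) auto
      qed (use g00 M1 small z in auto)
      also have "\<dots> \<le> 2 * M1 * (1/2) / (1/4)"
        using z M1 by (intro frac_le mult_left_mono) auto
      finally show ?thesis by simp
    qed
    have g2: "cmod (g z) \<le> 6 * M2 / \<epsilon>" if z: "cmod z \<le> r2" for z
    proof -
      have "cmod (g z) \<le> 2 * M2 * cmod z / (3/2 - cmod z)"
        by (rule borel_caratheodory[where M = M2 and R = "3/2"])
          (use g_hol g00 M2 large z \<epsilon> in \<open>auto simp: r2_def\<close>)
      also have "\<dots> \<le> 2 * M2 * (3/2) / (\<epsilon> / 2)"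
        using z M2 \<epsilon> by (intro frac_le mult_left_mono) (auto simp: r2_def)
      finally show ?thesis by simp
    qed
    define z where "z = s - s0"
    \<comment> \<open>The centre has the same height as \<open>s\<close>, so the displacement is
      real, and the distance is governed by \<open>Re s\<close> alone.\<close>
    have z_eq: "z = of_real (Re s - 2)" by (simp add: z_def s0_def t_def complex_eq_iff)
    have z: "cmod z \<le> 3/2 - \<epsilon>" unfolding z_eq norm_of_real using s \<epsilon> by auto
    have "cmod (g z) \<le> C * (4 * M1) + \<epsilon>\<^sup>2 / 6 * (6 * M2 / \<epsilon>)"
      by (rule C(2)[OF g_hol _ g1 g2 z]) (use \<epsilon> in \<open>auto simp: r2_def\<close>)
    also have "\<epsilon>\<^sup>2 / 6 * (6 * M2 / \<epsilon>) = \<epsilon> * M2" using \<epsilon> by (simp add: power2_eq_square)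
    finally have gz: "cmod (g z) \<le> C * (4 * M1) + \<epsilon> * M2" .
    have z32: "cmod z < 3/2" using z \<epsilon> by simp
    have "G s = G s0 * exp (g z)"
      using h_eq[OF z32] G0 by (simp add: h_def z_def field_simps)
    then have "cmod (1 / G s) = cmod (1 / G s0) * exp (- Re (g z))"
      by (simp add: norm_divide norm_mult exp_minus field_simps)
    also have "\<dots> \<le> (3 * zeta54) * exp (C * (4 * M1) + \<epsilon> * M2)"
    proof (intro mult_mono cent)
      have "- Re (g z) \<le> cmod (g z)" using abs_Re_le_cmod[of "g z"] by linarith
      then show "exp (- Re (g z)) \<le> exp (C * (4 * M1) + \<epsilon> * M2)" using gz by simp
    qed (use Z in auto)
    also have "C * (4 * M1) + \<epsilon> * M2 = (C * (4 * M1) + \<epsilon> * (ln k + 1)) + \<epsilon> * ln T"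
    proof -
      have "ln (k * T) = ln k + ln T" using k1 T by (intro ln_mult_pos) auto
      then show ?thesis by (simp add: M2_def algebra_simps)
    qed
    also have "(3 * zeta54) * exp ((C * (4 * M1) + \<epsilon> * (ln k + 1)) + \<epsilon> * ln T) = A * T powr \<epsilon>"
      using T unfolding exp_add[of "C * (4 * M1) + \<epsilon> * (ln k + 1)"] by (simp add: A_def powr_def)
    finally show ?thesis by (simp add: G_def T_def t_def)
  qed
  ultimately show thesis by (rule that)
qed

text \<open>\<open>D\<close> is the holomorphic version of 1/L: for the principal character it
  vanishes at \<open>s = 1\<close>, where the quotient formed from the default value of
  \<open>char_L\<close> would be wrong. Writing it as \<open>u / char_G\<close> with
  \<open>|u| \<le> 1\<close> covers this point. The constant \<open>A\<close> is the same for all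
  moduli and characters.\<close>

theorem inverse_L_function:
  assumes GRH: generalized_riemann_hypothesis and \<epsilon>: "0 < \<epsilon>" "\<epsilon> \<le> 1/2"
  obtains A where "A \<ge> 0" "\<And>q chi. dirichlet_character q chi \<Longrightarrow>
    \<exists>D. D holomorphic_on {s. Re s > 1/2} \<and>
      (\<forall>s. Re s > 1 \<longrightarrow> (\<lambda>n. of_int (moebius_mu (Suc n)) * chi (Suc n) * of_nat (Suc n) powr (-s)) sums D s) \<and>
      (\<forall>s. 1/2 + \<epsilon> \<le> Re s \<longrightarrow> Re s \<le> 3/2 + \<epsilon> \<longrightarrow> cmod (D s) \<le> A * real q powr \<epsilon> * (2 + \<bar>Im s\<bar>) powr \<epsilon>)"
proof -
  obtain A where A: "A \<ge> 0" "\<And>q chi s. dirichlet_character q chi \<Longrightarrow> 1/2 + \<epsilon> \<le> Re s \<Longrightarrow> Re s \<le> 3/2 + \<epsilon> \<Longrightarrow>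
    cmod (1 / char_G q chi s) \<le> A * (real q * (2 + \<bar>Im s\<bar>)) powr \<epsilon>"
    using norm_inverse_char_G_le[OF GRH \<epsilon>] by blast
  have "\<exists>D. D holomorphic_on {s. Re s > 1/2} \<and>
      (\<forall>s. Re s > 1 \<longrightarrow> (\<lambda>n. of_int (moebius_mu (Suc n)) * chi (Suc n) * of_nat (Suc n) powr (-s)) sums D s) \<and>
      (\<forall>s. 1/2 + \<epsilon> \<le> Re s \<longrightarrow> Re s \<le> 3/2 + \<epsilon> \<longrightarrow> cmod (D s) \<le> A * real q powr \<epsilon> * (2 + \<bar>Im s\<bar>) powr \<epsilon>)"
    if chi: "dirichlet_character q chi" for q chi
  proof -
    define u where "u s = (if char_mean q chi = 0 then 1 else (s - 1) / (s + 1))" for s :: complex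
    define D where "D s = u s * (1 / char_G q chi s)" for s
    have "u holomorphic_on {s. Re s > 1/2}"
    proof (cases "char_mean q chi = 0")
      case False
      have "(\<lambda>s::complex. (s - 1) / (s + 1)) holomorphic_on {s. Re s > 1/2}"
        by (intro holomorphic_intros) (auto simp: complex_eq_iff)
      with False show ?thesis by (simp add: u_def[abs_def])
    qed (simp add: u_def[abs_def])
    moreover have "char_G q chi holomorphic_on {s. Re s > 1/2}"
      by (rule holomorphic_on_subset[OF char_G_holomorphic[OF chi]]) auto
    ultimately have hol: "D holomorphic_on {s. Re s > 1/2}"
      unfolding D_def by (intro holomorphic_intros) (use char_G_nonzero[OF GRH chi] in auto)
    have sums: "(\<lambda>n. of_int (moebius_mu (Suc n)) * chi (Suc n) * of_nat (Suc n) powr (-s)) sums D s" if s: "Re s > 1" for s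
    proof -
      have "s \<noteq> 1" "Re s > 0" using s by auto
      moreover have "s - 1 \<noteq> 0" "s + 1 \<noteq> 0" using s by (auto simp: complex_eq_iff)
      ultimately have "D s = 1 / char_L q chi s"
        by (cases "char_mean q chi = 0") (simp add: D_def u_def char_G_def, simp add: D_def u_def char_G_eq)
      then show ?thesis
        using char_L_inverse(2)[OF chi s] by (simp add: char_term_def mult.assoc)
    qed
    have le: "cmod (D s) \<le> A * real q powr \<epsilon> * (2 + \<bar>Im s\<bar>) powr \<epsilon>" if s: "1/2 + \<epsilon> \<le> Re s" "Re s \<le> 3/2 + \<epsilon>" for s
    proof -
      have "cmod (u s) \<le> 1"
        using norm_minus_le_norm_plus[of s] norm_plus_one_ge[of s] s \<epsilon> by (auto simp: u_def norm_divide divide_le_eq_1)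
      then have "cmod (D s) \<le> 1 * (A * (real q * (2 + \<bar>Im s\<bar>)) powr \<epsilon>)"
        unfolding D_def norm_mult using A(2)[OF chi s] by (intro mult_mono) auto
      also have "\<dots> = A * real q powr \<epsilon> * (2 + \<bar>Im s\<bar>) powr \<epsilon>" by (simp add: powr_mult)
      finally show ?thesis .
    qed
    show ?thesis using hol sums le by (intro exI[of _ D]) simp
  qed
  then show thesis by (rule that[OF A(1)])
qed

section \<open>Exponential sums over the Moebius function\<close>

lemma summable_exp_decay:
  assumes "\<And>n. cmod (a n) \<le> 1" and w: "Re w > 0"
  shows "summable (\<lambda>n. a n * exp (- of_nat (Suc n) * w))"
proof (rule summable_comparison_test')
  show "summable (\<lambda>n. exp (- Re w) ^ n)" using w by (intro summable_geometric) simp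
  show "cmod (a n * exp (- of_nat (Suc n) * w)) \<le> exp (- Re w) ^ n" if "n \<ge> 0" for n
  proof -
    have "cmod (a n * exp (- of_nat (Suc n) * w)) \<le> 1 * exp (- (real (Suc n) * Re w))"
      unfolding norm_mult using assms by (intro mult_mono) (auto simp: algebra_simps)
    also have "\<dots> \<le> exp (- (real n * Re w))" using w by (simp add: algebra_simps)
    also have "\<dots> = exp (- Re w) ^ n" by (simp add: exp_of_nat_mult [symmetric])
    finally show ?thesis .
  qed
qed

lemma norm_of_int_le_1: "\<bar>k\<bar> \<le> 1 \<Longrightarrow> cmod (of_int k) \<le> 1"
  by (simp add: norm_of_int) 

lemma powr_minus_Suc_le_1: "\<epsilon> \<ge> 0 \<Longrightarrow> real (Suc n) powr (-\<epsilon>) \<le> 1"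
  by (simp add: powr_minus inverse_le_1_iff ge_one_powr_ge_zero del: of_nat_Suc)

text \<open>\<open>moebius_mu (d * n)\<close> vanishes unless \<open>n\<close> is coprime to
  \<open>d\<close>. Building this condition into the character keeps it a character, of modulus
  \<open>d * q\<close>, and makes \<open>moebius_mu (d * n)\<close> factor.\<close>

lemma dirichlet_character_restrict:
  assumes chi: "dirichlet_character q chi" and d: "d > 0"
  shows "dirichlet_character (d * q) (\<lambda>n. if coprime n d then chi n else 0)"
  unfolding dirichlet_character_def
proof (intro conjI allI)
  show "d * q > 0" using assms by (simp add: dirichlet_character_def)
  fix m n
  have "coprime (n + d * q) d \<longleftrightarrow> coprime n d"
    by (metis add.commute coprime_iff_gcd_eq_1 gcd_add_mult mult.commute gcd.commute)
  moreover have "chi (n + d * q) = chi n"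
    by (rule dirichlet_character_cong[OF chi]) (simp add: cong_def)
  ultimately show "(if coprime (n + d * q) d then chi (n + d * q) else 0) = (if coprime n d then chi n else 0)"
    by simp
  show "(if coprime (m * n) d then chi (m * n) else 0) =
      (if coprime m d then chi m else 0) * (if coprime n d then chi n else 0)"
    by (simp add: dirichlet_character_mult[OF chi] coprime_mult_left_iff)
  show "(if coprime n d then chi n else 0) \<noteq> 0 \<longleftrightarrow> coprime n (d * q)"
    by (simp add: dirichlet_character_zero_iff[OF chi] coprime_mult_right_iff)
qed

definition twist_term :: "real \<Rightarrow> complex \<Rightarrow> (nat \<Rightarrow> complex) \<Rightarrow> nat \<Rightarrow> complex" where
  "twist_term \<epsilon> w h n = of_int (moebius_mu n) * h n * of_real (real n powr (-\<epsilon>)) * exp (- of_nat n * w)"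

lemma twist_term_sums:
  assumes h: "\<And>n. cmod (h n) \<le> 1" and \<epsilon>: "\<epsilon> \<ge> 0" and w: "Re w > 0"
  shows "(\<lambda>n. twist_term \<epsilon> w h (Suc n)) sums (\<Sum>n. twist_term \<epsilon> w h (Suc n))"
  unfolding twist_term_def
proof (intro summable_sums summable_exp_decay w)
  show "cmod (of_int (moebius_mu (Suc n)) * h (Suc n) * of_real (real (Suc n) powr - \<epsilon>)) \<le> 1" for n
    unfolding norm_mult norm_of_real
    using h[of "Suc n"] norm_of_int_le_1[OF abs_moebius_mu_le[of "Suc n"]] powr_minus_Suc_le_1[OF \<epsilon>, of n]
    by (intro mult_le_one) (auto simp del: of_nat_Suc)
qed

text \<open>Isolates the analytic input: one constant \<open>B\<close> valid for all moduli, all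
  characters and all \<open>w\<close>. The bounds for additive twists below follow from it by finite
  Fourier analysis on the residues.\<close>

locale twisted_bound =
  fixes \<epsilon> B :: real
  assumes \<epsilon>: "0 < \<epsilon>" "\<epsilon> \<le> 1/2" and B: "B \<ge> 0"
    and char_bound: "\<And>q chi w. dirichlet_character q chi \<Longrightarrow> Re w > 0 \<Longrightarrow>
      cmod (\<Sum>n. twist_term \<epsilon> w chi (Suc n)) \<le> B * real q powr \<epsilon> * cmod w powr (1/2 + \<epsilon>) / Re w powr (1 + \<epsilon>)"
begin

text \<open>Numbers with gcd \<open>d\<close> are \<open>d * m\<close> with \<open>m\<close> coprime
  to \<open>q'\<close>, and \<open>m \<mapsto> h (d * m)\<close> has period \<open>q'\<close>, so it
  expands into characters modulo \<open>q'\<close>. Each of them leads to the sum at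
  \<open>d * w\<close>. The powers of \<open>d\<close> combine to the stated bound with the extra
  factor \<open>d powr (- 1 - \<epsilon>)\<close>, which makes the sum over all \<open>d\<close>
  converge.\<close>

lemma gcd_class_bound:
  assumes q': "q' > 0" and d: "d > 0" and h: "\<And>n. cmod (h n) \<le> 1" and per: "\<And>n. h (n + d * q') = h n" and w: "Re w > 0"
  shows "cmod (\<Sum>n. if gcd (Suc n) (d * q') = d then twist_term \<epsilon> w h (Suc n) else 0)
     \<le> B * real (d * q') powr (1/2 + \<epsilon>) * cmod w powr (1/2 + \<epsilon>) / Re w powr (1 + \<epsilon>) * real d powr (- 1 - \<epsilon>)"
proof -
  define f where "f n = (if gcd (Suc n) (d * q') = d then twist_term \<epsilon> w h (Suc n) else 0)" for n
  obtain X :: "(nat \<Rightarrow> complex) set" and c where X: "finite X" "\<And>chi. chi \<in> X \<Longrightarrow> dirichlet_character q' chi"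
    "\<And>n. coprime n q' \<Longrightarrow> h (d * n) = (\<Sum>chi\<in>X. c chi * chi n)" "(\<Sum>chi\<in>X. cmod (c chi)) \<le> sqrt q'"
  proof (rule character_expansion[OF q', of "\<lambda>n. h (d * n)"])
    show "h (d * (n + q')) = h (d * n)" for n using per[of "d * n"] by (simp add: distrib_left)
  qed (use h in auto)
  define chi' where "chi' chi n = (if coprime n d then chi n else 0)" for chi :: "nat \<Rightarrow> complex" and n
  have chi': "dirichlet_character (d * q') (chi' chi)" if "chi \<in> X" for chi
    unfolding chi'_def by (rule dirichlet_character_restrict[OF X(2)[OF that] d])
  define dw where "dw = of_nat d * w"
  have dw: "Re dw > 0" "Re dw = real d * Re w" "cmod dw = real d * cmod w"
    using d w by (auto simp: dw_def norm_mult)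
  define m where "m = of_int (moebius_mu d) * complex_of_real (real d powr (-\<epsilon>))"
  have m: "cmod m \<le> real d powr (-\<epsilon>)"
    unfolding m_def norm_mult norm_of_real using norm_of_int_le_1[OF abs_moebius_mu_le[of d]]
    by (simp add: mult_left_le_one_le)
  \<comment> \<open>Series are indexed from 0 with the term of \<open>Suc n\<close>, so the multiple
    \<open>d * Suc n\<close> sits at index \<open>d * Suc n - 1\<close>.\<close>
  have key: "f (d * Suc n - 1) = m * (\<Sum>chi\<in>X. c chi * twist_term \<epsilon> dw (chi' chi) (Suc n))" for n
  proof -
    have Suc: "Suc (d * Suc n - 1) = d * Suc n" using d by simp
    have gcd: "gcd (d * Suc n) (d * q') = d \<longleftrightarrow> coprime (Suc n) q'"
      unfolding gcd_mult_distrib_nat[symmetric] coprime_iff_gcd_eq_1 using d mult_eq_self_implies_10[of d "gcd (Suc n) q'"]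
      by (auto simp del: mult_Suc_right)
    have f: "f (d * Suc n - 1) = (if coprime (Suc n) q' then twist_term \<epsilon> w h (d * Suc n) else 0)"
      unfolding f_def Suc gcd ..
    have ex: "- of_nat (d * Suc n) * w = - of_nat (Suc n) * dw"
      by (simp add: dw_def del: of_nat_Suc mult_Suc_right)
    have pw: "real (d * Suc n) powr (-\<epsilon>) = real d powr (-\<epsilon>) * real (Suc n) powr (-\<epsilon>)"
      unfolding of_nat_mult by (rule powr_mult)
    consider (a) "\<not> coprime (Suc n) q'" | (b) "coprime (Suc n) q'" "\<not> coprime (Suc n) d"
      | (c) "coprime (Suc n) q'" "coprime (Suc n) d" by blast
    then show ?thesis
    proof cases
      case a
      then have "chi' chi (Suc n) = 0" if "chi \<in> X" for chi
        using dirichlet_character_zero_iff[OF X(2)[OF that], of "Suc n"] by (simp add: chi'_def)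
      then show ?thesis unfolding f using a by (simp add: twist_term_def)
    next
      case b
      then have "moebius_mu (d * Suc n) = 0" using moebius_mu_mult[of d "Suc n"] by (simp add: coprime_commute)
      then show ?thesis unfolding f using b by (simp add: twist_term_def chi'_def)
    next
      case c
      then have mu: "moebius_mu (d * Suc n) = moebius_mu d * moebius_mu (Suc n)"
        using moebius_mu_mult[of d "Suc n"] by (simp add: coprime_commute)
      have "f (d * Suc n - 1) = twist_term \<epsilon> w h (d * Suc n)" unfolding f using c(1) by simp
      also have "\<dots> = m * (of_int (moebius_mu (Suc n)) * h (d * Suc n) * of_real (real (Suc n) powr (-\<epsilon>)) * exp (- of_nat (Suc n) * dw))"
        unfolding twist_term_def ex pw mu m_def of_int_mult of_real_mult by (simp only: mult_ac)
      also have "h (d * Suc n) = (\<Sum>chi\<in>X. c chi * chi' chi (Suc n))"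
        unfolding X(3)[OF c(1)] using c(2) by (simp add: chi'_def)
      also have "of_int (moebius_mu (Suc n)) * (\<Sum>chi\<in>X. c chi * chi' chi (Suc n)) * of_real (real (Suc n) powr (-\<epsilon>)) * exp (- of_nat (Suc n) * dw)
          = (\<Sum>chi\<in>X. c chi * twist_term \<epsilon> dw (chi' chi) (Suc n))"
        unfolding twist_term_def sum_distrib_left sum_distrib_right by (rule sum.cong) (simp_all only: mult_ac)
      finally show ?thesis .
    qed
  qed
  have "(\<lambda>n. f (d * Suc n - 1)) sums (m * (\<Sum>chi\<in>X. c chi * (\<Sum>n. twist_term \<epsilon> dw (chi' chi) (Suc n))))"
    unfolding key
    using \<epsilon> dw by (intro sums_mult sums_sum twist_term_sums norm_dirichlet_character_le[OF chi']) auto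
  moreover have "strict_mono (\<lambda>n. d * Suc n - 1)"
  proof (rule strict_monoI)
    fix x y :: nat assume "x < y"
    then have "d * Suc x < d * Suc y" "d * Suc x > 0" using d by (auto simp del: mult_Suc_right)
    then show "d * Suc x - 1 < d * Suc y - 1" by linarith
  qed
  moreover have "f n = 0" if "n \<notin> range (\<lambda>n. d * Suc n - 1)" for n
  proof -
    have "\<not> d dvd Suc n"
    proof
      assume "d dvd Suc n"
      then obtain k where k: "Suc n = d * k" by (auto elim: dvdE)
      then have "k \<noteq> 0" by (intro notI) simp
      then obtain j where "k = Suc j" by (cases k) auto
      then have "n = d * Suc j - 1" using k by simp
      then show False using that by blast
    qed
    then show ?thesis by (metis f_def gcd_dvd1)
  qed
  ultimately have "f sums (m * (\<Sum>chi\<in>X. c chi * (\<Sum>n. twist_term \<epsilon> dw (chi' chi) (Suc n))))"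
    using sums_mono_reindex[of "\<lambda>n. d * Suc n - 1" f] by blast
  then have "cmod (\<Sum>n. f n) = cmod m * cmod (\<Sum>chi\<in>X. c chi * (\<Sum>n. twist_term \<epsilon> dw (chi' chi) (Suc n)))"
    by (simp add: sums_iff norm_mult)
  also have "\<dots> \<le> real d powr (-\<epsilon>) * (sqrt q' * (B * real (d * q') powr \<epsilon> * cmod dw powr (1/2 + \<epsilon>) / Re dw powr (1 + \<epsilon>)))"
  proof (intro mult_mono m)
    have "cmod (\<Sum>chi\<in>X. c chi * (\<Sum>n. twist_term \<epsilon> dw (chi' chi) (Suc n)))
        \<le> (\<Sum>chi\<in>X. cmod (c chi) * (B * real (d * q') powr \<epsilon> * cmod dw powr (1/2 + \<epsilon>) / Re dw powr (1 + \<epsilon>)))"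
      by (intro sum_norm_le) (auto simp only: norm_mult intro!: mult_left_mono char_bound chi' dw(1) norm_ge_zero)
    also have "\<dots> \<le> sqrt q' * (B * real (d * q') powr \<epsilon> * cmod dw powr (1/2 + \<epsilon>) / Re dw powr (1 + \<epsilon>))"
      unfolding sum_distrib_right [symmetric] using X(4) B by (intro mult_right_mono) auto
    finally show "cmod (\<Sum>chi\<in>X. c chi * (\<Sum>n. twist_term \<epsilon> dw (chi' chi) (Suc n)))
        \<le> sqrt q' * (B * real (d * q') powr \<epsilon> * cmod dw powr (1/2 + \<epsilon>) / Re dw powr (1 + \<epsilon>))" .
  qed auto
  also have "\<dots> = B * real (d * q') powr (1/2 + \<epsilon>) * cmod w powr (1/2 + \<epsilon>) / Re w powr (1 + \<epsilon>) * real d powr (- 1 - \<epsilon>)"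
  proof -
    have "real (d * q') powr (1/2 + \<epsilon>) = real (d * q') powr \<epsilon> * (real d powr (1/2) * sqrt q')"
      using d q' by (simp add: powr_add powr_mult powr_half_sqrt)
    moreover have "cmod dw powr (1/2 + \<epsilon>) = real d powr (1/2 + \<epsilon>) * cmod w powr (1/2 + \<epsilon>)"
      unfolding dw(3) by (rule powr_mult)
    moreover have "Re dw powr (1 + \<epsilon>) = real d powr (1 + \<epsilon>) * Re w powr (1 + \<epsilon>)"
      unfolding dw(2) by (rule powr_mult)
    moreover have "real d powr (-\<epsilon>) * real d powr (1/2 + \<epsilon>) = real d powr (1/2)"
      by (simp add: powr_add [symmetric])
    moreover have "real d powr (- 1 - \<epsilon>) = 1 / real d powr (1 + \<epsilon>)"
      using powr_minus_divide[of "real d" "1 + \<epsilon>"] by simp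
    ultimately show ?thesis by (simp add: field_simps)
  qed
  finally show ?thesis unfolding f_def .
qed

text \<open>Splitting by \<open>gcd n q\<close> leaves a sum of
  \<open>d powr (-1 - \<epsilon>)\<close> over the divisors of \<open>q\<close>, at most zeta(1 +
  \<epsilon>); the number of divisors does not enter.\<close>

lemma periodic_twist_bound:
  assumes q: "q > 0" and h: "\<And>n. cmod (h n) \<le> 1" and per: "\<And>n. h (n + q) = h n" and w: "Re w > 0"
  shows "cmod (\<Sum>n. twist_term \<epsilon> w h (Suc n))
     \<le> B * (\<Sum>n. real (Suc n) powr (-1 - \<epsilon>)) * real q powr (1/2 + \<epsilon>) * cmod w powr (1/2 + \<epsilon>) / Re w powr (1 + \<epsilon>)"
proof -
  define f where "f d n = (if gcd (Suc n) q = d then twist_term \<epsilon> w h (Suc n) else 0)" for d n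
  define K where "K = B * real q powr (1/2 + \<epsilon>) * cmod w powr (1/2 + \<epsilon>) / Re w powr (1 + \<epsilon>)"
  have K: "K \<ge> 0" using B by (simp add: K_def)
  define D where "D = {d. d dvd q}"
  have fin: "finite D" unfolding D_def using q by simp
  have f_sums: "f d sums (\<Sum>n. f d n)" for d
  proof -
    have "f d = (\<lambda>n. twist_term \<epsilon> w (\<lambda>n. if gcd n q = d then h n else 0) (Suc n))"
      by (auto simp: f_def twist_term_def fun_eq_iff)
    then show ?thesis using twist_term_sums[of "\<lambda>n. if gcd n q = d then h n else 0" \<epsilon> w] h \<epsilon> w by auto
  qed
  have "(\<lambda>n. \<Sum>d\<in>D. f d n) sums (\<Sum>d\<in>D. \<Sum>n. f d n)" by (rule sums_sum[OF f_sums])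
  moreover have "(\<Sum>d\<in>D. f d n) = twist_term \<epsilon> w h (Suc n)" for n
    unfolding f_def using fin by (subst sum.delta') (auto simp: D_def)
  ultimately have "cmod (\<Sum>n. twist_term \<epsilon> w h (Suc n)) = cmod (\<Sum>d\<in>D. \<Sum>n. f d n)" by (simp add: sums_iff)
  also have "\<dots> \<le> (\<Sum>d\<in>D. K * real d powr (-1 - \<epsilon>))"
  proof (rule sum_norm_le)
    fix d assume "d \<in> D"
    then obtain q' where q': "q = d * q'" by (auto simp: D_def)
    then have "q' > 0" "d > 0" using q by auto
    then show "cmod (\<Sum>n. f d n) \<le> K * real d powr (-1 - \<epsilon>)"
      using gcd_class_bound[of q' d h w] h per w unfolding f_def K_def q' by simp
  qed
  also have "\<dots> = K * (\<Sum>d\<in>D. real d powr (-1 - \<epsilon>))" by (simp add: sum_distrib_left)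
  also have "(\<Sum>d\<in>D. real d powr (-1 - \<epsilon>)) = (\<Sum>n\<in>(\<lambda>d. d - 1) ` D. real (Suc n) powr (-1 - \<epsilon>))"
  proof (rule sum.reindex_cong[symmetric])
    have pos: "d > 0" if "d \<in> D" for d using that q by (auto simp: D_def intro: Nat.gr0I)
    then show "inj_on (\<lambda>d. d - 1) D" by (intro inj_onI) (metis Suc_diff_1)
    show "real (Suc (d - 1)) powr (-1 - \<epsilon>) = real d powr (-1 - \<epsilon>)" if "d \<in> D" for d using pos[OF that] by simp
  qed simp
  also have "K * (\<Sum>n\<in>(\<lambda>d. d - 1) ` D. real (Suc n) powr (-1 - \<epsilon>)) \<le> K * (\<Sum>n. real (Suc n) powr (-1 - \<epsilon>))"
    using \<epsilon> fin by (intro mult_left_mono K sum_le_suminf summable_Suc_powr) auto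
  finally show ?thesis by (simp add: K_def mult_ac)
qed

end

text \<open>With \<open>t = a / q + \<beta>\<close>, the smoothing and the offset
  \<open>\<beta>\<close> merge into one complex parameter \<open>w\<close>, and only the periodic
  factor \<open>e(a n / q)\<close> remains to be expanded.\<close>

theorem smoothed_exponential_sum_bound:
  assumes GRH: generalized_riemann_hypothesis and \<epsilon>: "0 < \<epsilon>" "\<epsilon> \<le> 1/2"
  obtains C where "C \<ge> 0" "\<And>t y. 0 < y \<Longrightarrow> y \<le> 1 \<Longrightarrow>
    cmod (\<Sum>n. exp_term moebius_mu t (Suc n) * of_real (real (Suc n) powr (-\<epsilon>)) * of_real (exp (- 2 * pi * real (Suc n) * y)))
      \<le> C * y powr (- 3/4 - \<epsilon>/2)"
proof -
  obtain A where A: "A \<ge> 0" "\<And>q chi. dirichlet_character q chi \<Longrightarrow>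
    \<exists>D. D holomorphic_on {s. Re s > 1/2} \<and>
      (\<forall>s. Re s > 1 \<longrightarrow> (\<lambda>n. of_int (moebius_mu (Suc n)) * chi (Suc n) * of_nat (Suc n) powr (-s)) sums D s) \<and>
      (\<forall>s. 1/2 + \<epsilon> \<le> Re s \<longrightarrow> Re s \<le> 3/2 + \<epsilon> \<longrightarrow> cmod (D s) \<le> A * real q powr \<epsilon> * (2 + \<bar>Im s\<bar>) powr \<epsilon>)"
    using inverse_L_function[OF GRH \<epsilon>] by blast
  define B where "B = mellin_const * A"
  interpret twisted_bound \<epsilon> B
  proof
    show "B \<ge> 0" using A mellin_const_nonneg by (simp add: B_def)
    fix q w and chi :: "nat \<Rightarrow> complex" assume chi: "dirichlet_character q chi" and w: "Re w > 0"
    from A(2)[OF chi] obtain D where D: "D holomorphic_on {s. Re s > 1/2}"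
      "\<And>s. Re s > 1 \<Longrightarrow> (\<lambda>n. of_int (moebius_mu (Suc n)) * chi (Suc n) * of_nat (Suc n) powr (-s)) sums D s"
      "\<And>s. 1/2 + \<epsilon> \<le> Re s \<Longrightarrow> Re s \<le> 3/2 + \<epsilon> \<Longrightarrow> cmod (D s) \<le> A * real q powr \<epsilon> * (2 + \<bar>Im s\<bar>) powr \<epsilon>" by blast
    have le: "cmod (of_int (moebius_mu n) * chi n) \<le> 1" for n
      unfolding norm_mult using norm_dirichlet_character_le[OF chi, of n] norm_of_int_le_1[OF abs_moebius_mu_le[of n]]
      by (intro mult_le_one) auto
    have "cmod (\<Sum>n. of_int (moebius_mu (Suc n)) * chi (Suc n) * of_real (real (Suc n) powr (-\<epsilon>)) * exp (- of_nat (Suc n) * w))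
        \<le> mellin_const * (A * real q powr \<epsilon>) * cmod w powr (1/2 + \<epsilon>) / Re w powr (1 + \<epsilon>)"
      by (rule dirichlet_series_exp_bound[OF le \<epsilon> D w])
    then show "cmod (\<Sum>n. twist_term \<epsilon> w chi (Suc n)) \<le> B * real q powr \<epsilon> * cmod w powr (1/2 + \<epsilon>) / Re w powr (1 + \<epsilon>)"
      unfolding twist_term_def B_def by (simp only: mult.assoc)
  qed (use \<epsilon> in auto)
  define Z where "Z = (\<Sum>n. real (Suc n) powr (-1 - \<epsilon>))"
  have Z: "Z \<ge> 0" unfolding Z_def using \<epsilon> by (intro suminf_nonneg summable_Suc_powr) auto
  define C where "C = B * Z * (6 * pi)"
  have "C \<ge> 0" using B Z by (simp add: C_def)
  moreover have "cmod (\<Sum>n. exp_term moebius_mu t (Suc n) * of_real (real (Suc n) powr (-\<epsilon>)) * of_real (exp (- 2 * pi * real (Suc n) * y)))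
      \<le> C * y powr (- 3/4 - \<epsilon>/2)" if y: "0 < y" "y \<le> 1" for t y
  proof -
    \<comment> \<open>With denominators up to order \<open>1 / sqrt y\<close>, both
      \<open>q * y\<close> and \<open>q * |\<beta>|\<close> are O(\<open>sqrt y\<close>), the
      balance between damping and approximation error.\<close>
    define x where "x = 1 / sqrt y"
    have x: "x \<ge> 1" using y by (simp add: x_def)
    define Q where "Q = nat \<lceil>x\<rceil>"
    have Q: "x \<le> real Q" "real Q \<le> 2 * x" using x unfolding Q_def by linarith+
    have "Q > 0" using Q x by (intro Nat.gr0I) auto
    then obtain a k where k: "0 < k" "k \<le> int Q" and ak: "\<bar>of_int k * t - of_int a\<bar> < 1 / real Q"
      by (rule Dirichlet_approx)
    define q where "q = nat k"
    have q: "q > 0" "real q \<le> real Q" "real_of_int k = real q" using k by (auto simp: q_def)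
    define \<beta> where "\<beta> = t - of_int a / real q"
    have \<beta>: "real q * \<bar>\<beta>\<bar> \<le> 1 / real Q"
    proof -
      have "real q * \<beta> = of_int k * t - of_int a" using q by (simp add: \<beta>_def field_simps)
      then have "real q * \<bar>\<beta>\<bar> = \<bar>of_int k * t - of_int a\<bar>" by (metis abs_mult abs_of_nat)
      then show ?thesis using ak by simp
    qed
    define h where "h n = exp (2 * of_real pi * \<i> * of_nat n * of_real (of_int a / real q))" for n
    define w where "w = Complex (2 * pi * y) (- 2 * pi * \<beta>)"
    have h1: "cmod (h n) \<le> 1" for n by (simp add: h_def)
    have per: "h (n + q) = h n" for n
    proof -
      have "h (n + q) = h n * exp (2 * of_real pi * \<i> * of_int a)"
        unfolding h_def exp_add[symmetric] using q(1) by (simp add: field_simps)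
      moreover have "exp (2 * of_real pi * \<i> * of_int a) = (1::complex)"
        using exp_integer_2pi[of "of_int a"] by (simp add: mult_ac)
      ultimately show ?thesis by simp
    qed
    have w: "Re w > 0" "Re w = 2 * pi * y" using y by (auto simp: w_def)
    have term_eq: "exp_term moebius_mu t (Suc n) * of_real (real (Suc n) powr (-\<epsilon>)) * of_real (exp (- 2 * pi * real (Suc n) * y))
        = twist_term \<epsilon> w h (Suc n)" for n
    proof -
      have "h (Suc n) * exp (- of_nat (Suc n) * w) = exp (2 * of_real pi * \<i> * of_nat (Suc n) * of_real t) * of_real (exp (- 2 * pi * real (Suc n) * y))"
      proof -
        have "2 * of_real pi * \<i> * of_nat (Suc n) * of_real (of_int a / real q) + - of_nat (Suc n) * w
            = 2 * of_real pi * \<i> * of_nat (Suc n) * of_real t + of_real (- 2 * pi * real (Suc n) * y)"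
          by (simp add: complex_eq_iff w_def \<beta>_def algebra_simps del: of_nat_Suc)
        then show ?thesis unfolding h_def exp_of_real[symmetric] exp_add[symmetric] by simp
      qed
      then have "of_int (moebius_mu (Suc n)) * of_real (real (Suc n) powr (-\<epsilon>)) * (h (Suc n) * exp (- of_nat (Suc n) * w))
          = of_int (moebius_mu (Suc n)) * of_real (real (Suc n) powr (-\<epsilon>)) *
            (exp (2 * of_real pi * \<i> * of_nat (Suc n) * of_real t) * of_real (exp (- 2 * pi * real (Suc n) * y)))"
        by (rule arg_cong)
      then show ?thesis unfolding twist_term_def exp_term_def by (simp only: mult_ac)
    qed
    have qw: "real q * cmod w \<le> 6 * pi * sqrt y"
    proof -
      have "cmod w \<le> 2 * pi * y + 2 * pi * \<bar>\<beta>\<bar>" using cmod_le[of w] y by (simp add: w_def abs_mult)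
      then have "real q * cmod w \<le> real q * (2 * pi * y + 2 * pi * \<bar>\<beta>\<bar>)" by (intro mult_left_mono) auto
      also have "\<dots> = 2 * pi * (real q * y + real q * \<bar>\<beta>\<bar>)" by (simp add: algebra_simps)
      also have "\<dots> \<le> 2 * pi * (2 * sqrt y + sqrt y)"
      proof (intro mult_left_mono add_mono)
        have "real q * y \<le> (2 * x) * y" using q Q y by (intro mult_right_mono) auto
        also have "\<dots> = 2 * sqrt y" using y real_div_sqrt[of y] by (simp add: x_def)
        finally show "real q * y \<le> 2 * sqrt y" .
        have "1 / real Q \<le> 1 / x" using Q x by (intro divide_left_mono) auto
        then show "real q * \<bar>\<beta>\<bar> \<le> sqrt y" using \<beta> by (simp add: x_def)
      qed auto
      finally show ?thesis by simp
    qed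
    have "cmod (\<Sum>n. twist_term \<epsilon> w h (Suc n)) \<le> B * Z * real q powr (1/2 + \<epsilon>) * cmod w powr (1/2 + \<epsilon>) / Re w powr (1 + \<epsilon>)"
      unfolding Z_def by (rule periodic_twist_bound[where q = q and h = h, OF q(1) h1 per w(1)])
    also have "\<dots> = B * Z * ((real q * cmod w) powr (1/2 + \<epsilon>) / Re w powr (1 + \<epsilon>))" by (simp add: powr_mult)
    \<comment> \<open>From \<open>q * |w| \<le> 6 * pi * sqrt y\<close>: the power
      \<open>1/2 + \<epsilon>\<close> turns \<open>sqrt y\<close> into
      \<open>y powr (1/4 + \<epsilon>/2)\<close>, and as this power is at most 1, the constant stays
      below \<open>6 * pi\<close>.\<close>
    also have "\<dots> \<le> B * Z * ((6 * pi * y powr (1/4 + \<epsilon>/2)) / y powr (1 + \<epsilon>))"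
    proof (intro mult_left_mono frac_le)
      have "(real q * cmod w) powr (1/2 + \<epsilon>) \<le> (6 * pi * sqrt y) powr (1/2 + \<epsilon>)"
        using qw \<epsilon> by (intro powr_mono2) auto
      also have "\<dots> = (6 * pi) powr (1/2 + \<epsilon>) * y powr (1/4 + \<epsilon>/2)"
        using y by (simp add: powr_mult powr_half_sqrt[symmetric] powr_powr algebra_simps)
      also have "\<dots> \<le> (6 * pi) powr 1 * y powr (1/4 + \<epsilon>/2)"
        using \<epsilon> pi_gt3 by (intro mult_right_mono powr_mono) auto
      finally show "(real q * cmod w) powr (1/2 + \<epsilon>) \<le> 6 * pi * y powr (1/4 + \<epsilon>/2)" by simp
      show "y powr (1 + \<epsilon>) \<le> Re w powr (1 + \<epsilon>)" unfolding w(2) using y \<epsilon> pi_gt3 by (intro powr_mono2) auto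
    qed (use y B Z in auto)
    also have "\<dots> = C * y powr ((1/4 + \<epsilon>/2) - (1 + \<epsilon>))" unfolding powr_diff by (simp add: C_def)
    also have "(1/4 + \<epsilon>/2) - (1 + \<epsilon>) = - 3/4 - \<epsilon>/2" by (simp add: field_simps)
    finally show ?thesis unfolding term_eq .
  qed
  ultimately show thesis by (rule that)
qed

section \<open>The truncation kernel\<close>

lemma sin_ge_half:
  assumes "0 \<le> x" "x \<le> pi / 2"
  shows "x / 2 \<le> sin x"
proof -
  have "\<bar>sin x - x\<bar> \<le> x ^ 3 / 6"
    using Maclaurin_sin_bound[of x 3] assms by (simp add: eval_nat_numeral sin_coeff_def fact_reduce)
  moreover have "x ^ 3 / 6 \<le> x / 2"
  proof -
    have "x\<^sup>2 \<le> (1.7)\<^sup>2" using assms pi_less_4 pi_approx by (intro power_mono) auto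
    then have "x\<^sup>2 \<le> 3" by (simp add: power2_eq_square)
    then have "x\<^sup>2 * x \<le> 3 * x" using assms by (intro mult_right_mono) auto
    then show ?thesis by (simp add: power3_eq_cube power2_eq_square)
  qed
  ultimately show ?thesis by linarith
qed

lemma norm_cis_minus_1_ge:
  assumes u: "0 \<le> u" "u \<le> 1"
  shows "2 * min u (1 - u) \<le> cmod (cis (2 * pi * u) - 1)"
proof -
  have "(cmod (cis (2 * pi * u) - 1))\<^sup>2 = (2 * sin (pi * u))\<^sup>2"
  proof -
    have c: "cos (2 * pi * u) = 1 - 2 * (sin (pi * u))\<^sup>2" using cos_double_sin[of "pi * u"] by (simp add: mult_ac)
    have "(cmod (cis (2 * pi * u) - 1))\<^sup>2 = (cos (2 * pi * u))\<^sup>2 + (sin (2 * pi * u))\<^sup>2 + 1 - 2 * cos (2 * pi * u)"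
      unfolding cmod_power2 by (simp add: power2_eq_square algebra_simps)
    also have "\<dots> = 2 - 2 * cos (2 * pi * u)" using sin_cos_squared_add2[of "2 * pi * u"] by simp
    also have "\<dots> = (2 * sin (pi * u))\<^sup>2" unfolding c by (simp add: power_mult_distrib)
    finally show ?thesis .
  qed
  moreover have "0 \<le> 2 * sin (pi * u)" using u by (simp add: sin_ge_zero mult_left_le)
  ultimately have eq: "cmod (cis (2 * pi * u) - 1) = 2 * sin (pi * u)"
    by (rule power2_eq_imp_eq[OF _ norm_ge_zero])
  define v where "v = min u (1 - u)"
  have v: "0 \<le> v" "v \<le> 1/2" using u by (auto simp: v_def min_def)
  have "sin (pi * u) = sin (pi * v)"
  proof (cases "u \<le> 1 - u")
    case False
    then have "pi * v = pi - pi * u" by (simp add: v_def algebra_simps)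
    then show ?thesis by simp
  qed (simp add: v_def)
  moreover have "(pi * v) / 2 \<le> sin (pi * v)"
  proof (rule sin_ge_half)
    show "pi * v \<le> pi / 2" using mult_left_mono[OF v(2), of pi] by simp
  qed (use v in simp)
  moreover have "2 * v \<le> pi * v" using v pi_gt3 by (intro mult_right_mono) auto
  ultimately show ?thesis unfolding eq by (simp add: v_def)
qed

text \<open>Moving a point of the unit circle radially outwards does not bring it closer to 1: the
  squared distances differ by \<open>(r - 1) * (r + 1 - 2 * Re z)\<close>.\<close>

lemma norm_expanded_minus_1_ge:
  assumes "cmod z = 1" "r \<ge> 1"
  shows "cmod (z - 1) \<le> cmod (of_real r * z - 1)"
proof (rule power2_le_imp_le)
  have z: "(Re z)\<^sup>2 + (Im z)\<^sup>2 = 1" using assms(1) cmod_power2[of z] by simp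
  have "(cmod (of_real r * z - 1))\<^sup>2 = r\<^sup>2 * ((Re z)\<^sup>2 + (Im z)\<^sup>2) - 2 * r * Re z + 1"
    unfolding cmod_power2 by (simp add: power2_eq_square algebra_simps)
  moreover have "(cmod (z - 1))\<^sup>2 = ((Re z)\<^sup>2 + (Im z)\<^sup>2) - 2 * Re z + 1"
    unfolding cmod_power2 by (simp add: power2_eq_square algebra_simps)
  moreover have "(r\<^sup>2 - 2 * r * Re z + 1) - (1 - 2 * Re z + 1) = (r - 1) * (r + 1 - 2 * Re z)"
    by (simp add: power2_eq_square algebra_simps)
  moreover have "0 \<le> (r - 1) * (r + 1 - 2 * Re z)"
    using complex_Re_le_cmod[of z] assms by (intro mult_nonneg_nonneg) auto
  ultimately show "(cmod (z - 1))\<^sup>2 \<le> (cmod (of_real r * z - 1))\<^sup>2" unfolding z by simp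
qed simp

lemma sum_powr_le:
  fixes \<epsilon> :: real
  assumes "0 < \<epsilon>" "\<epsilon> \<le> 1"
  shows "(\<Sum>j=1..J. real j powr (\<epsilon> - 1)) \<le> real J powr \<epsilon> / \<epsilon>"
proof (induction J)
  case (Suc J)
  define x where "x = real (Suc J)"
  have x: "x > 0" "real J = x - 1" by (auto simp: x_def)
  \<comment> \<open>Weighted arithmetic-geometric mean of \<open>J = x - 1\<close> and
    \<open>x\<close>; divided by \<open>x powr (1 - \<epsilon>)\<close> it is the induction
    step.\<close>
  have "real J powr \<epsilon> * x powr (1 - \<epsilon>) \<le> x - \<epsilon>"
  proof (cases "J = 0")
    case False
    then have "real J powr \<epsilon> * x powr (1 - \<epsilon>) \<le> \<epsilon> * real J + (1 - \<epsilon>) * x"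
      using assms x by (intro Youngs_inequality_0) auto
    then show ?thesis unfolding x(2) by (simp add: algebra_simps)
  qed (use assms x in simp)
  then have "real J powr \<epsilon> * x powr (1 - \<epsilon>) * x powr (\<epsilon> - 1) \<le> (x - \<epsilon>) * x powr (\<epsilon> - 1)"
    by (intro mult_right_mono) auto
  moreover have "real J powr \<epsilon> * x powr (1 - \<epsilon>) * x powr (\<epsilon> - 1) = real J powr \<epsilon>"
    using x by (simp add: mult.assoc powr_add[symmetric])
  moreover have "x * x powr (\<epsilon> - 1) = x powr \<epsilon>" using x by (simp add: powr_mult_base)
  ultimately have "real J powr \<epsilon> + \<epsilon> * x powr (\<epsilon> - 1) \<le> x powr \<epsilon>" by (simp add: left_diff_distrib)
  then have "(real J powr \<epsilon> + \<epsilon> * x powr (\<epsilon> - 1)) / \<epsilon> \<le> x powr \<epsilon> / \<epsilon>" using assms by (intro divide_right_mono) auto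
  then have "real J powr \<epsilon> / \<epsilon> + x powr (\<epsilon> - 1) \<le> x powr \<epsilon> / \<epsilon>" using assms by (simp add: add_divide_distrib)
  with Suc.IH show ?case unfolding x_def[symmetric] by (simp add: x_def)
qed simp

text \<open>Two upper bounds are interpolated geometrically. For the kernel this replaces the
  borderline singularity \<open>1 / v\<close> by the summable
  \<open>v powr (\<epsilon> - 1)\<close>, at the price of a factor
  \<open>N powr \<epsilon>\<close>.\<close>

lemma min_le_powr_mean:
  fixes a b \<epsilon> x :: real
  assumes "0 \<le> \<epsilon>" "\<epsilon> \<le> 1" "0 \<le> x" "x \<le> a" "x \<le> b"
  shows "x \<le> a powr \<epsilon> * b powr (1 - \<epsilon>)"
proof -
  have "x = x powr \<epsilon> * x powr (1 - \<epsilon>)" using assms by (simp add: powr_add[symmetric])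
  also have "\<dots> \<le> a powr \<epsilon> * b powr (1 - \<epsilon>)" using assms by (intro mult_mono powr_mono2) auto
  finally show ?thesis .
qed

text \<open>A Dirichlet kernel on the frequencies \<open>1..N\<close> whose coefficients
  \<open>exp (2 * pi * k / N)\<close> undo the damping \<open>exp (- 2 * pi * k / N)\<close> of the
  smoothed sum.\<close>

definition trunc_kernel :: "nat \<Rightarrow> real \<Rightarrow> complex" where
  "trunc_kernel N u = (\<Sum>k=1..N. (of_real (exp (2 * pi / N)) * cis (2 * pi * u)) ^ k)"

lemma norm_trunc_kernel_le:
  assumes N: "N \<ge> 1"
  shows "cmod (trunc_kernel N u) \<le> exp (4 * pi) * real N"
    and "0 < u \<Longrightarrow> u < 1 \<Longrightarrow> cmod (trunc_kernel N u) \<le> exp (4 * pi) / min u (1 - u)"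
proof -
  define r where "r = exp (2 * pi / N)"
  have r: "r \<ge> 1" by (simp add: r_def)
  \<comment> \<open>The range up to \<open>2 * N\<close> includes the exponent \<open>N + 1\<close>
    of the closed geometric sum; it gives \<open>exp (4 * pi)\<close>.\<close>
  have r_pow: "r ^ k \<le> exp (4 * pi)" if "k \<le> 2 * N" for k
  proof -
    have "r ^ k = exp (real k * (2 * pi / N))" by (simp only: r_def exp_of_nat_mult)
    also have "\<dots> \<le> exp (real (2 * N) * (2 * pi / N))" using that by (intro exp_le_cancel_iff[THEN iffD2] mult_right_mono) auto
    also have "real (2 * N) * (2 * pi / N) = 4 * pi" using N by simp
    finally show ?thesis .
  qed
  have norm: "cmod ((of_real r * cis (2 * pi * u)) ^ k) = r ^ k" for k using r by (simp add: norm_power norm_mult)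
  have "cmod (trunc_kernel N u) \<le> (\<Sum>k=1..N. exp (4 * pi))"
    unfolding trunc_kernel_def r_def[symmetric] by (intro sum_norm_le) (use norm r_pow in auto)
  then show "cmod (trunc_kernel N u) \<le> exp (4 * pi) * real N" by (simp add: mult.commute)
  assume u: "0 < u" "u < 1"
  define z where "z = of_real r * cis (2 * pi * u)"
  define v where "v = min u (1 - u)"
  have v: "v > 0" using u by (simp add: v_def)
  have "2 * v \<le> cmod (cis (2 * pi * u) - 1)" unfolding v_def using u by (intro norm_cis_minus_1_ge) auto
  also have "\<dots> \<le> cmod (z - 1)" unfolding z_def by (rule norm_expanded_minus_1_ge[OF _ r]) simp
  finally have z1: "2 * v \<le> cmod (z - 1)" .
  have "cmod (trunc_kernel N u) * cmod (z - 1) = cmod (z ^ Suc N - z)"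
  proof -
    have "(z - 1) * trunc_kernel N u = z ^ Suc N - z"
      unfolding trunc_kernel_def r_def[symmetric] z_def[symmetric] by (induction N) (simp_all add: algebra_simps)
    then show ?thesis by (metis mult.commute norm_mult)
  qed
  also have "\<dots> \<le> cmod (z ^ Suc N) + cmod (z ^ 1)" using norm_triangle_ineq4[of "z ^ Suc N" z] by simp
  also have "\<dots> \<le> exp (4 * pi) + exp (4 * pi)" unfolding z_def norm using N by (intro add_mono r_pow) auto
  finally have "cmod (trunc_kernel N u) * (2 * v) \<le> 2 * exp (4 * pi)"
    using mult_left_mono[OF z1, of "cmod (trunc_kernel N u)"] by simp
  then show "cmod (trunc_kernel N u) \<le> exp (4 * pi) / min u (1 - u)"
    using v unfolding v_def[symmetric] by (simp add: pos_le_divide_eq)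
qed

text \<open>The discrete \<open>L1\<close> norm of the kernel, normalised by \<open>M\<close>, is
  O(\<open>N powr \<epsilon>\<close>) uniformly in the number \<open>M\<close> of sample points. The
  node 0 is bounded by \<open>N\<close>, which is at most \<open>M\<close>.\<close>

lemma sum_trunc_kernel_le:
  assumes N: "1 \<le> N" "N \<le> M" and \<epsilon>: "0 < \<epsilon>" "\<epsilon> \<le> 1"
  shows "(\<Sum>j<M. cmod (trunc_kernel N (real j / M))) \<le> exp (4 * pi) * (1 + 2 / \<epsilon>) * real M * real N powr \<epsilon>"
proof -
  have M: "real M \<ge> 1" using N by simp
  define E where "E = exp (4 * pi)"
  have E: "E > 0" by (simp add: E_def)
  have le: "cmod (trunc_kernel N (real j / M)) \<le> E * real N powr \<epsilon> * real M powr (1 - \<epsilon>) * (real j powr (\<epsilon> - 1) + real (M - j) powr (\<epsilon> - 1))"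
    if j: "j \<in> {1..M-1}" for j
  proof -
    define v where "v = min (real j / M) (1 - real j / M)"
    have u: "0 < real j / M" "real j / M < 1" using j M by auto
    have v0: "v > 0" using u by (simp add: v_def)
    have "cmod (trunc_kernel N (real j / M)) \<le> (E * real N) powr \<epsilon> * (E / v) powr (1 - \<epsilon>)"
      unfolding E_def v_def using norm_trunc_kernel_le[OF N(1)] u \<epsilon> by (intro min_le_powr_mean) auto
    also have "\<dots> = E * real N powr \<epsilon> * v powr (\<epsilon> - 1)"
    proof -
      have "E powr \<epsilon> * E powr (1 - \<epsilon>) = E" using E by (simp add: powr_add[symmetric])
      moreover have "1 / v powr (1 - \<epsilon>) = v powr (\<epsilon> - 1)" using powr_minus_divide[of v "1 - \<epsilon>"] by simp
      moreover have "(E * real N) powr \<epsilon> * (E / v) powr (1 - \<epsilon>) = (E powr \<epsilon> * E powr (1 - \<epsilon>)) * real N powr \<epsilon> * (1 / v powr (1 - \<epsilon>))"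
        using E v0 by (simp add: powr_mult powr_divide)
      ultimately show ?thesis by simp
    qed
    also have "\<dots> \<le> E * real N powr \<epsilon> * (real M powr (1 - \<epsilon>) * (real j powr (\<epsilon> - 1) + real (M - j) powr (\<epsilon> - 1)))"
    proof (rule mult_left_mono)
      have d: "(real i / M) powr (\<epsilon> - 1) = real M powr (1 - \<epsilon>) * real i powr (\<epsilon> - 1)" for i
      proof -
        have "1 / real M powr (\<epsilon> - 1) = real M powr (1 - \<epsilon>)" using powr_minus_divide[of "real M" "\<epsilon> - 1"] by simp
        moreover have "(real i / M) powr (\<epsilon> - 1) = real i powr (\<epsilon> - 1) * (1 / real M powr (\<epsilon> - 1))" by (simp add: powr_divide)
        ultimately show ?thesis by simp
      qed
      have "j \<le> M" using j by auto
      then have e: "1 - real j / M = real (M - j) / M" using M by (simp add: of_nat_diff field_simps)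
      have "v powr (\<epsilon> - 1) \<le> (real j / M) powr (\<epsilon> - 1) + (1 - real j / M) powr (\<epsilon> - 1)"
        by (cases "real j / M \<le> 1 - real j / M") (simp_all add: v_def)
      then show "v powr (\<epsilon> - 1) \<le> real M powr (1 - \<epsilon>) * (real j powr (\<epsilon> - 1) + real (M - j) powr (\<epsilon> - 1))"
        unfolding e d by (simp add: distrib_left)
    qed (use E in simp)
    finally show ?thesis by (simp only: mult.assoc)
  qed
  have split: "{..<M} = insert 0 {1..M-1}" using N by auto
  have "(\<Sum>j=1..M-1. cmod (trunc_kernel N (real j / M)))
      \<le> (\<Sum>j=1..M-1. E * real N powr \<epsilon> * real M powr (1 - \<epsilon>) * (real j powr (\<epsilon> - 1) + real (M - j) powr (\<epsilon> - 1)))"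
    by (intro sum_mono le)
  also have "\<dots> = E * real N powr \<epsilon> * real M powr (1 - \<epsilon>) *
      ((\<Sum>j=1..M-1. real j powr (\<epsilon> - 1)) + (\<Sum>j=1..M-1. real (M - j) powr (\<epsilon> - 1)))"
    by (simp only: sum_distrib_left[symmetric] sum.distrib)
  also have "(\<Sum>j=1..M-1. real (M - j) powr (\<epsilon> - 1)) = (\<Sum>j=1..M-1. real j powr (\<epsilon> - 1))"
    by (rule sum.reindex_bij_witness[of _ "\<lambda>j. M - j" "\<lambda>j. M - j"]) auto
  also have "E * real N powr \<epsilon> * real M powr (1 - \<epsilon>) *
      ((\<Sum>j=1..M-1. real j powr (\<epsilon> - 1)) + (\<Sum>j=1..M-1. real j powr (\<epsilon> - 1)))
      \<le> E * real N powr \<epsilon> * real M powr (1 - \<epsilon>) * (real M powr \<epsilon> / \<epsilon> + real M powr \<epsilon> / \<epsilon>)"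
  proof -
    have "real (M - 1) powr \<epsilon> / \<epsilon> \<le> real M powr \<epsilon> / \<epsilon>" using \<epsilon> by (intro divide_right_mono powr_mono2) auto
    then show ?thesis using sum_powr_le[OF \<epsilon>, of "M - 1"] E by (intro mult_left_mono add_mono) auto
  qed
  also have "\<dots> = E * (2 / \<epsilon>) * real N powr \<epsilon> * (real M powr (1 - \<epsilon>) * real M powr \<epsilon>)" by (simp add: algebra_simps)
  also have "real M powr (1 - \<epsilon>) * real M powr \<epsilon> = real M" using M by (simp add: powr_add[symmetric])
  finally have main: "(\<Sum>j=1..M-1. cmod (trunc_kernel N (real j / M))) \<le> E * (2 / \<epsilon>) * real N powr \<epsilon> * real M" .
  have "cmod (trunc_kernel N (real 0 / M)) \<le> E * real N" unfolding E_def by (rule norm_trunc_kernel_le(1)[OF N(1)])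
  also have "\<dots> \<le> E * (real N powr \<epsilon> * real M)"
  proof (intro mult_left_mono)
    have "1 \<le> real N powr \<epsilon>" using N \<epsilon> by (intro ge_one_powr_ge_zero) auto
    then have "1 * real M \<le> real N powr \<epsilon> * real M" by (intro mult_right_mono) auto
    moreover have "real N \<le> real M" using N by simp
    ultimately show "real N \<le> real N powr \<epsilon> * real M" by linarith
  qed (use E in simp)
  finally have zero: "cmod (trunc_kernel N (real 0 / M)) \<le> E * (real N powr \<epsilon> * real M)" .
  have "(\<Sum>j<M. cmod (trunc_kernel N (real j / M)))
      = cmod (trunc_kernel N (real 0 / M)) + (\<Sum>j=1..M-1. cmod (trunc_kernel N (real j / M)))"
    unfolding split by (subst sum.insert) auto
  also have "\<dots> \<le> E * (real N powr \<epsilon> * real M) + E * (2 / \<epsilon>) * real N powr \<epsilon> * real M" by (rule add_mono[OF zero main])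
  also have "\<dots> = E * (1 + 2 / \<epsilon>) * real M * real N powr \<epsilon>" by (simp add: algebra_simps)
  finally show ?thesis unfolding E_def .
qed

text \<open>Averaging over \<open>M\<close> equally spaced points is exact for frequencies below
  \<open>M\<close>, so finite sums can take the place of integrals over the circle.\<close>

lemma discrete_orthogonality:
  assumes "n < M" "k < M"
  shows "(\<Sum>j<M. cis (2 * pi * (real n * (t - real j / M))) * cis (2 * pi * (real j / M)) ^ k)
     = (if n = k then of_nat M * cis (2 * pi * (real n * t)) else 0)"
proof -
  define x where "x = cis (2 * pi * ((real k - real n) / M))"
  have M: "real M > 0" using assms by simp
  have "(\<Sum>j<M. cis (2 * pi * (real n * (t - real j / M))) * cis (2 * pi * (real j / M)) ^ k)
      = (\<Sum>j<M. cis (2 * pi * (real n * t)) * x ^ j)"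
  proof (rule sum.cong)
    fix j
    have "2 * pi * (real n * (t - real j / M)) + real k * (2 * pi * (real j / M))
        = 2 * pi * (real n * t) + real j * (2 * pi * ((real k - real n) / M))"
      using M by (simp add: field_simps)
    then show "cis (2 * pi * (real n * (t - real j / M))) * cis (2 * pi * (real j / M)) ^ k = cis (2 * pi * (real n * t)) * x ^ j"
      unfolding x_def Complex.DeMoivre cis_mult by (rule arg_cong)
  qed simp
  also have "\<dots> = cis (2 * pi * (real n * t)) * (\<Sum>j<M. x ^ j)" by (simp add: sum_distrib_left)
  finally have eq: "(\<Sum>j<M. cis (2 * pi * (real n * (t - real j / M))) * cis (2 * pi * (real j / M)) ^ k)
      = cis (2 * pi * (real n * t)) * (\<Sum>j<M. x ^ j)" .
  show ?thesis
  proof (cases "n = k")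
    case True
    then have "x = 1" by (simp add: x_def)
    then show ?thesis unfolding eq using True by (simp add: mult.commute)
  next
    case False
    have "x ^ M = cis (real M * (2 * pi * ((real k - real n) / M)))" unfolding x_def Complex.DeMoivre ..
    also have "real M * (2 * pi * ((real k - real n) / M)) = 2 * pi * (of_int (int k - int n))" using M by simp
    also have "cis (2 * pi * (of_int (int k - int n))) = 1" by (rule cis_multiple_2pi) simp
    finally have xM: "x ^ M = 1" .
    have "x \<noteq> 1"
    proof
      assume "x = 1"
      then have "exp (\<i> * of_real (2 * pi * ((real k - real n) / M))) = 1" by (simp add: x_def cis_conv_exp)
      then obtain m :: int where m: "2 * pi * ((real k - real n) / M) = of_int (2 * m) * pi"
        unfolding exp_eq_1 by auto
      have "(real k - real n) / M = 2 * pi * ((real k - real n) / M) / (2 * pi)" by simp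
      also have "\<dots> = of_int m" unfolding m by simp
      finally have "(real k - real n) / M = of_int m" .
      then have "real k - real n = of_int m * real M" using M by (simp add: field_simps)
      then have "real_of_int (int k - int n) = real_of_int (m * int M)" by simp
      then have km: "int k - int n = m * int M" by (simp only: of_int_eq_iff)
      moreover have "\<bar>int k - int n\<bar> < int M" using assms by linarith
      ultimately have "\<bar>m\<bar> * int M < 1 * int M" by (simp add: abs_mult)
      then have "m = 0" using assms by (simp add: mult_less_cancel_right)
      then show False using km False by simp
    qed
    then have "(\<Sum>j<M. x ^ j) = 0" using geometric_sum[of x M] xM by simp
    then show ?thesis unfolding eq using False by simp
  qed
qed

text \<open>Discrete convolution with the kernel selects the frequencies \<open>1..N\<close> and
  removes their damping, so the sharp sum is bounded by the supremum of the damped sum times the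
  normalised \<open>L1\<close> norm of the kernel.\<close>

lemma truncation_bound:
  fixes b :: "nat \<Rightarrow> complex"
  assumes N: "N \<ge> 1" and b: "\<And>n. cmod (b n) \<le> 1" and \<epsilon>: "0 < \<epsilon>" "\<epsilon> \<le> 1"
    and B: "\<And>t. cmod (\<Sum>n. b (Suc n) * cis (2 * pi * (real (Suc n) * t)) * of_real (exp (- 2 * pi * real (Suc n) / N))) \<le> B"
  shows "cmod (\<Sum>n=1..N. b n * cis (2 * pi * (real n * t))) \<le> (B + 1) * (exp (4 * pi) * (1 + 2 / \<epsilon>) * real N powr \<epsilon>)"
proof -
  define \<rho> where "\<rho> = exp (- (2 * pi / N))"
  have \<rho>: "0 < \<rho>" "\<rho> < 1" using N by (auto simp: \<rho>_def)
  have \<rho>_pow: "exp (- 2 * pi * real n / N) = \<rho> ^ n" for n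
    unfolding \<rho>_def exp_of_nat_mult[symmetric] by (simp add: mult_ac)
  define g where "g t n = b n * cis (2 * pi * (real n * t)) * of_real (\<rho> ^ n)" for t n
  have g_le: "cmod (g t n) \<le> \<rho> ^ n" for t n
    unfolding g_def norm_mult norm_of_real norm_cis using b[of n] \<rho> by (simp add: mult_left_le_one_le)
  have summ: "summable (\<lambda>n. \<rho> ^ Suc n)" using \<rho> by (simp add: summable_mult)
  obtain L0 where L0: "\<And>n. n \<ge> L0 \<Longrightarrow> norm (\<Sum>i. \<rho> ^ Suc (i + n)) < 1"
    using suminf_exist_split[OF zero_less_one summ] by blast
  \<comment> \<open>The damped series is cut so late that the tail is below 1, which explains
    \<open>B + 1\<close>, and not before \<open>N\<close>. With \<open>M = L + 1\<close> nodes all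
    frequencies stay below \<open>M\<close>, so no aliasing occurs.\<close>
  define L where "L = max L0 N"
  have L: "L \<ge> N" "norm (\<Sum>i. \<rho> ^ Suc (i + L)) < 1" using L0[of L] by (auto simp: L_def)
  define M where "M = Suc L"
  define P where "P t = (\<Sum>n=1..L. g t n)" for t
  have P: "cmod (P t) \<le> B + 1" for t
  proof -
    have sg: "summable (\<lambda>n. g t (Suc n))" by (rule summable_comparison_test'[OF summ, of 0]) (rule g_le)
    have "(\<Sum>n. g t (Suc n)) = (\<Sum>n. g t (Suc (n + L))) + (\<Sum>n<L. g t (Suc n))"
      by (rule suminf_split_initial_segment[OF sg])
    moreover have "(\<Sum>n<L. g t (Suc n)) = P t"
      unfolding P_def by (simp add: sum.shift_bounds_Suc_ivl[symmetric] atLeast0LessThan[symmetric] atLeastLessThanSuc_atLeastAtMost)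
    ultimately have "P t = (\<Sum>n. g t (Suc n)) - (\<Sum>n. g t (Suc (n + L)))" by simp
    then have "cmod (P t) \<le> cmod (\<Sum>n. g t (Suc n)) + cmod (\<Sum>n. g t (Suc (n + L)))" by (simp add: norm_triangle_ineq4)
    also have "\<dots> \<le> B + 1"
    proof (rule add_mono)
      show "cmod (\<Sum>n. g t (Suc n)) \<le> B" using B[of t] unfolding g_def \<rho>_pow .
      have "cmod (\<Sum>n. g t (Suc (n + L))) \<le> (\<Sum>n. \<rho> ^ Suc (n + L))"
        by (rule norm_suminf_le[OF g_le summable_ignore_initial_segment[OF summ]])
      then show "cmod (\<Sum>n. g t (Suc (n + L))) \<le> 1" using L(2) by simp
    qed
    finally show ?thesis .
  qed
  have M: "real M > 0" by (simp add: M_def)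
  have inv: "(of_real (exp (2 * pi / N)) :: complex) ^ n * of_real (\<rho> ^ n) = 1" for n
    unfolding of_real_power[symmetric] of_real_mult[symmetric] power_mult_distrib[symmetric] \<rho>_def exp_add[symmetric] by simp
  have "(\<Sum>j<M. P (t - real j / M) * trunc_kernel N (real j / M))
      = (\<Sum>j<M. \<Sum>n=1..L. \<Sum>k=1..N. b n * of_real (\<rho> ^ n) * of_real (exp (2 * pi / N)) ^ k *
          (cis (2 * pi * (real n * (t - real j / M))) * cis (2 * pi * (real j / M)) ^ k))"
    unfolding P_def trunc_kernel_def g_def sum_product power_mult_distrib by (simp only: mult_ac)
  also have "\<dots> = (\<Sum>n=1..L. \<Sum>k=1..N. b n * of_real (\<rho> ^ n) * of_real (exp (2 * pi / N)) ^ k *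
          (\<Sum>j<M. cis (2 * pi * (real n * (t - real j / M))) * cis (2 * pi * (real j / M)) ^ k))"
    by (subst sum.swap, rule sum.cong[OF refl], subst sum.swap) (simp only: sum_distrib_left)
  also have "\<dots> = (\<Sum>n=1..L. \<Sum>k=1..N. if n = k then of_nat M * (b n * cis (2 * pi * (real n * t))) else 0)"
  proof (intro sum.cong refl)
    fix n k assume nk: "n \<in> {1..L}" "k \<in> {1..N}"
    then have "n < M" "k < M" using L by (auto simp: M_def)
    note o = discrete_orthogonality[OF this]
    show "b n * of_real (\<rho> ^ n) * of_real (exp (2 * pi / N)) ^ k *
          (\<Sum>j<M. cis (2 * pi * (real n * (t - real j / M))) * cis (2 * pi * (real j / M)) ^ k)
        = (if n = k then of_nat M * (b n * cis (2 * pi * (real n * t))) else 0)"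
    proof (cases "n = k")
      case True
      have "b n * of_real (\<rho> ^ n) * of_real (exp (2 * pi / N)) ^ k * (of_nat M * cis (2 * pi * (real n * t)))
          = (of_real (exp (2 * pi / N)) ^ n * of_real (\<rho> ^ n)) * (of_nat M * (b n * cis (2 * pi * (real n * t))))"
        unfolding True by (simp only: mult_ac)
      then show ?thesis unfolding o inv using True by simp
    next
      case False
      then show ?thesis unfolding o by simp
    qed
  qed
  also have "\<dots> = (\<Sum>k=1..N. \<Sum>n=1..L. if n = k then of_nat M * (b n * cis (2 * pi * (real n * t))) else 0)"
    by (rule sum.swap)
  also have "\<dots> = (\<Sum>k=1..N. of_nat M * (b k * cis (2 * pi * (real k * t))))"
    by (intro sum.cong refl) (use L in \<open>simp add: sum.delta\<close>)
  also have "\<dots> = of_nat M * (\<Sum>n=1..N. b n * cis (2 * pi * (real n * t)))" by (simp only: sum_distrib_left)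
  finally have "real M * cmod (\<Sum>n=1..N. b n * cis (2 * pi * (real n * t)))
      = cmod (\<Sum>j<M. P (t - real j / M) * trunc_kernel N (real j / M))" by (simp only: norm_mult norm_of_nat)
  also have "\<dots> \<le> (\<Sum>j<M. (B + 1) * cmod (trunc_kernel N (real j / M)))"
    by (intro sum_norm_le) (simp only: norm_mult, intro mult_right_mono P norm_ge_zero)
  also have "\<dots> = (B + 1) * (\<Sum>j<M. cmod (trunc_kernel N (real j / M)))" by (simp only: sum_distrib_left)
  also have "\<dots> \<le> (B + 1) * (exp (4 * pi) * (1 + 2 / \<epsilon>) * real M * real N powr \<epsilon>)"
    using sum_trunc_kernel_le[OF N _ \<epsilon>, of M] L order_trans[OF norm_ge_zero P[of t]]
    by (intro mult_left_mono) (auto simp: M_def simp del: of_nat_Suc)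
  also have "\<dots> = real M * ((B + 1) * (exp (4 * pi) * (1 + 2 / \<epsilon>) * real N powr \<epsilon>))" by (simp only: mult_ac)
  finally show ?thesis using M by (simp only: mult_le_cancel_left_pos)
qed

section \<open>Removing the weight, passing to the Liouville function, final exponents\<close>

lemma weight_removal:
  fixes b :: "nat \<Rightarrow> complex"
  assumes N: "N \<ge> 1" and \<epsilon>: "0 \<le> \<epsilon>" "\<epsilon> \<le> 1" and C: "C \<ge> 0" and \<theta>: "\<theta> \<ge> 0"
    and bound: "\<And>n. n \<ge> 1 \<Longrightarrow> cmod (\<Sum>j=1..n. b j * of_real (real j powr (-\<epsilon>))) \<le> C * real n powr \<theta>"
  shows "cmod (\<Sum>n=1..N. b n) \<le> 4 * C * real N powr (\<theta> + \<epsilon>)"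
proof -
  define S where "S n = (\<Sum>j=1..n. b j * complex_of_real (real j powr (-\<epsilon>)))" for n
  define w where "w n = real n powr \<epsilon>" for n
  have mono: "w m \<le> w n" if "m \<le> n" for m n unfolding w_def using that \<epsilon> by (intro powr_mono2) auto
  have "(\<Sum>n=1..N. b n) = (\<Sum>n\<in>{0<..N}. b n * of_real (real n powr (-\<epsilon>)) * complex_of_real (w n))"
  proof (rule sum.cong)
    fix n assume "n \<in> {0<..N}"
    then have "real n powr (-\<epsilon>) * w n = 1" by (simp add: w_def powr_add[symmetric])
    then have "complex_of_real (real n powr (-\<epsilon>)) * complex_of_real (w n) = 1" by (metis of_real_mult of_real_1)
    then show "b n = b n * of_real (real n powr (-\<epsilon>)) * complex_of_real (w n)" by (simp only: mult.assoc mult_1_right)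
  qed auto
  also have "\<dots> = S N * of_real (w (Suc N)) - S 0 * of_real (w (Suc 0)) + (\<Sum>n\<in>{0<..N}. S n * (of_real (w n) - of_real (w (Suc n))))"
    unfolding S_def by (rule abel_summation) simp
  also have "\<dots> = S N * of_real (w (Suc N)) + (\<Sum>n\<in>{0<..N}. S n * (of_real (w n) - of_real (w (Suc n))))"
    by (simp add: S_def)
  finally have eq: "(\<Sum>n=1..N. b n) = S N * of_real (w (Suc N)) + (\<Sum>n\<in>{0<..N}. S n * (of_real (w n) - of_real (w (Suc n))))" .
  have S: "cmod (S n) \<le> C * real N powr \<theta>" if "1 \<le> n" "n \<le> N" for n
  proof -
    have "cmod (S n) \<le> C * real n powr \<theta>" unfolding S_def by (rule bound[OF that(1)])
    also have "\<dots> \<le> C * real N powr \<theta>" using that C \<theta> by (intro mult_left_mono powr_mono2) auto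
    finally show ?thesis .
  qed
  have "cmod (\<Sum>n=1..N. b n) \<le> C * real N powr \<theta> * w (Suc N) + (\<Sum>n\<in>{0<..N}. C * real N powr \<theta> * (w (Suc n) - w n))"
    unfolding eq
  proof (intro order_trans[OF norm_triangle_ineq] add_mono sum_norm_le)
    show "cmod (S N * of_real (w (Suc N))) \<le> C * real N powr \<theta> * w (Suc N)"
      unfolding norm_mult using S[OF N order_refl] by (auto simp: w_def intro!: mult_right_mono)
    fix n assume n: "n \<in> {0<..N}"
    have "cmod (of_real (w n) - of_real (w (Suc n))) = w (Suc n) - w n"
      unfolding of_real_diff[symmetric] norm_of_real using mono[of n "Suc n"] by simp
    then show "cmod (S n * (of_real (w n) - of_real (w (Suc n)))) \<le> C * real N powr \<theta> * (w (Suc n) - w n)"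
      unfolding norm_mult using S[of n] n mono[of n "Suc n"] by (auto intro!: mult_right_mono)
  qed
  \<comment> \<open>The weight is increasing, so its total variation telescopes and is at most
    \<open>(N + 1) powr \<epsilon> \<le> 2 * N powr \<epsilon>\<close>; together with the boundary
    term this makes the factor 4.\<close>
  also have "(\<Sum>n\<in>{0<..N}. C * real N powr \<theta> * (w (Suc n) - w n)) = C * real N powr \<theta> * (w (Suc N) - w 1)"
  proof -
    have "(\<Sum>n\<in>{0<..N}. w (Suc n) - w n) = w (Suc N) - w 1" by (induction N) (simp_all add: atLeastSucAtMost_greaterThanAtMost[symmetric])
    then show ?thesis by (simp only: sum_distrib_left[symmetric])
  qed
  also have "C * real N powr \<theta> * w (Suc N) + \<dots> \<le> C * real N powr \<theta> * w (Suc N) + C * real N powr \<theta> * w (Suc N)"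
    using C by (intro add_left_mono mult_left_mono) (auto simp: w_def)
  also have "\<dots> \<le> C * real N powr \<theta> * (2 * real N powr \<epsilon>) + C * real N powr \<theta> * (2 * real N powr \<epsilon>)"
  proof -
    have "w (Suc N) \<le> (2 * real N) powr \<epsilon>" unfolding w_def using N \<epsilon> by (intro powr_mono2) auto
    also have "\<dots> = 2 powr \<epsilon> * real N powr \<epsilon>" by (simp add: powr_mult)
    also have "\<dots> \<le> 2 powr 1 * real N powr \<epsilon>" using \<epsilon> by (intro mult_right_mono powr_mono) auto
    finally have "w (Suc N) \<le> 2 * real N powr \<epsilon>" by simp
    then show ?thesis using C by (intro add_mono mult_left_mono) auto
  qed
  also have "\<dots> = 4 * C * real N powr (\<theta> + \<epsilon>)" by (simp add: powr_add)
  finally show ?thesis .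
qed

lemma exp_term_eq_cis: "exp_term f t n = of_int (f n) * cis (2 * pi * (real n * t))"
  unfolding exp_term_def cis_conv_exp by (simp add: mult_ac)

text \<open>Writing \<open>n = k\<^sup>2 * m\<close> yields, for each \<open>k\<close>, a Moebius
  sum of length \<open>N div k\<^sup>2\<close> at the frequency \<open>k\<^sup>2 * t\<close>; hence
  uniformity in \<open>t\<close> is indispensable. The bounds add up because
  \<open>2 * \<theta> > 1\<close>.\<close>

lemma liouville_sum_bound:
  assumes \<theta>: "\<theta> > 1/2" and bound: "\<And>N t. N \<ge> 1 \<Longrightarrow> cmod (\<Sum>n=1..N. exp_term moebius_mu t n) \<le> C * real N powr \<theta>"
    and N: "N \<ge> 1"
  shows "cmod (\<Sum>n=1..N. exp_term liouville_lambda t n) \<le> C * (\<Sum>k. real (Suc k) powr (- 2 * \<theta>)) * real N powr \<theta>"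
proof -
  have C: "C \<ge> 0" using order_trans[OF norm_ge_zero bound[of 1 0]] by simp
  have "(\<Sum>n=1..N. exp_term liouville_lambda t n)
      = (\<Sum>n=1..N. \<Sum>k | k \<in> {1..N} \<and> k\<^sup>2 dvd n. of_int (moebius_mu (n div k\<^sup>2)) * cis (2 * pi * (real n * t)))"
  proof (rule sum.cong[OF refl])
    fix n assume n: "n \<in> {1..N}"
    have "{k. k\<^sup>2 dvd n} = {k. k \<in> {1..N} \<and> k\<^sup>2 dvd n}"
    proof (intro Collect_cong iffI conjI)
      fix k assume k: "k\<^sup>2 dvd n"
      then have "k \<noteq> 0" using n by (intro notI) simp
      moreover have "k \<le> k\<^sup>2" by (simp add: power2_eq_square)
      moreover have "k\<^sup>2 \<le> n" using k n by (intro dvd_imp_le) auto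
      ultimately show "k \<in> {1..N}" using n by auto
    qed auto
    then have "liouville_lambda n = (\<Sum>k | k \<in> {1..N} \<and> k\<^sup>2 dvd n. moebius_mu (n div k\<^sup>2))"
      using liouville_lambda_eq_sum[of n] n by simp
    then show "exp_term liouville_lambda t n = (\<Sum>k | k \<in> {1..N} \<and> k\<^sup>2 dvd n. of_int (moebius_mu (n div k\<^sup>2)) * cis (2 * pi * (real n * t)))"
      unfolding exp_term_eq_cis by (simp only: of_int_sum sum_distrib_right)
  qed
  also have "\<dots> = (\<Sum>k=1..N. \<Sum>n | n \<in> {1..N} \<and> k\<^sup>2 dvd n. of_int (moebius_mu (n div k\<^sup>2)) * cis (2 * pi * (real n * t)))"
    by (rule sum.swap_restrict) auto
  also have "\<dots> = (\<Sum>k=1..N. \<Sum>m=1..N div k\<^sup>2. exp_term moebius_mu (real (k\<^sup>2) * t) m)"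
  proof (rule sum.cong[OF refl])
    fix k assume "k \<in> {1..N}"
    then have k: "k\<^sup>2 > 0" by simp
    show "(\<Sum>n | n \<in> {1..N} \<and> k\<^sup>2 dvd n. of_int (moebius_mu (n div k\<^sup>2)) * cis (2 * pi * (real n * t)))
        = (\<Sum>m=1..N div k\<^sup>2. exp_term moebius_mu (real (k\<^sup>2) * t) m)"
    proof (rule sum.reindex_bij_witness[of _ "\<lambda>m. k\<^sup>2 * m" "\<lambda>n. n div k\<^sup>2"])
      fix n assume "n \<in> {n. n \<in> {1..N} \<and> k\<^sup>2 dvd n}"
      then have "k\<^sup>2 dvd n" and n: "1 \<le> n" "n \<le> N" by auto
      then obtain m where "n = k\<^sup>2 * m" by (elim dvdE)
      note m = this n
      have div: "n div k\<^sup>2 = m" using k m(1) by simp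
      show "k\<^sup>2 * (n div k\<^sup>2) = n" unfolding div using m by simp
      have "m \<noteq> 0" using m by (intro notI) simp
      moreover have "m \<le> N div k\<^sup>2" using div_le_mono[OF m(3), of "k\<^sup>2"] unfolding div .
      ultimately show "n div k\<^sup>2 \<in> {1..N div k\<^sup>2}" unfolding div by simp
      show "exp_term moebius_mu (real (k\<^sup>2) * t) (n div k\<^sup>2) = of_int (moebius_mu (n div k\<^sup>2)) * cis (2 * pi * (real n * t))"
        unfolding exp_term_eq_cis div unfolding m(1) of_nat_mult by (simp only: mult_ac)
    next
      fix m assume m: "m \<in> {1..N div k\<^sup>2}"
      show "k\<^sup>2 * m div k\<^sup>2 = m" using k by simp
      have "k\<^sup>2 * m \<le> k\<^sup>2 * (N div k\<^sup>2)" using m by simp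
      also have "\<dots> \<le> N" by simp
      finally show "k\<^sup>2 * m \<in> {n. n \<in> {1..N} \<and> k\<^sup>2 dvd n}" using m k by (auto simp: Suc_le_eq)
    qed
  qed
  finally have "cmod (\<Sum>n=1..N. exp_term liouville_lambda t n)
      \<le> (\<Sum>k=1..N. cmod (\<Sum>m=1..N div k\<^sup>2. exp_term moebius_mu (real (k\<^sup>2) * t) m))" by (simp only: norm_sum)
  also have "\<dots> \<le> (\<Sum>k=1..N. C * real N powr \<theta> * real k powr (- 2 * \<theta>))"
  proof (rule sum_mono)
    fix k assume "k \<in> {1..N}"
    then have k: "real k > 0" by simp
    show "cmod (\<Sum>m=1..N div k\<^sup>2. exp_term moebius_mu (real (k\<^sup>2) * t) m) \<le> C * real N powr \<theta> * real k powr (- 2 * \<theta>)"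
    proof (cases "N div k\<^sup>2 = 0")
      case True
      then show ?thesis using C by simp
    next
      case False
      then have "cmod (\<Sum>m=1..N div k\<^sup>2. exp_term moebius_mu (real (k\<^sup>2) * t) m) \<le> C * real (N div k\<^sup>2) powr \<theta>"
        by (intro bound) simp
      also have "\<dots> \<le> C * (real N / real (k\<^sup>2)) powr \<theta>"
        using C \<theta> by (intro mult_left_mono powr_mono2 of_nat_div_le_of_nat) auto
      also have "(real N / real (k\<^sup>2)) powr \<theta> = real N powr \<theta> * real k powr (- 2 * \<theta>)"
      proof -
        have "real (k\<^sup>2) powr \<theta> = real k powr (2 * \<theta>)"
          using k by (simp add: powr_powr[symmetric])
        then show ?thesis using powr_minus_divide[of "real k" "2 * \<theta>"] by (simp add: powr_divide)
      qed
      finally show ?thesis by (simp only: mult.assoc)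
    qed
  qed
  also have "\<dots> = C * real N powr \<theta> * (\<Sum>k<N. real (Suc k) powr (- 2 * \<theta>))"
    unfolding sum_distrib_left[symmetric] by (simp add: sum.atLeast1_atMost_eq)
  also have "\<dots> \<le> C * real N powr \<theta> * (\<Sum>k. real (Suc k) powr (- 2 * \<theta>))"
    using C \<theta> by (intro mult_left_mono sum_le_suminf summable_Suc_powr) auto
  finally show ?thesis by (simp only: mult_ac)
qed

text \<open>Serves both values 1/4 and 1/2 of \<open>\<eta>\<close>. The exponent
  \<open>\<eta>\<close> is only approached, but the bound \<open>2 - \<eta>\<close> for the
  dimension holds exactly, being the infimum of \<open>2 - (\<eta> - \<epsilon>)\<close>.\<close>

lemma F_regularity:
  assumes \<eta>: "0 < \<eta>" "\<eta> \<le> 1/2"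
    and bound: "\<And>\<epsilon>. 0 < \<epsilon> \<Longrightarrow> \<epsilon> < \<eta> \<Longrightarrow> \<exists>C. \<forall>N\<ge>1. \<forall>t. cmod (\<Sum>n=1..N. exp_term f t n) \<le> C * real N powr (1 - \<eta> + \<epsilon>)"
  shows "\<forall>\<epsilon>::real. 0 < \<epsilon> \<and> \<epsilon> < \<eta> \<longrightarrow>
        hoelder_continuous (\<eta> - \<epsilon>) (F f) \<and>
        hoelder_continuous (\<eta> - \<epsilon>) (\<lambda>t. cmod (F f t)) \<and>
        hoelder_continuous (\<eta> - \<epsilon>) (\<lambda>t. Re (F f t)) \<and>
        hoelder_continuous (\<eta> - \<epsilon>) (\<lambda>t. Im (F f t))" (is ?hoelder)
    and "upper_box_dim (graph01 (\<lambda>t. cmod (F f t))) \<le> ereal (2 - \<eta>) \<and>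
        upper_box_dim (graph01 (\<lambda>t. Re (F f t))) \<le> ereal (2 - \<eta>) \<and>
        upper_box_dim (graph01 (\<lambda>t. Im (F f t))) \<le> ereal (2 - \<eta>)"
proof -
  have F: "hoelder_continuous (\<eta> - \<epsilon>) (F f)" if \<epsilon>: "0 < \<epsilon>" "\<epsilon> < \<eta>" for \<epsilon>
  proof -
    obtain C where "\<And>N t. N \<ge> 1 \<Longrightarrow> cmod (\<Sum>n=1..N. exp_term f t n) \<le> C * real N powr (1 - \<eta> + \<epsilon>)"
      using bound[OF \<epsilon>] by blast
    then have "hoelder_continuous (1 - (1 - \<eta> + \<epsilon>)) (F f)"
      using \<eta> \<epsilon> by (intro hoelder_continuous_F) auto
    then show ?thesis by simp
  qed
  show ?hoelder using F hoelder_continuous_parts[OF F] by blast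
  show "upper_box_dim (graph01 (\<lambda>t. cmod (F f t))) \<le> ereal (2 - \<eta>) \<and>
        upper_box_dim (graph01 (\<lambda>t. Re (F f t))) \<le> ereal (2 - \<eta>) \<and>
        upper_box_dim (graph01 (\<lambda>t. Im (F f t))) \<le> ereal (2 - \<eta>)"
    using hoelder_continuous_parts[OF F] \<eta> by (intro conjI upper_box_dim_graph_limit) auto
qed

theorem moebius_sum_bound:
  assumes GRH: generalized_riemann_hypothesis and \<delta>: "0 < \<delta>" "\<delta> \<le> 1"
  obtains C where "\<And>N t. N \<ge> 1 \<Longrightarrow> cmod (\<Sum>n=1..N. exp_term moebius_mu t n) \<le> C * real N powr (3/4 + \<delta>)"
proof -
  \<comment> \<open>The losses are \<open>\<epsilon> / 2\<close> in the smoothed bound,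
    \<open>\<epsilon>\<close> in the truncation and \<open>\<epsilon>\<close> in removing the
    weight, together below \<open>3 * \<epsilon> = \<delta>\<close>.\<close>
  define \<epsilon> where "\<epsilon> = \<delta> / 3"
  have \<epsilon>: "0 < \<epsilon>" "\<epsilon> \<le> 1/2" using \<delta> by (auto simp: \<epsilon>_def)
  obtain C0 where C0: "C0 \<ge> 0" "\<And>t y. 0 < y \<Longrightarrow> y \<le> 1 \<Longrightarrow>
    cmod (\<Sum>n. exp_term moebius_mu t (Suc n) * of_real (real (Suc n) powr (-\<epsilon>)) * of_real (exp (- 2 * pi * real (Suc n) * y)))
      \<le> C0 * y powr (- 3/4 - \<epsilon>/2)"
    using smoothed_exponential_sum_bound[OF GRH \<epsilon>] by blast
  define K where "K = exp (4 * pi) * (1 + 2 / \<epsilon>)"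
  have K: "K \<ge> 0" using \<epsilon> by (simp add: K_def)
  define a where "a = 3/4 + \<epsilon>/2"
  define b where "b n = of_int (moebius_mu n) * complex_of_real (real n powr (-\<epsilon>))" for n
  have b: "cmod (b n) \<le> 1" for n
  proof (cases n)
    case (Suc m)
    have "cmod (of_int (moebius_mu n)) * real n powr (-\<epsilon>) \<le> 1"
      using norm_of_int_le_1[OF abs_moebius_mu_le[of n]] powr_minus_Suc_le_1[of \<epsilon> m] \<epsilon>
      unfolding Suc by (intro mult_le_one) auto
    then show ?thesis by (simp add: b_def norm_mult)
  qed (simp add: b_def)
  have weighted: "cmod (\<Sum>n=1..N. exp_term moebius_mu t n * of_real (real n powr (-\<epsilon>))) \<le> (C0 + 1) * K * real N powr (a + \<epsilon>)"
    if N: "N \<ge> 1" for N t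
  proof -
    have smooth: "cmod (\<Sum>n. b (Suc n) * cis (2 * pi * (real (Suc n) * t)) * of_real (exp (- 2 * pi * real (Suc n) / N)))
        \<le> C0 * real N powr a" for t
    proof -
      have "b (Suc n) * cis (2 * pi * (real (Suc n) * t)) * of_real (exp (- 2 * pi * real (Suc n) / N))
          = exp_term moebius_mu t (Suc n) * of_real (real (Suc n) powr (-\<epsilon>)) * of_real (exp (- 2 * pi * real (Suc n) * (1 / N)))" for n
        unfolding exp_term_eq_cis b_def times_divide_eq_right mult_1_right by (simp only: mult_ac)
      moreover have "(1 / real N) powr (- 3/4 - \<epsilon>/2) = real N powr a"
        using powr_minus_divide[of "real N" a] by (simp add: powr_divide a_def)
      ultimately show ?thesis using C0(2)[of "1 / real N" t] N by simp
    qed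
    have "cmod (\<Sum>n=1..N. b n * cis (2 * pi * (real n * t))) \<le> (C0 * real N powr a + 1) * (K * real N powr \<epsilon>)"
      unfolding K_def using \<epsilon> by (intro truncation_bound[OF N b _ _ smooth]) auto
    also have "\<dots> \<le> ((C0 + 1) * real N powr a) * (K * real N powr \<epsilon>)"
    proof (intro mult_right_mono)
      have "1 \<le> real N powr a" using N \<epsilon> by (intro ge_one_powr_ge_zero) (auto simp: a_def)
      then show "C0 * real N powr a + 1 \<le> (C0 + 1) * real N powr a" by (simp add: distrib_right)
    qed (use K in simp)
    also have "\<dots> = (C0 + 1) * K * real N powr (a + \<epsilon>)" unfolding powr_add by (simp only: mult_ac)
    finally show ?thesis unfolding exp_term_eq_cis b_def by (simp only: mult_ac)
  qed
  define C where "C = 4 * ((C0 + 1) * K)"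
  have C: "C \<ge> 0" using C0 K by (simp add: C_def)
  have "cmod (\<Sum>n=1..N. exp_term moebius_mu t n) \<le> C * real N powr (3/4 + \<delta>)" if N: "N \<ge> 1" for N t
  proof -
    have "cmod (\<Sum>n=1..N. exp_term moebius_mu t n) \<le> C * real N powr (a + \<epsilon> + \<epsilon>)"
      unfolding C_def by (rule weight_removal[OF N _ _ _ _ weighted]) (use \<epsilon> C0 K in \<open>auto simp: a_def\<close>)
    also have "\<dots> \<le> C * real N powr (3/4 + \<delta>)"
      using N \<delta> C by (intro mult_left_mono powr_mono) (auto simp: a_def \<epsilon>_def)
    finally show ?thesis .
  qed
  then show thesis by (rule that)
qed

text \<open>The hypothesis of the second part only concerns large \<open>x\<close>; below the threshold the trivial bound
  is absorbed into the constant.\<close>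

lemma sum_bound_from_threshold:
  assumes f: "\<And>n. \<bar>f n\<bar> \<le> 1" and \<theta>: "\<theta> \<ge> 0"
    and large: "\<And>x t. x \<ge> x0 \<Longrightarrow> cmod (\<Sum>n | 1 \<le> n \<and> real n \<le> x. exp_term f t n) \<le> C * x powr \<theta>"
  shows "\<exists>C. \<forall>N\<ge>1. \<forall>t. cmod (\<Sum>n=1..N. exp_term f t n) \<le> C * real N powr \<theta>"
proof (intro exI allI impI)
  fix N :: nat and t assume N: "N \<ge> 1"
  have p: "1 \<le> real N powr \<theta>" using N \<theta> by (intro ge_one_powr_ge_zero) auto
  show "cmod (\<Sum>n=1..N. exp_term f t n) \<le> (\<bar>C\<bar> + \<bar>x0\<bar>) * real N powr \<theta>"
  proof (cases "real N \<ge> x0")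
    case True
    have "{1..N} = {n. 1 \<le> n \<and> real n \<le> real N}" by auto
    then have "cmod (\<Sum>n=1..N. exp_term f t n) \<le> C * real N powr \<theta>" using large[OF True, of t] by simp
    also have "\<dots> \<le> (\<bar>C\<bar> + \<bar>x0\<bar>) * real N powr \<theta>" by (intro mult_right_mono) auto
    finally show ?thesis .
  next
    case False
    have "cmod (\<Sum>n=1..N. exp_term f t n) \<le> (\<Sum>n=1..N. 1)"
      using norm_of_int_le_1[OF f] by (intro sum_norm_le) (simp add: exp_term_eq_cis norm_mult)
    also have "\<dots> \<le> \<bar>x0\<bar>" using False by simp
    also have "\<dots> \<le> \<bar>x0\<bar> * real N powr \<theta>" using mult_left_mono[OF p, of "\<bar>x0\<bar>"] by simp
    also have "\<dots> \<le> (\<bar>C\<bar> + \<bar>x0\<bar>) * real N powr \<theta>" by (intro mult_right_mono) auto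
    finally show ?thesis .
  qed
qed

theorem corollary5p3:
  assumes GRH: "generalized_riemann_hypothesis"
  shows
    "(\<forall>f\<in>{moebius_mu, liouville_lambda}. \<forall>\<epsilon>::real. 0 < \<epsilon> \<and> \<epsilon> < 1/4 \<longrightarrow>
        hoelder_continuous (1/4 - \<epsilon>) (F f) \<and>
        hoelder_continuous (1/4 - \<epsilon>) (\<lambda>t. cmod (F f t)) \<and>
        hoelder_continuous (1/4 - \<epsilon>) (\<lambda>t. Re (F f t)) \<and>
        hoelder_continuous (1/4 - \<epsilon>) (\<lambda>t. Im (F f t))) \<and>
     (\<forall>f\<in>{moebius_mu, liouville_lambda}.
        upper_box_dim (graph01 (\<lambda>t. cmod (F f t))) \<le> ereal (7/4) \<and>
        upper_box_dim (graph01 (\<lambda>t. Re (F f t))) \<le> ereal (7/4) \<and>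
        upper_box_dim (graph01 (\<lambda>t. Im (F f t))) \<le> ereal (7/4)) \<and>
     ((\<forall>\<epsilon>::real. \<epsilon> > 0 \<longrightarrow> (\<exists>(C::real) (x0::real). \<forall>x\<ge>x0. \<forall>t::real.
        cmod (\<Sum>n | 1 \<le> n \<and> real n \<le> x. exp_term moebius_mu t n) \<le> C * x powr (1/2 + \<epsilon>) \<and>
        cmod (\<Sum>n | 1 \<le> n \<and> real n \<le> x. exp_term liouville_lambda t n) \<le> C * x powr (1/2 + \<epsilon>)))
     \<longrightarrow>
      (\<forall>f\<in>{moebius_mu, liouville_lambda}. \<forall>\<epsilon>::real. 0 < \<epsilon> \<and> \<epsilon> < 1/2 \<longrightarrow>
        hoelder_continuous (1/2 - \<epsilon>) (F f) \<and>
        hoelder_continuous (1/2 - \<epsilon>) (\<lambda>t. cmod (F f t)) \<and>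
        hoelder_continuous (1/2 - \<epsilon>) (\<lambda>t. Re (F f t)) \<and>
        hoelder_continuous (1/2 - \<epsilon>) (\<lambda>t. Im (F f t))) \<and>
      (\<forall>f\<in>{moebius_mu, liouville_lambda}.
        upper_box_dim (graph01 (\<lambda>t. cmod (F f t))) \<le> ereal (3/2) \<and>
        upper_box_dim (graph01 (\<lambda>t. Re (F f t))) \<le> ereal (3/2) \<and>
        upper_box_dim (graph01 (\<lambda>t. Im (F f t))) \<le> ereal (3/2)))"
proof -
  have moebius: "\<exists>C. \<forall>N\<ge>1. \<forall>t. cmod (\<Sum>n=1..N. exp_term moebius_mu t n) \<le> C * real N powr (1 - 1/4 + \<epsilon>)"
    if "0 < \<epsilon>" "\<epsilon> < 1/4" for \<epsilon> :: real
  proof -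
    have "\<epsilon> \<le> 1" using that by simp
    then obtain C where "\<And>N t. N \<ge> 1 \<Longrightarrow> cmod (\<Sum>n=1..N. exp_term moebius_mu t n) \<le> C * real N powr (3/4 + \<epsilon>)"
      using moebius_sum_bound[OF GRH] \<open>0 < \<epsilon>\<close> by blast
    then show ?thesis by auto
  qed
  have quarter: "\<exists>C. \<forall>N\<ge>1. \<forall>t. cmod (\<Sum>n=1..N. exp_term f t n) \<le> C * real N powr (1 - 1/4 + \<epsilon>)"
    if f: "f \<in> {moebius_mu, liouville_lambda}" and \<epsilon>: "0 < \<epsilon>" "\<epsilon> < 1/4" for f and \<epsilon> :: real
  proof -
    obtain C where C: "\<And>N t. N \<ge> 1 \<Longrightarrow> cmod (\<Sum>n=1..N. exp_term moebius_mu t n) \<le> C * real N powr (1 - 1/4 + \<epsilon>)"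
      using moebius[OF \<epsilon>] by blast
    have "1 - 1/4 + \<epsilon> > 1/2" using \<epsilon> by simp
    from liouville_sum_bound[OF this C] f C show ?thesis by blast
  qed
  have "(0::real) < 1/4" "(1/4::real) \<le> 1/2" "(0::real) < 1/2" "(1/2::real) \<le> 1/2" by auto
  note range = this
  have dims: "ereal (2 - 1/4) = ereal (7/4)" "ereal (2 - 1/2) = ereal (3/2)" by auto
  have part1: "\<forall>f\<in>{moebius_mu, liouville_lambda}. \<forall>\<epsilon>::real. 0 < \<epsilon> \<and> \<epsilon> < 1/4 \<longrightarrow>
        hoelder_continuous (1/4 - \<epsilon>) (F f) \<and>
        hoelder_continuous (1/4 - \<epsilon>) (\<lambda>t. cmod (F f t)) \<and>
        hoelder_continuous (1/4 - \<epsilon>) (\<lambda>t. Re (F f t)) \<and>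
        hoelder_continuous (1/4 - \<epsilon>) (\<lambda>t. Im (F f t))"
    by (rule ballI, rule F_regularity(1)[OF range(1,2) quarter])
  have part2: "\<forall>f\<in>{moebius_mu, liouville_lambda}.
        upper_box_dim (graph01 (\<lambda>t. cmod (F f t))) \<le> ereal (7/4) \<and>
        upper_box_dim (graph01 (\<lambda>t. Re (F f t))) \<le> ereal (7/4) \<and>
        upper_box_dim (graph01 (\<lambda>t. Im (F f t))) \<le> ereal (7/4)"
    by (rule ballI, rule F_regularity(2)[OF range(1,2) quarter, unfolded dims])
  have part3: "(\<forall>f\<in>{moebius_mu, liouville_lambda}. \<forall>\<epsilon>::real. 0 < \<epsilon> \<and> \<epsilon> < 1/2 \<longrightarrow>
        hoelder_continuous (1/2 - \<epsilon>) (F f) \<and>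
        hoelder_continuous (1/2 - \<epsilon>) (\<lambda>t. cmod (F f t)) \<and>
        hoelder_continuous (1/2 - \<epsilon>) (\<lambda>t. Re (F f t)) \<and>
        hoelder_continuous (1/2 - \<epsilon>) (\<lambda>t. Im (F f t))) \<and>
      (\<forall>f\<in>{moebius_mu, liouville_lambda}.
        upper_box_dim (graph01 (\<lambda>t. cmod (F f t))) \<le> ereal (3/2) \<and>
        upper_box_dim (graph01 (\<lambda>t. Re (F f t))) \<le> ereal (3/2) \<and>
        upper_box_dim (graph01 (\<lambda>t. Im (F f t))) \<le> ereal (3/2))"
    if hyp: "\<forall>\<epsilon>::real. \<epsilon> > 0 \<longrightarrow> (\<exists>(C::real) (x0::real). \<forall>x\<ge>x0. \<forall>t::real.
        cmod (\<Sum>n | 1 \<le> n \<and> real n \<le> x. exp_term moebius_mu t n) \<le> C * x powr (1/2 + \<epsilon>) \<and>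
        cmod (\<Sum>n | 1 \<le> n \<and> real n \<le> x. exp_term liouville_lambda t n) \<le> C * x powr (1/2 + \<epsilon>))"
  proof -
    have half: "\<exists>C. \<forall>N\<ge>1. \<forall>t. cmod (\<Sum>n=1..N. exp_term f t n) \<le> C * real N powr (1 - 1/2 + \<epsilon>)"
      if f: "f \<in> {moebius_mu, liouville_lambda}" and \<epsilon>: "0 < \<epsilon>" "\<epsilon> < 1/2" for f and \<epsilon> :: real
    proof -
      from hyp \<epsilon>(1) obtain C x0 where C: "\<And>x t. x \<ge> x0 \<Longrightarrow>
          cmod (\<Sum>n | 1 \<le> n \<and> real n \<le> x. exp_term moebius_mu t n) \<le> C * x powr (1/2 + \<epsilon>) \<and>
          cmod (\<Sum>n | 1 \<le> n \<and> real n \<le> x. exp_term liouville_lambda t n) \<le> C * x powr (1/2 + \<epsilon>)"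
        by blast
      have e: "1 - 1/2 + \<epsilon> = 1/2 + \<epsilon>" by simp
      show ?thesis unfolding e
      proof (rule sum_bound_from_threshold)
        show "\<bar>f n\<bar> \<le> 1" for n using f abs_moebius_mu_le abs_liouville_lambda_le by blast
        show "cmod (\<Sum>n | 1 \<le> n \<and> real n \<le> x. exp_term f t n) \<le> C * x powr (1/2 + \<epsilon>)" if "x \<ge> x0" for x t
          using C[OF that, of t] f by blast
      qed (use \<epsilon> in simp)
    qed
    show ?thesis
      by (rule conjI; rule ballI; rule F_regularity[OF range(3,4) half, unfolded dims])
  qed
  show ?thesis by (rule conjI[OF part1 conjI[OF part2 impI[OF part3]]])
qed

end
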